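(* Let $(A,\mathfrak{m})$ be a local complete intersection ring. Let $M$ and $N$ be finitely generated $A$-modules, and let $I$ be an ideal of $A$. Then the set $$\bigcup_{n \ge 1} \bigcup_{i \ge 0}\mathrm{Ass}_A\left(\mathrm{Ext}_A^i(M,N/I^n N)\right)$$ is finite.
   Context: All rings are commutative Noetherian with identity. A local ring $A$ is a local complete intersection ring if its $\mathfrak{m}$-adic completion is $\widehat{A} = Q/(\mathbf{f})$, where $Q$ is a complete regular local ring and $\mathbf{f}=f_1,\ldots,f_c$ is a $Q$-regular sequence. $\mathrm{Ass}_A(E)$ denotes the set of associated prime ideals of an $A$-module $E$. *)

theory Defs
  imports "HOL-Algebra.Algebra" "HOL-Library.Extended_Nat"
begin

section \<open>Local complete intersection rings\<close>

locale noetherian_local_ring = noetherian_ring R + cring R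
  for R (structure) and \<mm> +
  assumes max_ideal: "maximalideal \<mm> R"
    and max_ideal_unique: "maximalideal J R \<Longrightarrow> J = \<mm>"

abbreviation ideal_power :: "('a, 'b) ring_scheme \<Rightarrow> 'a set \<Rightarrow> nat \<Rightarrow> 'a set"
  where "ideal_power R I n \<equiv> I [^]\<^bsub>ideals_set R\<^esub> n"

definition krull_dim :: "('a, 'b) ring_scheme \<Rightarrow> enat"
  where "krull_dim R = Sup {enat n | n.
    \<exists>p. (\<forall>i\<le>n. primeideal (p i) R) \<and> (\<forall>i<n. p i \<subset> p (Suc i))}"

definition min_generators :: "('a, 'b) ring_scheme \<Rightarrow> 'a set \<Rightarrow> nat"
  where "min_generators R I =
    (LEAST n. \<exists>S \<subseteq> carrier R. finite S \<and> card S = n \<and> Idl\<^bsub>R\<^esub> S = I)"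

locale regular_local_ring = noetherian_local_ring +
  assumes regular: "enat (min_generators R \<mm>) = krull_dim R"

text \<open>
  The completion is the inverse limit of the quotients \<open>R / I\<^sup>n\<close>.  Its elements are sequences
  of cosets; a coset of \<open>I\<^sup>n\<^sup>+\<^sup>1\<close> is mapped to a coset of \<open>I\<^sup>n\<close> under the projection exactly
  when it is contained in it.
\<close>

definition completion :: "('a, 'b) ring_scheme \<Rightarrow> 'a set \<Rightarrow> (nat \<Rightarrow> 'a set) ring"
  where "completion R I =
    \<lparr>carrier = {x. \<forall>n. x n \<in> carrier (R Quot ideal_power R I n) \<and> x (Suc n) \<subseteq> x n},
     monoid.mult = (\<lambda>x y n. x n \<otimes>\<^bsub>R Quot ideal_power R I n\<^esub> y n),
     monoid.one = (\<lambda>n. \<one>\<^bsub>R Quot ideal_power R I n\<^esub>),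
     ring.zero = (\<lambda>n. \<zero>\<^bsub>R Quot ideal_power R I n\<^esub>),
     ring.add = (\<lambda>x y n. x n \<oplus>\<^bsub>R Quot ideal_power R I n\<^esub> y n)\<rparr>"

definition to_completion :: "('a, 'b) ring_scheme \<Rightarrow> 'a set \<Rightarrow> 'a \<Rightarrow> nat \<Rightarrow> 'a set"
  where "to_completion R I a = (\<lambda>n. ideal_power R I n +>\<^bsub>R\<^esub> a)"

definition adically_complete :: "('a, 'b) ring_scheme \<Rightarrow> 'a set \<Rightarrow> bool"
  where "adically_complete R I \<longleftrightarrow> to_completion R I \<in> ring_iso R (completion R I)"

definition regular_sequence :: "('a, 'b) ring_scheme \<Rightarrow> 'a list \<Rightarrow> bool"
  where "regular_sequence R fs \<longleftrightarrow>
    set fs \<subseteq> carrier R \<and> Idl\<^bsub>R\<^esub> (set fs) \<noteq> carrier R \<and>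
    (\<forall>i<length fs. \<forall>x\<in>carrier R.
       fs ! i \<otimes>\<^bsub>R\<^esub> x \<in> Idl\<^bsub>R\<^esub> (set (take i fs)) \<longrightarrow> x \<in> Idl\<^bsub>R\<^esub> (set (take i fs)))"

text \<open>
  The ring \<open>Q\<close> is not determined by \<open>A\<close>, so the type of its elements is an explicit parameter;
  results about local complete intersections are to be stated for an arbitrary type \<open>'q\<close>.
\<close>

definition local_complete_intersection ::
    "'q itself \<Rightarrow> ('a, 'b) ring_scheme \<Rightarrow> 'a set \<Rightarrow> bool"
  where "local_complete_intersection (_ :: 'q itself) A \<mm> \<longleftrightarrow>
    noetherian_local_ring A \<mm> \<and>
    (\<exists>(Q :: 'q ring) \<nn> fs.
       regular_local_ring Q \<nn> \<and> adically_complete Q \<nn> \<and> regular_sequence Q fs \<and>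
       completion A \<mm> \<simeq> Q Quot (Idl\<^bsub>Q\<^esub> (set fs)))"


section \<open>Modules\<close>

definition module_span ::
    "('a, 'b) ring_scheme \<Rightarrow> ('a, 'm, 'c) module_scheme \<Rightarrow> 'm set \<Rightarrow> 'm set"
  where "module_span A M S = \<Inter>{H. submodule H A M \<and> S \<subseteq> H}"

definition finitely_generated_module ::
    "('a, 'b) ring_scheme \<Rightarrow> ('a, 'm, 'c) module_scheme \<Rightarrow> bool"
  where "finitely_generated_module A M \<longleftrightarrow>
    module A M \<and> (\<exists>S. finite S \<and> S \<subseteq> carrier M \<and> module_span A M S = carrier M)"

definition ideal_smult ::
    "('a, 'b) ring_scheme \<Rightarrow> 'a set \<Rightarrow> ('a, 'm, 'c) module_scheme \<Rightarrow> 'm set"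
  where "ideal_smult A I M = module_span A M {a \<odot>\<^bsub>M\<^esub> x | a x. a \<in> I \<and> x \<in> carrier M}"

text \<open>
  Modules are records extending rings; the fields \<^term>\<open>monoid.mult\<close> and \<^term>\<open>monoid.one\<close> play no role
  for a module and are left undefined.
\<close>

definition quotient_module ::
    "('a, 'm, 'c) module_scheme \<Rightarrow> 'm set \<Rightarrow> ('a, 'm set) module"
  where "quotient_module M H =
    \<lparr>carrier = a_rcosets\<^bsub>M\<^esub> H, monoid.mult = undefined, monoid.one = undefined,
     ring.zero = H, ring.add = set_add M,
     module.smult = (\<lambda>a C. \<Union>x\<in>C. H +>\<^bsub>M\<^esub> (a \<odot>\<^bsub>M\<^esub> x))\<rparr>"

definition module_hom_set ::
    "('a, 'b) ring_scheme \<Rightarrow> ('a, 'm, 'c) module_scheme \<Rightarrow> ('a, 'n, 'd) module_scheme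
      \<Rightarrow> ('m \<Rightarrow> 'n) set"
  where "module_hom_set A M N = {h \<in> carrier M \<rightarrow> carrier N.
    (\<forall>x\<in>carrier M. \<forall>y\<in>carrier M. h (x \<oplus>\<^bsub>M\<^esub> y) = h x \<oplus>\<^bsub>N\<^esub> h y) \<and>
    (\<forall>a\<in>carrier A. \<forall>x\<in>carrier M. h (a \<odot>\<^bsub>M\<^esub> x) = a \<odot>\<^bsub>N\<^esub> h x)}"

definition Hom_module ::
    "('a, 'b) ring_scheme \<Rightarrow> ('a, 'm, 'c) module_scheme \<Rightarrow> ('a, 'n, 'd) module_scheme
      \<Rightarrow> ('a, 'm \<Rightarrow> 'n) module"
  where "Hom_module A M N =
    \<lparr>carrier = module_hom_set A M N \<inter> extensional (carrier M),
     monoid.mult = undefined, monoid.one = undefined,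
     ring.zero = (\<lambda>x\<in>carrier M. \<zero>\<^bsub>N\<^esub>),
     ring.add = (\<lambda>g h. \<lambda>x\<in>carrier M. g x \<oplus>\<^bsub>N\<^esub> h x),
     module.smult = (\<lambda>a h. \<lambda>x\<in>carrier M. a \<odot>\<^bsub>N\<^esub> h x)\<rparr>"

definition associated_primes ::
    "('a, 'b) ring_scheme \<Rightarrow> ('a, 'm, 'c) module_scheme \<Rightarrow> 'a set set"
  where "associated_primes A M = {P. primeideal P A \<and>
    (\<exists>x\<in>carrier M. P = {a \<in> carrier A. a \<odot>\<^bsub>M\<^esub> x = \<zero>\<^bsub>M\<^esub>})}"


section \<open>Free resolutions and Ext\<close>

text \<open>The free module with basis \<open>B\<close>: finitely supported functions, extended by zero outside \<open>B\<close>.\<close>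

definition free_module :: "('a, 'b) ring_scheme \<Rightarrow> 'x set \<Rightarrow> ('a, 'x \<Rightarrow> 'a) module"
  where "free_module A B =
    \<lparr>carrier = {f. range f \<subseteq> carrier A \<and> {x. f x \<noteq> \<zero>\<^bsub>A\<^esub>} \<subseteq> B \<and> finite {x. f x \<noteq> \<zero>\<^bsub>A\<^esub>}},
     monoid.mult = undefined, monoid.one = undefined,
     ring.zero = (\<lambda>_. \<zero>\<^bsub>A\<^esub>),
     ring.add = (\<lambda>f g x. f x \<oplus>\<^bsub>A\<^esub> g x),
     module.smult = (\<lambda>a f x. a \<otimes>\<^bsub>A\<^esub> f x)\<rparr>"

text \<open>
  An exact sequence \<open>\<dots> \<rightarrow> F\<^sub>2 \<rightarrow> F\<^sub>1 \<rightarrow> F\<^sub>0 \<rightarrow> M \<rightarrow> 0\<close> with \<open>F\<^sub>i\<close> free on \<open>B i\<close>, differentials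
  \<open>d i\<close> from \<open>F\<^sub>i\<^sub>+\<^sub>1\<close> to \<open>F\<^sub>i\<close> and augmentation \<open>e\<close>.
\<close>

definition free_resolution ::
    "('a, 'b) ring_scheme \<Rightarrow> ('a, 'm, 'c) module_scheme \<Rightarrow> (nat \<Rightarrow> 'x set)
      \<Rightarrow> (nat \<Rightarrow> ('x \<Rightarrow> 'a) \<Rightarrow> ('x \<Rightarrow> 'a)) \<Rightarrow> (('x \<Rightarrow> 'a) \<Rightarrow> 'm) \<Rightarrow> bool"
  where "free_resolution A M B d e \<longleftrightarrow>
    e \<in> module_hom_set A (free_module A (B 0)) M \<and>
    (\<forall>i. d i \<in> module_hom_set A (free_module A (B (Suc i))) (free_module A (B i))) \<and>
    e ` carrier (free_module A (B 0)) = carrier M \<and>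
    d 0 ` carrier (free_module A (B 1)) =
      {f \<in> carrier (free_module A (B 0)). e f = \<zero>\<^bsub>M\<^esub>} \<and>
    (\<forall>i. d (Suc i) ` carrier (free_module A (B (Suc (Suc i)))) =
      {f \<in> carrier (free_module A (B (Suc i))). d i f = \<zero>\<^bsub>free_module A (B i)\<^esub>})"

definition Hom_differential ::
    "('a, 'b) ring_scheme \<Rightarrow> (nat \<Rightarrow> 'x set) \<Rightarrow> (nat \<Rightarrow> ('x \<Rightarrow> 'a) \<Rightarrow> ('x \<Rightarrow> 'a))
      \<Rightarrow> nat \<Rightarrow> (('x \<Rightarrow> 'a) \<Rightarrow> 'n) \<Rightarrow> (('x \<Rightarrow> 'a) \<Rightarrow> 'n)"
  where "Hom_differential A B d i h = (\<lambda>f\<in>carrier (free_module A (B (Suc i))). h (d i f))"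

definition Hom_cocycles ::
    "('a, 'b) ring_scheme \<Rightarrow> (nat \<Rightarrow> 'x set) \<Rightarrow> (nat \<Rightarrow> ('x \<Rightarrow> 'a) \<Rightarrow> ('x \<Rightarrow> 'a))
      \<Rightarrow> ('a, 'n, 'd) module_scheme \<Rightarrow> nat \<Rightarrow> (('x \<Rightarrow> 'a) \<Rightarrow> 'n) set"
  where "Hom_cocycles A B d N i =
    {h \<in> carrier (Hom_module A (free_module A (B i)) N).
       Hom_differential A B d i h = \<zero>\<^bsub>Hom_module A (free_module A (B (Suc i))) N\<^esub>}"

fun Hom_coboundaries ::
    "('a, 'b) ring_scheme \<Rightarrow> (nat \<Rightarrow> 'x set) \<Rightarrow> (nat \<Rightarrow> ('x \<Rightarrow> 'a) \<Rightarrow> ('x \<Rightarrow> 'a))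
      \<Rightarrow> ('a, 'n, 'd) module_scheme \<Rightarrow> nat \<Rightarrow> (('x \<Rightarrow> 'a) \<Rightarrow> 'n) set"
  where
    "Hom_coboundaries A B d N 0 = {\<zero>\<^bsub>Hom_module A (free_module A (B 0)) N\<^esub>}"
  | "Hom_coboundaries A B d N (Suc i) =
      Hom_differential A B d i ` carrier (Hom_module A (free_module A (B i)) N)"

definition Hom_cohomology ::
    "('a, 'b) ring_scheme \<Rightarrow> (nat \<Rightarrow> 'x set) \<Rightarrow> (nat \<Rightarrow> ('x \<Rightarrow> 'a) \<Rightarrow> ('x \<Rightarrow> 'a))
      \<Rightarrow> ('a, 'n, 'd) module_scheme \<Rightarrow> nat \<Rightarrow> ('a, (('x \<Rightarrow> 'a) \<Rightarrow> 'n) set) module"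
  where "Hom_cohomology A B d N i =
    quotient_module
      ((Hom_module A (free_module A (B i)) N)\<lparr>carrier := Hom_cocycles A B d N i\<rparr>)
      (Hom_coboundaries A B d N i)"

text \<open>
  Ext is computed from a fixed but arbitrary free resolution of the first argument.  The basis
  elements are taken from the type of lists over \<open>'m \<times> 'a \<times> nat\<close>, which is large enough for a
  free resolution of any module to exist (lemma \<open>free_resolution_exists\<close> below).
\<close>

definition some_free_resolution ::
    "('a, 'b) ring_scheme \<Rightarrow> ('a, 'm, 'c) module_scheme
      \<Rightarrow> (nat \<Rightarrow> ('m \<times> 'a \<times> nat) list set)
        \<times> (nat \<Rightarrow> (('m \<times> 'a \<times> nat) list \<Rightarrow> 'a) \<Rightarrow> (('m \<times> 'a \<times> nat) list \<Rightarrow> 'a))"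
  where "some_free_resolution A M = (SOME (B, d). \<exists>e. free_resolution A M B d e)"

definition Ext ::
    "('a, 'b) ring_scheme \<Rightarrow> nat \<Rightarrow> ('a, 'm, 'c) module_scheme \<Rightarrow> ('a, 'n, 'd) module_scheme
      \<Rightarrow> ('a, ((('m \<times> 'a \<times> nat) list \<Rightarrow> 'a) \<Rightarrow> 'n) set) module"
  where "Ext A i M N = (case some_free_resolution A M of (B, d) \<Rightarrow> Hom_cohomology A B d N i)"


subsection \<open>Existence of free resolutions\<close>

lemma free_module_is_module:
  assumes "cring A"
  shows "module A (free_module A B)"
proof -
  interpret cring A by fact
  let ?F = "free_module A B"
  have car: "f \<in> carrier ?F \<longleftrightarrow>
      (\<forall>x. f x \<in> carrier A) \<and> (\<forall>x. f x \<noteq> \<zero>\<^bsub>A\<^esub> \<longrightarrow> x \<in> B) \<and> finite {x. f x \<noteq> \<zero>\<^bsub>A\<^esub>}" for f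
    by (auto simp: free_module_def)
  have add: "f \<oplus>\<^bsub>?F\<^esub> g = (\<lambda>x. f x \<oplus>\<^bsub>A\<^esub> g x)" for f g by (simp add: free_module_def)
  have zero: "\<zero>\<^bsub>?F\<^esub> = (\<lambda>x. \<zero>\<^bsub>A\<^esub>)" by (simp add: free_module_def)
  have smult: "a \<odot>\<^bsub>?F\<^esub> f = (\<lambda>x. a \<otimes>\<^bsub>A\<^esub> f x)" for a f by (simp add: free_module_def)
  have add_closed: "f \<oplus>\<^bsub>?F\<^esub> g \<in> carrier ?F" if f: "f \<in> carrier ?F" and g: "g \<in> carrier ?F" for f g
  proof -
    have sub: "{x. f x \<oplus>\<^bsub>A\<^esub> g x \<noteq> \<zero>\<^bsub>A\<^esub>} \<subseteq> {x. f x \<noteq> \<zero>\<^bsub>A\<^esub>} \<union> {x. g x \<noteq> \<zero>\<^bsub>A\<^esub>}"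
      by auto
    have "finite {x. f x \<oplus>\<^bsub>A\<^esub> g x \<noteq> \<zero>\<^bsub>A\<^esub>}"
      by (rule finite_subset[OF sub]) (use f g in \<open>simp add: car\<close>)
    moreover have "x \<in> B" if "f x \<oplus>\<^bsub>A\<^esub> g x \<noteq> \<zero>\<^bsub>A\<^esub>" for x
      using f g that sub by (auto simp: car)
    ultimately show ?thesis using f g by (simp add: car add)
  qed
  have smult_closed: "a \<odot>\<^bsub>?F\<^esub> f \<in> carrier ?F" if a: "a \<in> carrier A" and f: "f \<in> carrier ?F" for a f
  proof -
    have sub: "{x. a \<otimes>\<^bsub>A\<^esub> f x \<noteq> \<zero>\<^bsub>A\<^esub>} \<subseteq> {x. f x \<noteq> \<zero>\<^bsub>A\<^esub>}"
      using a by auto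
    moreover have "finite {x. a \<otimes>\<^bsub>A\<^esub> f x \<noteq> \<zero>\<^bsub>A\<^esub>}"
      by (rule finite_subset[OF sub]) (use f in \<open>simp add: car\<close>)
    ultimately show ?thesis using a f by (auto simp: car smult)
  qed
  have neg: "\<exists>g\<in>carrier ?F. g \<oplus>\<^bsub>?F\<^esub> f = \<zero>\<^bsub>?F\<^esub>" if f: "f \<in> carrier ?F" for f
  proof
    have "{x. \<ominus>\<^bsub>A\<^esub> f x \<noteq> \<zero>\<^bsub>A\<^esub>} = {x. f x \<noteq> \<zero>\<^bsub>A\<^esub>}"
      using f by (auto simp: car)
    then show "(\<lambda>x. \<ominus>\<^bsub>A\<^esub> f x) \<in> carrier ?F"
      using f by (auto simp: car)
    show "(\<lambda>x. \<ominus>\<^bsub>A\<^esub> f x) \<oplus>\<^bsub>?F\<^esub> f = \<zero>\<^bsub>?F\<^esub>"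
      using f by (simp add: add zero car l_neg)
  qed
  have "abelian_group ?F"
  proof (rule abelian_groupI)
    show "\<zero>\<^bsub>?F\<^esub> \<in> carrier ?F" by (simp add: car zero)
  next
    fix f g assume "f \<in> carrier ?F" "g \<in> carrier ?F"
    then show "f \<oplus>\<^bsub>?F\<^esub> g \<in> carrier ?F" by (rule add_closed)
  next
    fix f g k assume "f \<in> carrier ?F" "g \<in> carrier ?F" "k \<in> carrier ?F"
    then show "f \<oplus>\<^bsub>?F\<^esub> g \<oplus>\<^bsub>?F\<^esub> k = f \<oplus>\<^bsub>?F\<^esub> (g \<oplus>\<^bsub>?F\<^esub> k)"
      by (simp add: car add a_assoc)
  next
    fix f g assume "f \<in> carrier ?F" "g \<in> carrier ?F"
    then show "f \<oplus>\<^bsub>?F\<^esub> g = g \<oplus>\<^bsub>?F\<^esub> f" by (simp add: car add a_comm)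
  next
    fix f assume f: "f \<in> carrier ?F"
    then show "\<zero>\<^bsub>?F\<^esub> \<oplus>\<^bsub>?F\<^esub> f = f" by (simp add: car add zero)
    show "\<exists>g\<in>carrier ?F. g \<oplus>\<^bsub>?F\<^esub> f = \<zero>\<^bsub>?F\<^esub>" by (rule neg[OF f])
  qed
  then show ?thesis
  proof (intro moduleI)
    fix a f assume "a \<in> carrier A" "f \<in> carrier ?F"
    then show "a \<odot>\<^bsub>?F\<^esub> f \<in> carrier ?F" by (rule smult_closed)
  qed (simp_all add: assms car add smult l_distr r_distr m_assoc)
qed

lemma (in module) free_module_cover:
  assumes inj: "inj_on j K" and K: "submodule K R M"
  shows "\<exists>h\<in>module_hom_set R (free_module R (j ` K)) M.
           h ` carrier (free_module R (j ` K)) = K"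
proof -
  define c where "c = inv_into K j"
  define h where "h f = (\<Oplus>\<^bsub>M\<^esub>x\<in>{x. f x \<noteq> \<zero>}. f x \<odot>\<^bsub>M\<^esub> c x)" for f
  let ?F = "free_module R (j ` K)"
  have KM: "K \<subseteq> carrier M" using submoduleE(1)[OF K] .
  have c: "c x \<in> K" if "x \<in> j ` K" for x
    using that by (simp add: c_def inv_into_into)
  have car: "f \<in> carrier ?F \<longleftrightarrow>
      (\<forall>x. f x \<in> carrier R) \<and> {x. f x \<noteq> \<zero>} \<subseteq> j ` K \<and> finite {x. f x \<noteq> \<zero>}" for f
    by (auto simp: free_module_def)
  have add: "f \<oplus>\<^bsub>?F\<^esub> g = (\<lambda>x. f x \<oplus> g x)" for f g by (simp add: free_module_def)
  have smult: "a \<odot>\<^bsub>?F\<^esub> f = (\<lambda>x. a \<otimes> f x)" for a f by (simp add: free_module_def)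
  have h_eq: "h f = (\<Oplus>\<^bsub>M\<^esub>x\<in>S. f x \<odot>\<^bsub>M\<^esub> c x)"
    if "f \<in> carrier ?F" "finite S" "{x. f x \<noteq> \<zero>} \<subseteq> S" "S \<subseteq> j ` K" for f S
    unfolding h_def
    by (rule M.add.finprod_mono_neutral_cong_left)
       (use that c KM in \<open>auto simp: car subset_iff Pi_iff\<close>)
  interpret F: module R ?F by (rule free_module_is_module) (rule R.is_cring)
  have hM: "h f \<in> carrier M" if "f \<in> carrier ?F" for f
    unfolding h_def by (rule M.finsum_closed) (use that c KM in \<open>auto simp: car subset_iff\<close>)
  have h_add: "h (f \<oplus>\<^bsub>?F\<^esub> g) = h f \<oplus>\<^bsub>M\<^esub> h g"
    if f: "f \<in> carrier ?F" and g: "g \<in> carrier ?F" for f g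
  proof -
    define S where "S = {x. f x \<noteq> \<zero>} \<union> {x. g x \<noteq> \<zero>}"
    have S: "finite S" "S \<subseteq> j ` K" "{x. f x \<noteq> \<zero>} \<subseteq> S" "{x. g x \<noteq> \<zero>} \<subseteq> S"
      using f g by (auto simp: car S_def)
    have fg: "{x. (f \<oplus>\<^bsub>?F\<^esub> g) x \<noteq> \<zero>} \<subseteq> S"
      by (auto simp: add S_def)
    have cS: "c x \<in> carrier M" if "x \<in> S" for x using that c S KM by blast
    have "h (f \<oplus>\<^bsub>?F\<^esub> g) = (\<Oplus>\<^bsub>M\<^esub>x\<in>S. (f \<oplus>\<^bsub>?F\<^esub> g) x \<odot>\<^bsub>M\<^esub> c x)"
      by (rule h_eq) (use f g fg S in auto)
    also have "\<dots> = (\<Oplus>\<^bsub>M\<^esub>x\<in>S. f x \<odot>\<^bsub>M\<^esub> c x \<oplus>\<^bsub>M\<^esub> g x \<odot>\<^bsub>M\<^esub> c x)"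
      by (rule M.finsum_cong') (use f g cS in \<open>auto simp: car add smult_l_distr\<close>)
    also have "\<dots> = (\<Oplus>\<^bsub>M\<^esub>x\<in>S. f x \<odot>\<^bsub>M\<^esub> c x) \<oplus>\<^bsub>M\<^esub> (\<Oplus>\<^bsub>M\<^esub>x\<in>S. g x \<odot>\<^bsub>M\<^esub> c x)"
      by (rule M.finsum_addf) (use f g cS in \<open>auto simp: car\<close>)
    also have "\<dots> = h f \<oplus>\<^bsub>M\<^esub> h g"
      using h_eq[OF f S(1,3,2)] h_eq[OF g S(1,4,2)] by simp
    finally show ?thesis .
  qed
  have h_smult: "h (a \<odot>\<^bsub>?F\<^esub> f) = a \<odot>\<^bsub>M\<^esub> h f" if a: "a \<in> carrier R" and f: "f \<in> carrier ?F" for a f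
  proof -
    define S where "S = {x. f x \<noteq> \<zero>}"
    have S: "finite S" "S \<subseteq> j ` K" using f by (auto simp: car S_def)
    have af: "{x. (a \<odot>\<^bsub>?F\<^esub> f) x \<noteq> \<zero>} \<subseteq> S"
      using a by (auto simp: smult S_def)
    have cS: "c x \<in> carrier M" if "x \<in> S" for x using that c S KM by blast
    have "h (a \<odot>\<^bsub>?F\<^esub> f) = (\<Oplus>\<^bsub>M\<^esub>x\<in>S. (a \<odot>\<^bsub>?F\<^esub> f) x \<odot>\<^bsub>M\<^esub> c x)"
      by (rule h_eq) (use a f af S in auto)
    also have "\<dots> = (\<Oplus>\<^bsub>M\<^esub>x\<in>S. a \<odot>\<^bsub>M\<^esub> (f x \<odot>\<^bsub>M\<^esub> c x))"
      by (rule M.finsum_cong') (use a f cS in \<open>auto simp: car smult smult_assoc1\<close>)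
    also have "\<dots> = a \<odot>\<^bsub>M\<^esub> h f"
      unfolding h_def S_def[symmetric]
      by (rule finsum_smult_ldistr[symmetric]) (use a f cS S in \<open>auto simp: car\<close>)
    finally show ?thesis .
  qed
  have h_K: "h f \<in> K" if f: "f \<in> carrier ?F" for f
  proof -
    have zK: "\<zero>\<^bsub>M\<^esub> \<in> K"
      using subgroup.one_closed[OF submodule.axioms(1)[OF K]] by simp
    have "(\<Oplus>\<^bsub>M\<^esub>x\<in>S. f x \<odot>\<^bsub>M\<^esub> c x) \<in> K" if "finite S" "S \<subseteq> j ` K" for S
      using that
    proof (induction S)
      case empty
      then show ?case by (simp add: zK)
    next
      case (insert x S)
      have t: "f y \<odot>\<^bsub>M\<^esub> c y \<in> K" if "y \<in> insert x S" for y
        using that insert.prems c f submoduleE(4)[OF K] by (auto simp: car)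
      then show ?case
        using insert KM submoduleE(5)[OF K] by (subst M.finsum_insert) auto
    qed
    then show ?thesis using f by (simp add: h_def car)
  qed
  have h_onto: "k \<in> h ` carrier ?F" if k: "k \<in> K" for k
  proof -
    define f where "f x = (if x = j k then \<one> else \<zero>)" for x
    have supp: "{x. f x \<noteq> \<zero>} \<subseteq> {j k}" by (auto simp: f_def)
    then have f: "f \<in> carrier ?F"
      using k finite_subset[OF supp] by (auto simp: car f_def)
    have "h f = (\<Oplus>\<^bsub>M\<^esub>x\<in>{j k}. f x \<odot>\<^bsub>M\<^esub> c x)"
      by (rule h_eq) (use f supp k in auto)
    also have "\<dots> = k"
      using k KM inj by (subst M.finsum_insert) (auto simp: f_def c_def)
    finally show ?thesis using f by force
  qed
  show ?thesis
  proof
    show "h \<in> module_hom_set R ?F M"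
      by (auto simp: module_hom_set_def hM h_add h_smult)
    show "h ` carrier ?F = K"
      using h_K h_onto by blast
  qed
qed

lemma submodule_kernel:
  assumes "module A M" "module A N" and h: "h \<in> module_hom_set A M N"
  shows "submodule {x \<in> carrier M. h x = \<zero>\<^bsub>N\<^esub>} A M"
proof -
  interpret M: module A M by fact
  interpret N: module A N by fact
  have hc: "h x \<in> carrier N" if "x \<in> carrier M" for x
    using h that by (auto simp: module_hom_set_def)
  have hadd: "h (x \<oplus>\<^bsub>M\<^esub> y) = h x \<oplus>\<^bsub>N\<^esub> h y" if "x \<in> carrier M" "y \<in> carrier M" for x y
    using h that by (auto simp: module_hom_set_def)
  have hsm: "h (a \<odot>\<^bsub>M\<^esub> x) = a \<odot>\<^bsub>N\<^esub> h x" if "a \<in> carrier A" "x \<in> carrier M" for a x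
    using h that by (auto simp: module_hom_set_def)
  have h0: "h \<zero>\<^bsub>M\<^esub> = \<zero>\<^bsub>N\<^esub>"
    using hadd[of "\<zero>\<^bsub>M\<^esub>" "\<zero>\<^bsub>M\<^esub>"] hc[of "\<zero>\<^bsub>M\<^esub>"] by simp
  show ?thesis
  proof (rule M.submoduleI)
    fix x assume x: "x \<in> {x \<in> carrier M. h x = \<zero>\<^bsub>N\<^esub>}"
    then have "h x \<oplus>\<^bsub>N\<^esub> h (\<ominus>\<^bsub>M\<^esub> x) = \<zero>\<^bsub>N\<^esub>"
      using hadd[of x "\<ominus>\<^bsub>M\<^esub> x"] h0 by (simp add: M.M.r_neg)
    then show "\<ominus>\<^bsub>M\<^esub> x \<in> {x \<in> carrier M. h x = \<zero>\<^bsub>N\<^esub>}"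
      using x hc[of "\<ominus>\<^bsub>M\<^esub> x"] by simp
  qed (auto simp: h0 hadd hsm)
qed

lemma inj_encode:
  defines "code \<equiv> (\<lambda>(w, a). (undefined :: 'm, a :: 'a, length w) # w)"
  shows "inj (\<lambda>l. concat (map code l))"
proof (rule injI)
  fix k l :: "(('m \<times> 'a \<times> nat) list \<times> 'a) list"
  assume "concat (map code k) = concat (map code l)"
  then show "k = l"
  proof (induction k arbitrary: l)
    case Nil
    then show ?case by (cases l) (auto simp: code_def split: prod.splits)
  next
    case (Cons p k)
    then obtain q l' where l: "l = q # l'"
      by (cases l) (auto simp: code_def split: prod.splits)
    obtain v a w b where pq: "p = (v, a)" "q = (w, b)" by (cases p, cases q) auto
    from Cons.prems have "a = b" "length v = length w"
      and eq: "v @ concat (map code k) = w @ concat (map code l')"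
      by (auto simp: l pq code_def)
    with Cons.IH[of l'] show ?case by (auto simp: l pq)
  qed
qed

lemma inj_finite_support:
  shows "\<exists>j :: (('m \<times> 'a \<times> nat) list \<Rightarrow> 'a) \<Rightarrow> ('m \<times> 'a \<times> nat) list.
           inj_on j {f. finite {x. f x \<noteq> z}}"
proof -
  define s where "s f = (SOME xs. set xs = {x. f x \<noteq> z})"
    for f :: "('m \<times> 'a \<times> nat) list \<Rightarrow> 'a"
  define g where "g f = map (\<lambda>x. (x, f x)) (s f)" for f
  have s: "set (s f) = {x. f x \<noteq> z}" if "finite {x. f x \<noteq> z}" for f
    unfolding s_def by (rule someI_ex) (rule finite_list[OF that])
  have g: "inj_on g {f. finite {x. f x \<noteq> z}}"
  proof (rule inj_onI)
    fix f f' assume fin: "f \<in> {f. finite {x. f x \<noteq> z}}" "f' \<in> {f. finite {x. f x \<noteq> z}}"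
      and "g f = g f'"
    then have *: "set (g f) = set (g f')" by simp
    have "{(x, f x) |x. f x \<noteq> z} = {(x, f' x) |x. f' x \<noteq> z}"
      using * fin s[of f] s[of f'] by (auto simp: g_def image_def)
    then show "f = f'"
      by (intro ext) (auto simp: set_eq_iff, metis)
  qed
  show ?thesis
    using comp_inj_on[OF g inj_on_subset[OF inj_encode subset_UNIV]] by blast
qed

lemma free_resolution_exists:
  fixes A :: "('a, 'b) ring_scheme" and M :: "('a, 'm, 'c) module_scheme"
  assumes M: "module A M"
  shows "\<exists>(B :: nat \<Rightarrow> ('m \<times> 'a \<times> nat) list set) d e. free_resolution A M B d e"
proof -
  interpret module A M by fact
  have F: "module A (free_module A Y)" for Y :: "('m \<times> 'a \<times> nat) list set"
    by (rule free_module_is_module) (rule R.is_cring)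
  obtain j :: "(('m \<times> 'a \<times> nat) list \<Rightarrow> 'a) \<Rightarrow> ('m \<times> 'a \<times> nat) list"
    where j: "inj_on j {f. finite {x. f x \<noteq> \<zero>\<^bsub>A\<^esub>}}"
    by (rule exE[OF inj_finite_support])
  have jF: "inj_on j K" if "K \<subseteq> carrier (free_module A Y)" for K Y
    by (rule inj_on_subset[OF j]) (use that in \<open>auto simp: free_module_def\<close>)

  define B0 where "B0 = (\<lambda>m. [(m, undefined :: 'a, 0 :: nat)]) ` carrier M"
  obtain e where e: "e \<in> module_hom_set A (free_module A B0) M"
      "e ` carrier (free_module A B0) = carrier M"
    using free_module_cover[of "\<lambda>m. [(m, undefined, 0)]", OF _ carrier_is_submodule]
    unfolding B0_def by (auto simp: inj_on_def)
  define K0 where "K0 = {f \<in> carrier (free_module A B0). e f = \<zero>\<^bsub>M\<^esub>}"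
  have K0: "submodule K0 A (free_module A B0)"
    unfolding K0_def by (rule submodule_kernel[OF F M e(1)])

  define D where "D Y K = (SOME h. h \<in> module_hom_set A (free_module A (j ` K)) (free_module A Y) \<and>
      h ` carrier (free_module A (j ` K)) = K)" for Y K
  have D: "D Y K \<in> module_hom_set A (free_module A (j ` K)) (free_module A Y)"
      "D Y K ` carrier (free_module A (j ` K)) = K"
    if "submodule K A (free_module A Y)" for Y K
  proof -
    have "\<exists>h. h \<in> module_hom_set A (free_module A (j ` K)) (free_module A Y) \<and>
        h ` carrier (free_module A (j ` K)) = K"
      using module.free_module_cover[OF F jF[OF module.submoduleE(1)[OF F that]] that] by blast
    from someI_ex[OF this]
    show "D Y K \<in> module_hom_set A (free_module A (j ` K)) (free_module A Y)"
      "D Y K ` carrier (free_module A (j ` K)) = K"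
      by (simp_all add: D_def)
  qed
  define st where "st = rec_nat (B0, K0) (\<lambda>_ (Y, K).
      (j ` K, {f \<in> carrier (free_module A (j ` K)). D Y K f = \<zero>\<^bsub>free_module A Y\<^esub>}))"
  define B where "B i = fst (st i)" for i
  define K where "K i = snd (st i)" for i
  define d where "d i = D (B i) (K i)" for i
  have B_0: "B 0 = B0" and K_0: "K 0 = K0" by (simp_all add: B_def K_def st_def)
  have B_Suc: "B (Suc i) = j ` K i" for i
    by (simp add: B_def K_def st_def case_prod_beta)
  have K_Suc: "K (Suc i) =
      {f \<in> carrier (free_module A (B (Suc i))). d i f = \<zero>\<^bsub>free_module A (B i)\<^esub>}" for i
    unfolding B_Suc by (simp add: B_def K_def d_def st_def case_prod_beta)
  have K: "submodule (K i) A (free_module A (B i))" for i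
  proof (induction i)
    case 0
    then show ?case by (simp add: B_0 K_0 K0)
  next
    case (Suc i)
    have "d i \<in> module_hom_set A (free_module A (B (Suc i))) (free_module A (B i))"
      unfolding B_Suc d_def by (rule D(1)[OF Suc])
    then show ?case
      unfolding K_Suc by (rule submodule_kernel[OF F F])
  qed
  have "free_resolution A M B d e"
    unfolding free_resolution_def
  proof (intro conjI allI)
    show "e \<in> module_hom_set A (free_module A (B 0)) M"
      "e ` carrier (free_module A (B 0)) = carrier M"
      by (simp_all add: B_0 e)
    show "d i \<in> module_hom_set A (free_module A (B (Suc i))) (free_module A (B i))" for i
      unfolding B_Suc d_def by (rule D(1)[OF K])
    have im: "d i ` carrier (free_module A (B (Suc i))) = K i" for i
      unfolding B_Suc d_def by (rule D(2)[OF K])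
    show "d 0 ` carrier (free_module A (B 1)) =
        {f \<in> carrier (free_module A (B 0)). e f = \<zero>\<^bsub>M\<^esub>}"
      using im[of 0] by (simp add: K_0 K0_def B_0)
    show "d (Suc i) ` carrier (free_module A (B (Suc (Suc i)))) =
        {f \<in> carrier (free_module A (B (Suc i))). d i f = \<zero>\<^bsub>free_module A (B i)\<^esub>}" for i
      using im[of "Suc i"] by (simp add: K_Suc)
  qed
  then show ?thesis by blast
qed

lemma some_free_resolution:
  fixes A :: "('a, 'b) ring_scheme" and M :: "('a, 'm, 'c) module_scheme"
  assumes "module A M" "some_free_resolution A M = (B, d)"
  shows "\<exists>e. free_resolution A M B d e"
proof -
  obtain B' :: "nat \<Rightarrow> ('m \<times> 'a \<times> nat) list set" and d' e'
    where "free_resolution A M B' d' e'"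
    using free_resolution_exists[OF assms(1)] by auto
  then have "case (B', d') of (B, d) \<Rightarrow> \<exists>e. free_resolution A M B d e"
    by auto
  then have "case some_free_resolution A M of (B, d) \<Rightarrow> \<exists>e. free_resolution A M B d e"
    unfolding some_free_resolution_def by (rule someI)
  then show ?thesis
    using assms(2) by simp
qed

end

theory Submission
 imports Defs "HOL-Library.Function_Algebras" "HOL-Library.Poly_Mapping" "HOL-Library.Multiset"
begin

text \<open>Let \<open>S = Q/(f)\<close> be the completion of \<open>A\<close>. A finite \<open>Q\<close>-free resolution of the completion of \<open>M\<close> (\<open>Q\<close> is
 regular) together with higher homotopies for \<open>f\<close> yields an \<open>S\<close>-free resolution on which operators
 \<open>t\<^sub>1, \<dots>, t\<^sub>c\<close> act (Shamash, Eisenbud). By Hilbert's basis theorem the cochains of all degrees with values in \<open>N\<close>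
 form one Noetherian module \<open>X\<close> over \<open>S[t\<^sub>1, \<dots>, t\<^sub>c]\<close>, and the associated primes of \<open>H(X/I\<^sup>nX)\<close> for all \<open>n\<close>
 are controlled by two finitely generated Rees modules. By flatness (Artin--Rees and Krull), the
 annihilator of a class in \<open>Ext\<close> over \<open>A\<close> is contracted from the annihilator of its image over \<open>S\<close>.

 Rings are presented as a ring type modulo an ideal \<open>K\<close>, modules as subquotients \<open>W / U\<close> of an abelian
 group type; \<open>osub Om\<close> are the subgroups stable under the operators \<open>Om\<close>, and \<open>noeth Om W U\<close> says that
 \<open>W / U\<close> is a Noetherian \<open>Om\<close>-module.\<close>

text \<open>The union runs over two unbounded indices, and each is absorbed by turning it into a
  grading: the operators \<open>t\<close> collect all cohomological degrees \<open>i\<close>, the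
  Rees variable all exponents \<open>n\<close>. An associated prime of a graded piece is the
  annihilator of a homogeneous element, so one finiteness theorem for Noetherian modules bounds them
  all. It is proved for scalars acting through a larger family of operators, since the modules are
  far from finitely generated over the ring whose primes are counted; that ring is always the one
  presenting \<open>A\<close>, acting through the completion map. For the cohomology to be a module
  over the polynomial ring, the \<open>t\<close> must commute with the differential exactly and not
  only up to homotopy, which shapes the recursion for the higher homotopies. Finite rank matters
  twice: for Hilbert's theorem, where the finite global dimension of \<open>Q\<close> supplies it,
  and for the passage to the completion, where each single term must be finite. The completion
  enters only through approximation: \<open>A\<close> and \<open>S\<close> agree modulo all powers
  of the maximal ideal.\<close>

section \<open>Operator-stable subgroups and chain conditions on subquotients\<close>

definition osub :: "('b::ab_group_add => 'b) set => 'b set => bool" where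
 "osub Om V \<longleftrightarrow> 0 : V & (\<forall>x\<in>V. \<forall>y\<in>V. x - y : V) & (\<forall>w\<in>Om. \<forall>x\<in>V. w x : V)"

definition noeth :: "('b::ab_group_add => 'b) set => 'b set => 'b set => bool" where
 "noeth Om W U \<longleftrightarrow> (\<forall>f :: nat => 'b set.
  (\<forall>n. osub Om (f n) & U <= f n & f n <= W & f n <= f (Suc n)) --> (\<exists>n. \<forall>m\<ge>n. f m = f n))"

definition splus :: "'b::ab_group_add set => 'b set => 'b set" (infixl \<open>\<boxplus>\<close> 65) where
 "A \<boxplus> B = {a + b |a b. a : A & b : B}"

lemma osubI:
 assumes "0 : V" "!!x y. x : V ==> y : V ==> x - y : V" "!!w x. w : Om ==> x : V ==> w x : V"
 shows "osub Om V"
 using assms by (auto simp: osub_def)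

lemma osub_zero: "osub Om V ==> 0 : V"
 and osub_diff: "osub Om V ==> x : V ==> y : V ==> x - y : V"
 and osub_op: "osub Om V ==> w : Om ==> x : V ==> w x : V"
 by (auto simp: osub_def)

lemma osub_uminus: "osub Om V ==> x : V ==> - x : V"
 using osub_diff[of Om V 0 x] by (simp add: osub_zero)

lemma osub_add: "osub Om V ==> x : V ==> y : V ==> x + y : V"
 using osub_diff[of Om V x "- y"] by (simp add: osub_uminus)

lemma osub_sum: "osub Om V ==> (!!i. i : I ==> f i : V) ==> sum f I : V"
 by (induction I rule: infinite_finite_induct) (auto simp: osub_zero osub_add)

lemma osub_diffD: "osub Om V ==> x - y : V ==> y : V ==> x : V"
 using osub_add[of Om V "x - y" y] by simp

lemma osub_diffD': "osub Om V ==> x - y : V ==> x : V ==> y : V"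
 using osub_diff[of Om V x "x - y"] by simp

lemma osub_add_iff: "osub Om V ==> y : V ==> x + y : V \<longleftrightarrow> x : V"
 using osub_add[of Om V x y] osub_diff[of Om V "x + y" y] by auto

lemma osub_add_iff': "osub Om V ==> y : V ==> y + x : V \<longleftrightarrow> x : V"
 using osub_add_iff[of Om V y x] by (simp add: add.commute)

lemma osub_diff_iff: "osub Om V ==> y : V ==> x - y : V \<longleftrightarrow> x : V"
 using osub_diff[of Om V x y] osub_diffD by blast

lemma osub_mono: "osub Om V ==> Om' <= Om ==> osub Om' V"
 by (auto simp: osub_def)

lemma osub_Int: "osub Om V ==> osub Om W ==> osub Om (V \<inter> W)"
 by (auto simp: osub_def)

lemma splusI: "a : A ==> b : B ==> a + b : A \<boxplus> B"
 by (auto simp: splus_def)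

lemma splusE: "x : A \<boxplus> B ==> (!!a b. x = a + b ==> a : A ==> b : B ==> P) ==> P"
 by (auto simp: splus_def)

lemma splus_sub1: "osub Om B ==> A <= A \<boxplus> B"
 using splusI[of _ A 0 B] by (force simp: osub_zero)

lemma splus_sub2: "osub Om A ==> B <= A \<boxplus> B"
 using splusI[of 0 A _ B] by (force simp: osub_zero)

lemma splus_least: "osub Om C ==> A <= C ==> B <= C ==> A \<boxplus> B <= C"
 by (auto simp: splus_def intro!: osub_add[of Om C])

lemma splus_mono: "A <= A' ==> B <= B' ==> A \<boxplus> B <= A' \<boxplus> B'"
 by (auto simp: splus_def)

lemma osub_splus:
 assumes add: "!!w. w : Om ==> additive w" and A: "osub Om A" and B: "osub Om B"
 shows "osub Om (A \<boxplus> B)"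
proof (rule osubI)
 show "0 : A \<boxplus> B" using splusI[OF osub_zero[OF A] osub_zero[OF B]] by simp
 show "x - y : A \<boxplus> B" if xy: "x : A \<boxplus> B" "y : A \<boxplus> B" for x y
 proof -
  obtain a b a' b' where e: "x = a + b" "y = a' + b'" "a : A" "b : B" "a' : A" "b' : B"
   using xy by (metis splusE)
  hence "x - y = (a - a') + (b - b')" by simp
  thus ?thesis using e A B splusI osub_diff by metis
 qed
 show "w x : A \<boxplus> B" if w: "w : Om" and x: "x : A \<boxplus> B" for w x
 proof -
  obtain a b where e: "x = a + b" "a : A" "b : B"
   using x by (metis splusE)
  thus ?thesis using splusI[OF osub_op[OF A w e(2)] osub_op[OF B w e(3)]]
   by (simp add: additive.add[OF add[OF w]])
 qed
qed

lemma noethD: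
 assumes "noeth Om W U" "!!n. osub Om (f n)" "!!n. U <= f n" "!!n. f n <= W" "!!n. f n <= f (Suc n)"
 shows "\<exists>n. \<forall>m\<ge>n. f m = f n"
 using assms unfolding noeth_def by blast

text \<open>If no member above \<open>V0\<close> were maximal, repeatedly choosing a larger one
  would give a chain that never becomes stationary. The later Noetherian inductions go through this
  form.\<close>

lemma noeth_max:
 assumes N: "noeth Om W U" and C: "V0 : C" "!!V. V : C ==> osub Om V & U <= V & V <= W"
 shows "\<exists>V\<in>C. V0 <= V & (\<forall>V'\<in>C. V <= V' --> V' = V)"
proof (rule ccontr)
 assume neg: "\<not> ?thesis"
 have "\<exists>V'. V' : C & V <= V' & V' ~= V" if "V : C" "V0 <= V" for V
  using neg that by blast
 then obtain g where g: "!!V. V : C ==> V0 <= V ==> g V : C & V <= g V & g V ~= V"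
  by metis
 define f where "f n = (g ^^ n) V0" for n
 have f: "f n : C & V0 <= f n" for n
 proof (induction n)
  case (Suc n)
  thus ?case using g[of "f n"] by (auto simp: f_def)
 qed (simp add: f_def C(1))
 have fS: "f (Suc n) = g (f n)" for n by (simp add: f_def)
 have "\<exists>n. \<forall>m\<ge>n. f m = f n"
  by (rule noethD[OF N]) (simp_all add: f C(2) g fS)
 then obtain n where "f (Suc n) = f n" by (meson le_SucI order_refl)
 with g[of "f n"] f[of n] fS[of n] show False by auto
qed

lemma noeth_maxE:
 assumes N: "noeth Om W U" and "V0 : C" and "!!V. V : C ==> osub Om V"
  and "!!V. V : C ==> U <= V" "!!V. V : C ==> V <= W"
 obtains V where "V : C" "V0 <= V" "!!V'. V' : C ==> V <= V' ==> V' = V"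
proof -
 have "\<exists>V\<in>C. V0 <= V & (\<forall>V'\<in>C. V <= V' --> V' = V)"
  by (rule noeth_max[OF N assms(2)]) (simp add: assms)
 thus thesis using that by meson
qed

lemma noeth_mono:
 assumes "noeth Om W U" "W' <= W" "U <= U'" "Om <= Om'"
 shows "noeth Om' W' U'"
 unfolding noeth_def
proof (intro allI impI)
 fix f assume f: "\<forall>n. osub Om' (f n) & U' <= f n & f n <= W' & f n <= f (Suc n)"
 show "\<exists>n. \<forall>m\<ge>n. f m = f n"
  by (rule noethD[OF assms(1)]) (use f assms osub_mono in \<open>blast+\<close>)
qed

text \<open>A chain condition is inherited along a monotone map of submodule lattices that is
  injective on comparable pairs. This stands in for isomorphisms of quotient modules, of which only
  the correspondence of submodules is used.\<close>

lemma noeth_pull: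
 assumes N: "noeth Om W U"
  and Ph: "!!V. osub Om' V ==> U' <= V ==> V <= W' ==> osub Om (Ph V) & U <= Ph V & Ph V <= W"
  and mono: "!!V V'. V <= V' ==> Ph V <= Ph V'"
  and inj: "!!V V'. osub Om' V ==> U' <= V ==> osub Om' V' ==> V' <= W' ==> V <= V' ==> Ph V = Ph V' ==> V' <= V"
 shows "noeth Om' W' U'"
 unfolding noeth_def
proof (intro allI impI)
 fix f assume f: "\<forall>n. osub Om' (f n) & U' <= f n & f n <= W' & f n <= f (Suc n)"
 have up: "f n <= f m" if "n <= m" for n m
  using f that by (metis lift_Suc_mono_le)
 have f': "osub Om' (f n)" "U' <= f n" "f n <= W'" "f n <= f (Suc n)" for n
  using f by auto
 have "\<exists>n. \<forall>m\<ge>n. Ph (f m) = Ph (f n)"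
  by (rule noethD[OF N]) (simp_all add: Ph f' mono)
 then obtain n where n: "\<forall>m\<ge>n. Ph (f m) = Ph (f n)" by blast
 have "f m = f n" if "m >= n" for m
 proof
  show "f n <= f m" by (rule up[OF that])
  have "Ph (f n) = Ph (f m)" using n that by metis
  thus "f m <= f n" by (rule inj[OF f'(1) f'(2) f'(1) f'(3) up[OF that]])
 qed
 thus "\<exists>n. \<forall>m\<ge>n. f m = f n" by blast
qed

text \<open>By the modular law, two comparable submodules with the same sum with \<open>V\<close>
  and the same intersection with \<open>V\<close> coincide, so a chain is stationary as soon as both
  of these are.\<close>

lemma noeth_extend:
 assumes add: "!!w. w : Om ==> additive w"
  and N1: "noeth Om W V" and N2: "noeth Om V U" and V: "osub Om V" and sub: "U <= V" "V <= W" "osub Om W"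
 shows "noeth Om W U"
 unfolding noeth_def
proof (intro allI impI)
 fix f assume f: "\<forall>n. osub Om (f n) & U <= f n & f n <= W & f n <= f (Suc n)"
 have up: "f n <= f m" if "n <= m" for n m
  using f that by (metis lift_Suc_mono_le)
 have "\<exists>n. \<forall>m\<ge>n. f m \<boxplus> V = f n \<boxplus> V"
 proof (rule noethD[OF N1])
  show "osub Om (f n \<boxplus> V)" for n using osub_splus[OF add _ V] f by blast
  show "V <= f n \<boxplus> V" for n using splus_sub2 f by blast
  show "f n \<boxplus> V <= W" for n using splus_least[OF sub(3) _ sub(2)] f by blast
  show "f n \<boxplus> V <= f (Suc n) \<boxplus> V" for n using splus_mono f by blast
 qed
 then obtain n1 where n1: "!!m. m >= n1 ==> f m \<boxplus> V = f n1 \<boxplus> V" by blast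
 have "\<exists>n. \<forall>m\<ge>n. f m \<inter> V = f n \<inter> V"
  by (rule noethD[OF N2]) (use f sub V osub_Int in \<open>blast+\<close>)
 then obtain n2 where n2: "!!m. m >= n2 ==> f m \<inter> V = f n2 \<inter> V" by blast
 define n where "n = max n1 n2"
 have "f m = f n" if m: "m >= n" for m
 proof
  show "f n <= f m" by (rule up[OF m])
  show "f m <= f n"
  proof
   fix x assume x: "x : f m"
   have om: "osub Om (f m)" "osub Om (f n)" using f by auto
   have "x : f m \<boxplus> V" using x splus_sub1[OF V] by blast
   hence "x : f n \<boxplus> V" using n1[of m] n1[of n] m by (simp add: n_def)
   then obtain a b where ab: "x = a + b" "a : f n" "b : V" by (metis splusE)
   hence "b : f m" using x up[OF m] osub_diff[OF om(1), of x a] by auto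
   hence "b : f n" using ab n2[of m] n2[of n] m by (auto simp: n_def)
   thus "x : f n" using ab osub_add[OF om(2)] by blast
  qed
 qed
 thus "\<exists>n. \<forall>m\<ge>n. f m = f n" by blast
qed

lemma noeth_refl: "noeth Om U U"
 unfolding noeth_def by (metis subset_antisym)

section \<open>Adjoining a commuting operator\<close>

text \<open>\<open>tfilt t V U n\<close> is \<open>U + V + t V + ... + t^(n-1) V\<close>, the
  polynomials in \<open>t\<close> of degree below \<open>n\<close> with coefficients in
  \<open>V\<close>, relative to \<open>U\<close>. The index is one above the degree so that the
  bottom stage is \<open>U\<close> itself.\<close>

fun tfilt :: "('b::ab_group_add => 'b) => 'b set => 'b set => nat => 'b set" where
 "tfilt t V U 0 = U"
| "tfilt t V U (Suc n) = tfilt t V U n \<boxplus> (t ^^ n) ` V"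

lemma additive_funpow: "additive (t :: 'b::ab_group_add => 'b) ==> additive (t ^^ n)"
 by (induction n) (auto simp: additive_def)

context
 fixes Om :: "('b::ab_group_add => 'b) set" and t :: "'b => 'b"
 assumes add: "!!w. w : Om ==> additive w" and addt: "additive t"
  and comm: "!!w x. w : Om ==> w (t x) = t (w x)"
begin

lemma comm_funpow: "w : Om ==> w ((t ^^ n) x) = (t ^^ n) (w x)"
 by (induction n arbitrary: x) (auto simp: comm)

lemma osub_funpow_image:
 assumes V: "osub Om V" shows "osub Om ((t ^^ n) ` V)"
proof (rule osubI)
 have tp: "additive (t ^^ n)" by (rule additive_funpow[OF addt])
 show "0 : (t ^^ n) ` V"
  using osub_zero[OF V] additive.zero[OF tp] by (metis image_eqI)
 show "x - y : (t ^^ n) ` V" if xy: "x : (t ^^ n) ` V" "y : (t ^^ n) ` V" for x y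
  using xy osub_diff[OF V] additive.diff[OF tp] by (smt (verit) image_iff)
 show "w x : (t ^^ n) ` V" if w: "w : Om" and x: "x : (t ^^ n) ` V" for w x
  using x osub_op[OF V w] comm_funpow[OF w] by auto
qed

lemma osub_tfilt: "osub Om V ==> osub Om U ==> osub Om (tfilt t V U n)"
 by (induction n) (simp_all add: osub_splus[OF add] osub_funpow_image)

lemma tfilt_mono: assumes "osub Om V" "osub Om U" "m <= n" shows "tfilt t V U m <= tfilt t V U n"
proof (rule lift_Suc_mono_le[OF _ assms(3)])
 show "tfilt t V U n <= tfilt t V U (Suc n)" for n
  using splus_sub1[OF osub_funpow_image[OF assms(1)]] by simp
qed

lemma t_tfilt:
 assumes V: "osub Om V" and U: "osub (insert t Om) U" and x: "x : tfilt t V U n"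
 shows "t x : tfilt t V U (Suc n)"
 using x
proof (induction n arbitrary: x)
 case 0
 have U': "osub Om U" using osub_mono[OF U] by blast
 have "t x : U" using 0 osub_op[OF U] by simp
 thus ?case using tfilt_mono[OF V U', of 0 1] by auto
next
 case (Suc n)
 then obtain a v where a: "x = a + (t ^^ n) v" "a : tfilt t V U n" "v : V"
  by (auto elim!: splusE)
 have "t x = t a + (t ^^ Suc n) v" by (simp add: a(1) additive.add[OF addt])
 thus ?case using Suc.IH[OF a(2)] a(3) by (auto intro!: splusI simp del: funpow.simps)
qed

lemma osub_Union_tfilt:
 assumes V: "osub Om V" and U: "osub (insert t Om) U"
 shows "osub (insert t Om) (\<Union>n. tfilt t V U n)"
proof -
 have U': "osub Om U" using osub_mono[OF U] by blast
 note sub = osub_tfilt[OF V U'] and mono = tfilt_mono[OF V U']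
 show ?thesis
 proof (rule osubI)
  show "0 : (\<Union>n. tfilt t V U n)" using osub_zero[OF sub] by blast
  show "x - y : (\<Union>n. tfilt t V U n)"
   if xy: "x : (\<Union>n. tfilt t V U n)" "y : (\<Union>n. tfilt t V U n)" for x y
  proof -
   obtain m n where "x : tfilt t V U m" "y : tfilt t V U n" using xy by blast
   hence "x : tfilt t V U (max m n)" "y : tfilt t V U (max m n)"
    using mono[of m "max m n"] mono[of n "max m n"] by auto
   thus ?thesis using osub_diff[OF sub] by blast
  qed
  show "w x : (\<Union>n. tfilt t V U n)" if "w : insert t Om" "x : (\<Union>n. tfilt t V U n)" for w x
   using that t_tfilt[OF V U] osub_op[OF sub] by blast
 qed
qed

text \<open>Hilbert's basis theorem; \<open>L n J\<close> collects the leading coefficients of the elements of \<open>J\<close>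
 of degree \<open>n\<close>.\<close>

lemma noeth_adjoin:
 assumes V: "osub Om V" and U: "osub (insert t Om) U" and V0: "V0 <= U" "V0 <= V" and N: "noeth Om V V0"
  and W: "W <= (\<Union>n. tfilt t V U n)"
 shows "noeth (insert t Om) W U"
 unfolding noeth_def
proof (intro allI impI)
 fix f assume f: "\<forall>n. osub (insert t Om) (f n) & U <= f n & f n <= W & f n <= f (Suc n)"
 have up: "f n <= f m" if "n <= m" for n m
  using f that by (metis lift_Suc_mono_le)
 have U': "osub Om U" using osub_mono[OF U] by blast
 have f': "osub Om (f n)" for n using f osub_mono by blast
 note sub = osub_tfilt[OF V U'] and mono = tfilt_mono[OF V U']
 define L where "L n J = {v\<in>V. \<exists>a\<in>tfilt t V U n. (t ^^ n) v + a : J}" for n J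
 have tp: "additive (t ^^ n)" for n by (rule additive_funpow[OF addt])
 have L_sub: "osub Om (L n J)" if J: "osub Om J" for n J
 proof (rule osubI)
  show "0 : L n J" by (auto simp: L_def osub_zero[OF V] additive.zero[OF tp]
    intro!: bexI[of _ 0] osub_zero[OF J] osub_zero[OF sub])
  show "x - y : L n J" if "x : L n J" "y : L n J" for x y
  proof -
   obtain a b where ab: "a : tfilt t V U n" "(t ^^ n) x + a : J" "b : tfilt t V U n" "(t ^^ n) y + b : J"
    "x : V" "y : V" using \<open>x : L n J\<close> \<open>y : L n J\<close> by (auto simp: L_def)
   have "(t ^^ n) (x - y) + (a - b) = ((t ^^ n) x + a) - ((t ^^ n) y + b)"
    by (simp add: additive.diff[OF tp])
   hence "(t ^^ n) (x - y) + (a - b) : J" using ab osub_diff[OF J] by metis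
   thus ?thesis using ab osub_diff[OF sub] osub_diff[OF V] by (auto simp: L_def)
  qed
  show "w x : L n J" if w: "w : Om" and x: "x : L n J" for w x
  proof -
   obtain a where a: "a : tfilt t V U n" "(t ^^ n) x + a : J" "x : V" using x by (auto simp: L_def)
   have "(t ^^ n) (w x) + w a = w ((t ^^ n) x + a)"
    by (simp add: comm_funpow[OF w] additive.add[OF add[OF w]])
   hence "(t ^^ n) (w x) + w a : J" using osub_op[OF J w a(2)] by simp
   thus ?thesis using osub_op[OF sub w a(1)] osub_op[OF V w a(3)] by (auto simp: L_def)
  qed
 qed
 have L_Suc: "L n (f i) <= L (Suc n) (f i)" for n i
 proof
  fix v assume "v : L n (f i)"
  then obtain a where a: "a : tfilt t V U n" "(t ^^ n) v + a : f i" "v : V" by (auto simp: L_def)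
  have "(t ^^ Suc n) v + t a = t ((t ^^ n) v + a)" by (simp add: additive.add[OF addt])
  also have "\<dots> : f i" using f a osub_op by blast
  finally show "v : L (Suc n) (f i)" using a(3) t_tfilt[OF V U a(1)] by (auto simp: L_def)
 qed
 have L_mono: "L n J <= L n J'" if "J <= J'" for n J J' using that by (auto simp: L_def)
 have L_V0: "V0 <= L n (f i)" for n i
 proof
  fix v assume v: "v : V0"
  have "(t ^^ n) v : U" by (induction n) (use v V0 osub_op[OF U] in auto)
  hence "(t ^^ n) v + 0 : f i" using f by auto
  thus "v : L n (f i)" using v V0 osub_zero[OF sub] by (auto simp: L_def simp del: add_0_right)
 qed
 have L_ok: "osub Om (L n (f i))" "V0 <= L n (f i)" "L n (f i) <= V" for n i
  using L_sub[OF f'] L_V0[of n i] V0 by (auto simp: L_def)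
 have Lup: "L n (f i) <= L n' (f i')" if "n <= n'" "i <= i'" for n n' i i'
  using lift_Suc_mono_le[of "%n. L n (f i)", OF L_Suc that(1)] L_mono[OF up[OF that(2)], of n'] by blast
 \<comment> \<open>\<open>L\<close> grows with the degree and along the chain, so its diagonal is an
   ascending chain of submodules of \<open>V\<close>. From the stationary index \<open>k\<close> on,
   degree and chain index can be varied independently.\<close>
 have "\<exists>n. \<forall>m\<ge>n. L m (f m) = L n (f n)"
  by (rule noethD[OF N]) (use L_ok Lup in auto)
 then obtain k where k: "!!m. m >= k ==> L m (f m) = L k (f k)" by blast
 have k': "L n (f m) = L k (f k)" if "n >= k" "m >= k" for n m
  using Lup[of k n k m] Lup[of n "max n m" m "max n m"] k[of "max n m"] that by auto
 have "\<exists>c. \<forall>m\<ge>c. L n (f m) = L n (f c)" for n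
  by (rule noethD[OF N]) (use L_ok Lup in auto)
 then obtain c where c: "!!n m. m >= c n ==> L n (f m) = L n (f (c n))" by metis
 \<comment> \<open>Beyond \<open>M\<close> the leading coefficients agree in every degree at once:
   degrees at least \<open>k\<close> are covered by the diagonal, and the finitely many lower
   degrees have their own bounds \<open>c n\<close>.\<close>
 define M where "M = Max (insert k (c ` {..<k}))"
 have M: "M >= k" "n < k ==> M >= c n" for n by (auto simp: M_def)
 have LM: "L n (f m) = L n (f M)" if "m >= M" for n m
 proof (cases "n < k")
  case True
  thus ?thesis using c[of n m] c[of n M] M(2)[OF True] that by simp
 next
  case False
  thus ?thesis using k'[of n m] k'[of n M] M(1) that by simp
 qed
 have "f m = f M" if m: "m >= M" for m
 proof
  show "f M <= f m" by (rule up[OF m])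
  have "x : f M" if "x : f m" "x : tfilt t V U n" for x n
   using that
  proof (induction n arbitrary: x)
   case 0
   thus ?case using f by auto
  next
   case (Suc n)
   obtain a v where x: "x = a + (t ^^ n) v" "a : tfilt t V U n" "v : V"
    using Suc.prems by (auto elim!: splusE)
   hence "v : L n (f m)" using Suc.prems by (auto simp: L_def add.commute)
   then obtain b where b: "b : tfilt t V U n" "(t ^^ n) v + b : f M"
    using LM[OF m, of n] unfolding L_def by blast
   have "x - ((t ^^ n) v + b) : f m" using Suc.prems b up[OF m] osub_diff[OF f'] by blast
   moreover have e: "x - ((t ^^ n) v + b) = a - b" using x by simp
   ultimately have "a - b : f m" by metis
   hence "a - b : f M" using Suc.IH[of "a - b"] osub_diff[OF sub x(2) b(1)] by blast
   hence "x - ((t ^^ n) v + b) : f M" using e by metis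
   thus ?case using b(2) osub_diffD[OF f'] by blast
  qed
  thus "f m <= f M" using W f by blast
 qed
 thus "\<exists>n. \<forall>m\<ge>n. f m = f n" by blast
qed
end

section \<open>Finitely generated modules\<close>

definition sp :: "('r => 'b => 'b::ab_group_add) => 'b set => ('i => 'b) => 'i set => 'b set" where
 "sp s U y J = {u + (\<Sum>j\<in>J. s (r j) (y j)) |u r. u : U}"

abbreviation "submod s \<equiv> osub (range s)"

abbreviation scl :: "('r::comm_ring_1 => 'r) set" where "scl \<equiv> range (*)"

lemma sp_I: "u : U ==> u + (\<Sum>j\<in>J. s (r j) (y j)) : sp s U y J"
 by (auto simp: sp_def)

lemma sp_E: "x : sp s U y J ==> (!!u r. u : U ==> x = u + (\<Sum>j\<in>J. s (r j) (y j)) ==> P) ==> P"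
 by (auto simp: sp_def)

lemma module_ring: "Modules.module ((*) :: 'r::comm_ring_1 => 'r => 'r)"
 by unfold_locales (simp_all add: algebra_simps)

context Modules.module
begin

lemma additive_scale: "w : range scale ==> additive w"
 by (auto simp: additive_def scale_right_distrib)

lemma osub_scale: "submod scale V ==> x : V ==> scale r x : V"
 by (rule osub_op) auto

lemma osub_sp:
 assumes U: "submod scale U" shows "submod scale (sp scale U y J)"
proof (rule osubI)
 show "0 : sp scale U y J"
  using sp_I[OF osub_zero[OF U], of scale "%_. 0" y J] by simp
 show "a - b : sp scale U y J" if ab: "a : sp scale U y J" "b : sp scale U y J" for a b
 proof -
  obtain u r where a: "u : U" "a = u + (\<Sum>j\<in>J. scale (r j) (y j))" using ab(1) by (rule sp_E)
  obtain v q where b: "v : U" "b = v + (\<Sum>j\<in>J. scale (q j) (y j))" using ab(2) by (rule sp_E)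
  have "a - b = (u - v) + (\<Sum>j\<in>J. scale (r j - q j) (y j))"
   by (simp add: a b scale_left_diff_distrib sum_subtractf)
  thus ?thesis using sp_I[OF osub_diff[OF U a(1) b(1)]] by metis
 qed
 show "w a : sp scale U y J" if w: "w : range scale" and a: "a : sp scale U y J" for w a
 proof -
  obtain q where w: "w = scale q" using w by blast
  obtain u r where a: "u : U" "a = u + (\<Sum>j\<in>J. scale (r j) (y j))" using a by (rule sp_E)
  have "w a = scale q u + (\<Sum>j\<in>J. scale (q * r j) (y j))"
   by (simp add: a w scale_right_distrib scale_sum_right)
  thus ?thesis using sp_I[OF osub_scale[OF U a(1)]] by metis
 qed
qed

lemma sp_base: "U <= sp scale U y J"
 using sp_I[of _ U scale "%_. 0" y J] by force

lemma sp_gen: assumes U: "submod scale U" and J: "finite J" "j : J" shows "y j : sp scale U y J"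
proof -
 have "0 + (\<Sum>i\<in>J. scale (if i = j then 1 else 0) (y i)) : sp scale U y J"
  by (rule sp_I) (rule osub_zero[OF U])
 also have "(\<Sum>i\<in>J. scale (if i = j then 1 else 0) (y i)) = (\<Sum>i\<in>J. if i = j then y i else 0)"
  by (rule sum.cong) auto
 also have "\<dots> = y j" using J by simp
 finally show ?thesis by simp
qed

lemma sp_least:
 assumes V: "submod scale V" and "U <= V" "!!j. j : J ==> y j : V"
 shows "sp scale U y J <= V"
 using assms by (auto elim!: sp_E intro!: osub_add[OF V] osub_sum[OF V] osub_scale[OF V])

text \<open>The cyclic module \<open>(V + R x) / V\<close> is a quotient of the ring modulo
  \<open>K\<close>; a submodule \<open>J\<close> corresponds to the ideal of multipliers that carry
  \<open>x\<close> into it.\<close>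

lemma noeth_cyclic:
 assumes N: "noeth scl UNIV K" and V: "submod scale V" and K: "!!k. k : K ==> scale k x : V"
 shows "noeth (range scale) (V \<boxplus> range (%r. scale r x)) V"
proof (rule noeth_pull[OF N, where Ph = "%J. {r. scale r x : J}"])
 fix J assume J: "submod scale J" "V <= J"
 show "osub scl {r. scale r x : J} & K <= {r. scale r x : J} & {r. scale r x : J} <= UNIV"
  using J K by (auto intro!: osubI simp: osub_zero scale_left_diff_distrib osub_diff osub_scale
    simp flip: scale_scale)
next
 fix J J' assume J: "submod scale J" "V <= J" "submod scale J'"
  "J' <= V \<boxplus> range (%r. scale r x)" "J <= J'" "{r. scale r x : J} = {r. scale r x : J'}"
 show "J' <= J"
 proof
  fix z assume z: "z : J'"
  then obtain v r where v: "z = v + scale r x" "v : V" using J(4) by (auto elim!: splusE dest!: subsetD)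
  hence "scale r x : J'" using z J(2,5) osub_add_iff'[OF J(3), of v "scale r x"] by auto
  hence "scale r x : J" using J(6) by auto
  thus "z : J" using v J(2) osub_add[OF J(1)] by auto
 qed
qed auto

lemma sp_insert:
 assumes "finite J" "j ~: J"
 shows "sp scale U y (insert j J) = sp scale U y J \<boxplus> range (%r. scale r (y j))"
proof
 show "sp scale U y (insert j J) <= sp scale U y J \<boxplus> range (%r. scale r (y j))"
 proof
  fix x assume "x : sp scale U y (insert j J)"
  then obtain u r where "u : U" "x = u + (\<Sum>j\<in>insert j J. scale (r j) (y j))" by (rule sp_E)
  hence "x = (u + (\<Sum>j\<in>J. scale (r j) (y j))) + scale (r j) (y j)"
   using assms by (simp add: algebra_simps)
  thus "x : sp scale U y J \<boxplus> range (%r. scale r (y j))"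
   by (simp only:) (intro splusI sp_I \<open>u : U\<close> rangeI)
 qed
 show "sp scale U y J \<boxplus> range (%r. scale r (y j)) <= sp scale U y (insert j J)"
 proof
  fix x assume "x : sp scale U y J \<boxplus> range (%r. scale r (y j))"
  then obtain a q where x: "x = a + scale q (y j)" "a : sp scale U y J" by (auto elim!: splusE)
  from x(2) obtain u r where a: "u : U" "a = u + (\<Sum>j\<in>J. scale (r j) (y j))" by (rule sp_E)
  have "(\<Sum>i\<in>J. scale ((r(j:=q)) i) (y i)) = (\<Sum>j\<in>J. scale (r j) (y j))"
   by (rule sum.cong) (use assms in auto)
  hence "x = u + (\<Sum>i\<in>insert j J. scale ((r(j:=q)) i) (y i))"
   using assms a x by (simp add: algebra_simps)
  thus "x : sp scale U y (insert j J)" using sp_I[OF a(1)] by metis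
 qed
qed

lemma noeth_sp:
 assumes N: "noeth scl UNIV K" and U: "submod scale U" and J: "finite J"
  and K: "!!k j. k : K ==> j : J ==> scale k (y j) : U"
 shows "noeth (range scale) (sp scale U y J) U"
 using J K
proof (induction J)
 case empty
 thus ?case by (simp add: sp_def noeth_refl)
next
 case (insert j J)
 have sub: "submod scale (sp scale U y I)" for I by (rule osub_sp[OF U])
 show ?case
 proof (rule noeth_extend[OF additive_scale])
  have "scale k (y j) : sp scale U y J" if "k : K" for k
   using insert.prems[OF that, of j] sp_base by auto
  thus "noeth (range scale) (sp scale U y (insert j J)) (sp scale U y J)"
   unfolding sp_insert[OF insert.hyps] by (rule noeth_cyclic[OF N sub])
  show "noeth (range scale) (sp scale U y J) U" using insert by auto
  show "sp scale U y J <= sp scale U y (insert j J)"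
   by (rule sp_least[OF sub sp_base]) (use insert.hyps in \<open>auto intro!: sp_gen[OF U]\<close>)
 qed (auto simp: sub sp_base)
qed

lemma sp_cong: "(!!j. j : J ==> y j = y' j) ==> sp scale U y J = sp scale U y' J"
 by (simp add: sp_def)

text \<open>A maximal finitely generated submodule above \<open>U\<close> cannot omit any element of
  \<open>W\<close>, since that element could be adjoined as one more generator.\<close>

lemma noeth_fg:
 assumes N: "noeth (range scale) W U" and W: "submod scale W" and U: "submod scale U" "U <= W"
 obtains p :: nat and y where "!!j. j < p ==> y j : W" "W = sp scale U y {..<p}"
proof -
 define C where "C = {sp scale U y {..<p} |y p. \<forall>j<(p::nat). y j : W}"
 have "U : C"
  unfolding C_def by (rule CollectI, rule exI[of _ "%_. 0"], rule exI[of _ 0]) (simp add: sp_def)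
 moreover have CW: "V <= W" if "V : C" for V
  using that sp_least[OF W U(2)] unfolding C_def by (smt (verit) lessThan_iff mem_Collect_eq)
 moreover have "submod scale V" "U <= V" if "V : C" for V
  using that osub_sp[OF U(1)] sp_base unfolding C_def by (smt (verit) mem_Collect_eq)+
 ultimately obtain V where V: "V : C" "!!V'. V' : C ==> V <= V' ==> V' = V"
  using noeth_maxE[OF N, of U C] by metis
 then obtain y and p :: nat where y: "V = sp scale U y {..<p}" "\<forall>j<p. y j : W" by (auto simp: C_def)
 have "x : V" if x: "x : W" for x
 proof -
  define y' where "y' = y(p := x)"
  have "\<forall>j<Suc p. y' j : W" using y x by (auto simp: y'_def less_Suc_eq)
  hence "sp scale U y' {..<Suc p} : C" unfolding C_def by blast
  moreover have y'V: "V = sp scale U y' {..<p}"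
   unfolding y(1) by (rule sp_cong) (auto simp: y'_def)
  have "V <= sp scale U y' {..<Suc p}"
   unfolding y'V by (rule sp_least[OF osub_sp[OF U(1)] sp_base]) (auto intro!: sp_gen[OF U(1)])
  ultimately have "sp scale U y' {..<Suc p} = V" by (rule V(2))
  moreover have "y' p : sp scale U y' {..<Suc p}" by (rule sp_gen[OF U(1)]) auto
  ultimately show ?thesis by (simp add: y'_def)
 qed
 hence "W = V" using CW[OF V(1)] by blast
 thus thesis using that y by blast
qed

end

section \<open>Associated primes\<close>

definition primep :: "'r::comm_ring_1 set => bool" where
 "primep P \<longleftrightarrow> 1 ~: P & (\<forall>a b. a * b : P --> a : P \<or> b : P)"

definition assp :: "('r::comm_ring_1 => 'b => 'b) => 'b set => 'b set => 'r set set" where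
 "assp s W U = {P. primep P & (\<exists>x\<in>W. P = {a. s a x : U})}"

text \<open>A ring (modulo \<open>K\<close>) acting on \<open>W / U\<close> through operators that commute with \<open>Om\<close>; the action is
 only required to be a ring action modulo \<open>U\<close>.\<close>

definition acts :: "('b::ab_group_add => 'b) set => 'r::comm_ring_1 set => ('r => 'b => 'b) => 'b set => 'b set => bool" where
 "acts Om K s W U \<longleftrightarrow>
  (\<forall>a. s a : Om & additive (s a) & (\<forall>w\<in>Om. \<forall>x. w (s a x) = s a (w x))) \<and>
  (\<forall>x\<in>W. (\<forall>a b. s (a - b) x - (s a x - s b x) : U) & (\<forall>a b. s (a * b) x - s a (s b x) : U) \<and>
    s 1 x - x : U & (\<forall>k\<in>K. s k x : U))"

lemma assp_finite:
 assumes NR: "noeth scl UNIV K" and N: "noeth Om W U" and U: "osub Om U" and W: "osub Om W" and UW: "U <= W"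
  and act: "acts Om K s W U"
 shows "finite (assp s W U)"
proof -
 have sO: "s a : Om" and sadd: "additive (s a)" and comm: "w : Om ==> w (s a x) = s a (w x)" for a w x
  using act by (auto simp: acts_def)
 have "\<forall>x\<in>W. (\<forall>a b. s (a - b) x - (s a x - s b x) : U) & (\<forall>a b. s (a * b) x - s a (s b x) : U) \<and>
    s 1 x - x : U & (\<forall>k\<in>K. s k x : U)"
  using act unfolding acts_def by (rule conjunct2)
 hence s_diff: "s (a - b) x - (s a x - s b x) : U" and s_mult: "s (a * b) x - s a (s b x) : U"
  and s_one: "s 1 x - x : U" and s_K: "k : K ==> s k x : U" if "x : W" for a b k x
  using that by blast+
 define C where "C = {V. osub Om V & U <= V & V <= W & finite (assp s V U)}"
 have "assp s U U <= {}"
  using osub_op[OF U sO] by (auto simp: assp_def primep_def)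
 hence "U : C" using U UW by (auto simp: C_def)
 then obtain V where V: "V : C" "!!V'. V' : C ==> V <= V' ==> V' = V"
  by (rule noeth_maxE[OF N]) (auto simp: C_def)
 have Vs: "osub Om V" "U <= V" "V <= W" "finite (assp s V U)" using V(1) by (auto simp: C_def)
 define p where "p y = {a. s a y : V}" for y
 have p: "osub scl (p y) & K <= p y & p y <= UNIV" if y: "y : W" for y
 proof (intro conjI osubI)
  show K: "K <= p y" using s_K[OF y] Vs by (auto simp: p_def)
  have "s (0 - 0) y : V"
   using s_diff[OF y, of 0 0] Vs by auto
  thus "0 : p y" by (simp add: p_def)
  show "a - b : p y" if ab: "a : p y" "b : p y" for a b
  proof -
   have "s (a - b) y - (s a y - s b y) : V" using s_diff[OF y] Vs(2) by blast
   moreover have "s a y - s b y : V" using ab osub_diff[OF Vs(1)] by (simp add: p_def)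
   ultimately show ?thesis using osub_diffD[OF Vs(1)] by (simp add: p_def)
  qed
  show "w a : p y" if w: "w : scl" and a: "a : p y" for w a
  proof -
   obtain b where w: "w = (*) b" using w by blast
   have "s (b * a) y - s b (s a y) : V" using s_mult[OF y] Vs(2) by blast
   moreover have "s b (s a y) : V" using a osub_op[OF Vs(1) sO] by (simp add: p_def)
   ultimately show ?thesis using osub_diffD[OF Vs(1)] by (simp add: p_def w)
  qed
 qed auto
 have "V = W"
 proof (rule ccontr)
  assume "V ~= W"
  then obtain y0 where "y0 : W" "y0 ~: V" using Vs by blast
  hence "p y0 : p ` (W - V)" by blast
  then obtain Q where Q: "Q : p ` (W - V)" "!!Q'. Q' : p ` (W - V) ==> Q <= Q' ==> Q' = Q"
   by (rule noeth_maxE[OF NR]) (use p in auto)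
  then obtain y where y: "y : W" "y ~: V" "Q = p y" by blast
  have y3: "p z = p y" if "z : W" "z ~: V" "p y <= p z" for z
   using Q(2)[of "p z"] that y by blast
  \<comment> \<open>Defined through the ideal \<open>p y\<close> rather than by adjoining
    \<open>y\<close>, so that stability under \<open>Om\<close> follows from the commutation of
    scalars with \<open>Om\<close>.\<close>
  define V' where "V' = {z\<in>W. \<forall>a\<in>p y. s a z : V}"
  have V': "osub Om V'"
   using osub_zero[OF W] osub_zero[OF Vs(1)] osub_diff[OF W] osub_diff[OF Vs(1)] osub_op[OF W] osub_op[OF Vs(1)]
   by (auto intro!: osubI simp: V'_def additive.zero[OF sadd] additive.diff[OF sadd] simp flip: comm)
  have VV': "V <= V'" using Vs osub_op[OF Vs(1) sO] by (auto simp: V'_def)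
  have yV': "y : V'" using y by (auto simp: V'_def p_def)
  have pz: "p z = p y" if "z : V'" "z ~: V" for z
   by (rule y3) (use that in \<open>auto simp: V'_def p_def\<close>)
  have "assp s V' U <= insert (p y) (assp s V U)"
  proof
   fix P assume "P : assp s V' U"
   then obtain x where P: "primep P" "x : V'" "P = {a. s a x : U}" by (auto simp: assp_def)
   have xW: "x : W" using P(2) by (simp add: V'_def)
   show "P : insert (p y) (assp s V U)"
   \<comment> \<open>If a scalar outside \<open>P\<close> moves \<open>x\<close> into
     \<open>V\<close>, primality makes \<open>P\<close> the annihilator of that multiple, so
     \<open>P\<close> is already counted for \<open>V\<close>. Otherwise the annihilators of
     \<open>x\<close> modulo \<open>U\<close> and modulo \<open>V\<close> agree.\<close>
   proof (cases "\<exists>b. s b x : V & b ~: P")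
    case True
    then obtain b where b: "s b x : V" "b ~: P" by blast
    have "a : P \<longleftrightarrow> s a (s b x) : U" for a
    proof
     assume "a : P"
     hence "s b (s a x) : U" using P osub_op[OF U sO] by auto
     thus "s a (s b x) : U" using comm[OF sO[of a], of b x] by simp
    next
     assume "s a (s b x) : U"
     hence "a * b : P" using P s_mult[OF xW, of a b] osub_diffD[OF U] by auto
     thus "a : P" using b P by (auto simp: primep_def)
    qed
    hence "P = {a. s a (s b x) : U}" by blast
    hence "P : assp s V U" using P(1) b(1) unfolding assp_def by blast
    thus ?thesis by simp
   next
    case False
    hence "p x = P" using P(3) Vs(2) by (auto simp: p_def)
    moreover have "x ~: V"
    proof
     assume "x : V"
     hence "1 : p x" using s_one[OF xW] Vs osub_diffD[OF Vs(1)] by (auto simp: p_def)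
     thus False using P(1) \<open>p x = P\<close> by (simp add: primep_def)
    qed
    ultimately show ?thesis using pz[OF P(2)] by simp
   qed
  qed
  hence "finite (assp s V' U)" using Vs(4) finite_subset by (metis finite_insert)
  hence "V' : C" using V' Vs(2) VV' by (auto simp: C_def V'_def)
  hence "V' = V" using VV' by (rule V(2))
  thus False using yV' y(2) by simp
 qed
 thus ?thesis using Vs by simp
qed

section \<open>Rees modules\<close>

definition lft :: "('b => 'b) => (nat => 'b) => nat => 'b" where
 "lft w g = (%n. w (g n))"

text \<open>Multiplication by \<open>a T\<close> in the Rees variable \<open>T\<close>, where the
  family \<open>g\<close> stands for the polynomial with coefficients \<open>g n\<close> at
  \<open>T^n\<close>.\<close>

definition rsh :: "('b::zero => 'b) => (nat => 'b) => nat => 'b" where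
 "rsh a g = (%n. case n of 0 => 0 | Suc m => a (g m))"

definition fam :: "(nat => 'b::zero set) => (nat => 'b) set" where
 "fam G = {g. finite {n. g n ~= 0} & (\<forall>n. g n : G n)}"

definition sng :: "nat => 'b::zero => nat => 'b" where
 "sng n x = (%m. if m = n then x else 0)"

lemma sng_fam: "(!!m. 0 : G m) ==> sng n x : fam G \<longleftrightarrow> x : G n"
 unfolding fam_def sng_def by (auto intro: finite_subset[of _ "{n}"])

lemma sum_sng: "finite {n. g n ~= 0} ==> (g :: nat => 'b::comm_monoid_add) = (\<Sum>n\<in>{n. g n ~= 0}. sng n (g n))"
proof (rule ext)
 fix m assume f: "finite {n. g n ~= 0}"
 have "(\<Sum>n\<in>{n. g n ~= 0}. sng n (g n)) m = (\<Sum>n\<in>{n. g n ~= 0}. if n = m then g n else 0)"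
  by (induction rule: finite_induct[OF f]) (auto simp: sng_def plus_fun_def zero_fun_def)
 thus "g m = (\<Sum>n\<in>{n. g n ~= 0}. sng n (g n)) m" using f by simp
qed

text \<open>\<open>Z n\<close> is \<open>I\<^sup>n Z\<^sub>0 + U\<close> for \<open>I\<close> generated by the operators \<open>As\<close>; families stand for elements of the Rees
 module, on which \<open>a \<in> As\<close> acts as \<open>rsh a\<close>.\<close>

locale rees =
 fixes Om :: "('b::ab_group_add => 'b) set" and As :: "('b => 'b) set" and Z :: "nat => 'b set" and U :: "'b set"
 assumes add: "w : Om ==> additive w" and addA: "a : As ==> additive a"
  and comm: "w : Om ==> a : As ==> w (a x) = a (w x)"
  and commA: "a : As ==> a' : As ==> a (a' x) = a' (a x)"
  and finA: "finite As"
  and U: "osub Om U" and aU: "a : As ==> x : U ==> a x : U"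
  and Z: "osub Om (Z n)" and UZ: "U <= Z n" and aZ: "a : As ==> x : Z n ==> a x : Z (Suc n)"
  and gen: "osub Om C ==> U <= C ==> (!!a x. a : As ==> x : Z n ==> a x : C) ==> Z (Suc n) <= C"
  and N0: "noeth Om (Z 0) U"
begin

definition OR :: "('b => 'b) set => ((nat => 'b) => (nat => 'b)) set" where
 "OR B = lft ` Om \<union> rsh ` B"

lemma additive_lft: "additive w ==> additive (lft w)"
 by (auto simp: additive_def lft_def plus_fun_def)

lemma additive_rsh: "additive w ==> additive (rsh w)"
 by (auto simp: additive_def rsh_def plus_fun_def fun_eq_iff split: nat.split)

lemma additive_OR: "B <= As ==> w : OR B ==> additive w"
 using add addA by (auto simp: OR_def intro: additive_lft additive_rsh)

lemma osub_fam:
 assumes G: "!!n. osub Om (G n)" and B: "B <= As" and aG: "!!a n x. a : B ==> x : G n ==> a x : G (Suc n)"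
 shows "osub (OR B) (fam G)"
proof (rule osubI)
 show "0 : fam G" by (auto simp: fam_def zero_fun_def osub_zero[OF G])
 show "g - h : fam G" if gh: "g : fam G" "h : fam G" for g h
 proof -
  have "finite {n. (g - h) n ~= 0}"
   by (rule finite_subset[of _ "{n. g n ~= 0} \<union> {n. h n ~= 0}"]) (use gh in \<open>auto simp: fam_def\<close>)
  thus ?thesis using gh osub_diff[OF G] by (simp add: fam_def)
 qed
 show "w g : fam G" if w: "w : OR B" and g: "g : fam G" for w g
 proof -
  consider v where "v : Om" "w = lft v" | a where "a : B" "w = rsh a" using w by (auto simp: OR_def)
  thus ?thesis
  proof cases
   case 1
   have "{n. v (g n) ~= 0} <= {n. g n ~= 0}" using additive.zero[OF add[OF 1(1)]] by auto
   thus ?thesis using g 1 osub_op[OF G 1(1)] finite_subset by (auto simp: fam_def lft_def)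
  next
   case 2
   have "{n. rsh a g n ~= 0} <= Suc ` {n. g n ~= 0}"
   proof
    fix n assume n: "n : {n. rsh a g n ~= 0}"
    have a0: "a 0 = 0" using additive.zero[OF addA] 2 B by auto
    show "n : Suc ` {n. g n ~= 0}"
     by (cases n) (use n a0 in \<open>auto simp: rsh_def\<close>)
   qed
   hence "finite {n. rsh a g n ~= 0}" using g finite_surj by (auto simp: fam_def)
   moreover have "rsh a g n : G n" for n
    by (cases n) (use g aG[OF 2(1)] osub_zero[OF G] in \<open>auto simp: fam_def rsh_def\<close>)
   ultimately show ?thesis by (simp add: fam_def 2)
  qed
 qed
qed

abbreviation "UU \<equiv> fam (%_. U)"

lemma osub_UU: "B <= As ==> osub (OR B) UU"
 by (rule osub_fam[OF U]) (auto intro: aU)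

lemma sng_diff: "sng n x - sng n (y :: 'c::ab_group_add) = sng n (x - y)"
 by (rule ext) (simp add: sng_def)

lemma lft_sng: "additive w ==> lft w (sng n x) = sng n (w x)"
 by (auto simp: sng_def lft_def fun_eq_iff additive.zero)

lemma rsh_sng: "additive w ==> rsh w (sng n x) = sng (Suc n) (w x)"
 by (auto simp: sng_def rsh_def fun_eq_iff additive.zero split: nat.split)

lemma sng_zero [simp]: "sng n 0 = 0"
 by (auto simp: sng_def zero_fun_def)

lemma osub_sng:
 assumes J: "osub (OR B) J" shows "osub Om {x. sng n x : J}"
proof (rule osubI)
 show "0 : {x. sng n x : J}" using osub_zero[OF J] by simp
 show "x - y : {x. sng n x : J}" if "x : {x. sng n x : J}" "y : {x. sng n x : J}" for x y
  using that osub_diff[OF J] by (simp flip: sng_diff)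
 show "w x : {x. sng n x : J}" if "w : Om" "x : {x. sng n x : J}" for w x
  using that osub_op[OF J, of "lft w" "sng n x"] by (simp add: OR_def lft_sng[OF add])
qed

lemma sng_UU: "x : U ==> sng n x : UU"
 by (subst sng_fam) (auto simp: osub_zero[OF U])

text \<open>Modulo families with values in \<open>U\<close> only the component in degree 0 survives,
  so the claim is the chain condition for \<open>Z 0 / U\<close>.\<close>

lemma rees_base: "noeth (OR {}) (fam (%n. if n = 0 then Z 0 else U)) UU"
proof (rule noeth_pull[OF N0, where Ph = "%J. {x. sng 0 x : J} \<inter> Z 0"])
 fix J assume J: "osub (OR {}) J" "UU <= J"
 show "osub Om ({x. sng 0 x : J} \<inter> Z 0) & U <= {x. sng 0 x : J} \<inter> Z 0 & {x. sng 0 x : J} \<inter> Z 0 <= Z 0"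
  using osub_Int[OF osub_sng[OF J(1)] Z] J(2) UZ sng_UU by blast
next
 fix J J' assume J: "osub (OR {}) J" "UU <= J" "osub (OR {}) J'" "J' <= fam (%n. if n = 0 then Z 0 else U)"
  "J <= J'" "{x. sng 0 x : J} \<inter> Z 0 = {x. sng 0 x : J'} \<inter> Z 0"
 show "J' <= J"
 proof
  fix g assume g: "g : J'"
  hence "g : fam (%n. if n = 0 then Z 0 else U)" using J(4) by blast
  hence fin: "finite {n. g n ~= 0}" and gn: "g n : (if n = 0 then Z 0 else U)" for n
   by (auto simp: fam_def)
  have gU: "g n : U" if "n ~= 0" for n using gn[of n] that by simp
  have gf: "finite {n. g n ~= 0}" "g 0 : Z 0" "!!n. n ~= 0 ==> g n : U"
   using fin gn[of 0] gU by simp_all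
  define u where "u = g(0 := 0)"
  have "finite {n. u n ~= 0}"
   by (rule finite_subset[OF _ fin]) (auto simp: u_def split: if_splits)
  hence "u : UU"
   using gf osub_zero[OF U] by (auto simp: fam_def u_def)
  moreover have gu: "sng 0 (g 0) = g - u" by (auto simp: sng_def u_def fun_diff_def)
  ultimately have "sng 0 (g 0) : J'" using g J(2,5) osub_diff[OF J(3)] by auto
  hence "sng 0 (g 0) : J" using gf J(6) by blast
  thus "g : J" using \<open>u : UU\<close> J(2) gu osub_diffD[OF J(1), of g u] by auto
 qed
qed auto

lemma OR_insert: "OR (insert a B) = insert (rsh a) (OR B)"
 by (auto simp: OR_def)

lemma rsh_comm:
 assumes a: "a : As" and B: "B <= As" and w: "w : OR B" shows "w (rsh a g) = rsh a (w g)"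
proof -
 consider v where "v : Om" "w = lft v" | b where "b : As" "w = rsh b" using w B by (auto simp: OR_def)
 thus ?thesis
 proof cases
  case 1
  thus ?thesis
   by (simp add: lft_def rsh_def fun_eq_iff comm[OF 1(1) a] additive.zero[OF add[OF 1(1)]] split: nat.split)
 next
  case 2
  thus ?thesis
   by (simp add: rsh_def fun_eq_iff commA[OF 2(1) a] additive.zero[OF addA[OF a]]
     additive.zero[OF addA[OF 2(1)]] split: nat.split)
 qed
qed

text \<open>Each \<open>rsh a\<close> is an additive operator commuting with those already present,
  so adjoining the finitely many \<open>a\<close> one by one is a repeated use of Hilbert's basis
  theorem.\<close>

lemma rees_step:
 assumes "B <= As"
 shows "\<exists>W. osub (OR B) W & sng 0 ` Z 0 <= W & UU <= W & noeth (OR B) W UU"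
 using finite_subset[OF assms finA] assms
proof (induction B)
 case empty
 let ?W = "fam (%n. if n = 0 then Z 0 else U)"
 have "osub (OR {}) ?W" by (rule osub_fam) (auto simp: Z U)
 moreover have "sng 0 ` Z 0 <= ?W" using osub_zero[OF Z] osub_zero[OF U] by (subst image_subset_iff) (auto simp: sng_fam)
 moreover have "UU <= ?W" using UZ by (auto simp: fam_def)
 ultimately show ?case using rees_base by blast
next
 case (insert a B)
 then obtain W where W: "osub (OR B) W" "sng 0 ` Z 0 <= W" "UU <= W" "noeth (OR B) W UU" by auto
 have a: "a : As" and B: "B <= As" using insert.prems by auto
 let ?W = "\<Union>n. tfilt (rsh a) W UU n"
 have U': "osub (insert (rsh a) (OR B)) UU"
  using osub_UU[OF insert.prems] by (simp add: OR_insert)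
 have "osub (OR (insert a B)) ?W"
  unfolding OR_insert by (rule osub_Union_tfilt[OF additive_OR[OF B] additive_rsh[OF addA[OF a]] rsh_comm[OF a B] W(1) U'])
 moreover have "W <= tfilt (rsh a) W UU (Suc 0)" using splus_sub2[OF osub_UU[OF B]] by simp
 hence "W <= ?W" by blast
 moreover have "noeth (OR (insert a B)) ?W UU"
  unfolding OR_insert
  by (rule noeth_adjoin[OF additive_OR[OF B] additive_rsh[OF addA[OF a]] rsh_comm[OF a B] W(1) U' _ W(3,4)]) auto
 ultimately show ?case using W by blast
qed

lemma noeth_rees: "noeth (OR As) (fam Z) UU"
proof -
 obtain W where W: "osub (OR As) W" "sng 0 ` Z 0 <= W" "UU <= W" "noeth (OR As) W UU"
  using rees_step[OF order_refl] by (elim exE conjE)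
 \<comment> \<open>By \<open>gen\<close>, the part in degree 0 generates every higher degree under
   the shifts \<open>rsh a\<close>; hence \<open>W\<close> contains the whole Rees module.\<close>
 have s: "Z n <= {x. sng n x : W}" for n
 proof (induction n)
  case (Suc n)
  show ?case
  proof (rule gen[OF osub_sng[OF W(1)]])
   show "U <= {x. sng (Suc n) x : W}" using W(3) sng_UU by blast
   show "a x : {x. sng (Suc n) x : W}" if "a : As" "x : Z n" for a x
   proof -
    have "rsh a (sng n x) : W" by (rule osub_op[OF W(1)]) (use that Suc in \<open>auto simp: OR_def\<close>)
    thus ?thesis by (simp add: rsh_sng[OF addA[OF that(1)]])
   qed
  qed
 qed (use W in auto)
 have "fam Z <= W"
 proof
  fix g assume g: "g : fam Z"
  hence fin: "finite {n. g n ~= 0}" by (simp add: fam_def)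
  have m: "(\<Sum>n\<in>{n. g n ~= 0}. sng n (g n)) : W"
   by (rule osub_sum[OF W(1)]) (use g s in \<open>auto simp: fam_def\<close>)
  have e: "g = (\<Sum>n\<in>{n. g n ~= 0}. sng n (g n))" by (rule sum_sng[OF fin])
  show "g : W" by (rule ssubst[OF e, of "%z. z : W"]) (rule m)
 qed
 thus ?thesis by (rule noeth_mono[OF W(4)]) auto
qed

lemma fam_mono: "(!!n. G n <= H n) ==> fam G <= fam H"
 by (auto simp: fam_def)

text \<open>\<open>G\<close> and \<open>H\<close> define graded submodules of the Rees module, and
  an associated prime of one piece \<open>G n / H n\<close> is the annihilator of the homogeneous
  element \<open>sng n x\<close> in \<open>fam G / fam H\<close>, which is Noetherian over
  \<open>OR As\<close>.\<close>

lemma assp_family: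
 assumes NR: "noeth scl UNIV K" and act: "acts Om K s (Z 0) U"
  and sZ: "!!n. Z n <= Z 0"
  and G: "!!n. osub Om (G n)" "!!n. G n <= Z n" "!!a n x. a : As ==> x : G n ==> a x : G (Suc n)"
  and H: "!!n. osub Om (H n)" "!!n. H n <= G n" "!!n. U <= H n" "!!a n x. a : As ==> x : H n ==> a x : H (Suc n)"
 shows "finite (\<Union>n. assp s (G n) (H n))"
proof -
 have sO: "s a : Om" and sadd: "additive (s a)" and scomm: "w : Om ==> w (s a x) = s a (w x)" for a w x
  using act by (auto simp: acts_def)
 have "acts (OR As) K (%a. lft (s a)) (fam G) (fam H)"
  unfolding acts_def
 proof (intro conjI allI ballI)
  show "lft (s a) : OR As" for a using sO by (auto simp: OR_def)
  show "additive (lft (s a))" for a by (rule additive_lft[OF sadd])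
  show "w (lft (s a) g) = lft (s a) (w g)" if "w : OR As" for w a g
   using that by (auto simp: OR_def lft_def scomm rsh_def fun_eq_iff additive.zero[OF sadd] comm[OF sO] split: nat.split)
 next
  fix g assume g: "g : fam G"
  hence gn: "g n : Z 0" for n using G sZ by (force simp: fam_def)
  have fin: "finite {n. g n ~= 0}" using g by (simp add: fam_def)
  have mem: "h : fam H" if "!!n. h n : U" "!!n. g n = 0 ==> h n = 0" for h
   using that H(3) finite_subset[OF _ fin, of "{n. h n ~= 0}"] by (auto simp: fam_def)
  have *: "\<forall>x\<in>Z 0. (\<forall>a b. s (a - b) x - (s a x - s b x) : U) & (\<forall>a b. s (a * b) x - s a (s b x) : U) \<and>
    s 1 x - x : U & (\<forall>k\<in>K. s k x : U)"
   using act unfolding acts_def by (rule conjunct2)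
  have z: "s a 0 = 0" for a using additive.zero[OF sadd] .
  show "lft (s (a - b)) g - (lft (s a) g - lft (s b) g) : fam H" for a b
   by (rule mem) (use * gn z in \<open>simp_all add: lft_def fun_diff_def\<close>)
  show "lft (s (a * b)) g - lft (s a) (lft (s b) g) : fam H" for a b
   by (rule mem) (use * gn z in \<open>simp_all add: lft_def fun_diff_def\<close>)
  show "lft (s 1) g - g : fam H"
   by (rule mem) (use * gn z in \<open>simp_all add: lft_def fun_diff_def\<close>)
  show "lft (s k) g : fam H" if "k : K" for k
   by (rule mem) (use * gn z that in \<open>simp_all add: lft_def fun_diff_def\<close>)
 qed
 moreover have "noeth (OR As) (fam G) (fam H)"
  by (rule noeth_mono[OF noeth_rees fam_mono[OF G(2)] fam_mono[OF H(3)] order_refl])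
 moreover have "osub (OR As) (fam H)" by (rule osub_fam) (use H in auto)
 moreover have "osub (OR As) (fam G)" by (rule osub_fam) (use G in auto)
 moreover have "fam H <= fam G" by (rule fam_mono[OF H(2)])
 ultimately have "finite (assp (%a. lft (s a)) (fam G) (fam H))"
  by (intro assp_finite[OF NR])
 moreover have "assp s (G n) (H n) <= assp (%a. lft (s a)) (fam G) (fam H)" for n
 proof
  fix P assume "P : assp s (G n) (H n)"
  then obtain x where x: "primep P" "x : G n" "P = {a. s a x : H n}" by (auto simp: assp_def)
  have "P = {a. lft (s a) (sng n x) : fam H}"
   by (simp add: lft_sng[OF sadd] sng_fam osub_zero[OF H(1)] x(3))
  moreover have "sng n x : fam G" using x(2) by (simp add: sng_fam osub_zero[OF G(1)])
  ultimately show "P : assp (%a. lft (s a)) (fam G) (fam H)" using x(1) by (auto simp: assp_def)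
 qed
 ultimately show ?thesis by (meson UN_least finite_subset)
qed

text \<open>The graded submodule \<open>fam G\<close> is generated in degrees up to some
  \<open>c\<close>. The conclusion says that \<open>Z (Suc n) \<inter> Y\<close> lies in the ideal
  times \<open>Z n \<inter> Y\<close>, plus \<open>U\<close>; quantifying over test submodules
  \<open>C\<close> avoids naming that product.\<close>

lemma artin_rees:
 assumes Y: "osub Om Y" "U <= Y" and aY: "!!a x. a : As ==> x : Y ==> a x : Y"
 obtains c where "!!n C. n >= c ==> osub Om C ==> U <= C ==> (!!a x. a : As ==> x : Z n \<inter> Y ==> a x : C)
  ==> Z (Suc n) \<inter> Y <= C"
proof -
 define G where "G n = Z n \<inter> Y" for n
 have G: "osub Om (G n)" "U <= G n" "a : As ==> x : G n ==> a x : G (Suc n)" for n a x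
  using osub_Int[OF Z Y(1)] UZ Y(2) by (auto simp: G_def intro: aZ aY)
 have GG: "osub (OR As) (fam G)" by (rule osub_fam[OF G(1)]) (auto intro: G)
 define F where "F c = \<Inter>{J. osub (OR As) J & UU <= J & J <= fam G & (\<forall>n\<le>c. sng n ` G n <= J)}" for c
 have Fle: "F c <= J" if "osub (OR As) J" "UU <= J" "J <= fam G" "!!n. n <= c ==> sng n ` G n <= J" for c J
  using that unfolding F_def by blast
 have sG: "sng n ` G n <= fam G" for n using osub_zero[OF G(1)] by (auto simp: sng_fam)
 have UG: "UU <= fam G" by (rule fam_mono) (rule G)
 have "\<exists>c. \<forall>m\<ge>c. F m = F c"
 proof (rule noethD[OF noeth_rees])
  show "osub (OR As) (F n)" for n by (auto simp: F_def osub_def)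
  show "UU <= F n" for n by (auto simp: F_def)
  show "F n <= fam Z" for n
   using Fle[OF GG UG order_refl sG] fam_mono[of G Z] by (auto simp: G_def)
  show "F n <= F (Suc n)" for n unfolding F_def by (intro Inter_anti_mono Collect_mono) auto
 qed
 then obtain c where c: "!!m. m >= c ==> F m = F c" by blast
 show thesis
 proof (rule that)
  fix n C assume n: "n >= c" and C: "osub Om C" "U <= C" "!!a x. a : As ==> x : Z n \<inter> Y ==> a x : C"
  \<comment> \<open>Cutting \<open>G\<close> by \<open>C\<close> in the single degree
    \<open>Suc n\<close> leaves a graded submodule, because the shifts from degree \<open>n\<close>
    land in \<open>C\<close> by assumption. It still contains the generators of degree at most
    \<open>n\<close>.\<close>
  define G' where "G' k = (if k = Suc n then G k \<inter> C else G k)" for k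
  have G'G: "G' k <= G k" for k by (auto simp: G'_def)
  show "Z (Suc n) \<inter> Y <= C"
  proof
   fix x assume x: "x : Z (Suc n) \<inter> Y"
   hence "x : G (Suc n)" by (simp add: G_def)
   hence "sng (Suc n) x : F (Suc n)" unfolding F_def by blast
   also have "F (Suc n) = F n" using c[of n] c[of "Suc n"] n by simp
   also have "F n <= fam G'"
   proof (rule Fle)
    show "osub (OR As) (fam G')"
    proof (rule osub_fam[OF _ order_refl])
     show "osub Om (G' k)" for k using G(1) osub_Int[OF G(1) C(1)] by (simp add: G'_def)
     show "a x : G' (Suc k)" if "a : As" "x : G' k" for a k x
     proof -
      have xG: "x : G k" using that(2) G'G by blast
      have "a x : C" if "k = n" using C(3)[OF \<open>a : As\<close>, of x] xG that by (simp add: G_def)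
      thus ?thesis using G(3)[OF that(1) xG] by (auto simp: G'_def)
     qed
    qed
    show "UU <= fam G'"
    proof (rule fam_mono)
     show "U <= G' k" for k using G(2) C(2) by (auto simp: G'_def)
    qed
    show "fam G' <= fam G" by (rule fam_mono) (rule G'G)
    show "sng k ` G k <= fam G'" if "k <= n" for k
    proof -
     have "0 : G' m" for m using osub_zero[OF G(1)] osub_zero[OF C(1)] by (auto simp: G'_def)
     moreover have "G' k = G k" using that by (simp add: G'_def)
     ultimately show ?thesis by (simp add: image_subset_iff sng_fam)
    qed
   qed
   finally have "sng (Suc n) x (Suc n) : G' (Suc n)" unfolding fam_def by blast
   thus "x : C" by (simp add: sng_def G'_def)
  qed
 qed
qed

end

section \<open>Cohomology modulo powers of an ideal\<close>

lemma osub_diff_cong: "osub Om V ==> x - y : V ==> x : V \<longleftrightarrow> y : V"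
 using osub_diffD[of Om V x y] osub_diffD'[of Om V x y] by metis

lemma osub_INT: "(!!n. osub Om (f n)) ==> osub Om (\<Inter>n. f n)"
 by (simp add: osub_def)

lemma osub_imageI:
 assumes D: "additive D" and comm: "!!w x. w : Om ==> w (D x) = D (w x)" and V: "osub Om V"
 shows "osub Om (D ` V)"
proof (rule osubI)
 show "0 : D ` V" using osub_zero[OF V] additive.zero[OF D] by (metis image_eqI)
 show "x - y : D ` V" if xy: "x : D ` V" "y : D ` V" for x y
  using xy osub_diff[OF V] additive.diff[OF D] by (smt (verit) image_iff)
 show "w x : D ` V" if w: "w : Om" and x: "x : D ` V" for w x
  using x osub_op[OF V w] comm[OF w] by auto
qed

lemma osub_vimageI:
 assumes D: "additive D" and comm: "!!w x. w : Om ==> w (D x) = D (w x)" and V: "osub Om V" and W: "osub Om W"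
 shows "osub Om {x\<in>W. D x : V}"
proof (rule osubI)
 show "0 : {x\<in>W. D x : V}" using osub_zero[OF V] osub_zero[OF W] by (simp add: additive.zero[OF D])
 show "x - y : {x\<in>W. D x : V}" if "x : {x\<in>W. D x : V}" "y : {x\<in>W. D x : V}" for x y
  using that osub_diff[OF V] osub_diff[OF W] by (simp add: additive.diff[OF D])
 show "w x : {x\<in>W. D x : V}" if w: "w : Om" and x: "x : {x\<in>W. D x : V}" for w x
  using x osub_op[OF V w] osub_op[OF W w] by (simp flip: comm[OF w])
qed

lemma acts_op: "acts Om K s W U ==> s a : Om"
 and acts_add: "acts Om K s W U ==> additive (s a)"
 and acts_comm: "acts Om K s W U ==> w : Om ==> w (s a x) = s a (w x)"
 by (auto simp: acts_def)

lemma acts_mult: "acts Om K s W U ==> x : W ==> s (a * b) x - s a (s b x) : U"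
 unfolding acts_def by (drule conjunct2, drule (1) bspec, simp)+

text \<open>Primality turns \<open>a * b : P\<close> into \<open>a : P\<close>. This allows a class
  with prime annihilator to be replaced by any multiple by a scalar outside \<open>P\<close>, and so
  to be moved into a chosen step of a filtration.\<close>

lemma colon_prime:
 assumes act: "acts Om K s W U" and B: "osub Om B" "U <= B" and x: "x : W"
  and P: "primep P" "P = {a. s a x : B}" and b: "b ~: P"
 shows "P = {a. s a (s b x) : B}"
proof -
 have "a : P \<longleftrightarrow> s a (s b x) : B" for a
 proof
  assume "a : P"
  hence "s b (s a x) : B" using P osub_op[OF B(1) acts_op[OF act]] by auto
  thus "s a (s b x) : B" using acts_comm[OF act acts_op[OF act], of a b x] by simp
 next
  assume s: "s a (s b x) : B"
  have "s (a * b) x - s a (s b x) : B" using acts_mult[OF act x] B(2) by blast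
  hence "a * b : P" using s osub_diffD[OF B(1)] P(2) by blast
  thus "a : P" using b P(1) by (auto simp: primep_def)
 qed
 thus ?thesis by blast
qed

lemma colon_shift:
 assumes act: "acts Om K s W U" and B: "osub Om B" and xy: "x - y : B"
 shows "{a. s a x : B} = {a. s a y : B}"
proof -
 have "s a x : B \<longleftrightarrow> s a y : B" for a
 proof -
  have "s a (x - y) : B" by (rule osub_op[OF B acts_op[OF act] xy])
  hence "s a x - s a y : B" by (simp only: additive.diff[OF acts_add[OF act]])
  thus ?thesis by (rule osub_diff_cong[OF B])
 qed
 thus ?thesis by blast
qed

text \<open>Cohomology modulo powers: \<open>Z n\<close> plays the role of \<open>I\<^sup>n X + U\<close>. The classes outside
 \<open>ker D + Z n\<close> are mapped by \<open>D\<close> to \<open>(Z n \<inter> im D) / D (Z n)\<close>, the remaining ones are filtered by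
 \<open>im D + (ker D \<inter> Z j)\<close>; both are homogeneous pieces of a subquotient of the Rees module.\<close>

lemma (in rees) assp_cohomology:
 assumes NR: "noeth scl UNIV K" and act: "acts Om K s (Z 0) U"
  and D: "additive D" and Dcomm: "!!w x. w : Om ==> w (D x) = D (w x)"
  and DA: "!!a x. a : As ==> a (D x) = D (a x)"
  and DZ: "!!x. x : Z 0 ==> D x : Z 0" and DU: "!!x. x : U ==> D x : U"
  and DD: "!!x. x : Z 0 ==> D (D x) : U" and ZZ: "!!n. Z (Suc n) <= Z n"
 shows "finite (\<Union>n. assp s {x\<in>Z 0. D x : Z n} (D ` Z 0 \<boxplus> Z n))"
proof -
 note Dadd = additive.add[OF D] and Ddiff = additive.diff[OF D]
 have Zle: "Z m <= Z n" if "n <= m" for m n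
  using that
 proof (induction rule: dec_induct)
  case (step k)
  thus ?case using ZZ[of k] by blast
 qed simp
 have Z0: "Z n <= Z 0" for n using Zle[of 0 n] by simp
 have DZn: "D ` Z n <= Z n" for n
 proof (induction n)
  case (Suc n)
  have "Z (Suc n) <= {x\<in>UNIV. D x : Z (Suc n)}"
  proof (rule gen)
   show "osub Om {x\<in>UNIV. D x : Z (Suc n)}"
    by (rule osub_vimageI[OF D Dcomm Z]) (simp_all add: osub_def)
   show "U <= {x\<in>UNIV. D x : Z (Suc n)}" using DU UZ by blast
   show "a x : {x\<in>UNIV. D x : Z (Suc n)}" if "a : As" "x : Z n" for a x
   proof -
    have "a (D x) : Z (Suc n)" using Suc that by (intro aZ) auto
    thus ?thesis by (simp add: DA[OF that(1)])
   qed
  qed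
  thus ?case by auto
 qed (use DZ in auto)
 have DZ': "osub Om (D ` Z n)" for n by (rule osub_imageI[OF D Dcomm Z])
 have DA': "a x : D ` Z (Suc n)" if a: "a : As" and x: "x : D ` Z n" for a x n
  using x aZ[OF a] by (auto simp: DA[OF a])
 define S where "S = D ` Z 0 \<boxplus> U"
 have osS: "osub Om (D ` Z n \<boxplus> U)" for n by (rule osub_splus[OF add DZ' U])
 have S: "osub Om S" "U <= S" "D ` Z 0 <= S" "S <= Z 0"
  using osS[of 0] splus_sub2[OF DZ'] splus_sub1[OF U] splus_least[OF Z DZn UZ] by (auto simp: S_def)
 have aS: "a x : S" if a: "a : As" and x: "x : S" for a x
 proof -
  obtain z u where z: "x = D z + u" "z : Z 0" "u : U" using x by (auto simp: S_def elim!: splusE)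
  have "a x = D (a z) + a u" using z by (simp add: additive.add[OF addA[OF a]] DA[OF a])
  moreover have "a z : Z 0" using aZ[OF a z(2)] ZZ by blast
  ultimately show ?thesis using aU[OF a z(3)] by (auto simp: S_def intro: splusI)
 qed
 define G1 where "G1 n = Z n \<inter> S" for n
 \<comment> \<open>For \<open>y\<close> in \<open>Z 0\<close> the image \<open>D y\<close> lies in
   \<open>H1 n\<close> exactly when \<open>y\<close> lies in \<open>K0 \<boxplus> Z n\<close>. This
   is why \<open>G1 n / H1 n\<close> detects the classes outside that submodule.\<close>
 define H1 where "H1 n = D ` Z n \<boxplus> U" for n
 have fin1: "finite (\<Union>n. assp s (G1 n) (H1 n))"
 proof (rule assp_family[OF NR act Z0])
  show "osub Om (G1 n)" for n using osub_Int[OF Z S(1)] by (simp add: G1_def)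
  show "G1 n <= Z n" for n by (simp add: G1_def)
  show "a x : G1 (Suc n)" if "a : As" "x : G1 n" for a n x
   using that aZ aS by (auto simp: G1_def)
  show "osub Om (H1 n)" for n using osS by (simp add: H1_def)
  show "H1 n <= G1 n" for n
   using splus_least[OF Z DZn UZ, of n] splus_mono[of "D ` Z n" "D ` Z 0" U U] Z0[of n]
   by (auto simp: H1_def G1_def S_def)
  show "U <= H1 n" for n using splus_sub2[OF DZ'] by (simp add: H1_def)
  show "a x : H1 (Suc n)" if a: "a : As" and x: "x : H1 n" for a n x
  proof -
   obtain y u where y: "x = y + u" "y : D ` Z n" "u : U" using x by (auto simp: H1_def elim!: splusE)
   thus ?thesis using DA'[OF a y(2)] aU[OF a y(3)]
    by (auto simp: H1_def additive.add[OF addA[OF a]] intro: splusI)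
  qed
 qed
 define K0 where "K0 = {x\<in>Z 0. D x : U}"
 have K0: "osub Om K0" "U <= K0" "K0 <= Z 0"
  using osub_vimageI[OF D Dcomm U Z] DU UZ by (auto simp: K0_def)
 have aK0: "a x : K0" if a: "a : As" and x: "x : K0" for a x
  using x aZ[OF a] ZZ aU[OF a] by (auto simp: K0_def simp flip: DA[OF a])
 have SK0: "S <= K0" by (unfold S_def, rule splus_least[OF K0(1) _ K0(2)]) (use DD DZ in \<open>auto simp: K0_def\<close>)
 define E where "E j = S \<boxplus> (K0 \<inter> Z j)" for j
 have KZ: "osub Om (K0 \<inter> Z j)" for j by (rule osub_Int[OF K0(1) Z])
 have E: "osub Om (E j)" "S <= E j" "K0 \<inter> Z j <= E j" "E (Suc j) <= E j" for j
  using osub_splus[OF add S(1) KZ, of j] splus_sub1[OF KZ, of S j] splus_sub2[OF S(1)]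
   splus_mono[OF order_refl, of "K0 \<inter> Z (Suc j)" "K0 \<inter> Z j" S] ZZ[of j]
  by (auto simp: E_def)
 have aE: "a x : E (Suc j)" if a: "a : As" and x: "x : E j" for a x j
 proof -
  obtain y u where y: "x = y + u" "y : S" "u : K0" "u : Z j" using x by (auto simp: E_def elim!: splusE)
  thus ?thesis using aS[OF a y(2)] aK0[OF a y(3)] aZ[OF a y(4)]
   by (auto simp: E_def additive.add[OF addA[OF a]] intro: splusI)
 qed
 define G2 where "G2 j = K0 \<inter> Z j" for j
 \<comment> \<open>The part of \<open>K0 \<inter> Z j\<close> that falls one step deeper in the
   filtration \<open>E\<close>, so that \<open>G2 j / H2 j\<close> is the quotient of
   \<open>E j\<close> by \<open>E (Suc j)\<close>.\<close>
 define H2 where "H2 j = K0 \<inter> Z j \<inter> E (Suc j)" for j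
 have fin2: "finite (\<Union>n. assp s (G2 n) (H2 n))"
 proof (rule assp_family[OF NR act Z0])
  show "osub Om (G2 n)" for n using KZ by (simp add: G2_def)
  show "G2 n <= Z n" for n by (simp add: G2_def)
  show "a x : G2 (Suc n)" if "a : As" "x : G2 n" for a n x
   using that aZ aK0 by (auto simp: G2_def)
  show "osub Om (H2 n)" for n using osub_Int[OF KZ E(1)] by (simp add: H2_def)
  show "H2 n <= G2 n" for n by (auto simp: H2_def G2_def)
  show "U <= H2 n" for n using K0(2) UZ S(2) E(2) unfolding H2_def by blast
  show "a x : H2 (Suc n)" if "a : As" "x : H2 n" for a n x
   using that aZ aK0 aE by (auto simp: H2_def)
 qed
 \<comment> \<open>Descent along \<open>E\<close>, whose stage 0 contains \<open>K0\<close> and so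
   admits no proper annihilator. At the step where some scalar outside \<open>P\<close> moves
   \<open>k\<close> into \<open>E n\<close>, that multiple represents an element of
   \<open>E n / E (Suc n)\<close> with annihilator \<open>P\<close>.\<close>
 have claim: "\<exists>j. P : assp s (G2 j) (H2 j)" if "primep P" "k : K0" "P = {a. s a k : E n}" for P k n
  using that
 proof (induction n)
  case 0
  have "K0 <= E 0" using E(3)[of 0] K0(3) by blast
  hence "1 : P" using 0 osub_op[OF K0(1) acts_op[OF act]] by blast
  thus ?case using 0(1) by (simp add: primep_def)
 next
  case (Suc n)
  have kZ: "k : Z 0" using Suc.prems K0 by blast
  show ?case
  proof (cases "\<exists>b. b ~: P & s b k : E n")
   case True
   then obtain b where b: "b ~: P" "s b k : E n" by blast
   then obtain d k' where k': "s b k = d + k'" "d : S" "k' : K0 \<inter> Z n" by (auto simp: E_def elim!: splusE)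
   have "P = {a. s a (s b k) : E (Suc n)}"
    by (rule colon_prime[OF act E(1) _ kZ Suc.prems(1,3) b(1)]) (use S(2) E(2) in blast)
   also have "\<dots> = {a. s a k' : E (Suc n)}"
    by (rule colon_shift[OF act E(1)]) (use k' E(2) in auto)
   also have "\<dots> = {a. s a k' : H2 n}"
    using osub_op[OF KZ acts_op[OF act] k'(3)] by (auto simp: H2_def)
   finally show ?thesis using Suc.prems(1) k'(3) by (auto simp: assp_def G2_def)
  next
   case False
   hence "P = {a. s a k : E n}" using Suc.prems(3) E(4) by blast
   thus ?thesis using Suc by blast
  qed
 qed
 have "assp s {x\<in>Z 0. D x : Z n} (D ` Z 0 \<boxplus> Z n) <= (\<Union>n. assp s (G1 n) (H1 n)) \<union> (\<Union>n. assp s (G2 n) (H2 n))" for n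
 proof
  fix P assume "P : assp s {x\<in>Z 0. D x : Z n} (D ` Z 0 \<boxplus> Z n)"
  then obtain x where P: "primep P" "x : Z 0" "D x : Z n" "P = {a. s a x : D ` Z 0 \<boxplus> Z n}" by (auto simp: assp_def)
  let ?B = "D ` Z 0 \<boxplus> Z n"
  have B: "osub Om ?B" by (rule osub_splus[OF add DZ' Z])
  have BS: "S <= ?B" "Z n <= ?B"
   using splus_mono[OF order_refl UZ] splus_sub2[OF DZ'] by (auto simp: S_def)
  have BF: "?B <= K0 \<boxplus> Z n" using splus_mono[of "D ` Z 0" K0 "Z n" "Z n"] S(3) SK0 by blast
  show "P : (\<Union>n. assp s (G1 n) (H1 n)) \<union> (\<Union>n. assp s (G2 n) (H2 n))"
  proof (cases "\<exists>b. b ~: P & s b x : K0 \<boxplus> Z n")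
   case True
   then obtain b where b: "b ~: P" "s b x : K0 \<boxplus> Z n" by blast
   then obtain k z where k: "s b x = k + z" "k : K0" "z : Z n" by (auto elim!: splusE)
   have "P = {a. s a (s b x) : ?B}"
    by (rule colon_prime[OF act B _ P(2,1,4) b(1)]) (use BS UZ in blast)
   also have "\<dots> = {a. s a k : ?B}"
    by (rule colon_shift[OF act B]) (use k BS in auto)
   also have "\<dots> = {a. s a k : E n}"
   proof -
    have "y : ?B \<longleftrightarrow> y : E n" if y: "y : K0" for y
    proof
     assume "y : ?B"
     then obtain d z where d: "y = d + z" "d : D ` Z 0" "z : Z n" by (auto elim!: splusE)
     hence "z : K0" using y osub_diff[OF K0(1), of y d] S(3) SK0 by auto
     thus "y : E n" unfolding d(1) E_def using d S(3) by (intro splusI) auto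
    next
     assume "y : E n"
     thus "y : ?B" using splus_least[OF B BS(1), of "K0 \<inter> Z n"] BS(2) by (auto simp: E_def)
    qed
    thus ?thesis using osub_op[OF K0(1) acts_op[OF act] k(2)] by blast
   qed
   finally have "P = {a. s a k : E n}" .
   from claim[OF P(1) k(2) this] show ?thesis by blast
  next
   case False
   hence "P = {a. s a x : K0 \<boxplus> Z n}" using P(4) BF by blast
   also have "\<dots> = {a. s a (D x) : H1 n}"
   proof -
    have "y : K0 \<boxplus> Z n \<longleftrightarrow> D y : H1 n" if y: "y : Z 0" for y
    proof
     assume "y : K0 \<boxplus> Z n"
     then obtain k z where "y = k + z" "k : K0" "z : Z n" by (auto elim!: splusE)
     hence "D y = D z + D k" "D z : D ` Z n" "D k : U"
      by (simp_all add: K0_def Dadd add.commute)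
     thus "D y : H1 n" by (simp only: H1_def) (intro splusI)
    next
     assume "D y : H1 n"
     then obtain z u where z: "D y = D z + u" "z : Z n" "u : U" by (auto simp: H1_def elim!: splusE)
     hence "y - z : K0" using y Z0[of n] osub_diff[OF Z, of y 0 z] by (auto simp: K0_def Ddiff)
     thus "y : K0 \<boxplus> Z n" using splusI[of "y - z" K0 z "Z n"] z by simp
    qed
    moreover have "s a x : Z 0" for a using osub_op[OF Z acts_op[OF act] P(2)] .
    moreover have "D (s a x) = s a (D x)" for a using Dcomm[OF acts_op[OF act]] by simp
    ultimately show ?thesis by simp
   qed
   finally have "P = {a. s a (D x) : H1 n}" .
   moreover have "D x : G1 n" using P S(3) by (auto simp: G1_def)
   ultimately show ?thesis using P(1) unfolding assp_def by blast
  qed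
 qed
 hence "(\<Union>n. assp s {x\<in>Z 0. D x : Z n} (D ` Z 0 \<boxplus> Z n)) <= (\<Union>n. assp s (G1 n) (H1 n)) \<union> (\<Union>n. assp s (G2 n) (H2 n))"
  by blast
 thus ?thesis using fin1 fin2 finite_subset by blast
qed

section \<open>Nakayama's lemma and Krull's intersection theorem\<close>

text \<open>For finite \<open>J\<close>: the ideal generated by the \<open>a j\<close> lies in the
  Jacobson radical of the ring modulo \<open>K\<close>.\<close>

definition jac :: "'r::comm_ring_1 set => ('i => 'r) => 'i set => bool" where
 "jac K a J \<longleftrightarrow> (\<forall>r. \<exists>v. v * (1 - (\<Sum>j\<in>J. r j * a j)) - 1 : K)"

text \<open>For finite \<open>J\<close> and \<open>U\<close> contained in \<open>W\<close> this is
  \<open>I^n W + U\<close>, with \<open>I\<close> the ideal generated by the \<open>a j\<close>. The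
  recursion needs neither ideal powers nor generated submodules.\<close>

fun ifl :: "('r => 'b => 'b::ab_group_add) => ('i => 'r) => 'i set => 'b set => 'b set => nat => 'b set" where
 "ifl s a J U W 0 = W"
| "ifl s a J U W (Suc n) = {u + (\<Sum>j\<in>J. s (a j) (x j)) |u x. u : U & (\<forall>j\<in>J. x j : ifl s a J U W n)}"

context Modules.module
begin

text \<open>A maximal proper submodule \<open>V\<close> above \<open>U\<close> satisfies
  \<open>Y = V + R y\<close>. Testing \<open>gen\<close> on \<open>V + T y\<close>, with
  \<open>T\<close> the ideal generated by the \<open>a j\<close>, gives \<open>y = v + t y\<close>,
  and inverting \<open>1 - t\<close> modulo \<open>K\<close> puts \<open>y\<close> into
  \<open>V\<close>. The product of the ideal with \<open>Y\<close> appears only through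
  \<open>gen\<close>.\<close>

lemma nakayama:
 assumes N: "noeth (range scale) Y U" and Y: "submod scale Y" and U: "submod scale U" "U <= Y"
  and K: "!!k y. k : K ==> y : Y ==> scale k y : U" and J: "finite J" and jac: "jac K a J"
  and gen: "!!C. submod scale C ==> U <= C ==> (!!j y. j : J ==> y : Y ==> scale (a j) y : C) ==> Y <= C"
 shows "Y = U"
proof (rule ccontr)
 assume "Y ~= U"
 define C where "C = {V. submod scale V & U <= V & V <= Y & V ~= Y}"
 have "U : C" using U \<open>Y ~= U\<close> by (auto simp: C_def)
 then obtain V where V: "V : C" "!!V'. V' : C ==> V <= V' ==> V' = V"
  by (rule noeth_maxE[OF N]) (auto simp: C_def)
 have Vs: "submod scale V" "U <= V" "V <= Y" "V ~= Y" using V(1) by (auto simp: C_def)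
 then obtain y where y: "y : Y" "y ~: V" by blast
 have adds: "additive (%r. scale r y)" by (simp add: additive_def scale_left_distrib)
 have img: "submod scale ((%r. scale r y) ` T)" if T: "osub scl T" for T
 proof (rule osubI)
  show "0 : (%r. scale r y) ` T" using osub_zero[OF T] by (intro image_eqI[of _ _ 0]) simp_all
  show "p - q : (%r. scale r y) ` T" if pq: "p : (%r. scale r y) ` T" "q : (%r. scale r y) ` T" for p q
   using pq osub_diff[OF T] by (auto simp flip: scale_left_diff_distrib)
  show "w p : (%r. scale r y) ` T" if "w : range scale" "p : (%r. scale r y) ` T" for w p
   using that osub_op[OF T, of "(*) c" for c] by auto
 qed
 have os: "submod scale (V \<boxplus> (%r. scale r y) ` T)" if "osub scl T" for T
  by (rule osub_splus[OF additive_scale Vs(1) img[OF that]])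
 have univ: "osub scl (UNIV :: 'a set)" by (simp add: osub_def)
 have VY: "V \<boxplus> range (%r. scale r y) = Y"
 proof (rule ccontr)
  assume "V \<boxplus> range (%r. scale r y) ~= Y"
  moreover have "V <= V \<boxplus> range (%r. scale r y)" by (rule splus_sub1[OF img[OF univ]])
  moreover have "V \<boxplus> range (%r. scale r y) <= Y"
   by (rule splus_least[OF Y Vs(3)]) (use osub_scale[OF Y y(1)] in auto)
  ultimately have "V \<boxplus> range (%r. scale r y) = V"
   using V(2)[of "V \<boxplus> range (%r. scale r y)"] Vs os[OF univ] by (auto simp: C_def)
  moreover have "0 + scale 1 y : V \<boxplus> range (%r. scale r y)" by (intro splusI osub_zero[OF Vs(1)] rangeI)
  ultimately show False using y by simp
 qed
 define T where "T = {\<Sum>j\<in>J. r j * a j |r. True}"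
 have T: "osub scl T"
 proof (rule osubI)
  show "0 : T" unfolding T_def by (intro CollectI exI[of _ "%_. 0"]) simp
  show "p - q : T" if pq: "p : T" "q : T" for p q
  proof -
   obtain r r' where "p = (\<Sum>j\<in>J. r j * a j)" "q = (\<Sum>j\<in>J. r' j * a j)" using pq by (auto simp: T_def)
   hence "p - q = (\<Sum>j\<in>J. (r j - r' j) * a j)" by (simp add: sum_subtractf left_diff_distrib)
   thus ?thesis unfolding T_def by (intro CollectI exI[of _ "%j. r j - r' j"] conjI TrueI)
  qed
  show "w p : T" if wp: "w : scl" "p : T" for w p
  proof -
   obtain c r where "w = (*) c" "p = (\<Sum>j\<in>J. r j * a j)" using wp by (auto simp: T_def)
   hence "w p = (\<Sum>j\<in>J. (c * r j) * a j)" by (simp add: sum_distrib_left mult.assoc)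
   thus ?thesis unfolding T_def by (intro CollectI exI[of _ "%j. c * r j"] conjI TrueI)
  qed
 qed
 have aT: "a j : T" if "j : J" for j
 proof -
  have "(\<Sum>i\<in>J. (if i = j then 1 else 0) * a i) = (\<Sum>i\<in>J. if i = j then a i else 0)" by (rule sum.cong) auto
  also have "\<dots> = a j" using that J by simp
  finally show ?thesis unfolding T_def
   by (intro CollectI exI[of _ "%i. if i = j then 1 else 0"] conjI TrueI) simp
 qed
 have "Y <= V \<boxplus> (%r. scale r y) ` T"
 proof (rule gen[OF os[OF T]])
  show "U <= V \<boxplus> (%r. scale r y) ` T" using splus_sub1[OF img[OF T], of V] Vs(2) by blast
  show "scale (a j) z : V \<boxplus> (%r. scale r y) ` T" if j: "j : J" and z: "z : Y" for j z
  proof -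
   obtain v r where v: "z = v + scale r y" "v : V" using z by (auto simp flip: VY elim!: splusE)
   have "scale (a j) z = scale (a j) v + scale (r * a j) y"
    by (simp add: v scale_right_distrib mult.commute)
   moreover have "r * a j : T" by (rule osub_op[OF T _ aT[OF j]]) simp
   ultimately show ?thesis using osub_scale[OF Vs(1) v(2)] by (auto intro: splusI)
  qed
 qed
 then obtain v t where t: "y = v + scale t y" "v : V" "t : T" using y(1) by (auto elim!: splusE dest!: subsetD)
 obtain r where r: "t = (\<Sum>j\<in>J. r j * a j)" using t(3) by (auto simp: T_def)
 obtain w where w: "w * (1 - t) - 1 : K" using jac unfolding jac_def r by blast
 have "scale (1 - t) y = v" using t(1) by (simp add: scale_left_diff_distrib algebra_simps)
 hence wv: "scale (w * (1 - t)) y : V" using osub_scale[OF Vs(1) t(2), of w] by (simp flip: scale_scale)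
 have "scale (w * (1 - t) - 1) y : V" using K[OF w y(1)] Vs(2) by blast
 hence "y : V" using wv osub_diff[OF Vs(1) wv] by (force simp: scale_left_diff_distrib)
 thus False using y by simp
qed

lemma osub_ifl:
 assumes U: "submod scale U" and W: "submod scale W"
 shows "submod scale (ifl scale a J U W n)"
proof (induction n)
 case (Suc n)
 show ?case
 proof (rule osubI)
  show "0 : ifl scale a J U W (Suc n)"
   using osub_zero[OF U] osub_zero[OF Suc] by (auto intro!: exI[of _ 0] exI[of _ "%_. 0"])
  show "p - q : ifl scale a J U W (Suc n)" if pq: "p : ifl scale a J U W (Suc n)" "q : ifl scale a J U W (Suc n)" for p q
  proof -
   obtain u x u' x' where e: "p = u + (\<Sum>j\<in>J. scale (a j) (x j))" "q = u' + (\<Sum>j\<in>J. scale (a j) (x' j))"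
    "u : U" "u' : U" "\<forall>j\<in>J. x j : ifl scale a J U W n" "\<forall>j\<in>J. x' j : ifl scale a J U W n" using pq by auto
   have "p - q = (u - u') + (\<Sum>j\<in>J. scale (a j) (x j - x' j))"
    by (simp add: e scale_right_diff_distrib sum_subtractf)
   thus ?thesis using e osub_diff[OF U] osub_diff[OF Suc]
    by (auto intro!: exI[of _ "u - u'"] exI[of _ "%j. x j - x' j"])
  qed
  show "w p : ifl scale a J U W (Suc n)" if w: "w : range scale" and p: "p : ifl scale a J U W (Suc n)" for w p
  proof -
   obtain c where c: "w = scale c" using w by blast
   obtain u x where e: "p = u + (\<Sum>j\<in>J. scale (a j) (x j))"
    "u : U" "\<forall>j\<in>J. x j : ifl scale a J U W n" using p by auto
   have "w p = scale c u + (\<Sum>j\<in>J. scale (a j) (scale c (x j)))"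
    by (simp add: e c scale_right_distrib scale_sum_right mult.commute)
   thus ?thesis using e osub_scale[OF U] osub_scale[OF Suc]
    by (auto intro!: exI[of _ "scale c u"] exI[of _ "%j. scale c (x j)"])
  qed
 qed
qed (simp add: W)

lemma ifl_base:
 assumes U: "submod scale U" "U <= W" and W: "submod scale W"
 shows "U <= ifl scale a J U W n"
proof (cases n)
 case (Suc m)
 have "u : ifl scale a J U W (Suc m)" if "u : U" for u
  using that osub_zero[OF osub_ifl[OF U(1) W]]
  by (auto intro!: exI[of _ u] exI[of _ "%_. 0"])
 thus ?thesis using Suc by blast
qed (simp add: U)

lemma ifl_mult:
 assumes U: "submod scale U" and W: "submod scale W" and J: "finite J" "j : J"
  and x: "x : ifl scale a J U W n"
 shows "scale (a j) x : ifl scale a J U W (Suc n)"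
proof -
 have "(\<Sum>i\<in>J. scale (a i) (if i = j then x else 0)) = (\<Sum>i\<in>J. if i = j then scale (a i) x else 0)"
  by (rule sum.cong) auto
 also have "\<dots> = scale (a j) x" using J by simp
 finally show ?thesis
  using osub_zero[OF U] osub_zero[OF osub_ifl[OF U W]] x
  by (auto intro!: exI[of _ 0] exI[of _ "%i. if i = j then x else 0"])
qed

lemma ifl_least:
 assumes C: "submod scale C" "U <= C" "!!j x. j : J ==> x : ifl scale a J U W n ==> scale (a j) x : C"
 shows "ifl scale a J U W (Suc n) <= C"
proof
 fix p assume "p : ifl scale a J U W (Suc n)"
 then obtain u x where p: "p = u + (\<Sum>j\<in>J. scale (a j) (x j))" "u : U" "\<forall>j\<in>J. x j : ifl scale a J U W n"
  by auto
 have "(\<Sum>j\<in>J. scale (a j) (x j)) : C"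
  by (rule osub_sum[OF C(1)]) (use p C(3) in blast)
 thus "p : C" using p C(2) osub_add[OF C(1)] by blast
qed

lemma ifl_decreasing:
 assumes U: "submod scale U" "U <= W" and W: "submod scale W"
 shows "ifl scale a J U W (Suc n) <= ifl scale a J U W n"
 by (rule ifl_least[OF osub_ifl[OF U(1) W] ifl_base[OF U W]]) (rule osub_scale[OF osub_ifl[OF U(1) W]])

lemma rees_ifl:
 assumes N: "noeth (range scale) W U" and W: "submod scale W" and U: "submod scale U" "U <= W"
  and J: "finite J"
 shows "rees (range scale) ((%j. scale (a j)) ` J) (ifl scale a J U W) U"
proof (rule rees.intro)
 show "w : range scale ==> additive w" for w by (rule additive_scale)
 show "w : (%j. scale (a j)) ` J ==> additive w" for w by (rule additive_scale) auto
 show "w (b x) = b (w x)" if "w : range scale" "b : (%j. scale (a j)) ` J" for w b x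
  using that by (auto simp: mult.commute)
 show "w (b x) = b (w x)" if "w : (%j. scale (a j)) ` J" "b : (%j. scale (a j)) ` J" for w b x
  using that by (auto simp: mult.commute)
 show "finite ((%j. scale (a j)) ` J)" using J by simp
 show "submod scale U" by fact
 show "w x : U" if "w : (%j. scale (a j)) ` J" "x : U" for w x
  using that osub_scale[OF U(1)] by auto
 show "submod scale (ifl scale a J U W n)" for n by (rule osub_ifl[OF U(1) W])
 show "U <= ifl scale a J U W n" for n by (rule ifl_base[OF U W])
 show "w x : ifl scale a J U W (Suc n)" if "w : (%j. scale (a j)) ` J" "x : ifl scale a J U W n" for w x n
  using that ifl_mult[OF U(1) W J] by blast
 show "ifl scale a J U W (Suc n) <= C"
  if C: "submod scale C" "U <= C" "!!w x. w : (%j. scale (a j)) ` J ==> x : ifl scale a J U W n ==> w x : C" for C n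
  by (rule ifl_least[OF C(1,2)]) (use C(3) in blast)
 show "noeth (range scale) (ifl scale a J U W 0) U" using N by (simp only: ifl.simps(1))
qed

text \<open>The intersection \<open>Y\<close> is contained in every stage, so Artin-Rees for
  \<open>Y\<close> places \<open>Y\<close> inside the ideal times \<open>Y\<close>, plus
  \<open>U\<close>; Nakayama's lemma then leaves \<open>Y = U\<close>.\<close>

lemma krull_intersection:
 assumes N: "noeth (range scale) W U" and W: "submod scale W" and U: "submod scale U" "U <= W"
  and K: "!!k y. k : K ==> y : W ==> scale k y : U" and J: "finite J" and jac: "jac K a J"
 shows "(\<Inter>n. ifl scale a J U W n) = U"
proof -
 interpret rees "range scale" "(%j. scale (a j)) ` J" "ifl scale a J U W" U
  by (rule rees_ifl[OF N W U J])
 define Y where "Y = (\<Inter>n. ifl scale a J U W n)"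
 have Yi: "Y <= ifl scale a J U W n" for n by (auto simp: Y_def)
 have Y: "submod scale Y" unfolding Y_def by (rule osub_INT) (rule Z)
 have UY: "U <= Y" unfolding Y_def by (rule INT_greatest) (rule UZ)
 have aY: "w x : Y" if "w : (%j. scale (a j)) ` J" "x : Y" for w x
  using that(1) osub_scale[OF Y that(2)] by auto
 obtain c where c: "!!n C. n >= c ==> submod scale C ==> U <= C ==>
   (!!w x. w : (%j. scale (a j)) ` J ==> x : ifl scale a J U W n \<inter> Y ==> w x : C)
  ==> ifl scale a J U W (Suc n) \<inter> Y <= C"
  by (rule artin_rees[OF Y UY]) (auto intro: aY)
 have "Y = U"
 proof (rule nakayama[OF _ Y U(1) UY _ J jac])
  show "noeth (range scale) Y U" by (rule noeth_mono[OF N]) (use Yi[of 0] in auto)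
  show "scale k y : U" if "k : K" "y : Y" for k y using that K Yi[of 0] by auto
  show "Y <= C" if C: "submod scale C" "U <= C" "!!j y. j : J ==> y : Y ==> scale (a j) y : C" for C
  proof -
   have "ifl scale a J U W (Suc c) \<inter> Y <= C"
    by (rule c[OF order_refl C(1,2)]) (use C(3) in blast)
   thus ?thesis using Yi[of "Suc c"] by blast
  qed
 qed
 thus ?thesis by (simp add: Y_def)
qed

end

section \<open>Free modules and complexes\<close>

abbreviation "lookup \<equiv> Poly_Mapping.lookup"
abbreviation "keys \<equiv> Poly_Mapping.keys"
abbreviation "single \<equiv> Poly_Mapping.single"

definition sc :: "'r::comm_ring_1 => ('x \<Rightarrow>\<^sub>0 'r) => ('x \<Rightarrow>\<^sub>0 'r)" where
 "sc r x = Poly_Mapping.map ((*) r) x"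

lemma lookup_sc [simp]: "lookup (sc r x) k = r * lookup x k"
 by (simp add: sc_def Poly_Mapping.map.rep_eq when_def)

lemma module_sc: "Modules.module sc"
 by unfold_locales (auto intro!: poly_mapping_eqI simp: lookup_add algebra_simps)

interpretation sc: Modules.module sc by (rule module_sc)

lemma sc_single [simp]: "sc r (single b q) = single b (r * q)"
 by (rule poly_mapping_eqI) (simp add: lookup_single when_def)

lemma keys_sc: "keys (sc r x) <= keys x"
 by (auto simp: in_keys_iff)

definition lin :: "('r::comm_ring_1 => 'b => 'b::ab_group_add) => ('x => 'b) => ('x \<Rightarrow>\<^sub>0 'r) => 'b" where
 "lin s c x = (\<Sum>b\<in>keys x. s (lookup x b) (c b))"

definition cf :: "'r::zero set => ('x \<Rightarrow>\<^sub>0 'r) set" where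
 "cf J = {x. \<forall>b. lookup x b : J}"

context Modules.module
begin

lemma lin_superset: "finite S ==> keys x <= S ==> lin scale c x = (\<Sum>b\<in>S. scale (lookup x b) (c b))"
 unfolding lin_def by (rule sum.mono_neutral_left) (auto simp: in_keys_iff)

lemma lin_zero [simp]: "lin scale c 0 = 0"
 by (simp add: lin_def)

lemma lin_single [simp]: "lin scale c (single b r) = scale r (c b)"
 by (subst lin_superset[of "{b}"]) auto

lemma lin_add: "lin scale c (x + y) = lin scale c x + lin scale c y"
proof -
 let ?S = "keys x \<union> keys y"
 have "keys (x + y) <= ?S" by (rule Poly_Mapping.keys_add)
 thus ?thesis
  by (simp add: lin_superset[of ?S] lookup_add scale_left_distrib sum.distrib)
qed

lemma additive_lin: "additive (lin scale c)"
 by (simp add: additive_def lin_add)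

lemmas lin_diff = additive.diff[OF additive_lin]
lemmas lin_sum = additive.sum[OF additive_lin]

lemma lin_sc: "lin scale c (sc r x) = scale r (lin scale c x)"
 by (simp add: lin_superset[OF finite_keys keys_sc] scale_sum_right lin_def[of _ _ x])

lemma lin_cong: "(!!b. b : keys x ==> c b = c' b) ==> lin scale c x = lin scale c' x"
 by (simp add: lin_def)

lemma lin_mem: "submod scale V ==> (!!b. b : keys x ==> c b : V) ==> lin scale c x : V"
 unfolding lin_def by (rule osub_sum) (auto intro: osub_scale)

lemma lin_fun_diff: "lin scale (%b. c b - c' b) x = lin scale c x - lin scale c' x"
 by (simp add: lin_def scale_right_diff_distrib sum_subtractf)

lemma lin_fun_add: "lin scale (%b. c b + c' b) x = lin scale c x + lin scale c' x"
 by (simp add: lin_def scale_right_distrib sum.distrib)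

lemma lin_fun_scale: "lin scale (%b. scale r (c b)) x = scale r (lin scale c x)"
 by (simp add: lin_def scale_sum_right mult.commute)

lemma lin_lin: "lin scale c (lin sc d x) = lin scale (%b. lin scale c (d b)) x"
 unfolding lin_def[of sc] by (simp add: lin_sum lin_sc) (simp add: lin_def)

lemma lin_cf:
 assumes U: "submod scale U" and "x : cf K" "!!k b. k : K ==> b : keys x ==> scale k (c b) : U"
 shows "lin scale c x : U"
 unfolding lin_def by (rule osub_sum[OF U]) (use assms in \<open>auto simp: cf_def\<close>)

end

lemma lin_unit: "lin sc (%b. single b 1) x = x"
 by (simp add: lin_def poly_mapping_eq_iff fun_eq_iff lookup_sum lookup_single when_def in_keys_iff)

lemma osub_kin: "submod sc {x. keys x <= S}"
proof (rule osubI)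
 show "x - y : {x. keys x <= S}" if xy: "x : {x. keys x <= S}" "y : {x. keys x <= S}" for x y :: "'a \<Rightarrow>\<^sub>0 'b"
 proof -
  have "keys (x - y) <= keys x \<union> keys y" by (auto simp: in_keys_iff lookup_minus)
  thus ?thesis using xy by auto
 qed
next
 show "w x : {x. keys x <= S}" if w: "w : range sc" "x : {x. keys x <= S}" for w and x :: "'a \<Rightarrow>\<^sub>0 'b"
 proof -
  obtain r where "w = sc r" using w by blast
  thus ?thesis using keys_sc[of r x] w by auto
 qed
qed simp

lemma keys_lin: "(!!b. b : keys x ==> keys (c b) <= S) ==> keys (lin sc c x) <= S"
 using sc.lin_mem[OF osub_kin[of S], of x c] by simp

lemma osub_cf: "osub scl K ==> submod sc (cf K)"
 by (rule osubI) (auto simp: cf_def lookup_minus osub_zero osub_diff osub_op[of scl K "(*) r" for r])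

lemma ideal_mult: "osub scl (K :: 'r::comm_ring_1 set) ==> k : K ==> k * r : K"
 using osub_op[of scl K "(*) r" k] by (simp add: mult.commute)

lemma sc_cf: "osub scl K ==> k : K ==> sc k x : cf K"
 by (simp add: cf_def ideal_mult)

lemma lin_sc_cf: "osub scl K ==> x : cf K ==> lin sc c x : cf K"
 by (rule sc.lin_cf[OF osub_cf]) (auto intro: sc_cf)

section \<open>Graded complexes on a basis, chain maps and homotopies\<close>

definition gr :: "'x set => ('x => nat) => nat => 'x set" where
 "gr B dg i = {b\<in>B. dg b = i}"

text \<open>A complex of free modules over the ring modulo \<open>K\<close>, given by the
  differential on a graded basis. All degrees live in one free module, so that chain maps and
  homotopies are single functions on the basis.\<close>

definition cplx :: "'r::comm_ring_1 set => 'x set => ('x => nat) => ('x => ('x \<Rightarrow>\<^sub>0 'r)) => bool" where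
 "cplx K B dg dd \<longleftrightarrow> (\<forall>b\<in>B. keys (dd b) <= {b'\<in>B. Suc (dg b') = dg b} & lin sc dd (dd b) : cf K)"

text \<open>Exactness is demanded in positive degrees; the homology in degree 0 is the module being
  resolved.\<close>

definition exct :: "'r::comm_ring_1 set => 'x set => ('x => nat) => ('x => ('x \<Rightarrow>\<^sub>0 'r)) => bool" where
 "exct K B dg dd \<longleftrightarrow> (\<forall>i x. keys x <= gr B dg (Suc i) --> lin sc dd x : cf K -->
  (\<exists>y. keys y <= gr B dg (Suc (Suc i)) & x - lin sc dd y : cf K))"

lemma cplx_keys: "cplx K B dg dd ==> b : gr B dg (Suc i) ==> keys (dd b) <= gr B dg i"
 unfolding cplx_def gr_def by fastforce

lemma cplx_keys0: "cplx K B dg dd ==> b : gr B dg 0 ==> dd b = 0"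
proof -
 assume c: "cplx K B dg dd" and b: "b : gr B dg 0"
 hence "keys (dd b) <= {b'\<in>B. Suc (dg b') = dg b}" "dg b = 0" unfolding cplx_def gr_def by auto
 hence "keys (dd b) = {}" by auto
 thus ?thesis by simp
qed

lemma cplx_sq: "cplx K B dg dd ==> b : B ==> lin sc dd (dd b) : cf K"
 by (simp add: cplx_def)

text \<open>The comparison theorem for resolutions. Exactness removes the obstruction in all degrees
  from 2 on; in degree 1 it is \<open>al1\<close>, which says that \<open>al0\<close> induces a map
  on homology in degree 0.\<close>

lemma chain_map_exists:
 fixes K :: "'r::comm_ring_1 set" and B :: "'x set" and B' :: "'y set"
 assumes K: "osub scl K" and G: "cplx K B dg dd" and H: "cplx K B' dg' dd'" and ex: "exct K B' dg' dd'"
  and al0: "!!b. b : gr B dg 0 ==> keys (al0 b) <= gr B' dg' 0"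
  and al1: "!!b. b : gr B dg 1 ==> \<exists>y. keys y <= gr B' dg' 1 & lin sc al0 (dd b) - lin sc dd' y : cf K"
 shows "\<exists>al. \<forall>b\<in>B. (dg b = 0 --> al b = al0 b) & keys (al b) <= gr B' dg' (dg b) \<and>
  lin sc al (dd b) - lin sc dd' (al b) : cf K"
proof -
 note oK = osub_cf[OF K]
 define P where "P f b v \<longleftrightarrow> (b : B --> (dg b = 0 --> v = al0 b) & keys v <= gr B' dg' (dg b) \<and>
  lin sc f (dd b) - lin sc dd' v : cf K)" for f b v
 have "\<exists>f. \<forall>b. P f b (f b)"
 \<comment> \<open>The condition on the value at \<open>b\<close> involves only the values on the
   keys of \<open>dd b\<close>, which have smaller degree, so the choices can be made by
   well-founded recursion.\<close>
 proof (rule dependent_wf_choice[OF wf_measure[of dg]])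
  fix f g :: "'x => ('y \<Rightarrow>\<^sub>0 'r)" and b v assume fg: "!!z. (z, b) : Wellfounded.measure dg ==> f z = g z"
  have "lin sc f (dd b) = lin sc g (dd b)" if "b : B"
  proof (rule sc.lin_cong)
   fix z assume "z : keys (dd b)"
   hence "Suc (dg z) = dg b" using G that unfolding cplx_def by auto
   thus "f z = g z" by (intro fg) simp
  qed
  thus "P f b v = P g b v" by (auto simp: P_def)
 next
  fix b f assume "!!y. (y, b) : Wellfounded.measure dg ==> P f y (f y)"
  hence IH: "P f y (f y)" if "dg y < dg b" for y using that by simp
  have "\<exists>v. P f b v" if b: "b : B"
  proof -
   consider "dg b = 0" | "dg b = 1" | i where "dg b = Suc (Suc i)" by (metis One_nat_def not0_implies_Suc)
   thus ?thesis
   proof cases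
    case 1
    hence b0: "b : gr B dg 0" using b by (simp add: gr_def)
    have "lin sc dd' (al0 b) = lin sc (%_. 0) (al0 b)"
     by (rule sc.lin_cong) (use al0[OF b0] cplx_keys0[OF H] in blast)
    hence "lin sc dd' (al0 b) = 0" by (simp add: lin_def)
    hence "P f b (al0 b)" using 1 al0[OF b0] cplx_keys0[OF G b0] by (simp add: P_def osub_zero[OF oK])
    thus ?thesis by blast
   next
    case 2
    hence b1: "b : gr B dg (Suc 0)" using b by (simp add: gr_def)
    obtain y where y: "keys y <= gr B' dg' 1" "lin sc al0 (dd b) - lin sc dd' y : cf K" using al1 b1 by auto
    have "lin sc f (dd b) = lin sc al0 (dd b)"
    proof (rule sc.lin_cong)
     fix z assume "z : keys (dd b)"
     hence "z : B" "dg z = 0" using cplx_keys[OF G b1] by (auto simp: gr_def)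
     thus "f z = al0 z" using IH[of z] 2 by (simp add: P_def)
    qed
    hence "P f b y" using y 2 by (simp add: P_def)
    thus ?thesis by blast
   next
    case 3
    hence bi: "b : gr B dg (Suc (Suc i))" using b by (simp add: gr_def)
    have z: "z : B" "dg z = Suc i" "P f z (f z)" if "z : keys (dd b)" for z
     using that cplx_keys[OF G bi] IH[of z] 3 by (auto simp: gr_def)
    have kx: "keys (lin sc f (dd b)) <= gr B' dg' (Suc i)"
     by (rule keys_lin) (use z in \<open>auto simp: P_def\<close>)
    have "lin sc (%z. lin sc f (dd z) - lin sc dd' (f z)) (dd b) : cf K"
     by (rule sc.lin_mem[OF oK]) (use z in \<open>simp add: P_def\<close>)
    hence "lin sc f (lin sc dd (dd b)) - lin sc dd' (lin sc f (dd b)) : cf K"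
     by (simp only: sc.lin_lin sc.lin_fun_diff)
    moreover have "lin sc f (lin sc dd (dd b)) : cf K" by (rule lin_sc_cf[OF K cplx_sq[OF G b]])
    ultimately have "lin sc dd' (lin sc f (dd b)) : cf K" using osub_diffD'[OF oK] by blast
    then obtain y where "keys y <= gr B' dg' (Suc (Suc i))" "lin sc f (dd b) - lin sc dd' y : cf K"
     using ex kx unfolding exct_def by blast
    hence "P f b y" using 3 by (simp add: P_def)
    thus ?thesis by blast
   qed
  qed
  thus "\<exists>v. P f b v" by (cases "b : B") (auto simp: P_def)
 qed
 thus ?thesis unfolding P_def by blast
qed

text \<open>With the homotopy \<open>si\<close> known in lower degrees,
  \<open>ga b - si (dd b)\<close> is a cycle by the chain map identity, hence a boundary; in degree
  0 this is the assumption that \<open>ga\<close> induces zero on homology.\<close>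

lemma homotopy_exists:
 fixes K :: "'r::comm_ring_1 set" and B :: "'x set"
 assumes K: "osub scl K" and G: "cplx K B dg dd" and ex: "exct K B dg dd"
  and ga: "!!b. b : B ==> keys (ga b) <= gr B dg (dg b)" "!!b. b : B ==> lin sc ga (dd b) - lin sc dd (ga b) : cf K"
  and ga0: "!!b. b : gr B dg 0 ==> \<exists>y. keys y <= gr B dg 1 & ga b - lin sc dd y : cf K"
 shows "\<exists>si. \<forall>b\<in>B. keys (si b) <= gr B dg (Suc (dg b)) & ga b - lin sc si (dd b) - lin sc dd (si b) : cf K"
proof -
 note oK = osub_cf[OF K]
 define P where "P f b v \<longleftrightarrow> (b : B --> keys v <= gr B dg (Suc (dg b)) \<and>
  ga b - lin sc f (dd b) - lin sc dd v : cf K)" for f b v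
 have "\<exists>f. \<forall>b. P f b (f b)"
 proof (rule dependent_wf_choice[OF wf_measure[of dg]])
  fix f g :: "'x => ('x \<Rightarrow>\<^sub>0 'r)" and b v assume fg: "!!z. (z, b) : Wellfounded.measure dg ==> f z = g z"
  have "lin sc f (dd b) = lin sc g (dd b)" if "b : B"
  proof (rule sc.lin_cong)
   fix z assume "z : keys (dd b)"
   hence "Suc (dg z) = dg b" using G that unfolding cplx_def by auto
   thus "f z = g z" by (intro fg) simp
  qed
  thus "P f b v = P g b v" by (auto simp: P_def)
 next
  fix b f assume "!!y. (y, b) : Wellfounded.measure dg ==> P f y (f y)"
  hence IH: "P f y (f y)" if "dg y < dg b" for y using that by simp
  have "\<exists>v. P f b v" if b: "b : B"
  proof (cases "dg b")
   case 0
   hence b0: "b : gr B dg 0" using b by (simp add: gr_def)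
   obtain y where "keys y <= gr B dg 1" "ga b - lin sc dd y : cf K" using ga0[OF b0] by blast
   hence "P f b y" using cplx_keys0[OF G b0] 0 by (simp add: P_def)
   thus ?thesis by blast
  next
   case (Suc i)
   hence bi: "b : gr B dg (Suc i)" using b by (simp add: gr_def)
   have z: "z : B" "dg z = i" "P f z (f z)" if "z : keys (dd b)" for z
    using that cplx_keys[OF G bi] IH[of z] Suc by (auto simp: gr_def)
   define x where "x = ga b - lin sc f (dd b)"
   have "keys (lin sc f (dd b)) <= gr B dg (Suc i)"
    by (rule keys_lin) (use z in \<open>auto simp: P_def\<close>)
   hence kx: "keys x <= gr B dg (Suc i)"
    using ga(1)[OF b] Suc osub_diff[OF osub_kin, of "ga b" "gr B dg (Suc i)" "lin sc f (dd b)"]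
    by (simp add: x_def)
   have "lin sc (%z. ga z - lin sc f (dd z) - lin sc dd (f z)) (dd b) : cf K"
    by (rule sc.lin_mem[OF oK]) (use z in \<open>simp add: P_def\<close>)
   hence e1: "lin sc ga (dd b) - lin sc f (lin sc dd (dd b)) - lin sc dd (lin sc f (dd b)) : cf K"
    by (simp only: sc.lin_lin sc.lin_fun_diff)
   have e2: "lin sc f (lin sc dd (dd b)) : cf K" by (rule lin_sc_cf[OF K cplx_sq[OF G b]])
   have "(lin sc ga (dd b) - lin sc f (lin sc dd (dd b)) - lin sc dd (lin sc f (dd b))) + lin sc f (lin sc dd (dd b))
     - (lin sc ga (dd b) - lin sc dd (ga b)) : cf K"
    by (rule osub_diff[OF oK osub_add[OF oK e1 e2] ga(2)[OF b]])
   hence "lin sc dd x : cf K" by (simp add: x_def sc.lin_diff algebra_simps)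
   then obtain y where "keys y <= gr B dg (Suc (Suc i))" "x - lin sc dd y : cf K"
    using ex kx unfolding exct_def by blast
   hence "P f b y" using Suc by (simp add: P_def x_def)
   thus ?thesis by blast
  qed
  thus "\<exists>v. P f b v" by (cases "b : B") (auto simp: P_def)
 qed
 thus ?thesis unfolding P_def by blast
qed

section \<open>Annihilators of cohomology classes\<close>

text \<open>\<open>h\<close> represents a degree \<open>i\<close> class of the cochain complex with values in the ambient type modulo \<open>U\<close>;
 \<open>annx\<close> is its annihilator.\<close>

definition coh where
 "coh s B dg dd U i h \<longleftrightarrow> (\<forall>b\<in>gr B dg (Suc i). lin s h (dd b) : U)"

definition annx where
 "annx s B dg dd U i h = {r. \<exists>g. \<forall>b\<in>gr B dg i. s r (h b) - lin s g (dd b) : U}"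

text \<open>\<open>al0\<close> and \<open>bt0\<close> extend to chain maps in both directions, and
  \<open>btal\<close> says that the composite is the identity on homology in degree 0, hence
  homotopic to the identity. With \<open>h'\<close> the pullback of \<open>h\<close> along
  \<open>bt\<close>, a cochain bounding \<open>r h\<close> is pulled back along \<open>bt\<close>,
  and one bounding \<open>r h'\<close> is pulled back along \<open>al\<close> and corrected by the
  homotopy.\<close>

lemma (in Modules.module) annx_compare:
 fixes B :: "'x set" and B' :: "'y set"
 assumes K: "osub scl K" and G: "cplx K B dg dd" and H: "cplx K B' dg' dd'"
  and exG: "exct K B dg dd" and exH: "exct K B' dg' dd'"
  and al0: "!!b. b : gr B dg 0 ==> keys (al0 b) <= gr B' dg' 0"
  and al1: "!!b. b : gr B dg 1 ==> \<exists>y. keys y <= gr B' dg' 1 & lin sc al0 (dd b) - lin sc dd' y : cf K"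
  and bt0: "!!b. b : gr B' dg' 0 ==> keys (bt0 b) <= gr B dg 0"
  and bt1: "!!b. b : gr B' dg' 1 ==> \<exists>y. keys y <= gr B dg 1 & lin sc bt0 (dd' b) - lin sc dd y : cf K"
  and btal: "!!b. b : gr B dg 0 ==> \<exists>y. keys y <= gr B dg 1 & lin sc bt0 (al0 b) - single b 1 - lin sc dd y : cf K"
  and U: "submod scale U" and KU: "!!k x. k : K ==> scale k x : U"
  and h: "coh scale B dg dd U i h"
 shows "\<exists>h'. coh scale B' dg' dd' U i h' & annx scale B' dg' dd' U i h' = annx scale B dg dd U i h"
proof -
 note oK = osub_cf[OF K]
 obtain al where al: "!!b. b : B ==> dg b = 0 ==> al b = al0 b" "!!b. b : B ==> keys (al b) <= gr B' dg' (dg b)"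
  "!!b. b : B ==> lin sc al (dd b) - lin sc dd' (al b) : cf K"
  using chain_map_exists[OF K G H exH al0 al1] by blast
 obtain bt where bt: "!!b. b : B' ==> dg' b = 0 ==> bt b = bt0 b" "!!b. b : B' ==> keys (bt b) <= gr B dg (dg' b)"
  "!!b. b : B' ==> lin sc bt (dd' b) - lin sc dd (bt b) : cf K"
  using chain_map_exists[OF K H G exG bt0 bt1] by blast
 define ga where "ga b = lin sc bt (al b) - single b 1" for b
 have kbtal: "keys (lin sc bt (al b)) <= gr B dg (dg b)" if b: "b : B" for b
  by (rule keys_lin) (use al(2)[OF b] bt(2) in \<open>force simp: gr_def\<close>)
 have ga1: "keys (ga b) <= gr B dg (dg b)" if b: "b : B" for b
  using osub_diff[OF osub_kin, of "lin sc bt (al b)" "gr B dg (dg b)" "single b 1"] kbtal[OF b] b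
  by (simp add: ga_def gr_def)
 have linga: "lin sc ga x = lin sc bt (lin sc al x) - x" for x
  by (simp add: ga_def[abs_def] sc.lin_fun_diff sc.lin_lin lin_unit)
 have ga2: "lin sc ga (dd b) - lin sc dd (ga b) : cf K" if b: "b : B" for b
 proof -
  have "lin sc bt (lin sc al (dd b) - lin sc dd' (al b)) : cf K" by (rule lin_sc_cf[OF K al(3)[OF b]])
  moreover have "lin sc (%z. lin sc bt (dd' z) - lin sc dd (bt z)) (al b) : cf K"
   by (rule sc.lin_mem[OF oK]) (use al(2)[OF b] bt(3) in \<open>auto simp: gr_def\<close>)
  ultimately have "lin sc bt (lin sc al (dd b) - lin sc dd' (al b)) + lin sc (%z. lin sc bt (dd' z) - lin sc dd (bt z)) (al b) : cf K"
   by (rule osub_add[OF oK])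
  also have "lin sc bt (lin sc al (dd b) - lin sc dd' (al b)) + lin sc (%z. lin sc bt (dd' z) - lin sc dd (bt z)) (al b)
   = lin sc ga (dd b) - lin sc dd (ga b)"
   unfolding linga ga_def by (simp add: sc.lin_diff sc.lin_fun_diff sc.lin_lin)
  finally show ?thesis .
 qed
 have ga0: "\<exists>y. keys y <= gr B dg 1 & ga b - lin sc dd y : cf K" if b: "b : gr B dg 0" for b
 proof -
  have "lin sc bt (al b) = lin sc bt0 (al0 b)"
   using b al(1)[of b] al0[OF b] bt(1) by (simp add: gr_def) (auto intro!: sc.lin_cong)
  thus ?thesis using btal[OF b] by (simp add: ga_def)
 qed
 obtain si where si: "!!b. b : B ==> keys (si b) <= gr B dg (Suc (dg b))"
  "!!b. b : B ==> ga b - lin sc si (dd b) - lin sc dd (si b) : cf K"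
  using homotopy_exists[OF K G exG ga1 ga2 ga0] by blast
 have lU: "lin scale c x : U" if "x : cf K" for c and x :: "'z \<Rightarrow>\<^sub>0 'a"
  by (rule lin_cf[OF U that KU])
 have cc: "lin scale c x - lin scale c y : U" if "x - y : cf K" for c and x y :: "'z \<Rightarrow>\<^sub>0 'a"
  using lU[OF that, of c] by (simp add: lin_diff)
 have hc: "lin scale h (dd b) : U" if "b : gr B dg (Suc i)" for b using h that by (simp add: coh_def)
 define h' where "h' b = lin scale h (bt b)" for b
 have "coh scale B' dg' dd' U i h'"
  unfolding coh_def
 proof
  fix b assume b: "b : gr B' dg' (Suc i)"
  hence bB: "b : B'" "dg' b = Suc i" by (auto simp: gr_def)
  have "lin scale (%z. lin scale h (dd z)) (bt b) : U"
   by (rule lin_mem[OF U]) (use bt(2)[OF bB(1)] bB(2) hc in auto)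
  hence "lin scale h (lin sc dd (bt b)) : U" by (simp only: lin_lin)
  hence "lin scale h (lin sc bt (dd' b)) : U" using cc[OF bt(3)[OF bB(1)], of h] osub_diffD[OF U] by blast
  thus "lin scale h' (dd' b) : U" by (simp add: h'_def[abs_def] lin_lin)
 qed
 moreover have "annx scale B' dg' dd' U i h' = annx scale B dg dd U i h"
 proof (rule Set.set_eqI, rule iffI)
  fix r assume "r : annx scale B dg dd U i h"
  then obtain g where g: "!!b. b : gr B dg i ==> scale r (h b) - lin scale g (dd b) : U" by (auto simp: annx_def)
  have "scale r (h' b) - lin scale (%z. lin scale g (bt z)) (dd' b) : U" if b: "b : gr B' dg' i" for b
  proof -
   have bB: "b : B'" "dg' b = i" using b by (auto simp: gr_def)
   have "lin scale (%z. scale r (h z) - lin scale g (dd z)) (bt b) : U"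
    by (rule lin_mem[OF U]) (use bt(2)[OF bB(1)] bB(2) g in auto)
   hence e: "scale r (h' b) - lin scale g (lin sc dd (bt b)) : U"
    by (simp only: h'_def lin_fun_diff lin_fun_scale lin_lin)
   have "(scale r (h' b) - lin scale g (lin sc dd (bt b))) - (lin scale g (lin sc bt (dd' b)) - lin scale g (lin sc dd (bt b))) : U"
    by (rule osub_diff[OF U e cc[OF bt(3)[OF bB(1)]]])
   thus ?thesis by (simp add: lin_lin)
  qed
  thus "r : annx scale B' dg' dd' U i h'" unfolding annx_def by blast
 next
  fix r assume "r : annx scale B' dg' dd' U i h'"
  then obtain g where g: "!!b. b : gr B' dg' i ==> scale r (h' b) - lin scale g (dd' b) : U" by (auto simp: annx_def)
  \<comment> \<open>Modulo \<open>U\<close> the pullback of \<open>h\<close> along the composite of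
    \<open>al\<close> and \<open>bt\<close> differs from \<open>h\<close> by the coboundary of
    \<open>h\<close> composed with \<open>si\<close>, because \<open>h\<close> is a cocycle; this
    accounts for the second term.\<close>
  define g' where "g' b = lin scale g (al b) - scale r (lin scale h (si b))" for b
  have "scale r (h b) - lin scale g' (dd b) : U" if b: "b : gr B dg i" for b
  proof -
   have bB: "b : B" "dg b = i" using b by (auto simp: gr_def)
   have "lin scale (%z. scale r (h' z) - lin scale g (dd' z)) (al b) : U"
    by (rule lin_mem[OF U]) (use al(2)[OF bB(1)] bB(2) g in auto)
   hence 1: "scale r (lin scale h (lin sc bt (al b))) - lin scale g (lin sc dd' (al b)) : U"
    by (simp add: h'_def[abs_def] lin_fun_diff lin_fun_scale lin_lin)
   have 2: "lin scale g (lin sc al (dd b)) - lin scale g (lin sc dd' (al b)) : U"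
    by (rule cc[OF al(3)[OF bB(1)]])
   have "lin scale h (ga b - lin sc si (dd b) - lin sc dd (si b)) : U"
    by (rule lU[OF si(2)[OF bB(1)]])
   moreover have "lin scale (%z. lin scale h (dd z)) (si b) : U"
    by (rule lin_mem[OF U]) (use si(1)[OF bB(1)] bB(2) hc in auto)
   ultimately have "lin scale h (ga b - lin sc si (dd b) - lin sc dd (si b)) + lin scale (%z. lin scale h (dd z)) (si b) : U"
    by (rule osub_add[OF U])
   hence "lin scale h (lin sc bt (al b)) - h b - lin scale (%z. lin scale h (si z)) (dd b) : U"
    by (simp add: lin_diff ga_def lin_lin)
   hence 3: "scale r (lin scale h (lin sc bt (al b)) - h b - lin scale (%z. lin scale h (si z)) (dd b)) : U"
    by (rule osub_scale[OF U])
   have "scale r (lin scale h (lin sc bt (al b))) - lin scale g (lin sc dd' (al b)) -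
    (lin scale g (lin sc al (dd b)) - lin scale g (lin sc dd' (al b))) -
    scale r (lin scale h (lin sc bt (al b)) - h b - lin scale (%z. lin scale h (si z)) (dd b)) : U"
    by (rule osub_diff[OF U osub_diff[OF U 1 2] 3])
   also have "scale r (lin scale h (lin sc bt (al b))) - lin scale g (lin sc dd' (al b)) -
    (lin scale g (lin sc al (dd b)) - lin scale g (lin sc dd' (al b))) -
    scale r (lin scale h (lin sc bt (al b)) - h b - lin scale (%z. lin scale h (si z)) (dd b))
    = scale r (h b) - lin scale g' (dd b)"
    unfolding g'_def[abs_def] lin_fun_diff lin_fun_scale by (simp add: lin_lin scale_right_diff_distrib)
   finally show ?thesis .
  qed
  thus "r : annx scale B dg dd U i h" unfolding annx_def by blast
 qed
 ultimately show ?thesis by blast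
qed

section \<open>Krull's principal ideal theorem\<close>

definition pr :: "'r::comm_ring_1 set => bool" where "pr P \<longleftrightarrow> osub scl P & primep P"

text \<open>For an ideal \<open>W\<close> and a prime \<open>P\<close> this says that
  \<open>W\<close> is contracted from the localisation at \<open>P\<close>; \<open>satu P W\<close>
  is the contraction of its extension. Arguing with such ideals makes it unnecessary to construct
  the localisation.\<close>

definition satp :: "'r::comm_ring_1 set => 'r set => bool" where
 "satp P W \<longleftrightarrow> (\<forall>s r. s ~: P --> s * r : W --> r : W)"

definition satu :: "'r::comm_ring_1 set => 'r set => 'r set" where
 "satu P W = {r. \<exists>s. s ~: P & s * r : W}"

lemma ideal_smult: "osub scl (J :: 'r::comm_ring_1 set) ==> x : J ==> r * x : J"
 using osub_op[of scl J "(*) r" x] by simp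

lemma idealI:
 assumes "0 : J" "!!x y. x : J ==> y : J ==> x - y : J" "!!r x. x : J ==> r * x : J"
 shows "osub scl (J :: 'r::comm_ring_1 set)"
 using assms by (auto simp: osub_def)

lemma osub_scl_splus: "osub scl A ==> osub scl B ==> osub scl (A \<boxplus> (B :: 'r::comm_ring_1 set))"
 by (rule osub_splus[OF module.additive_scale[OF module_ring]])

abbreviation "prin x \<equiv> range (%r. r * x)"

lemma osub_princ: "osub scl (prin (x :: 'r::comm_ring_1))"
proof (rule idealI)
 show "0 : prin x" by (rule image_eqI[of _ _ 0]) auto
 show "a - b : prin x" if ab: "a : prin x" "b : prin x" for a b
  using ab by (auto simp flip: left_diff_distrib)
 show "r * a : prin x" if "a : prin x" for r a
  using that by (auto simp flip: mult.assoc)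
qed

lemma prD: "pr P ==> osub scl P" "pr P ==> 1 ~: P" "pr P ==> a * b : P ==> a : P \<or> b : P"
 unfolding pr_def primep_def by blast+

lemma pr_mult_notin: "pr P ==> a ~: P ==> b ~: P ==> a * b ~: P"
 using prD(3) by blast

lemma satu_osub:
 assumes P: "pr P" and W: "osub scl W" shows "osub scl (satu P W)"
proof (rule idealI)
 show "0 : satu P W" using osub_zero[OF W] prD(2)[OF P] by (auto simp: satu_def)
 show "x - y : satu P W" if xy: "x : satu P W" "y : satu P W" for x y
 proof -
  obtain s t where st: "s ~: P" "s * x : W" "t ~: P" "t * y : W" using xy by (auto simp: satu_def)
  have "(s * t) * (x - y) = t * (s * x) - s * (t * y)" by (simp add: algebra_simps)
  also have "\<dots> : W" by (rule osub_diff[OF W ideal_smult[OF W st(2)] ideal_smult[OF W st(4)]])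
  finally show ?thesis using pr_mult_notin[OF P st(1,3)] by (auto simp: satu_def)
 qed
 show "r * x : satu P W" if x: "x : satu P W" for r x
 proof -
  obtain s where s: "s ~: P" "s * x : W" using x by (auto simp: satu_def)
  have "s * (r * x) : W" using ideal_smult[OF W s(2), of r] by (simp add: algebra_simps)
  thus ?thesis using s by (auto simp: satu_def)
 qed
qed

lemma satu_sup: "pr P ==> W <= satu P W"
 using prD(2) by (auto simp: satu_def intro!: exI[of _ 1])

lemma satp_satu: "pr P ==> satp P (satu P W)"
 unfolding satp_def satu_def
proof (intro allI impI)
 fix s r assume P: "pr P" and s: "s ~: P" and "s * r : {r. \<exists>s. s ~: P & s * r : W}"
 then obtain t where "t ~: P" "t * (s * r) : W" by blast
 thus "r : {r. \<exists>s. s ~: P & s * r : W}"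
  using pr_mult_notin[OF P, of t s] s by (auto simp: mult.assoc intro!: exI[of _ "t * s"])
qed

lemma satu_least: "satp P V ==> W <= V ==> satu P W <= V"
 unfolding satp_def satu_def by blast

lemma satu_mono: "W <= V ==> satu P W <= satu P V"
 unfolding satu_def by blast

lemma satp_Int: "satp P V ==> satp P W ==> satp P (V \<inter> W)"
 unfolding satp_def by blast

lemma satp_antimono: "satp q W ==> q <= P ==> satp P W"
 unfolding satp_def by blast

lemma satp_prime: "pr p ==> p <= P ==> satp P p"
 unfolding satp_def using prD(3) by blast

text \<open>Nakayama's argument over the localisation at \<open>P\<close>: \<open>T\<close> is the
  contraction of \<open>V + P y\<close>, and a relation \<open>u y = v + t y\<close> with
  \<open>u\<close> outside and \<open>t\<close> inside \<open>P\<close> yields \<open>y : V\<close>,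
  since \<open>u - t\<close> is outside \<open>P\<close> and \<open>V\<close> is saturated.\<close>

lemma local_nakayama:
 assumes N: "noeth scl UNIV K" and KU: "K <= U" and P: "pr P" and U: "osub scl U" "satp P U"
  and Y: "osub scl Y" "satp P Y" and UY: "U <= Y"
  and gen: "!!T y. osub scl T ==> U <= T ==> (!!p c. p : P ==> c : Y ==> p * c : T) ==> y : Y ==> \<exists>s. s ~: P & s * y : T"
 shows "Y = U"
proof (rule ccontr)
 assume "Y ~= U"
 define C where "C = {V. osub scl V & satp P V & U <= V & V <= Y & V ~= Y}"
 have "U : C" using U UY \<open>Y ~= U\<close> by (auto simp: C_def)
 then obtain V where V: "V : C" "!!V'. V' : C ==> V <= V' ==> V' = V"
  by (rule noeth_maxE[OF N]) (use KU in \<open>auto simp: C_def\<close>)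
 have Vs: "osub scl V" "satp P V" "U <= V" "V <= Y" "V ~= Y" using V(1) by (auto simp: C_def)
 obtain y where y: "y : Y" "y ~: V" using Vs by blast
 define V' where "V' = satu P (V \<boxplus> prin y)"
 have sumY: "V \<boxplus> prin y <= Y"
  by (rule splus_least[OF Y(1) Vs(4)]) (use ideal_smult[OF Y(1) y(1)] in auto)
 have VV': "V <= V'" "y : V'"
 proof -
  have "V <= V \<boxplus> prin y" by (rule splus_sub1[OF osub_princ])
  thus "V <= V'" using satu_sup[OF P] by (auto simp: V'_def)
  have "0 + 1 * y : V \<boxplus> prin y" by (intro splusI osub_zero[OF Vs(1)] rangeI)
  thus "y : V'" using satu_sup[OF P] by (auto simp: V'_def)
 qed
 have "V' = Y"
 proof (rule ccontr)
  assume "V' ~= Y"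
  hence "V' : C"
   using satu_osub[OF P osub_scl_splus[OF Vs(1) osub_princ]] satp_satu[OF P] satu_least[OF Y(2) sumY] VV'(1) Vs(3)
   by (simp add: C_def V'_def)
  hence "V' = V" using VV'(1) by (rule V(2))
  thus False using VV'(2) y(2) by simp
 qed
 define T where "T = {z. \<exists>s t v. s ~: P & t : P & v : V & s * z = v + t * y}"
 have Pi: "osub scl P" by (rule prD[OF P])
 have "osub scl T"
 proof (rule idealI)
  show "0 : T" unfolding T_def
   by (intro CollectI exI[of _ 1] exI[of _ 0]) (use prD(2)[OF P] osub_zero[OF Pi] osub_zero[OF Vs(1)] in auto)
  show "a - b : T" if ab: "a : T" "b : T" for a b
  proof -
   obtain s t v where a: "s ~: P" "t : P" "v : V" "s * a = v + t * y" using ab(1) by (auto simp: T_def)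
   obtain s' t' v' where b: "s' ~: P" "t' : P" "v' : V" "s' * b = v' + t' * y" using ab(2) by (auto simp: T_def)
   have "(s * s') * (a - b) = s' * (s * a) - s * (s' * b)" by (simp add: algebra_simps)
   also have "\<dots> = (s' * v - s * v') + (s' * t - s * t') * y" unfolding a(4) b(4) by (simp add: algebra_simps)
   finally have "(s * s') * (a - b) = (s' * v - s * v') + (s' * t - s * t') * y" .
   moreover have "s' * v - s * v' : V" by (intro osub_diff[OF Vs(1)] ideal_smult[OF Vs(1)] a b)
   moreover have "s' * t - s * t' : P" by (intro osub_diff[OF Pi] ideal_smult[OF Pi] a b)
   ultimately show ?thesis using pr_mult_notin[OF P a(1) b(1)] unfolding T_def by blast
  qed
  show "r * a : T" if a: "a : T" for r a
  proof -
   obtain s t v where a: "s ~: P" "t : P" "v : V" "s * a = v + t * y" using a by (auto simp: T_def)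
   have "s * (r * a) = r * (s * a)" by (simp add: algebra_simps)
   also have "\<dots> = r * v + (r * t) * y" unfolding a(4) by (simp add: algebra_simps)
   finally show ?thesis using a ideal_smult[OF Vs(1) a(3)] ideal_smult[OF Pi a(2)] unfolding T_def by blast
  qed
 qed
 moreover have "U <= T"
 proof
  fix u assume "u : U"
  hence "u : V" using Vs by blast
  thus "u : T" unfolding T_def
   by (intro CollectI exI[of _ 1] exI[of _ 0] exI[of _ u]) (use prD(2)[OF P] osub_zero[OF Pi] in auto)
 qed
 moreover have "p * c : T" if p: "p : P" and c: "c : Y" for p c
 proof -
  have "c : V'" using c \<open>V' = Y\<close> by simp
  then obtain s v r where s: "s ~: P" "s * c = v + r * y" "v : V" by (auto simp: V'_def satu_def elim!: splusE)
  have "s * (p * c) = p * (s * c)" by (simp add: algebra_simps)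
  also have "\<dots> = p * v + (r * p) * y" unfolding s(2) by (simp add: algebra_simps)
  finally show ?thesis using s ideal_smult[OF Vs(1) s(3)] ideal_smult[OF Pi p] unfolding T_def by blast
 qed
 ultimately obtain s where s: "s ~: P" "s * y : T" using gen[of T y] y(1) by blast
 then obtain s' t v where t: "s' ~: P" "t : P" "v : V" "s' * (s * y) = v + t * y" by (auto simp: T_def)
 have "(s' * s - t) * y = s' * (s * y) - t * y" by (simp add: algebra_simps)
 hence "(s' * s - t) * y = v" unfolding t(4) by simp
 hence "(s' * s - t) * y : V" using t by simp
 moreover have "s' * s - t ~: P" using osub_diff_iff[OF Pi t(2)] pr_mult_notin[OF P t(1) s(1)] by blast
 ultimately have "y : V" using Vs(2) unfolding satp_def by blast
 thus False using y by simp
qed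

text \<open>Krull's argument with symbolic powers. If no such prime exists, \<open>P\<close> is
  minimal over the ideal \<open>a\<close> generated by \<open>oo\<close> and \<open>x\<close>, so
  the localisation at \<open>P\<close> satisfies the descending chain condition modulo
  \<open>a\<close>. The symbolic powers of \<open>q\<close> become stationary modulo
  \<open>a\<close>, Nakayama's lemma makes them stationary outright, and a second use of it at
  \<open>q\<close> forces \<open>q\<close> into \<open>oo\<close>.\<close>

lemma principal_ideal_theorem:
 assumes N: "noeth scl UNIV K" and o: "pr oo" "K <= oo" and q: "pr q" "oo \<subset> q" and P: "pr P" "q \<subset> P" and x: "x : P"
 obtains p where "pr p" "oo <= p" "x : p" "p \<subset> P"
proof (cases "\<exists>p. pr p & oo <= p & x : p & p \<subset> P")
 case False
 hence min: "p = P" if "pr p" "oo <= p" "x : p" "p <= P" for p using that by blast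
 have Pi: "osub scl P" and qi: "osub scl q" and oi: "osub scl oo" using prD P q o by auto
 have xq: "x ~: q" using False q P by blast
 define a where "a = oo \<boxplus> prin x"
 have a: "osub scl a" "oo <= a" "x : a"
 proof -
  show "osub scl a" unfolding a_def by (rule osub_scl_splus[OF oi osub_princ])
  show "oo <= a" unfolding a_def by (rule splus_sub1[OF osub_princ])
  have "0 + 1 * x : a" unfolding a_def by (intro splusI osub_zero[OF oi] rangeI)
  thus "x : a" by simp
 qed
 \<comment> \<open>A maximal annihilator modulo \<open>W\<close> is a prime that contains
   \<open>a\<close> and lies in \<open>P\<close>, so it is \<open>P\<close>: the quotient by a
   proper saturated ideal has a nonzero socle.\<close>
 have socle: "\<exists>w. w ~: W & (\<forall>p\<in>P. p * w : W)" if W: "osub scl W" "satp P W" "a <= W" "1 ~: W" for W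
 proof -
  define col where "col w = {r. r * w : W}" for w
  have col: "osub scl (col w)" "W <= col w" for w
  proof -
   show "osub scl (col w)" using osub_zero[OF W(1)] osub_diff[OF W(1)] ideal_smult[OF W(1)]
    by (auto intro!: idealI simp: col_def left_diff_distrib mult.assoc)
   show "W <= col w" using ideal_mult[OF W(1)] by (auto simp: col_def)
  qed
  have "col 1 : col ` (- W)" using W(4) by blast
  then obtain Q where Q: "Q : col ` (- W)" "!!Q'. Q' : col ` (- W) ==> Q <= Q' ==> Q' = Q"
  proof (rule noeth_maxE[OF N])
   fix V assume "V : col ` (- W)"
   then obtain w where w: "V = col w" by blast
   show "osub scl V" unfolding w by (rule col(1))
   show "K <= V" unfolding w using o(2) a(2) W(3) col(2)[of w] by order
  qed auto
  then obtain w where w: "w ~: W" "Q = col w" by blast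
  have "pr (col w)"
   unfolding pr_def primep_def
  proof (intro conjI allI impI)
   show "1 ~: col w" using w by (simp add: col_def)
   show "u : col w \<or> v : col w" if uv: "u * v : col w" for u v
   proof (rule disjCI)
    assume v: "v ~: col w"
    hence "col (v * w) : col ` (- W)" by (auto simp: col_def)
    moreover have "col w <= col (v * w)"
    proof
     fix r assume "r : col w"
     hence "v * (r * w) : W" by (auto simp: col_def intro: ideal_smult[OF W(1)])
     thus "r : col (v * w)" by (simp add: col_def mult.left_commute)
    qed
    ultimately have "col (v * w) = col w" using Q(2) w by blast
    thus "u : col w" using uv by (auto simp: col_def mult.assoc)
   qed
  qed (rule col)
  moreover have "col w <= P" using W(2) w(1) unfolding satp_def col_def by blast
  ultimately have "col w = P" using min col a W(3) by blast
  thus ?thesis using w(1) by (auto simp: col_def)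
 qed
 \<comment> \<open>The descending chain condition for saturated ideals between \<open>a\<close> and
   \<open>W\<close>. It is carried from the saturation of \<open>a\<close> up to the whole ring by
   Noetherian induction, one socle element at a time.\<close>
 define D where "D W \<longleftrightarrow> (\<forall>f :: nat => 'a set. (\<forall>n. osub scl (f n) & satp P (f n) & a <= f n & f n <= W & f (Suc n) <= f n)
  --> (\<exists>n. \<forall>m\<ge>n. f m = f n))" for W
 have DE: "\<exists>n. \<forall>m\<ge>n. f m = f n" if "D W" "!!n. osub scl (f n)" "!!n. satp P (f n)" "!!n. a <= f n"
  "!!n. f n <= W" "!!n. f (Suc n) <= f n" for f W
  using that by (simp add: D_def)
 have DU: "D UNIV"
 proof -
  define C where "C = {W. osub scl W & satp P W & a <= W & D W}"
  have "D (satu P a)"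
   unfolding D_def
  proof (intro allI impI)
   fix f assume f: "\<forall>n. osub scl (f n) & satp P (f n) & a <= f n & f n <= satu P a & f (Suc n) <= f n"
   have "f n = satu P a" for n using f satu_least[of P "f n" a] by blast
   thus "\<exists>n. \<forall>m\<ge>n. f m = f n" by simp
  qed
  hence "satu P a : C" using satu_osub[OF P(1) a(1)] satp_satu[OF P(1)] satu_sup[OF P(1)] by (simp add: C_def)
  then obtain W where W: "W : C" "!!V'. V' : C ==> W <= V' ==> V' = W"
   by (rule noeth_maxE[OF N]) (use o a in \<open>auto simp: C_def\<close>)
  have Ws: "osub scl W" "satp P W" "a <= W" "D W" using W(1) by (auto simp: C_def)
  have "1 : W"
  proof (rule ccontr)
   assume "1 ~: W"
   then obtain w where w: "w ~: W" "!!p. p : P ==> p * w : W" using socle Ws by blast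
   define W' where "W' = satu P (W \<boxplus> prin w)"
   have W': "osub scl W'" "satp P W'"
    unfolding W'_def by (rule satu_osub[OF P(1) osub_scl_splus[OF Ws(1) osub_princ]], rule satp_satu[OF P(1)])
   have "W <= W \<boxplus> prin w" by (rule splus_sub1[OF osub_princ])
   hence WW': "W <= W'" using satu_sup[OF P(1)] by (auto simp: W'_def)
   have "0 + 1 * w : W \<boxplus> prin w" by (intro splusI osub_zero[OF Ws(1)] rangeI)
   hence wW': "w : W'" using satu_sup[OF P(1)] by (auto simp: W'_def)
   have rep: "\<exists>s v r. s ~: P & v : W & r ~: P & s * z = v + r * w" if z: "z : W'" "z ~: W" for z
   proof -
    obtain s v r where s: "s ~: P" "s * z = v + r * w" "v : W" using z(1) by (auto simp: W'_def satu_def elim!: splusE)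
    have "r ~: P"
    proof
     assume "r : P"
     hence "s * z : W" using s osub_add[OF Ws(1)] w(2) by simp
     thus False using z(2) s(1) Ws(2) by (auto simp: satp_def)
    qed
    thus ?thesis using s by blast
   qed
   have "D W'"
    unfolding D_def
   proof (intro allI impI)
    fix f assume f: "\<forall>n. osub scl (f n) & satp P (f n) & a <= f n & f n <= W' & f (Suc n) <= f n"
    have down: "f m <= f n" if "n <= m" for n m
     using that
    proof (induction rule: dec_induct)
     case (step k)
     thus ?case using f by blast
    qed simp
    have fs: "osub scl (f n)" "satp P (f n)" "f n <= W'" "a <= f n" for n using f by auto
    have "\<exists>n. \<forall>m\<ge>n. f m \<inter> W = f n \<inter> W"
    proof (rule DE[OF Ws(4)])
     show "osub scl (f n \<inter> W)" "satp P (f n \<inter> W)" "a <= f n \<inter> W" "f n \<inter> W <= W" "f (Suc n) \<inter> W <= f n \<inter> W" for n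
      using osub_Int[OF fs(1) Ws(1)] satp_Int[OF fs(2) Ws(2)] fs(4) Ws(3) down[of n "Suc n"] by auto
    qed
    then obtain n1 where n1: "!!m. m >= n1 ==> f m \<inter> W = f n1 \<inter> W" by blast
    show "\<exists>n. \<forall>m\<ge>n. f m = f n"
    proof (cases "\<exists>n. f n <= W")
     case True
     then obtain n where n: "f n <= W" by blast
     have "f m = f n1 \<inter> W" if "m >= max n n1" for m
      using n1[of m] down[of n m] n that by auto
     thus ?thesis by (metis order_refl)
    next
     case False
     \<comment> \<open>No member of the chain lies inside \<open>W\<close>, and outside
       \<open>W\<close> every element is, up to factors outside \<open>P\<close> and terms in
       \<open>W\<close>, equal to \<open>w\<close>. Two such elements are therefore proportional up
       to an element of \<open>W\<close>, where the chain is already stationary.\<close>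
     have "f m <= f n" if m: "m >= n1" "m <= n" for m n
     proof
      fix y assume y: "y : f m"
      show "y : f n"
      proof (cases "y : W")
       case True
       thus ?thesis using y n1[of m] n1[of n] m by auto
      next
       case nW: False
       obtain z where z: "z : f n" "z ~: W" using False by blast
       obtain s v r where s: "s ~: P" "v : W" "r ~: P" "s * z = v + r * w"
        using rep[of z] z fs(3) by blast
       obtain s' v' r' where s': "s' ~: P" "v' : W" "r' ~: P" "s' * y = v' + r' * w"
        using rep[of y] y nW fs(3) by blast
       have e: "(r' * s) * z - (r * s') * y = r' * v - r * v'"
       proof -
        have "(r' * s) * z - (r * s') * y = r' * (s * z) - r * (s' * y)" by (simp add: algebra_simps)
        also have "\<dots> = r' * v - r * v'" unfolding s(4) s'(4) by (simp add: algebra_simps)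
        finally show ?thesis .
       qed
       have "(r' * s) * z : f n" by (rule ideal_smult[OF fs(1) z(1)])
       moreover have "(r' * s) * z - (r * s') * y : f m \<inter> W"
       proof
        show "(r' * s) * z - (r * s') * y : f m"
         using down[OF m(2)] z(1) y by (intro osub_diff[OF fs(1)] ideal_smult[OF fs(1)]) auto
        show "(r' * s) * z - (r * s') * y : W"
         unfolding e by (intro osub_diff[OF Ws(1)] ideal_smult[OF Ws(1)] s s')
       qed
       hence "(r' * s) * z - (r * s') * y : f n" using n1[of m] n1[of n] m by auto
       ultimately have "(r * s') * y : f n" using osub_diffD'[OF fs(1)] by blast
       moreover have "r * s' ~: P" by (rule pr_mult_notin[OF P(1) s(3) s'(1)])
       ultimately show ?thesis using fs(2) unfolding satp_def by blast
      qed
     qed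
     hence "f m = f n1" if "m >= n1" for m using down[OF that] that by blast
     thus ?thesis by blast
    qed
   qed
   hence "W' : C" using W' Ws(3) WW' by (simp add: C_def)
   hence "W' = W" using WW' by (rule W(2))
   thus False using w(1) wW' by simp
  qed
  hence "W = UNIV" using ideal_mult[OF Ws(1), of 1] by auto
  thus ?thesis using Ws(4) by simp
 qed
 \<comment> \<open>\<open>pw n\<close> is \<open>q^n + oo\<close>; its saturation \<open>Q n\<close>
   is the \<open>n\<close>-th symbolic power of \<open>q\<close> modulo \<open>oo\<close>.\<close>
 define pw where "pw = rec_nat UNIV (%_ J. \<Inter>{T. osub scl T & oo <= T & (\<forall>y\<in>q. \<forall>z\<in>J. y * z : T)})"
 have pw0: "pw 0 = UNIV" and pwS: "pw (Suc n) = \<Inter>{T. osub scl T & oo <= T & (\<forall>y\<in>q. \<forall>z\<in>pw n. y * z : T)}" for n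
  by (simp_all add: pw_def)
 have pwi: "osub scl (pw n)" "oo <= pw n" for n
  by (cases n; auto simp: pw0 pwS osub_def)+
 have pwm: "y * z : pw (Suc n)" if "y : q" "z : pw n" for y z n using that by (auto simp: pwS)
 have pwl: "pw (Suc n) <= T" if "osub scl T" "oo <= T" "!!y z. y : q ==> z : pw n ==> y * z : T" for n T
  using that unfolding pwS by blast
 have pwd: "pw (Suc n) <= pw n" for n
  by (rule pwl[OF pwi]) (use ideal_smult[OF pwi(1)] in blast)
 define Q where "Q n = satu q (pw n)" for n
 have Q: "osub scl (Q n)" "satp q (Q n)" "oo <= Q n" "Q (Suc n) <= Q n" "pw n <= Q n" for n
  using satu_osub[OF q(1) pwi(1)] satp_satu[OF q(1)] satu_sup[OF q(1), of "pw n"] pwi(2)[of n] satu_mono[OF pwd]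
  by (auto simp: Q_def)
 have QP: "satp P (Q n)" for n using satp_antimono[OF Q(2)] P(2) by blast
 define f where "f n = satu P (Q n \<boxplus> a)" for n
 have "\<exists>n. \<forall>m\<ge>n. f m = f n"
 proof (rule DE[OF DU])
  fix n
  show "osub scl (f n)" unfolding f_def by (rule satu_osub[OF P(1) osub_scl_splus[OF Q(1) a(1)]])
  show "satp P (f n)" unfolding f_def by (rule satp_satu[OF P(1)])
  show "a <= f n" using splus_sub2[OF Q(1)] satu_sup[OF P(1)] unfolding f_def by blast
  show "f (Suc n) <= f n" unfolding f_def by (rule satu_mono[OF splus_mono[OF Q(4) order_refl]])
 qed simp
 then obtain n where n: "!!m. m >= n ==> f m = f n" by blast
 \<comment> \<open>Up to a factor outside \<open>P\<close>, an element of \<open>Q n\<close> lies in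
   \<open>Q (Suc n)\<close> plus a multiple of \<open>x\<close>. Since \<open>x\<close> is not in
   \<open>q\<close> and \<open>Q n\<close> is saturated at \<open>q\<close>, the coefficient of
   \<open>x\<close> is again in \<open>Q n\<close>, which is the hypothesis of Nakayama's
   lemma.\<close>
 have QQ: "Q n = Q (Suc n)"
 proof (rule local_nakayama[OF N _ P(1) Q(1) QP Q(1) QP Q(4)])
  show "K <= Q (Suc n)" using o Q(3) by blast
  fix T y assume T: "osub scl T" "Q (Suc n) <= T" "!!p c. p : P ==> c : Q n ==> p * c : T" and y: "y : Q n"
  have "y : f n" using y splus_sub1[OF a(1), of "Q n"] satu_sup[OF P(1)] unfolding f_def by blast
  hence "y : f (Suc n)" using n[of "Suc n"] by simp
  then obtain s u oe c where s: "s ~: P" "s * y = u + (oe + c * x)" "u : Q (Suc n)" "oe : oo"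
   by (auto simp: f_def satu_def a_def elim!: splusE)
  define u' where "u' = u + oe"
  have u': "u' : Q (Suc n)" using s(3,4) Q(3) osub_add[OF Q(1)] unfolding u'_def by blast
  have "x * c = s * y - u'" unfolding s(2) u'_def by (simp add: algebra_simps)
  also have "\<dots> : Q n" using u' Q(4) by (intro osub_diff[OF Q(1)] ideal_smult[OF Q(1)] y) auto
  finally have "c : Q n" using xq Q(2) unfolding satp_def by blast
  hence "x * c : T" by (rule T(3)[OF x])
  moreover have "s * y = u' + x * c" unfolding s(2) u'_def by (simp add: algebra_simps)
  ultimately have "s * y : T" using u' T(2) osub_add[OF T(1)] by auto
  thus "\<exists>s. s ~: P & s * y : T" using s(1) by blast
 qed
 \<comment> \<open>At \<open>q\<close> symbolic and ordinary powers agree: up to a factor outside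
   \<open>q\<close>, an element of \<open>Q n = Q (Suc n)\<close> lies in \<open>q\<close> times
   \<open>Q n\<close>, plus \<open>oo\<close>.\<close>
 have Qo: "Q n = oo"
 proof (rule local_nakayama[OF N o(2) q(1) oi satp_prime[OF o(1)] Q(1) Q(2) Q(3)])
  show "oo <= q" using q by blast
  fix T y assume T: "osub scl T" "oo <= T" "!!p c. p : q ==> c : Q n ==> p * c : T" and y: "y : Q n"
  have "y : Q (Suc n)" using y QQ by simp
  then obtain s where s: "s ~: q" "s * y : pw (Suc n)" by (auto simp: Q_def satu_def)
  have "pw (Suc n) <= T" by (rule pwl[OF T(1,2)]) (use T(3) Q(5) in blast)
  thus "\<exists>s. s ~: q & s * y : T" using s by blast
 qed
 have "q <= oo"
 proof
  fix y assume y: "y : q"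
  have "y ^ k : pw k" for k
  proof (induction k)
   case (Suc k)
   thus ?case using pwm[OF y, of "y ^ k" k] by simp
  qed (simp add: pw0)
  hence "y ^ n : oo" using Q(5)[of n] Qo by blast
  moreover have "y ^ k : oo ==> y : oo" for k
   by (induction k) (use prD(2,3)[OF o(1)] in auto)
  ultimately show "y : oo" by blast
 qed
 thus ?thesis using q(2) by blast
qed (use that in blast)

section \<open>Regular local rings\<close>

definition locl :: "'r::comm_ring_1 set => 'r set => bool" where
 "locl K n \<longleftrightarrow> osub scl n & K <= n & 1 ~: n & (\<forall>x. x ~: n --> (\<exists>v. v * x - 1 : K))"

lemma locl_jac:
 assumes L: "locl K n" and a: "!!j. j : J ==> a j : n" shows "jac K a J"
 unfolding jac_def
proof
 fix r
 have n: "osub scl n" "1 ~: n" using L by (auto simp: locl_def)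
 have "(\<Sum>j\<in>J. r j * a j) : n" by (rule osub_sum[OF n(1)]) (rule ideal_smult[OF n(1) a])
 hence "1 - (\<Sum>j\<in>J. r j * a j) ~: n" using n osub_diff_iff[OF n(1)] by blast
 thus "\<exists>v. v * (1 - (\<Sum>j\<in>J. r j * a j)) - 1 : K" using L by (simp add: locl_def)
qed

lemma locl_prime_sub:
 assumes L: "locl K n" and P: "pr P" "K <= P" shows "P <= n"
proof
 fix x assume x: "x : P"
 show "x : n"
 proof (rule ccontr)
  assume "x ~: n"
  then obtain v where "v * x - 1 : K" using L by (auto simp: locl_def)
  hence "1 : P" using P osub_diffD'[OF prD(1)[OF P(1)]] ideal_smult[OF prD(1)[OF P(1)] x] by blast
  thus False using prD(2)[OF P(1)] by blast
 qed
qed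

lemma locl_prime:
 assumes L: "locl K n" shows "pr n"
 unfolding pr_def primep_def
proof (intro conjI allI impI)
 show n: "osub scl n" and "1 ~: n" using L by (auto simp: locl_def)
 fix a b assume ab: "a * b : n"
 show "a : n \<or> b : n"
 proof (rule ccontr)
  assume "\<not> (a : n \<or> b : n)"
  then obtain v where v: "v * a - 1 : K" and b: "b ~: n" using L by (auto simp: locl_def)
  have "b * (v * a - 1) : n" using v L by (intro ideal_smult[OF n]) (auto simp: locl_def)
  moreover have "v * (a * b) : n" by (rule ideal_smult[OF n ab])
  ultimately have "v * (a * b) - b * (v * a - 1) : n" by (intro osub_diff[OF n])
  thus False using b by (simp add: algebra_simps)
 qed
qed

lemma locl_mono: "locl K n ==> K <= K' ==> K' <= n ==> locl K' n"
 unfolding locl_def by blast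

definition chn :: "'r::comm_ring_1 set => nat => (nat => 'r set) => bool" where
 "chn K d p \<longleftrightarrow> (\<forall>i\<le>d. pr (p i) & K <= p i) & (\<forall>i<d. p i \<subset> p (Suc i))"

lemma chn_append:
 assumes p: "chn K m p" and P: "pr P" "p m \<subset> P"
 shows "chn K (Suc m) (p(Suc m := P))"
 unfolding chn_def
proof (intro conjI allI impI)
 have KP: "K <= P" using p P(2) by (auto simp: chn_def)
 fix i assume "i <= Suc m"
 thus "pr ((p(Suc m := P)) i)" "K <= (p(Suc m := P)) i"
  using p P(1) KP by (auto simp: chn_def le_Suc_eq)
next
 fix i assume "i < Suc m"
 thus "(p(Suc m := P)) i \<subset> (p(Suc m := P)) (Suc i)"
  using p P(2) by (cases "i = m") (auto simp: chn_def)
qed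

lemma chn_pred: "chn K (Suc m) p ==> chn K m p"
 by (simp add: chn_def)

text \<open>Working down from the top, the principal ideal theorem replaces the middle of three
  consecutive primes by one that contains \<open>x\<close>. Only the ends and the length of the
  chain are preserved, which is what a dimension count needs.\<close>

lemma chain_mod:
 assumes N: "noeth scl UNIV K" and p: "chn K (Suc m) p" and x: "x : p (Suc m)"
 shows "\<exists>q. chn K (Suc m) q & q 0 = p 0 & q (Suc m) = p (Suc m) & x : q 1"
 using p x
proof (induction m arbitrary: p)
 case 0
 thus ?case by auto
next
 case (Suc m)
 have pp: "!!i. i <= Suc (Suc m) ==> pr (p i) & K <= p i" "!!i. i < Suc (Suc m) ==> p i \<subset> p (Suc i)"
  using Suc.prems by (auto simp: chn_def)
 have "\<exists>P. pr P & p m \<subset> P & x : P & P \<subset> p (Suc (Suc m)) "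
 proof (cases "x : p (Suc m)")
  case True
  thus ?thesis using pp(1)[of "Suc m"] pp(2)[of m] pp(2)[of "Suc m"] by auto
 next
  case False
  obtain P where P: "pr P" "p m <= P" "x : P" "P \<subset> p (Suc (Suc m))"
   using principal_ideal_theorem[OF N, of "p m" "p (Suc m)" "p (Suc (Suc m))" x]
    pp(1)[of m] pp(1)[of "Suc m"] pp(1)[of "Suc (Suc m)"] pp(2)[of m] pp(2)[of "Suc m"] Suc.prems(2) by auto
  moreover have "p m ~= P" using P(3) False pp(2)[of m] by auto
  ultimately show ?thesis by blast
 qed
 then obtain P where P: "pr P" "p m \<subset> P" "x : P" "P \<subset> p (Suc (Suc m))" by blast
 define p' where "p' = p(Suc m := P)"
 have "chn K (Suc m) p'"
  unfolding p'_def by (rule chn_append[OF chn_pred[OF chn_pred[OF Suc.prems(1)]] P(1,2)])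
 then obtain q where q: "chn K (Suc m) q" "q 0 = p' 0" "q (Suc m) = p' (Suc m)" "x : q 1"
 proof -
  have "x : p' (Suc m)" using P(3) by (simp add: p'_def)
  thus thesis using Suc.IH[OF \<open>chn K (Suc m) p'\<close>] that by blast
 qed
 define q' where "q' = q(Suc (Suc m) := p (Suc (Suc m)))"
 have "chn K (Suc (Suc m)) q'"
  unfolding q'_def by (rule chn_append[OF q(1)]) (use q(3) P(4) pp(1)[of "Suc (Suc m)"] in \<open>auto simp: p'_def\<close>)
 moreover have "q' 0 = p 0" "x : q' 1" "q' (Suc (Suc m)) = p (Suc (Suc m))" using q by (auto simp: q'_def p'_def)
 ultimately show ?case by blast
qed

text \<open>Dividing by an element of the maximal ideal lowers the dimension by at most one. The top
  prime is replaced by \<open>n\<close> so that it contains \<open>x\<close> before the chain is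
  rearranged; the shifted chain starts strictly above \<open>p 0\<close>.\<close>

lemma chain_shift:
 assumes N: "noeth scl UNIV K" and K: "osub scl K" and L: "locl K n" and x: "x : n" and p: "chn K (Suc d) p"
 shows "\<exists>q. chn (K \<boxplus> prin x) d q & p 0 \<subset> q 0 & x : q 0"
proof -
 define p' where "p' = (if p (Suc d) = n then p else p(Suc d := n))"
 have pn: "p (Suc d) <= n" using locl_prime_sub[OF L] p by (auto simp: chn_def)
 have "p d \<subset> p (Suc d)" using p by (simp add: chn_def)
 hence "p d \<subset> n" using pn by blast
 hence "chn K (Suc d) p'"
  using p chn_append[OF chn_pred[OF p] locl_prime[OF L]] by (simp add: p'_def)
 moreover have "x : p' (Suc d)" using x by (auto simp: p'_def)
 ultimately obtain q where q: "chn K (Suc d) q" "q 0 = p' 0" "x : q 1"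
  using chain_mod[OF N] by blast
 have q0: "q 0 = p 0" using q(2) by (auto simp: p'_def)
 have up: "x : q (Suc i)" if "i <= d" for i
  using that
 proof (induction i)
  case (Suc i)
  hence "q (Suc i) \<subset> q (Suc (Suc i))" using q(1) by (simp add: chn_def)
  thus ?case using Suc by auto
 qed (use q in simp)
 have "chn (K \<boxplus> prin x) d (%i. q (Suc i))"
  unfolding chn_def
 proof (intro conjI allI impI)
  fix i assume i: "i <= d"
  show qi: "pr (q (Suc i))" using q(1) i by (simp add: chn_def)
  show "K \<boxplus> prin x <= q (Suc i)"
   by (rule splus_least[OF prD(1)[OF qi]])
    (use q(1) i up[OF i] ideal_smult[OF prD(1)[OF qi]] in \<open>auto simp: chn_def\<close>)
 next
  fix i assume "i < d"
  thus "q (Suc i) \<subset> q (Suc (Suc i))" using q(1) by (simp add: chn_def)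
 qed
 moreover have "q 0 \<subset> q (Suc 0)" using q(1) by (simp add: chn_def)
 ultimately show ?thesis using q0 q(3) by auto
qed

lemma sp_ring_Suc:
 "sp (*) K x {..<Suc d} = sp (*) (K \<boxplus> prin (x d :: 'r::comm_ring_1)) x {..<d}" (is "?A = ?B")
proof
 show "?A <= ?B"
 proof
  fix z assume "z : ?A"
  then obtain u r where "u : K" "z = u + (\<Sum>j<Suc d. r j * x j)" by (rule sp_E)
  hence "z = (u + r d * x d) + (\<Sum>j<d. r j * x j)" "u + r d * x d : K \<boxplus> prin (x d)"
   by (auto simp: algebra_simps intro: splusI)
  thus "z : ?B" using sp_I[of "u + r d * x d" "K \<boxplus> prin (x d)" "(*)" r x "{..<d}"] by simp
 qed
 show "?B <= ?A"
 proof
  fix z assume "z : ?B"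
  then obtain v r where v: "v : K \<boxplus> prin (x d)" "z = v + (\<Sum>j<d. r j * x j)" by (rule sp_E)
  obtain u c where u: "v = u + c * x d" "u : K" using v(1) by (auto elim!: splusE)
  have "z = u + (\<Sum>j<Suc d. (r(d := c)) j * x j)"
   using v u by (simp add: algebra_simps)
  thus "z : ?A" using sp_I[OF u(2), of "(*)" "r(d := c)" x "{..<Suc d}"] by simp
 qed
qed

lemma osub_sp_ring: "osub scl K ==> osub scl (sp (*) K (x :: _ => 'r::comm_ring_1) J)"
 by (rule module.osub_sp[OF module_ring])

lemma sp_ring_gen: "osub scl K ==> finite J ==> j : J ==> x j : sp (*) K (x :: _ => 'r::comm_ring_1) J"
 by (rule module.sp_gen[OF module_ring])

lemma K_mono: "K <= K \<boxplus> prin (x :: 'r::comm_ring_1)"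
 by (rule splus_sub1[OF osub_princ])

lemma x_in_Kx: "osub scl K ==> x : K \<boxplus> prin (x :: 'r::comm_ring_1)"
 using splusI[OF osub_zero, of scl K "1 * x" "prin x"] rangeI[of "%r. r * x" 1] by simp

text \<open>This is the theorem that a regular local ring is a domain. Modulo the generator
  \<open>x d\<close>, induction identifies the bottom of the shifted chain with
  \<open>K + (x d)\<close>. As \<open>p 0\<close> lies strictly below it, it omits
  \<open>x d\<close>, so every element of \<open>p 0\<close> is, up to \<open>K\<close>, the product
  of \<open>x d\<close> with an element of \<open>p 0\<close>, and Nakayama's lemma applies.\<close>

lemma regular_chain_bottom:
 assumes "noeth scl UNIV K" "osub scl K" "locl K n" "n = sp (*) K x {..<d}" "chn K d p"
 shows "p 0 = K"
 using assms
proof (induction d arbitrary: K p)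
 case 0
 hence "n = K" by (simp add: sp_def)
 moreover have "p 0 <= n" "K <= p 0" using locl_prime_sub 0 by (auto simp: chn_def)
 ultimately show ?case by blast
next
 case (Suc d)
 let ?K = "K \<boxplus> prin (x d)"
 have xn: "x d : n" unfolding Suc.prems(4) by (rule sp_ring_gen[OF Suc.prems(2)]) auto
 obtain q where q: "chn ?K d q" "p 0 \<subset> q 0" using chain_shift[OF Suc.prems(1-3) xn Suc.prems(5)] by blast
 have oK: "osub scl ?K" by (rule osub_scl_splus[OF Suc.prems(2) osub_princ])
 have nn: "n = sp (*) ?K x {..<d}" using Suc.prems(4) by (simp only: sp_ring_Suc)
 have Kn: "?K <= n" unfolding nn by (rule module.sp_base[OF module_ring])
 have "q 0 = ?K"
  by (rule Suc.IH[OF noeth_mono[OF Suc.prems(1) order_refl K_mono order_refl] oK locl_mono[OF Suc.prems(3) K_mono Kn] nn q(1)])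
 have p0: "pr (p 0)" "K <= p 0" using Suc.prems(5) by (auto simp: chn_def)
 note pi = prD(1)[OF p0(1)]
 have xp: "x d ~: p 0"
 proof
  assume "x d : p 0"
  hence "?K <= p 0" using p0 ideal_smult[OF pi] by (intro splus_least[OF pi]) auto
  thus False using q(2) \<open>q 0 = ?K\<close> by blast
 qed
 show ?case
 proof (rule module.nakayama[OF module_ring _ pi Suc.prems(2) p0(2)])
  show "noeth scl (p 0) K" by (rule noeth_mono[OF Suc.prems(1)]) auto
  show "k * y : K" if "k : K" for k y using ideal_mult[OF Suc.prems(2) that] .
  show "finite {()}" by simp
  show "jac K (%_. x d) {()}" by (rule locl_jac[OF Suc.prems(3)]) (rule xn)
  fix C assume C: "osub scl C" "K <= C" "!!j y. j : {()} ==> y : p 0 ==> x d * y : C"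
  show "p 0 <= C"
  proof
   fix y assume y: "y : p 0"
   hence "y : ?K" using q(2) \<open>q 0 = ?K\<close> by blast
   then obtain k r where k: "y = k + r * x d" "k : K" by (auto elim!: splusE)
   hence "r * x d : p 0" using y p0(2) osub_add_iff'[OF pi, of k] by auto
   hence "r : p 0" using prD(3)[OF p0(1)] xp by blast
   hence "x d * r : C" using C(3) by simp
   thus "y : C" using k C(2) osub_add[OF C(1)] by (auto simp: mult.commute)
  qed
 qed
qed

text \<open>Regularity in dimension \<open>d\<close>: the embedding dimension is at most
  \<open>d\<close> and the Krull dimension at least \<open>d\<close>.\<close>

definition reg :: "nat => 'r::comm_ring_1 set => 'r set => bool" where
 "reg d K n \<longleftrightarrow> (\<exists>x. n = sp (*) K x {..<d}) & (\<exists>p. chn K d p)"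

text \<open>\<open>K\<close> is prime, being the bottom of a chain of full length, so an element of
  \<open>n\<close> outside \<open>K\<close> is regular. The last generator is outside
  \<open>K\<close> because the shifted chain starts strictly above \<open>K\<close>.\<close>

lemma reg_step:
 assumes N: "noeth scl UNIV K" and K: "osub scl K" and L: "locl K n" and R: "reg (Suc d) K n"
 obtains x where "x : n" "!!r. x * r : K ==> r : K" "reg d (K \<boxplus> prin x) n"
  "locl (K \<boxplus> prin x) n"
proof -
 obtain x p where x: "n = sp (*) K x {..<Suc d}" and p: "chn K (Suc d) p" using R by (auto simp: reg_def)
 let ?K = "K \<boxplus> prin (x d)"
 have xn: "x d : n" unfolding x by (rule sp_ring_gen[OF K]) auto
 obtain q where q: "chn ?K d q" "p 0 \<subset> q 0" using chain_shift[OF N K L xn p] by blast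
 have oK: "osub scl ?K" by (rule osub_scl_splus[OF K osub_princ])
 have nn: "n = sp (*) ?K x {..<d}" using x by (simp only: sp_ring_Suc)
 have Kn: "?K <= n" unfolding nn by (rule module.sp_base[OF module_ring])
 have L': "locl ?K n" by (rule locl_mono[OF L K_mono Kn])
 have q0: "q 0 = ?K"
  by (rule regular_chain_bottom[OF noeth_mono[OF N order_refl K_mono order_refl] oK L' nn q(1)])
 have p0: "p 0 = K" by (rule regular_chain_bottom[OF N K L x p])
 have prK: "pr K" using p p0 by (auto simp: chn_def)
 have "x d ~: K"
 proof
  assume "x d : K"
  hence "?K <= K" using ideal_smult[OF K] by (intro splus_least[OF K]) auto
  thus False using q(2) q0 p0 by blast
 qed
 hence "x d * r : K ==> r : K" for r using prD(3)[OF prK] by blast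
 moreover have "reg d ?K n" using nn q(1) by (auto simp: reg_def)
 ultimately show thesis using that xn L' by blast
qed

section \<open>Syzygies over regular local rings\<close>

definition kerc :: "(nat => (nat \<Rightarrow>\<^sub>0 'r::comm_ring_1)) => nat => (nat \<Rightarrow>\<^sub>0 'r) set => (nat \<Rightarrow>\<^sub>0 'r) set" where
 "kerc c b V = {z. keys z <= {..<b} & lin sc c z : V}"

text \<open>The vectors of length \<open>b\<close> that vanish modulo \<open>K\<close>. Syzygies
  \<open>kerc c b V\<close> are modules relative to this base.\<close>

definition Kb :: "'r::comm_ring_1 set => nat => (nat \<Rightarrow>\<^sub>0 'r) set" where
 "Kb K b = {z. keys z <= {..<b} & z : cf K}"

text \<open>\<open>W / V\<close> has a free \<open>d\<close>-th syzygy, whatever generators are chosen.\<close>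

primrec FR :: "nat => 'r::comm_ring_1 set => (nat \<Rightarrow>\<^sub>0 'r) set => (nat \<Rightarrow>\<^sub>0 'r) set => bool" where
 "FR 0 K W V \<longleftrightarrow> (\<exists>p y. (\<forall>j<p. y j : W) & W = sp sc V y {..<p} & kerc y p V <= cf K)"
| "FR (Suc d) K W V \<longleftrightarrow> (\<forall>b c. (\<forall>j<b. c j : W) --> W = sp sc V c {..<b} --> FR d K (kerc c b V) (Kb K b))"

lemma sum_single_lin:
 fixes r :: "nat => 'r::comm_ring_1"
 shows "keys (\<Sum>j<b. single j (r j)) <= {..<b}" "j < b ==> lookup (\<Sum>j<b. single j (r j)) j = r j"
  "lin sc c (\<Sum>j<b. single j (r j)) = (\<Sum>j<b. sc (r j) (c j))"
proof -
 have "lookup (\<Sum>j<b. single j (r j)) i = (if i < b then r i else 0)" for i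
  by (simp add: lookup_sum lookup_single when_def)
 thus "keys (\<Sum>j<b. single j (r j)) <= {..<b}" "j < b ==> lookup (\<Sum>j<b. single j (r j)) j = r j"
  by (auto simp: in_keys_iff split: if_splits)
 show "lin sc c (\<Sum>j<b. single j (r j)) = (\<Sum>j<b. sc (r j) (c j))" by (simp add: sc.lin_sum)
qed

lemma sp_lin_I: "keys z <= {..<b::nat} ==> v : V ==> v + lin sc c z : sp sc V c {..<b}"
 using sp_I[of v V sc "lookup z" c "{..<b}"] sc.lin_superset[of "{..<b}" z c] by simp

lemma sp_lin_E:
 assumes "x : sp sc V c {..<b::nat}"
 obtains v z where "v : V" "keys z <= {..<b}" "x = v + lin sc c z"
proof -
 obtain v r where "v : V" "x = v + (\<Sum>j<b. sc (r j) (c j))" using assms by (rule sp_E)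
 thus thesis by (intro that[of v "\<Sum>j<b. single j (r j)"]) (simp_all add: sum_single_lin)
qed

lemma osub_kerc: "submod sc V ==> submod sc (kerc c b V)"
proof (rule osubI)
 assume V: "submod sc V"
 show "0 : kerc c b V" by (simp add: kerc_def osub_zero[OF V])
 show "x - y : kerc c b V" if xy: "x : kerc c b V" "y : kerc c b V" for x y
  using osub_diff[OF osub_kin[of "{..<b}"], of x y] xy osub_diff[OF V] by (simp add: kerc_def sc.lin_diff)
 show "w x : kerc c b V" if w: "w : range sc" "x : kerc c b V" for w x
  using w osub_op[OF osub_kin[of "{..<b}"] w(1), of x] sc.osub_scale[OF V] by (auto simp: kerc_def sc.lin_sc)
qed

lemma osub_Kb: "osub scl K ==> submod sc (Kb K b)"
 unfolding Kb_def using osub_Int[OF osub_kin[of "{..<b}"] osub_cf[of K]] by (simp add: Int_def)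

lemma Kb_kerc:
 assumes V: "submod sc V" and c: "!!j. j < b ==> c j : W" and KW: "!!k w. k : K ==> w : W ==> sc k w : V"
 shows "Kb K b <= kerc c b V"
 unfolding Kb_def kerc_def using sc.lin_cf[OF V, of _ K c] c KW by (auto simp: subset_iff)

lemma noeth_Kb:
 assumes N: "noeth scl UNIV K" and K: "osub scl K"
 shows "noeth (range sc) {z. keys z <= {..<b}} (Kb K b)"
proof (rule noeth_mono[OF sc.noeth_sp[OF N osub_Kb[OF K, of b], of "{..<b}" "%j. single j 1"]])
 show "sc k (single j 1) : Kb K b" if "k : K" "j : {..<b}" for k j
  using that osub_zero[OF K] by (auto simp: Kb_def cf_def lookup_single when_def)
 show "{z. keys z <= {..<b}} <= sp sc (Kb K b) (%j. single j 1) {..<b}"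
  using sp_lin_I[of _ b 0 "Kb K b" "%j. single j 1"] osub_zero[OF osub_Kb[OF K]] by (auto simp: lin_unit)
qed auto

text \<open>The coefficients in \<open>K + (x)\<close> are split one by one; absent coefficients are
  left alone, so that supports do not grow.\<close>

lemma cf_splus:
 assumes K: "osub scl K" and z: "z : cf (K \<boxplus> prin x)"
 obtains z0 z1 where "z = z0 + sc x z1" "z0 : cf K" "keys z1 <= keys z" "keys z0 <= keys z"
proof -
 have "\<exists>r. lookup z b - r * x : K" for b
 proof -
  have "lookup z b : K \<boxplus> prin x" using z by (simp add: cf_def)
  then obtain k r where "lookup z b = k + r * x" "k : K" by (auto elim!: splusE)
  thus ?thesis by (intro exI[of _ r]) simp
 qed
 then obtain r where r: "!!b. lookup z b - r b * x : K" by metis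
 define z1 where "z1 = (\<Sum>b\<in>keys z. single b (r b))"
 have l: "lookup z1 b = (if b : keys z then r b else 0)" for b
  by (simp add: z1_def lookup_sum lookup_single when_def)
 have k1: "keys z1 <= keys z" by (auto simp: in_keys_iff[of _ z1] l split: if_splits)
 have k0: "keys (z - sc x z1) <= keys z"
  using osub_diff[OF osub_kin[of "keys z"], of z "sc x z1"] k1 keys_sc[of x z1] by auto
 have "lookup (z - sc x z1) b : K" for b
 proof (cases "b : keys z")
  case True
  thus ?thesis using r[of b] by (simp add: lookup_minus l mult.commute)
 next
  case False
  hence "lookup (z - sc x z1) b = 0" by (simp add: lookup_minus l in_keys_iff)
  thus ?thesis using osub_zero[OF K] by simp
 qed
 hence "z - sc x z1 : cf K" by (simp add: cf_def)
 thus thesis using that[of "z - sc x z1" z1] k1 k0 by simp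
qed

lemma sp_enlarge:
 assumes W: "submod sc W" and V': "submod sc V'" "V <= V'" "V' <= W"
  and c: "finite J" "!!j. j : J ==> c j : W" and Wc: "W = sp sc V c J"
 shows "W = sp sc V' c J"
proof
 have "sp sc V c J <= sp sc V' c J"
  using V'(2) sc.sp_base[of V' c J] c(1) sc.sp_gen[OF V'(1)] by (intro sc.sp_least[OF sc.osub_sp[OF V'(1)]]) auto
 thus "W <= sp sc V' c J" using Wc by simp
 show "sp sc V' c J <= W" by (rule sc.sp_least[OF W V'(3) c(2)])
qed

text \<open>By the second isomorphism theorem both quotients are the same module, and generators of
  the first also generate the second with the same relations.\<close>

lemma FR_iso:
 assumes "submod sc W1" "submod sc V2" "W1 <= W2" "V1 = W1 \<inter> V2" "W2 = W1 \<boxplus> V2" "FR d K W2 V2"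
 shows "FR d K W1 V1"
proof (cases d)
 case 0
 then obtain p y where y: "!!j. j < p ==> y j : W2" "W2 = sp sc V2 y {..<p}" "kerc y p V2 <= cf K"
  using assms(6) by auto
 have "\<exists>w. w : W1 & y j - w : V2" if "j < p" for j
  using y(1)[OF that] assms(5) by (auto elim!: splusE)
 then obtain y' where y': "!!j. j < p ==> y' j : W1" "!!j. j < p ==> y j - y' j : V2" by metis
 have lin: "lin sc y z - lin sc y' z : V2" if "keys z <= {..<p}" for z
  using sc.lin_mem[OF assms(2), of z "%j. y j - y' j"] y'(2) that by (auto simp: sc.lin_fun_diff)
 have linW: "lin sc y' z : W1" if "keys z <= {..<p}" for z
  by (rule sc.lin_mem[OF assms(1)]) (use y'(1) that in auto)
 have "W1 = sp sc V1 y' {..<p}"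
 proof
  show "W1 <= sp sc V1 y' {..<p}"
  proof
   fix w assume w: "w : W1"
   hence "w : sp sc V2 y {..<p}" using assms(3) y(2) by blast
   then obtain v z where z: "v : V2" "keys z <= {..<p}" "w = v + lin sc y z" by (rule sp_lin_E)
   have "w - lin sc y' z = v + (lin sc y z - lin sc y' z)" using z(3) by simp
   hence "w - lin sc y' z : V2" using osub_add[OF assms(2) z(1) lin[OF z(2)]] by metis
   moreover have "w - lin sc y' z : W1" by (rule osub_diff[OF assms(1) w linW[OF z(2)]])
   ultimately have "w - lin sc y' z : V1" using assms(4) by blast
   from sp_lin_I[OF z(2) this, of y'] show "w : sp sc V1 y' {..<p}" by simp
  qed
  show "sp sc V1 y' {..<p} <= W1"
   by (rule sc.sp_least[OF assms(1)]) (use assms(4) y' in auto)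
 qed
 moreover have "kerc y' p V1 <= cf K"
 proof
  fix z assume "z : kerc y' p V1"
  hence z: "keys z <= {..<p}" "lin sc y' z : V2" using assms(4) by (auto simp: kerc_def)
  hence "lin sc y z : V2" using lin[OF z(1)] osub_diffD[OF assms(2)] by blast
  thus "z : cf K" using y(3) z(1) by (auto simp: kerc_def)
 qed
 ultimately show ?thesis using y'(1) 0 by auto
next
 case (Suc d')
 show ?thesis
  unfolding Suc FR.simps
 proof (intro allI impI)
  fix b :: nat and c assume c: "\<forall>j<b. c j : W1" and W1: "W1 = sp sc V1 c {..<b}"
  have "W2 = sp sc V2 c {..<b}"
  proof
   show "W2 <= sp sc V2 c {..<b}"
   proof
    fix w assume "w : W2"
    then obtain w1 v2 where w: "w = w1 + v2" "w1 : W1" "v2 : V2" using assms(5) by (auto elim!: splusE)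
    have "w1 : sp sc V1 c {..<b}" using w(2) W1 by simp
    then obtain v z where z: "v : V1" "keys z <= {..<b}" "w1 = v + lin sc c z" by (rule sp_lin_E)
    have "v + v2 : V2" using z(1) w(3) assms(4) osub_add[OF assms(2)] by blast
    from sp_lin_I[OF z(2) this, of c] show "w : sp sc V2 c {..<b}" by (simp add: w z algebra_simps)
   qed
   have W2: "x : W2" if "x = w + v" "w : W1" "v : V2" for x w v using that assms(5) by (auto intro: splusI)
   show "sp sc V2 c {..<b} <= W2"
   proof
    fix x assume "x : sp sc V2 c {..<b}"
    then obtain v z where z: "v : V2" "keys z <= {..<b}" "x = v + lin sc c z" by (rule sp_lin_E)
    have "lin sc c z : W1" by (rule sc.lin_mem[OF assms(1)]) (use c z in auto)
    thus "x : W2" using W2[of x "lin sc c z" v] z by (simp add: add.commute)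
   qed
  qed
  moreover have "\<forall>j<b. c j : W2" using c assms(3) by blast
  ultimately have "FR d' K (kerc c b V2) (Kb K b)" using assms(6) Suc by simp
  moreover have "kerc c b V2 = kerc c b V1"
  proof -
   have "lin sc c z : W1" if "keys z <= {..<b}" for z
    by (rule sc.lin_mem[OF assms(1)]) (use c that in auto)
   thus ?thesis using assms(4) by (auto simp: kerc_def)
  qed
  ultimately show "FR d' K (kerc c b V1) (Kb K b)" by simp
 qed
qed

text \<open>Because \<open>x\<close> is regular on \<open>W / V\<close>, reducing the first syzygy
  modulo \<open>x\<close> gives the first syzygy of the reduction; as \<open>x\<close> is also
  regular on free modules, the induction continues. At the end a basis modulo \<open>x\<close> lifts
  by Nakayama's lemma.\<close>

lemma FR_lift:
 assumes N: "noeth scl UNIV K" and K: "osub scl K" and x: "!!r. x * r : K ==> r : K" and jx: "jac K (%_. x) {()}"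
  and "submod sc W" "submod sc V" "V <= W" "noeth (range sc) W V"
  and "!!k w. k : K ==> w : W ==> sc k w : V" "!!w. w : W ==> sc x w : V ==> w : V"
  and "FR d (K \<boxplus> prin x) W (V \<boxplus> sc x ` W)"
 shows "FR d K W V"
 using assms(5-)
proof (induction d arbitrary: W V)
 case 0
 note W = 0(1) and V = 0(2,3) and NW = 0(4) and KW = 0(5) and xW = 0(6)
 let ?K = "K \<boxplus> prin x" and ?V = "V \<boxplus> sc x ` W"
 have sadd: "additive (sc x :: (nat \<Rightarrow>\<^sub>0 _) => _)" by (rule sc.additive_scale) simp
 have xWo: "submod sc (sc x ` W)" by (rule osub_imageI[OF sadd _ W]) (auto simp: mult.commute)
 have V': "submod sc ?V" by (rule osub_splus[OF sc.additive_scale V(1) xWo])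
 obtain p y where y: "!!j. j < p ==> y j : W" "W = sp sc ?V y {..<p}" "kerc y p ?V <= cf ?K"
  using 0(7) by auto
 let ?Y = "sp sc V y {..<p}"
 have Y: "submod sc ?Y" "V <= ?Y" "?Y <= W"
  using sc.osub_sp[OF V(1)] sc.sp_base[of V y "{..<p}"] sc.sp_least[OF W V(2), of "{..<p}" y] y(1) by auto
 have linY: "lin sc y z : W" if "keys z <= {..<p}" for z
  by (rule sc.lin_mem[OF W]) (use y(1) that in auto)
 have "W = ?Y"
 proof (rule sc.nakayama[OF noeth_mono[OF NW order_refl Y(2) order_refl] W Y(1,3) _ _ jx])
  show "sc k w : ?Y" if "k : K" "w : W" for k w using KW that Y(2) by blast
  fix C assume C: "submod sc C" "?Y <= C" "!!j w. j : {()} ==> w : W ==> sc x w : C"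
  have "?V <= C" by (rule splus_least[OF C(1)]) (use Y(2) C in auto)
  moreover have "y j : C" if "j < p" for j using sc.sp_gen[OF V(1), of "{..<p}" j y] that C(2) by auto
  ultimately have "sp sc ?V y {..<p} <= C" by (intro sc.sp_least[OF C(1)]) auto
  thus "W <= C" using y(2) by simp
 qed simp
 moreover have KbY: "Kb K p <= kerc y p V" by (rule Kb_kerc[OF V(1) y(1) KW])
 \<comment> \<open>Independence of the lifted basis: a relation vanishes modulo \<open>x\<close>, so
   up to \<open>K\<close> it is \<open>x\<close> times a vector, which is again a relation because
   \<open>x\<close> is regular on \<open>W / V\<close>. Nakayama's lemma removes all such
   relations.\<close>
 have "kerc y p V = Kb K p"
 proof (rule sc.nakayama[OF _ osub_kerc[OF V(1)] osub_Kb[OF K] KbY _ _ jx])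
  show "noeth (range sc) (kerc y p V) (Kb K p)" by (rule noeth_mono[OF noeth_Kb[OF N K]]) (auto simp: kerc_def)
  show "sc k z : Kb K p" if "k : K" "z : kerc y p V" for k z
   using that sc_cf[OF K] keys_sc[of k z] by (auto simp: Kb_def kerc_def)
  fix C assume C: "submod sc C" "Kb K p <= C" "!!j w. j : {()} ==> w : kerc y p V ==> sc x w : C"
  show "kerc y p V <= C"
  proof
   fix z assume z: "z : kerc y p V"
   hence "z : kerc y p ?V" using splus_sub1[OF xWo, of V] by (auto simp: kerc_def)
   then obtain z0 z1 where z01: "z = z0 + sc x z1" "z0 : cf K" "keys z1 <= keys z" "keys z0 <= keys z"
    using cf_splus[OF K, of z x] y(3) by blast
   have k: "keys z <= {..<p}" using z by (simp add: kerc_def)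
   have z0: "z0 : Kb K p" using z01 k by (auto simp: Kb_def)
   hence "lin sc y z0 : V" using KbY by (auto simp: kerc_def)
   hence "sc x (lin sc y z1) : V" using z osub_add_iff'[OF V(1)] by (simp add: z01(1) kerc_def sc.lin_add sc.lin_sc)
   hence "z1 : kerc y p V" using xW linY z01(3) k by (auto simp: kerc_def)
   thus "z : C" using C z0 osub_add[OF C(1)] z01(1) by auto
  qed
 qed simp
 ultimately show ?case using y(1) by (auto simp: Kb_def)
next
 case (Suc d)
 note W = Suc.prems(1) and V = Suc.prems(2,3) and NW = Suc.prems(4) and KW = Suc.prems(5) and xW = Suc.prems(6)
 let ?K = "K \<boxplus> prin x" and ?V = "V \<boxplus> sc x ` W"
 have sadd: "additive (sc x :: (nat \<Rightarrow>\<^sub>0 _) => _)" by (rule sc.additive_scale) simp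
 have xWo: "submod sc (sc x ` W)" if "submod sc W" for W :: "(nat \<Rightarrow>\<^sub>0 _) set"
  by (rule osub_imageI[OF sadd _ that]) (auto simp: mult.commute)
 have oK: "osub scl ?K" by (rule osub_scl_splus[OF K osub_princ])
 show ?case
  unfolding FR.simps
 proof (intro allI impI)
  fix b :: nat and c assume c: "\<forall>j<b. c j : W" and Wc: "W = sp sc V c {..<b}"
  have V': "submod sc ?V" by (rule osub_splus[OF sc.additive_scale V(1) xWo[OF W]])
  have VV': "V <= ?V" by (rule splus_sub1[OF xWo[OF W]])
  have "?V <= W" by (rule splus_least[OF W V(2)]) (use sc.osub_scale[OF W] in auto)
  hence "W = sp sc ?V c {..<b}"
   by (intro sp_enlarge[OF W V' VV' _ _ _ Wc]) (use c in auto)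
  hence F: "FR d ?K (kerc c b ?V) (Kb ?K b)" using Suc.prems(7) c by simp
  define Y where "Y = kerc c b V"
  have Y: "submod sc Y" unfolding Y_def by (rule osub_kerc[OF V(1)])
  have KY: "Kb K b <= Y" unfolding Y_def by (rule Kb_kerc[OF V(1) _ KW]) (use c in auto)
  have linc: "lin sc c z : W" if "keys z <= {..<b}" for z
   by (rule sc.lin_mem[OF W]) (use c that in auto)
  \<comment> \<open>The reduction of the syzygy module \<open>Y\<close> is compared with the
    syzygies of the reduction: regularity of \<open>x\<close> on \<open>W / V\<close> gives the
    intersection, and the fact that the \<open>c j\<close> generate \<open>W\<close> gives the
    sum.\<close>
  have F': "FR d ?K Y (Kb K b \<boxplus> sc x ` Y)"
  proof (rule FR_iso[OF Y osub_Kb[OF oK] _ _ _ F])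
   show "Y <= kerc c b ?V" using VV' by (auto simp: Y_def kerc_def)
   show "Kb K b \<boxplus> sc x ` Y = Y \<inter> Kb ?K b"
   proof
    have "sc x z : Kb ?K b" if "z : Y" for z
     using that keys_sc[of x z] sc_cf[OF oK x_in_Kx[OF K]] by (auto simp: Kb_def Y_def kerc_def)
    moreover have "Kb K b <= Kb ?K b" using K_mono[of K x] by (auto simp: Kb_def cf_def)
    ultimately show "Kb K b \<boxplus> sc x ` Y <= Y \<inter> Kb ?K b"
     using KY sc.osub_scale[OF Y] by (intro splus_least[OF osub_Int[OF Y osub_Kb[OF oK]]]) auto
    show "Y \<inter> Kb ?K b <= Kb K b \<boxplus> sc x ` Y"
    proof
     fix z assume z: "z : Y \<inter> Kb ?K b"
     then obtain z0 z1 where z01: "z = z0 + sc x z1" "z0 : cf K" "keys z1 <= keys z" "keys z0 <= keys z"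
      using cf_splus[OF K, of z x] by (auto simp: Kb_def)
     have k: "keys z <= {..<b}" using z by (simp add: Kb_def)
     have z0: "z0 : Kb K b" using z01 k by (auto simp: Kb_def)
     hence "lin sc c z0 : V" using KY by (auto simp: Y_def kerc_def)
     hence "sc x (lin sc c z1) : V" using z osub_add_iff'[OF V(1)] by (simp add: z01(1) Y_def kerc_def sc.lin_add sc.lin_sc)
     hence "z1 : Y" using xW linc z01(3) k by (auto simp: Y_def kerc_def)
     thus "z : Kb K b \<boxplus> sc x ` Y" using z0 z01(1) by (auto intro: splusI)
    qed
   qed
   show "kerc c b ?V = Y \<boxplus> Kb ?K b"
   proof
    show "kerc c b ?V <= Y \<boxplus> Kb ?K b"
    proof
     fix z assume z: "z : kerc c b ?V"
     then obtain v w where v: "lin sc c z = v + sc x w" "v : V" "w : W" by (auto simp: kerc_def elim!: splusE)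
     have "w : sp sc V c {..<b}" using v(3) Wc by simp
     then obtain v' z' where z': "v' : V" "keys z' <= {..<b}" "w = v' + lin sc c z'" by (rule sp_lin_E)
     have k: "keys z <= {..<b}" using z by (simp add: kerc_def)
     have kx: "keys (sc x z') <= {..<b}" using keys_sc[of x z'] z'(2) by blast
     have "lin sc c (z - sc x z') = v + sc x v'"
      by (simp add: sc.lin_diff sc.lin_sc v z' sc.scale_right_distrib)
     also have "\<dots> : V" by (rule osub_add[OF V(1) v(2) sc.osub_scale[OF V(1) z'(1)]])
     finally have "z - sc x z' : Y"
      using osub_diff[OF osub_kin[of "{..<b}"], of z "sc x z'"] k kx by (simp add: Y_def kerc_def)
     moreover have "sc x z' : Kb ?K b" using kx sc_cf[OF oK x_in_Kx[OF K]] by (auto simp: Kb_def)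
     ultimately show "z : Y \<boxplus> Kb ?K b" using splusI[of "z - sc x z'" Y "sc x z'"] by simp
    qed
    have "Kb ?K b <= kerc c b ?V"
    proof
     fix z assume z: "z : Kb ?K b"
     then obtain z0 z1 where z01: "z = z0 + sc x z1" "z0 : cf K" "keys z1 <= keys z" "keys z0 <= keys z"
      using cf_splus[OF K, of z x] by (auto simp: Kb_def)
     have k: "keys z <= {..<b}" using z by (simp add: Kb_def)
     have "z0 : Kb K b" using z01 k by (auto simp: Kb_def)
     hence "lin sc c z0 : V" using KY by (auto simp: Y_def kerc_def)
     moreover have "sc x (lin sc c z1) : sc x ` W" using linc z01(3) k by blast
     ultimately show "z : kerc c b ?V" using k by (auto simp: z01(1) kerc_def sc.lin_add sc.lin_sc intro!: splusI)
    qed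
    thus "Y \<boxplus> Kb ?K b <= kerc c b ?V"
     using VV' by (intro splus_least[OF osub_kerc[OF V']]) (auto simp: Y_def kerc_def)
   qed
  qed
  show "FR d K (kerc c b V) (Kb K b)"
   unfolding Y_def[symmetric]
  proof (rule Suc.IH[OF Y osub_Kb[OF K] KY _ _ _ F'])
   show "noeth (range sc) Y (Kb K b)" by (rule noeth_mono[OF noeth_Kb[OF N K]]) (auto simp: Y_def kerc_def)
   show "sc k z : Kb K b" if "k : K" "z : Y" for k z
    using that sc_cf[OF K] keys_sc[of k z] by (auto simp: Kb_def kerc_def Y_def)
   show "z : Kb K b" if "z : Y" "sc x z : Kb K b" for z
    using that x by (auto simp: Kb_def cf_def Y_def kerc_def)
  qed
 qed
qed

text \<open>Here \<open>K\<close> itself is the maximal ideal, so this is linear algebra: a relation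
  with a coefficient outside \<open>K\<close> expresses one generator through the others, and the
  number of generators drops.\<close>

lemma FR_field:
 assumes K: "osub scl K" and L: "locl K K"
  and W: "submod sc W" and V: "submod sc V" "V <= W" and KW: "!!k w. k : K ==> w : W ==> sc k w : V"
 shows "(!!j. j < p ==> y j : W) ==> W = sp sc V y {..<p::nat} ==> FR 0 K W V"
proof (induction p arbitrary: y)
 case 0
 hence "kerc y 0 V <= cf K" using osub_zero[OF K] by (auto simp: kerc_def cf_def)
 moreover have "\<forall>j<0. y j : W" by simp
 ultimately show ?case unfolding FR.simps using 0(2) by blast
next
 case (Suc p)
 show ?case
 proof (cases "kerc y (Suc p) V <= cf K")
  case True
  thus ?thesis unfolding FR.simps using Suc.prems by blast
 next
  case False
  then obtain z i where z: "keys z <= {..<Suc p}" "lin sc y z : V" "lookup z i ~: K" by (auto simp: kerc_def cf_def)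
  have "lookup z i ~= 0" using z(3) osub_zero[OF K] by auto
  hence i: "i < Suc p" using z(1) by (auto simp: in_keys_iff subset_iff)
  obtain v where v: "v * lookup z i - 1 : K" using L z(3) by (auto simp: locl_def)
  define y' where "y' j = y (if j < i then j else Suc j)" for j
  let ?S = "sp sc V y' {..<p}"
  have S: "submod sc ?S" "V <= ?S" by (rule sc.osub_sp[OF V(1)], rule sc.sp_base)
  have yS: "y j : ?S" if jp: "j < Suc p" "j ~= i" for j
  proof (cases "j < i")
   case True
   hence "y' j : ?S" using i by (intro sc.sp_gen[OF V(1)]) auto
   thus ?thesis using True by (simp add: y'_def)
  next
   case False
   then obtain k where k: "j = Suc k" "i <= k" using jp by (cases j) auto
   have "y' k : ?S" using k jp by (intro sc.sp_gen[OF V(1)]) auto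
   thus ?thesis using k by (simp add: y'_def)
  qed
  have "lin sc y z = (\<Sum>j<Suc p. sc (lookup z j) (y j))" by (rule sc.lin_superset[OF _ z(1)]) simp
  also have "\<dots> = sc (lookup z i) (y i) + (\<Sum>j\<in>{..<Suc p} - {i}. sc (lookup z j) (y j))"
   by (rule sum.remove) (use i in auto)
  finally have e: "lin sc y z = sc (lookup z i) (y i) + (\<Sum>j\<in>{..<Suc p} - {i}. sc (lookup z j) (y j))" .
  have "(\<Sum>j\<in>{..<Suc p} - {i}. sc (lookup z j) (y j)) : ?S"
   by (rule osub_sum[OF S(1)]) (auto intro!: sc.osub_scale[OF S(1)] yS)
  hence "sc (lookup z i) (y i) : ?S" using e z(2) S(2) osub_add_iff[OF S(1)] by auto
  hence "sc v (sc (lookup z i) (y i)) : ?S" by (rule sc.osub_scale[OF S(1)])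
  moreover have "sc (v * lookup z i - 1) (y i) : ?S" using KW[OF v Suc.prems(1)[OF i]] S(2) by blast
  hence "sc v (sc (lookup z i) (y i)) - y i : ?S" by (simp add: sc.scale_left_diff_distrib)
  ultimately have "y i : ?S" using osub_diffD'[OF S(1)] by blast
  hence "sp sc V y {..<Suc p} <= ?S"
   using yS by (intro sc.sp_least[OF S]) (metis lessThan_iff)
  moreover have y'W: "y' j : W" if "j < p" for j using Suc.prems(1) that by (auto simp: y'_def)
  hence "?S <= W" by (intro sc.sp_least[OF W V(2)]) auto
  ultimately have "W = ?S" using Suc.prems(2) by blast
  thus ?thesis using Suc.IH[of y'] y'W by blast
 qed
qed

text \<open>The bound \<open>d\<close> on the global dimension. The parameter \<open>x\<close> may
  have torsion on \<open>W / V\<close>, so the step passes to the first syzygy, which lies in a free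
  module, where \<open>x\<close> is regular. This uses up one syzygy and is paid for by the ring
  modulo \<open>x\<close>, whose dimension is one less.\<close>

lemma regular_FR:
 assumes "noeth scl UNIV K" "osub scl K" "locl K n" "reg d K n"
  and "submod sc W" "submod sc V" "V <= W" "noeth (range sc) W V"
  and "!!k w. k : K ==> w : W ==> sc k w : V"
 shows "FR d K W V"
 using assms
proof (induction d arbitrary: K W V)
 case 0
 have "n = K" using 0(4) by (auto simp: reg_def sp_def)
 hence L: "locl K K" using 0(3) by simp
 obtain p y where py: "!!j. j < p ==> y j : W" "W = sp sc V y {..<p::nat}"
  by (rule sc.noeth_fg[OF 0(8) 0(5) 0(6,7)]) (rule that)
 show ?case by (rule FR_field[OF 0(2) L 0(5-7) 0(9) py])
next
 case (Suc d)
 note N = Suc.prems(1) and K = Suc.prems(2) and L = Suc.prems(3)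
 note W = Suc.prems(5) and V = Suc.prems(6,7) and KW = Suc.prems(9)
 obtain x where x: "x : n" "!!r. x * r : K ==> r : K" "reg d (K \<boxplus> prin x) n"
  "locl (K \<boxplus> prin x) n"
  by (rule reg_step[OF N K L Suc.prems(4)]) blast
 let ?K = "K \<boxplus> prin x"
 have sadd: "additive (sc x :: (nat \<Rightarrow>\<^sub>0 _) => _)" by (rule sc.additive_scale) simp
 have jx: "jac K (%_. x) {()}" by (rule locl_jac[OF L]) (rule x(1))
 show ?case
  unfolding FR.simps
 proof (intro allI impI)
  fix b :: nat and c assume c: "\<forall>j<b. c j : W" and Wc: "W = sp sc V c {..<b}"
  define Y where "Y = kerc c b V"
  have Y: "submod sc Y" unfolding Y_def by (rule osub_kerc[OF V(1)])
  have KY: "Kb K b <= Y" unfolding Y_def by (rule Kb_kerc[OF V(1) _ KW]) (use c in auto)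
  have NY: "noeth (range sc) Y (Kb K b)" by (rule noeth_mono[OF noeth_Kb[OF N K]]) (auto simp: Y_def kerc_def)
  have KKY: "sc k z : Kb K b" if "k : K" "z : Y" for k z
   using that sc_cf[OF K] keys_sc[of k z] by (auto simp: Kb_def kerc_def Y_def)
  have xY: "submod sc (sc x ` Y)" by (rule osub_imageI[OF sadd _ Y]) (auto simp: mult.commute)
  have sub: "Kb K b <= Kb K b \<boxplus> sc x ` Y" by (rule splus_sub1[OF xY])
  have "FR d ?K Y (Kb K b \<boxplus> sc x ` Y)"
  proof (rule Suc.IH[OF noeth_mono[OF N order_refl K_mono order_refl] osub_scl_splus[OF K osub_princ] x(4,3) Y])
   show "submod sc (Kb K b \<boxplus> sc x ` Y)" by (rule osub_splus[OF sc.additive_scale osub_Kb[OF K] xY])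
   show "Kb K b \<boxplus> sc x ` Y <= Y" by (rule splus_least[OF Y KY]) (use sc.osub_scale[OF Y] in auto)
   show "noeth (range sc) Y (Kb K b \<boxplus> sc x ` Y)" by (rule noeth_mono[OF NY order_refl sub order_refl])
   show "sc k z : Kb K b \<boxplus> sc x ` Y" if k: "k : ?K" and z: "z : Y" for k z
   proof -
    obtain k' r where k: "k = k' + r * x" "k' : K" using k by (auto elim!: splusE)
    have e: "sc k z = sc k' z + sc x (sc r z)" by (simp add: k sc.scale_left_distrib mult.commute)
    show ?thesis unfolding e by (intro splusI KKY[OF k(2) z] imageI sc.osub_scale[OF Y z])
   qed
  qed
  hence F: "FR d ?K Y (Kb K b \<boxplus> sc x ` Y)" .
  have xK: "z : Kb K b" if "z : Y" "sc x z : Kb K b" for z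
   using that x(2) by (auto simp: Kb_def cf_def Y_def kerc_def)
  have "FR d K Y (Kb K b)"
   by (rule FR_lift[OF N K x(2) jx Y osub_Kb[OF K] KY NY KKY xK F])
  thus "FR d K (kerc c b V) (Kb K b)" by (simp add: Y_def)
 qed
qed

section \<open>Free resolutions\<close>

text \<open>A free resolution as data: ranks \<open>b i\<close> and generators \<open>c i\<close> of
  the successive syzygies. The first relations are taken modulo \<open>V\<close>, all later ones
  modulo \<open>K\<close>, hence the case distinction.\<close>

definition ressq where
 "ressq K W V b c \<longleftrightarrow> (\<forall>j<b 0. c 0 j : W) & W = sp sc V (c 0) {..<b 0} \<and>
  (\<forall>i. let Y = kerc (c i) (b i) (case i of 0 => V | Suc m => Kb K (b m)) in
   (\<forall>j<b (Suc i). c (Suc i) j : Y) & Y = sp sc (Kb K (b i)) (c (Suc i)) {..<b (Suc i)})"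

lemma ressq_Cons:
 assumes "\<forall>j<b0. c0 j : W" "W = sp sc V c0 {..<b0}" "ressq K (kerc c0 b0 V) (Kb K b0) b c"
 shows "ressq K W V (case_nat b0 b) (case_nat c0 c)"
 unfolding ressq_def
proof (intro conjI allI)
 fix i
 show "let Y = kerc (case i of 0 => c0 | Suc x => c x) (case i of 0 => b0 | Suc x => b x) (case i of 0 => V | Suc m => Kb K (case m of 0 => b0 | Suc x => b x))
    in (\<forall>j<case Suc i of 0 => b0 | Suc x => b x. (case Suc i of 0 => c0 | Suc x => c x) j : Y) \<and>
      Y = sp sc (Kb K (case i of 0 => b0 | Suc x => b x)) (case Suc i of 0 => c0 | Suc x => c x) {..<case Suc i of 0 => b0 | Suc x => b x}"
 proof (cases i)
  case 0
  have "(\<forall>j<b 0. c 0 j : kerc c0 b0 V) & kerc c0 b0 V = sp sc (Kb K b0) (c 0) {..<b 0}"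
   using assms(3) unfolding ressq_def by blast
  thus ?thesis unfolding 0 nat.case Let_def .
 next
  case (Suc k)
  have "let Y = kerc (c k) (b k) (case k of 0 => Kb K b0 | Suc m => Kb K (b m)) in
   (\<forall>j<b (Suc k). c (Suc k) j : Y) & Y = sp sc (Kb K (b k)) (c (Suc k)) {..<b (Suc k)}"
   using assms(3) unfolding ressq_def by blast
  thus ?thesis using Suc by (cases k) simp_all
 qed
qed (use assms in auto)

lemma kerc_gens:
 assumes N: "noeth scl UNIV K" and K: "osub scl K" and V: "submod sc V" and c: "!!j. j < b ==> c j : W"
  and KW: "!!k w. k : K ==> w : W ==> sc k w : V"
 obtains b' c' where "\<forall>j<b'. c' j : kerc c b V" "kerc c b V = sp sc (Kb K b) c' {..<b'::nat}"
proof -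
 have "noeth (range sc) (kerc c b V) (Kb K b)" by (rule noeth_mono[OF noeth_Kb[OF N K]]) (auto simp: kerc_def)
 thus thesis
  by (rule sc.noeth_fg[OF _ osub_kerc[OF V] osub_Kb[OF K] Kb_kerc[OF V c KW]]) (use that in auto)
qed

text \<open>Independent generators leave no relations, and the resolution continues by zero
  modules.\<close>

lemma ressq_trivial:
 assumes K: "osub scl K" and y: "kerc c b V = Kb K b" "\<forall>j<b. c j : W" "W = sp sc V c {..<b}"
 shows "ressq K W V (case_nat b (%_. 0)) (case_nat c (%_ _. 0))"
proof (rule ressq_Cons[OF y(2,3)])
 have 0: "kerc (%_. 0) 0 V' = {0}" "Kb K 0 = {0}" if "0 : V'" for V'
  using that osub_zero[OF K] by (auto simp: kerc_def Kb_def cf_def)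
 have Z: "0 : Kb K b" for b by (rule osub_zero[OF osub_Kb[OF K]])
 show "ressq K (kerc c b V) (Kb K b) (%_. 0) (%_ _. 0)"
  unfolding ressq_def y(1) using 0 Z by (auto simp: sp_def split: nat.split)
qed

text \<open>Generators of successive syzygies are chosen arbitrarily until the free one is reached,
  where a basis is taken and the resolution stops; this is why \<open>FR\<close> quantifies over all
  generators. The initial generators are prescribed so that degree 0 can be identified with a given
  free module.\<close>

lemma FR_ressq:
 assumes N: "noeth scl UNIV K" and K: "osub scl K"
  and "submod sc W" "submod sc V" "V <= W" "noeth (range sc) W V"
  and "!!k w. k : K ==> w : W ==> sc k w : V"
  and gens: "\<forall>j<b0. c0 j : W" "W = sp sc V c0 {..<b0}" and "FR (Suc d) K W V"
 shows "\<exists>b c. ressq K W V b c & (\<forall>i>Suc d. b i = 0) & b 0 = b0 & c 0 = c0"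
 using assms(3-)
proof (induction d arbitrary: W V b0 c0)
 case (0 W V)
 let ?Y = "kerc c0 b0 V"
 have "FR 0 K ?Y (Kb K b0)" using 0 by simp
 then obtain p y where y: "\<forall>j<p. y j : ?Y" "?Y = sp sc (Kb K b0) y {..<p}" "kerc y p (Kb K b0) <= cf K" by auto
 have KY: "sc k z : Kb K b0" if "k : K" "z : ?Y" for k z
  using that sc_cf[OF K] keys_sc[of k z] by (auto simp: Kb_def kerc_def)
 have "Kb K p <= kerc y p (Kb K b0)"
  by (rule Kb_kerc[OF osub_Kb[OF K] _ KY]) (use y in auto)
 hence "kerc y p (Kb K b0) = Kb K p" using y(3) by (auto simp: kerc_def Kb_def)
 hence "ressq K ?Y (Kb K b0) (case_nat p (%_. 0)) (case_nat y (%_ _. 0))"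
  by (rule ressq_trivial[OF K _ y(1,2)])
 hence "ressq K W V (case_nat b0 (case_nat p (%_. 0))) (case_nat c0 (case_nat y (%_ _. 0)))"
  by (rule ressq_Cons[OF 0(6,7)])
 thus ?case
  by (intro exI[of _ "case_nat b0 (case_nat p (%_. 0))"] exI[of _ "case_nat c0 (case_nat y (%_ _. 0))"])
   (auto split: nat.split)
next
 case (Suc d W V)
 let ?Y = "kerc c0 b0 V"
 have KY: "sc k z : Kb K b0" if "k : K" "z : ?Y" for k z
  using that sc_cf[OF K] keys_sc[of k z] by (auto simp: Kb_def kerc_def)
 have KbY: "Kb K b0 <= ?Y" by (rule Kb_kerc[OF Suc.prems(2) _ Suc.prems(5)]) (use Suc.prems(6) in auto)
 have F: "FR (Suc d) K ?Y (Kb K b0)"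
  using Suc.prems(6,7,8) unfolding FR.simps(2)[of "Suc d"] by blast
 have NY: "noeth (range sc) ?Y (Kb K b0)" by (rule noeth_mono[OF noeth_Kb[OF N K]]) (auto simp: kerc_def)
 obtain b1 c1 where g: "\<forall>j<b1. c1 j : ?Y" "?Y = sp sc (Kb K b0) c1 {..<b1::nat}"
  by (rule kerc_gens[OF N K Suc.prems(2) _ Suc.prems(5), of b0 c0]) (use Suc.prems(6) in auto)
 obtain b c where bc: "ressq K ?Y (Kb K b0) b c" "\<forall>i>Suc d. b i = 0"
  using Suc.IH[OF osub_kerc[OF Suc.prems(2)] osub_Kb[OF K] KbY NY KY g F] by blast
 have "ressq K W V (case_nat b0 b) (case_nat c0 c)" by (rule ressq_Cons[OF Suc.prems(6,7) bc(1)])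
 thus ?case using bc(2)
  by (intro exI[of _ "case_nat b0 b"] exI[of _ "case_nat c0 c"]) (auto split: nat.split)
qed

text \<open>Without regularity the resolution need not end, so the syzygies are chosen one after
  another by dependent choice. The state carries the rank, the generators and the submodule modulo
  which their relations are taken.\<close>

lemma ressq_exists:
 assumes N: "noeth scl UNIV K" and K: "osub scl K" and V: "submod sc V"
  and KW: "!!k w. k : K ==> w : W ==> sc k w : V"
  and gens: "\<forall>j<b0. c0 j : W" "W = sp sc V c0 {..<b0}"
 shows "\<exists>b c. ressq K W V b c & b 0 = b0 & c 0 = c0"
proof -
 define Q where "Q = (%(b :: nat, c, V :: (nat \<Rightarrow>\<^sub>0 'a) set). submod sc V \<and>
  (\<exists>W. (\<forall>j<b. c j : W) & (\<forall>k\<in>K. \<forall>w\<in>W. sc k w : V)))"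
 define R where "R = (%(b :: nat, c, V :: (nat \<Rightarrow>\<^sub>0 'a) set) (b' :: nat, c', V'). V' = Kb K b \<and>
  (\<forall>j<b'. c' j : kerc c b V) & kerc c b V = sp sc (Kb K b) c' {..<b'})"
 have "\<exists>f. \<forall>n. (Q (f n) & (n = 0 --> f n = (b0, c0, V))) & R (f n) (f (Suc n))"
 proof (rule dependent_nat_choice)
  show "\<exists>s. Q s & ((0::nat) = 0 --> s = (b0, c0, V))"
   using V KW gens(1) by (intro exI[of _ "(b0, c0, V)"]) (auto simp: Q_def)
  fix s :: "nat \<times> (nat => (nat \<Rightarrow>\<^sub>0 'a)) \<times> (nat \<Rightarrow>\<^sub>0 'a) set" and n :: nat
  assume s: "Q s & (n = 0 --> s = (b0, c0, V))"
  obtain b c V1 where sd: "s = (b, c, V1)" by (cases s)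
  obtain W where W: "submod sc V1" "!!j. j < b ==> c j : W" "!!k w. k : K ==> w : W ==> sc k w : V1"
   using s by (auto simp: Q_def sd)
  obtain b' c' where g: "\<forall>j<b'. c' j : kerc c b V1" "kerc c b V1 = sp sc (Kb K b) c' {..<b'::nat}"
   by (rule kerc_gens[OF N K W]) auto
  have "sc k w : Kb K b" if "k : K" "w : kerc c b V1" for k w
   using that sc_cf[OF K] keys_sc[of k w] by (auto simp: Kb_def kerc_def)
  hence "Q (b', c', Kb K b)"
   unfolding Q_def prod.case using g(1) osub_Kb[OF K] by blast
  thus "\<exists>s'. (Q s' & (Suc n = 0 --> s' = (b0, c0, V))) & R s s'"
   using g by (intro exI[of _ "(b', c', Kb K b)"]) (auto simp: R_def sd)
 qed
 then obtain f where f: "!!n. n = 0 --> f n = (b0, c0, V)" "!!n. R (f n) (f (Suc n))" by blast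
 define b where "b n = fst (f n)" for n
 define c where "c n = fst (snd (f n))" for n
 have f0: "f 0 = (b0, c0, V)" using f(1)[of 0] by simp
 have fn: "f n = (b n, c n, snd (snd (f n)))" for n by (simp add: b_def c_def)
 have V': "snd (snd (f i)) = (case i of 0 => V | Suc m => Kb K (b m))" for i
 proof (cases i)
  case (Suc m)
  thus ?thesis using f(2)[of m] fn[of m] fn[of "Suc m"] by (auto simp: R_def split: prod.splits)
 qed (simp add: f0)
 have "ressq K W V b c"
  unfolding ressq_def
 proof (intro conjI allI)
  show "j < b 0 --> c 0 j : W" for j using gens(1) f0 by (simp add: b_def c_def)
  show "W = sp sc V (c 0) {..<b 0}" using gens(2) f0 by (simp add: b_def c_def)
  fix i
  have "R (b i, c i, case i of 0 => V | Suc m => Kb K (b m)) (b (Suc i), c (Suc i), snd (snd (f (Suc i))))"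
   using f(2)[of i] fn[of i] fn[of "Suc i"] V'[of i] by metis
  thus "let Y = kerc (c i) (b i) (case i of 0 => V | Suc m => Kb K (b m)) in
   (\<forall>j<b (Suc i). c (Suc i) j : Y) & Y = sp sc (Kb K (b i)) (c (Suc i)) {..<b (Suc i)}"
   unfolding R_def prod.case Let_def by blast
 qed
 thus ?thesis using f0 by (intro exI[of _ b] exI[of _ c]) (auto simp: b_def c_def)
qed

definition emb :: "nat => (nat \<Rightarrow>\<^sub>0 'r::comm_ring_1) => (nat \<times> nat \<Rightarrow>\<^sub>0 'r)" where
 "emb i z = lin sc (%l. single (i, l) 1) z"

definition Bs :: "(nat => nat) => (nat \<times> nat) set" where "Bs b = {(i, j). j < b i}"

definition dl :: "(nat => nat => (nat \<Rightarrow>\<^sub>0 'r::comm_ring_1)) => nat \<times> nat => (nat \<times> nat \<Rightarrow>\<^sub>0 'r)" where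
 "dl c x = (case fst x of 0 => 0 | Suc k => emb k (c (Suc k) (snd x)))"

lemma lookup_emb: "lookup (emb i z) (k, l) = (if k = i then lookup z l else 0)"
 by (auto simp: emb_def lin_def lookup_sum lookup_single when_def in_keys_iff)

lemma keys_emb: "keys (emb i z) = Pair i ` keys z"
 by (auto simp: in_keys_iff lookup_emb split: if_splits)

lemma emb_cf: "osub scl K ==> emb i z : cf K \<longleftrightarrow> z : cf K"
 using osub_zero[of scl K] by (auto simp: cf_def lookup_emb)

lemma emb_diff: "emb i (x - y) = emb i x - emb i y"
 by (simp add: emb_def sc.lin_diff)

lemma lin_dl_emb_Suc: "lin sc (dl c) (emb (Suc k) z) = emb k (lin sc (c (Suc k)) z)"
 by (simp add: emb_def sc.lin_lin dl_def)

lemma lin_dl_emb_0: "lin sc (dl c) (emb 0 z) = 0"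
 by (simp add: emb_def sc.lin_lin dl_def) (simp add: lin_def)

lemma gr_Bs: "gr (Bs b) fst i = Pair i ` {..<b i}"
 by (auto simp: gr_def Bs_def)

lemma emb_surj:
 assumes "keys y <= gr (Bs b) fst i" obtains z where "y = emb i z" "keys z <= {..<b i}"
proof
 define z where "z = (\<Sum>l<b i. single l (lookup y (i, l)))"
 show k: "keys z <= {..<b i}" unfolding z_def by (rule sum_single_lin)
 have l: "lookup z l = lookup y (i, l)" if "l < b i" for l unfolding z_def by (rule sum_single_lin(2)[OF that])
 show "y = emb i z"
 proof (rule poly_mapping_eqI)
  fix x show "lookup y x = lookup (emb i z) x"
  proof (cases "x : gr (Bs b) fst i")
   case True
   thus ?thesis using l by (auto simp: gr_Bs lookup_emb)
  next
   case False
   hence "x ~: keys y" "x ~: keys (emb i z)" using assms k by (auto simp: keys_emb gr_Bs)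
   thus ?thesis by (simp add: in_keys_iff)
  qed
 qed
qed

lemma ressqD:
 assumes "ressq K W V b c"
 shows "j < b (Suc 0) ==> c (Suc 0) j : kerc (c 0) (b 0) V"
  "j < b (Suc (Suc i)) ==> c (Suc (Suc i)) j : kerc (c (Suc i)) (b (Suc i)) (Kb K (b i))"
  "kerc (c 0) (b 0) V = sp sc (Kb K (b 0)) (c (Suc 0)) {..<b (Suc 0)}"
  "kerc (c (Suc i)) (b (Suc i)) (Kb K (b i)) = sp sc (Kb K (b (Suc i))) (c (Suc (Suc i))) {..<b (Suc (Suc i))}"
proof -
 have *: "let Y = kerc (c i) (b i) (case i of 0 => V | Suc m => Kb K (b m)) in
   (\<forall>j<b (Suc i). c (Suc i) j : Y) & Y = sp sc (Kb K (b i)) (c (Suc i)) {..<b (Suc i)}" for i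
  using assms unfolding ressq_def by blast
 show "j < b (Suc 0) ==> c (Suc 0) j : kerc (c 0) (b 0) V"
  "kerc (c 0) (b 0) V = sp sc (Kb K (b 0)) (c (Suc 0)) {..<b (Suc 0)}"
  using *[of 0] unfolding nat.case Let_def by blast+
 show "j < b (Suc (Suc i)) ==> c (Suc (Suc i)) j : kerc (c (Suc i)) (b (Suc i)) (Kb K (b i))"
  "kerc (c (Suc i)) (b (Suc i)) (Kb K (b i)) = sp sc (Kb K (b (Suc i))) (c (Suc (Suc i))) {..<b (Suc (Suc i))}"
  using *[of "Suc i"] unfolding nat.case Let_def by blast+
qed

lemma ressq_keys: "ressq K W V b c ==> j < b (Suc k) ==> keys (c (Suc k) j) <= {..<b k}"
 using ressqD(1)[of K W V b c j] ressqD(2)[of K W V b c j "k - 1"] by (cases k) (auto simp: kerc_def)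

lemma ressq_cplx:
 assumes K: "osub scl K" and R: "ressq K W V b c"
 shows "cplx K (Bs b) fst (dl c)"
 unfolding cplx_def
proof (intro ballI conjI)
 fix x assume "x : Bs b"
 then obtain i j where x: "x = (i, j)" "j < b i" by (auto simp: Bs_def)
 show "keys (dl c x) <= {b' : Bs b. Suc (fst b') = fst x}"
  using ressq_keys[OF R, of j "i - 1"] x by (cases i) (auto simp: dl_def keys_emb Bs_def)
 show "lin sc (dl c) (dl c x) : cf K"
 proof (cases i)
  case 0
  thus ?thesis using x osub_zero[OF osub_cf[OF K]] by (simp add: dl_def)
 next
  case (Suc k)
  hence d: "dl c x = emb k (c (Suc k) j)" by (simp add: dl_def x)
  show ?thesis
  proof (cases k)
   case 0
   thus ?thesis using osub_zero[OF osub_cf[OF K]] by (simp add: d lin_dl_emb_0)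
  next
   case (Suc m)
   hence "c (Suc k) j : kerc (c (Suc m)) (b (Suc m)) (Kb K (b m))"
    using ressqD(2)[OF R, of j m] x \<open>i = Suc k\<close> by simp
   thus ?thesis using K by (simp add: d Suc lin_dl_emb_Suc emb_cf kerc_def Kb_def)
  qed
 qed
qed

lemma ressq_exct:
 assumes K: "osub scl K" and R: "ressq K W V b c"
 shows "exct K (Bs b) fst (dl c)"
 unfolding exct_def
proof (intro allI impI)
 fix i x assume x: "keys x <= gr (Bs b) fst (Suc i)" "lin sc (dl c) x : cf K"
 obtain z where z: "x = emb (Suc i) z" "keys z <= {..<b (Suc i)}" by (rule emb_surj[OF x(1)])
 have "lin sc (c (Suc i)) z : cf K" using x(2) by (simp add: z(1) lin_dl_emb_Suc emb_cf[OF K])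
 moreover have "keys (lin sc (c (Suc i)) z) <= {..<b i}"
  by (rule keys_lin) (use ressq_keys[OF R] z(2) in auto)
 ultimately have "z : kerc (c (Suc i)) (b (Suc i)) (Kb K (b i))" using z(2) by (simp add: kerc_def Kb_def)
 hence "z : sp sc (Kb K (b (Suc i))) (c (Suc (Suc i))) {..<b (Suc (Suc i))}" using ressqD(4)[OF R] by simp
 then obtain v z' where z': "v : Kb K (b (Suc i))" "keys z' <= {..<b (Suc (Suc i))}" "z = v + lin sc (c (Suc (Suc i))) z'"
  by (rule sp_lin_E)
 have "x - lin sc (dl c) (emb (Suc (Suc i)) z') = emb (Suc i) v"
  by (simp add: z(1) z'(3) lin_dl_emb_Suc flip: emb_diff)
 moreover have "emb (Suc i) v : cf K" using z'(1) K by (simp add: emb_cf Kb_def)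
 moreover have "keys (emb (Suc (Suc i)) z') <= gr (Bs b) fst (Suc (Suc i))" using z'(2) by (auto simp: keys_emb gr_Bs)
 ultimately show "\<exists>y. keys y <= gr (Bs b) fst (Suc (Suc i)) & x - lin sc (dl c) y : cf K" by metis
qed

text \<open>The homology of the complex in degree 0 is \<open>W / V\<close>: the first syzygy is
  generated by the values of the first differential and the vectors vanishing modulo
  \<open>K\<close>.\<close>

lemma ressq_H0:
 assumes K: "osub scl K" and V: "submod sc V" and R: "ressq K W V b c" and z: "keys z <= {..<b 0}"
  and KV: "!!v. v : Kb K (b 0) ==> lin sc (c 0) v : V"
 shows "lin sc (c 0) z : V \<longleftrightarrow> (\<exists>y. keys y <= gr (Bs b) fst 1 & emb 0 z - lin sc (dl c) y : cf K)"
proof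
 assume "lin sc (c 0) z : V"
 hence "z : sp sc (Kb K (b 0)) (c (Suc 0)) {..<b (Suc 0)}"
  using z ressqD(3)[OF R] by (auto simp: kerc_def)
 then obtain v z' where z': "v : Kb K (b 0)" "keys z' <= {..<b (Suc 0)}" "z = v + lin sc (c (Suc 0)) z'"
  by (rule sp_lin_E)
 have "emb 0 z - lin sc (dl c) (emb (Suc 0) z') = emb 0 v"
  by (simp add: z'(3) lin_dl_emb_Suc flip: emb_diff)
 moreover have "emb 0 v : cf K" using z'(1) K by (simp add: emb_cf Kb_def)
 moreover have "keys (emb (Suc 0) z') <= gr (Bs b) fst 1" using z'(2) by (auto simp: keys_emb gr_Bs)
 ultimately show "\<exists>y. keys y <= gr (Bs b) fst 1 & emb 0 z - lin sc (dl c) y : cf K" by metis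
next
 assume "\<exists>y. keys y <= gr (Bs b) fst 1 & emb 0 z - lin sc (dl c) y : cf K"
 then obtain y where y: "keys y <= gr (Bs b) fst (Suc 0)" "emb 0 z - lin sc (dl c) y : cf K" by auto
 obtain z' where z': "y = emb (Suc 0) z'" "keys z' <= {..<b (Suc 0)}" by (rule emb_surj[OF y(1)])
 have "z - lin sc (c (Suc 0)) z' : cf K" using y(2) by (simp add: z'(1) lin_dl_emb_Suc emb_cf[OF K] flip: emb_diff)
 moreover have "keys (lin sc (c (Suc 0)) z') <= {..<b 0}"
  by (rule keys_lin) (use ressq_keys[OF R] z'(2) in auto)
 hence "keys (z - lin sc (c (Suc 0)) z') <= {..<b 0}"
  using osub_diff[OF osub_kin[of "{..<b 0}"], of z] z by simp
 ultimately have "lin sc (c 0) (z - lin sc (c (Suc 0)) z') : V" by (intro KV) (simp add: Kb_def)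
 moreover have "lin sc (c 0) (lin sc (c (Suc 0)) z') : V"
  unfolding sc.lin_lin by (rule sc.lin_mem[OF V]) (use ressqD(1)[OF R] z'(2) in \<open>auto simp: kerc_def\<close>)
 ultimately show "lin sc (c 0) z : V" using osub_diffD[OF V] by (simp add: sc.lin_diff)
qed

section \<open>Higher homotopies\<close>

type_synonym 'x tmon = "nat multiset \<times> 'x"

text \<open>A variable acts on divided powers by removing one copy of \<open>j\<close> from the
  exponent, always with coefficient one; basis elements not involving \<open>j\<close> go to
  zero.\<close>

definition tc :: "nat => ('x tmon \<Rightarrow>\<^sub>0 'r::comm_ring_1) => ('x tmon \<Rightarrow>\<^sub>0 'r)" where
 "tc j x = Poly_Mapping.map_key (%(al, l). (add_mset j al, l)) x"

text \<open>A right inverse of \<open>tc j\<close> that commutes with the other \<open>tc i\<close>.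
  If \<open>tc j\<close> is regarded as a partial derivative, this is a choice of
  antiderivative.\<close>

definition ts :: "nat => ('x tmon \<Rightarrow>\<^sub>0 'r::comm_ring_1) => ('x tmon \<Rightarrow>\<^sub>0 'r)" where
 "ts j x = lin sc (%b. single (add_mset j (fst b), snd b) 1) x"

definition inc :: "('x \<Rightarrow>\<^sub>0 'r::comm_ring_1) => ('x tmon \<Rightarrow>\<^sub>0 'r)" where
 "inc x = lin sc (%l. single ({#}, l) 1) x"

definition res0 :: "('x tmon \<Rightarrow>\<^sub>0 'r::comm_ring_1) => ('x \<Rightarrow>\<^sub>0 'r)" where
 "res0 x = Poly_Mapping.map_key (Pair {#}) x"

lemma lookup_tc [simp]:
 fixes x :: "'x tmon \<Rightarrow>\<^sub>0 'r::comm_ring_1"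
 shows "lookup (tc j x) b = lookup x (add_mset j (fst b), snd b)"
proof -
 have "inj (%(al, l). (add_mset j al, l) :: 'x tmon)" by (auto simp: inj_def)
 from Poly_Mapping.map_key.rep_eq[OF this, of x] show ?thesis by (simp add: tc_def split: prod.split)
qed

lemma lookup_res0 [simp]:
 fixes x :: "'x tmon \<Rightarrow>\<^sub>0 'r::comm_ring_1"
 shows "lookup (res0 x) l = lookup x ({#}, l)"
proof -
 have "inj (Pair {#} :: 'x => 'x tmon)" by (auto simp: inj_def)
 from Poly_Mapping.map_key.rep_eq[OF this, of x] show ?thesis by (simp add: res0_def)
qed

lemma lookup_lin_single:
 assumes "inj g"
 shows "lookup (lin sc (%b. single (g b) 1) x) k = (if k : range g then lookup x (inv_into UNIV g k) else 0)"
proof -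
 have "lookup (lin sc (%b. single (g b) 1) x) k = (\<Sum>b\<in>keys x. if g b = k then lookup x b else 0)"
  by (simp add: lin_def lookup_sum lookup_single when_def)
 also have "\<dots> = (if k : range g then lookup x (inv_into UNIV g k) else 0)"
 proof (cases "k : range g")
  case True
  then obtain a where a: "k = g a" by blast
  have "(\<Sum>b\<in>keys x. if g b = k then lookup x b else 0) = (\<Sum>b\<in>keys x. if b = a then lookup x b else 0)"
   by (rule sum.cong) (use assms a in \<open>auto simp: inj_eq\<close>)
  also have "\<dots> = lookup x a" by (simp add: in_keys_iff)
  finally show ?thesis using True a assms by simp
 next
  case False
  hence "(\<Sum>b\<in>keys x. if g b = k then lookup x b else 0) = 0" by (intro sum.neutral) auto
  thus ?thesis using False by simp
 qed
 finally show ?thesis .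
qed

lemma lookup_ts [simp]:
 fixes x :: "'x tmon \<Rightarrow>\<^sub>0 'r::comm_ring_1"
 shows "lookup (ts j x) b = (if j \<in># fst b then lookup x (fst b - {#j#}, snd b) else 0)"
proof -
 let ?g = "%b :: 'x tmon. (add_mset j (fst b), snd b)"
 have g: "inj ?g" by (auto simp: inj_def)
 show ?thesis
 proof (cases "j \<in># fst b")
  case True
  hence "b = ?g (fst b - {#j#}, snd b)" by simp
  hence "b : range ?g" "inv_into UNIV ?g b = (fst b - {#j#}, snd b)" using inv_f_f[OF g] by (blast, metis)
  thus ?thesis using True lookup_lin_single[OF g, of x b] by (simp add: ts_def)
 next
  case False
  hence "b ~: range ?g" by auto
  thus ?thesis using False lookup_lin_single[OF g, of x b] by (simp add: ts_def)
 qed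
qed

lemma lookup_inc [simp]:
 fixes x :: "'x \<Rightarrow>\<^sub>0 'r::comm_ring_1"
 shows "lookup (inc x) b = (if fst b = {#} then lookup x (snd b) else 0)"
proof -
 have g: "inj (Pair {#} :: 'x => 'x tmon)" by (auto simp: inj_def)
 show ?thesis
  using lookup_lin_single[OF g, of x b] inv_f_f[OF g, of "snd b"] by (cases b) (auto simp: inc_def)
qed

lemma tc_ts [simp]: "tc j (ts j x) = x"
 by (rule poly_mapping_eqI) simp

lemma tc_ts_neq: "i ~= j ==> tc i (ts j x) = ts j (tc i x)"
 by (rule poly_mapping_eqI) (auto simp: diff_add_mset_swap)

lemma tc_tc: "tc i (tc j x) = tc j (tc i x)"
 by (rule poly_mapping_eqI) (simp add: add_mset_commute)

lemma tc_inc [simp]: "tc j (inc x) = 0"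
 by (rule poly_mapping_eqI) simp

lemma res0_inc [simp]: "res0 (inc x) = x"
 by (rule poly_mapping_eqI) simp

lemma tc_add: "tc j (x + y) = tc j x + tc j y" and tc_diff: "tc j (x - y) = tc j x - tc j y"
 and tc_sc: "tc j (sc r x) = sc r (tc j x)" and tc_zero [simp]: "tc j 0 = 0"
 by (rule poly_mapping_eqI; simp add: lookup_add lookup_minus)+

lemma tc_sum: "tc j (sum g A) = (\<Sum>i\<in>A. tc j (g i))"
 by (rule poly_mapping_eqI) (simp add: lookup_sum)

lemma inc_diff: "inc (x - y) = inc x - inc y"
 by (rule poly_mapping_eqI) (simp add: lookup_minus)

lemma ts_cf: "0 : J ==> x : cf J ==> ts j x : cf J"
 and inc_cf: "0 : J ==> inc z : cf J \<longleftrightarrow> z : cf J"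
 by (auto simp: cf_def dest: spec[of _ "({#}, _)"])

lemma tc_single: "tc j (single (al, l) r) = (if j \<in># al then single (al - {#j#}, l) r else 0)"
 by (rule poly_mapping_eqI) (auto simp: lookup_single when_def)

text \<open>Homogeneous elements of degree \<open>n - m\<close> in the variables below
  \<open>k\<close>. The offset is written on the other side of the equation, so that truncated
  subtraction does not arise and only 0 remains when \<open>m\<close> exceeds
  \<open>n\<close>.\<close>

definition GH :: "'x set => ('x => nat) => nat => nat => nat => ('x tmon \<Rightarrow>\<^sub>0 'r::zero) set" where
 "GH B dg k m n = {x. keys x <= {b. set_mset (fst b) <= {..<k} & snd b : B & dg (snd b) + 2 * size (fst b) + m = n}}"

lemma GH_iff: "x : GH B dg k m n \<longleftrightarrow> (\<forall>al l. lookup x (al, l) ~= 0 -->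
  set_mset al <= {..<k} & l : B & dg l + 2 * size al + m = n)"
 by (auto simp: GH_def in_keys_iff subset_iff)

lemma GH_lt: "x : GH B dg k m n ==> lookup x (add_mset j bt, l) ~= 0 ==> j < k"
 unfolding GH_iff by (metis insert_subset lessThan_iff set_mset_add_mset_insert)

lemma osub_GH: "submod sc (GH B dg k m n)"
 unfolding GH_def by (rule osub_kin)

lemma tc_GH: "x : GH B dg k m n ==> tc j x : GH B dg k (m + 2) n"
 unfolding GH_iff by (fastforce simp: algebra_simps)

lemma ts_GH: "x : GH B dg k (m + 2) n ==> j < k ==> ts j x : GH B dg k m n"
 unfolding GH_iff
proof (intro allI impI)
 fix al l assume x: "\<forall>al l. lookup x (al, l) ~= 0 --> set_mset al <= {..<k} & l : B & dg l + 2 * size al + (m + 2) = n"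
  and j: "j < k" and l: "lookup (ts j x) (al, l) ~= 0"
 hence a: "j \<in># al" "lookup x (al - {#j#}, l) ~= 0" by (auto split: if_splits)
 obtain bt where bt: "al = add_mset j bt" using a(1) by (meson mset_add)
 thus "set_mset al <= {..<k} & l : B & dg l + 2 * size al + m = n" using x a(2) j by auto
qed

lemma GH_mono: "x : GH B dg k m n ==> k <= k' ==> x : GH B dg k' m n"
 unfolding GH_iff by fastforce

lemma GH_tc_zero: "x : GH B dg k m n ==> k <= j ==> tc j x = 0"
 by (rule poly_mapping_eqI) (fastforce simp: GH_iff)

lemma GH_kernel:
 assumes x: "x : GH B dg (Suc k) m n" and t: "tc k x = 0" shows "x : GH B dg k m n"
 unfolding GH_iff
proof (intro allI impI)
 fix al l assume l: "lookup x (al, l) ~= 0"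
 hence a: "set_mset al <= {..<Suc k} & l : B & dg l + 2 * size al + m = n" using x by (auto simp: GH_iff)
 have "k \<notin># al"
 proof
  assume "k \<in># al"
  then obtain bt where "al = add_mset k bt" by (meson mset_add)
  hence "lookup (tc k x) (bt, l) ~= 0" using l by simp
  thus False using t by simp
 qed
 hence "set_mset al <= {..<k}" using a by (auto simp: less_Suc_eq)
 thus "set_mset al <= {..<k} & l : B & dg l + 2 * size al + m = n" using a by blast
qed

lemma GH_split:
 assumes x: "x : GH B dg (Suc k) m n" and t: "tc k x : cf J" and J: "osub scl J"
 obtains z where "z : GH B dg k m n" "x - z : cf J"
proof
 let ?z = "x - ts k (tc k x)"
 have "tc k ?z = 0" by (simp add: tc_diff)
 moreover have "?z : GH B dg (Suc k) m n"
  by (rule osub_diff[OF osub_GH x ts_GH[OF tc_GH[OF x]]]) simp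
 ultimately show "?z : GH B dg k m n" by (rule GH_kernel[rotated])
 show "x - ?z : cf J" using ts_cf[OF osub_zero[OF J] t] by simp
qed

lemma GH_0: assumes "x : GH B dg 0 m n" shows "x = inc (res0 x)" "keys (res0 x) <= {l\<in>B. dg l + m = n}"
proof -
 show "x = inc (res0 x)"
 proof (rule poly_mapping_eqI)
  fix b show "lookup x b = lookup (inc (res0 x)) b"
   using assms by (cases b) (auto simp: GH_iff)
 qed
 show "keys (res0 x) <= {l\<in>B. dg l + m = n}"
  using assms unfolding GH_iff by (fastforce simp: in_keys_iff)
qed

lemma inc_GH: "keys y <= {l\<in>B. dg l + m = n} ==> inc y : GH B dg k m n"
 unfolding GH_iff by (auto simp: in_keys_iff subset_iff split: if_splits)

lemma GH_all_tc:
 fixes x :: "'x tmon \<Rightarrow>\<^sub>0 'r::comm_ring_1"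
 assumes J: "osub scl J" and x: "x : GH B dg k m n" and t: "!!j. j < k ==> tc j x : cf J"
 shows "x - inc (res0 x) : cf J"
 unfolding cf_def
proof (rule CollectI, rule allI)
 fix b :: "'x tmon"
 obtain al l where b: "b = (al, l)" by (cases b)
 show "lookup (x - inc (res0 x)) b : J"
 proof (cases "al = {#} \<or> lookup x b = 0")
  case True
  thus ?thesis using osub_zero[OF J] by (auto simp: b lookup_minus)
 next
  case False
  then obtain j bt where j: "al = add_mset j bt" by (metis multiset_cases)
  hence "j < k" using GH_lt[OF x, of j bt l] False by (simp add: b)
  hence "lookup (tc j x) (bt, l) : J" using t by (auto simp: cf_def)
  thus ?thesis by (simp add: b j lookup_minus)
 qed
qed

text \<open>A Poincare lemma: the \<open>tc j\<close> act like partial derivatives, and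
  \<open>tc i (w j) = tc j (w i)\<close> is the integrability condition. The error in the new
  variable is integrated by \<open>ts\<close>, which does not disturb the variables already treated,
  because the error is constant in them.\<close>

lemma tc_extend:
 assumes "!!i j. i < k ==> j < k ==> tc i (w j) = tc j (w i)" "!!j. j < k ==> w j : GH B dg c (m + 2) n" "k <= c"
 shows "\<exists>v\<in>GH B dg c m n. \<forall>j<k. tc j v = w j"
 using assms
proof (induction k)
 case 0
 thus ?case using osub_zero[OF osub_GH] by blast
next
 case (Suc k)
 then obtain v where v: "v : GH B dg c m n" "!!j. j < k ==> tc j v = w j" by (metis Suc_leD less_SucI)
 define v' where "v' = v + ts k (w k - tc k v)"
 have "w k - tc k v : GH B dg c (m + 2) n"
  using Suc.prems(2)[of k] tc_GH[OF v(1)] by (intro osub_diff[OF osub_GH]) auto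
 hence "v' : GH B dg c m n"
  unfolding v'_def using Suc.prems(3) by (intro osub_add[OF osub_GH v(1)] ts_GH) auto
 moreover have "tc j v' = w j" if j: "j < Suc k" for j
 proof (cases "j = k")
  case True
  thus ?thesis by (simp add: v'_def tc_add)
 next
  case False
  hence jk: "j < k" using j by simp
  have "tc j (w k - tc k v) = 0"
   using Suc.prems(1)[of j k] jk v(2)[OF jk] tc_tc[of j k v] by (simp add: tc_diff)
  thus ?thesis using v(2)[OF jk] False by (simp add: v'_def tc_add tc_ts_neq) (simp add: ts_def)
 qed
 ultimately show ?case by blast
qed

text \<open>The basis element \<open>(m, b)\<close> stands for the divided power dual to the monomial \<open>t\<^sup>m\<close>, tensored with \<open>b\<close>.
 A differential on \<open>GB\<close> is sought whose square is \<open>Wf = \<Sum> f\<^sub>j t\<^sub>j\<close>, hence a complex modulo \<open>f\<close>.\<close>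

locale shamash =
 fixes K :: "'r::comm_ring_1 set" and B :: "'x set" and dg :: "'x => nat" and dd :: "'x => ('x \<Rightarrow>\<^sub>0 'r)"
  and c :: nat and f :: "nat => 'r"
 assumes K: "osub scl K" and cpl: "cplx K B dg dd" and exc: "exct K B dg dd"
  and kill: "j < c ==> b : gr B dg 0 ==> \<exists>y. keys y <= gr B dg 1 & sc (f j) (single b 1) - lin sc dd y : cf K"
begin

lemmas oK = osub_cf[OF K]

definition GB :: "('x tmon) set" where
 "GB = {b. set_mset (fst b) <= {..<c} & snd b : B}"

definition gd :: "'x tmon => nat" where "gd b = dg (snd b) + 2 * size (fst b)"

definition Wf :: "('x tmon \<Rightarrow>\<^sub>0 'r) => ('x tmon \<Rightarrow>\<^sub>0 'r)" where
 "Wf x = (\<Sum>j<c. sc (f j) (tc j x))"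

lemma tc_lin: "tc j (lin sc g x) = lin sc (%b. tc j (g b)) x"
 by (simp add: lin_def tc_sum tc_sc)

lemma lin_tc_commute:
 assumes "!!b. b : keys x ==> tc j (g b) = lin sc g (tc j (single b 1))"
 shows "tc j (lin sc g x) = lin sc g (tc j x)"
proof -
 have "tc j (lin sc g x) = lin sc (%b. tc j (g b)) x" by (rule tc_lin)
 also have "\<dots> = lin sc (%b. lin sc g (tc j (single b 1))) x" by (rule sc.lin_cong) (rule assms)
 also have "\<dots> = lin sc g (lin sc (%b. tc j (single b 1)) x)" by (simp only: sc.lin_lin)
 also have "lin sc (%b. tc j (single b 1)) x = tc j (lin sc (%b. single b 1) x)" by (simp only: tc_lin)
 finally show ?thesis by (simp add: lin_unit)
qed

lemma Wf_lin: "lin sc (%b. Wf (single b 1)) x = Wf x"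
proof -
 have "Wf (lin sc g x) = lin sc (%b. Wf (g b)) x" for g
  unfolding Wf_def tc_lin by (simp add: lin_def sc.scale_sum_right mult.commute) (rule sum.swap)
 hence "lin sc (%b. Wf (single b 1)) x = Wf (lin sc (%b. single b 1) x)" by simp
 thus ?thesis by (simp add: lin_unit)
qed

lemma lin_sq:
 assumes "!!b. b : keys x ==> lin sc g (g b) - Wf (single b 1) : cf K"
 shows "lin sc g (lin sc g x) - Wf x : cf K"
proof -
 have "lin sc (%b. lin sc g (g b) - Wf (single b 1)) x : cf K" by (rule sc.lin_mem[OF oK assms])
 thus ?thesis by (simp only: sc.lin_fun_diff Wf_lin sc.lin_lin)
qed

lemma Wf_tc: "tc i (Wf x) = Wf (tc i x)"
 by (simp add: Wf_def tc_sum tc_sc tc_tc[of i])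

lemma Wf_inc [simp]: "Wf (inc x) = 0"
 by (simp add: Wf_def)

lemma lin_inc: "lin sc g (inc x) = lin sc (%l. g ({#}, l)) x"
 by (simp add: inc_def sc.lin_lin)

lemma lin_inc': "lin sc (%l. inc (g l)) x = inc (lin sc g x)"
 unfolding inc_def by (simp only: sc.lin_lin)

lemma inc_single: "inc (single l 1) = single ({#}, l) 1"
 by (simp add: inc_def)

lemma keys_GH: "x : GH B dg c m n ==> b : keys x ==> b : GB & gd b + m = n"
 by (auto simp: GH_def GB_def gd_def)

text \<open>Recursion on the degree. Commutation with \<open>tc\<close> prescribes every
  \<open>tc j (D b)\<close>, so integration determines \<open>D b\<close> up to a part without
  variables. The remaining error in the equation for the square is, modulo \<open>K\<close>, a cycle
  without variables, and exactness of the complex on \<open>B\<close> corrects it. The components of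
  \<open>D\<close> are the higher homotopies.\<close>

lemma homotopies_exist:
 "\<exists>D. \<forall>b\<in>GB. D b : GH B dg c 1 (gd b) & (\<forall>j<c. tc j (D b) = lin sc D (tc j (single b 1))) \<and>
  lin sc D (D b) - Wf (single b 1) : cf K & (fst b = {#} --> D b = inc (dd (snd b)))"
proof -
 define P where "P D b v \<longleftrightarrow> (b : GB --> v : GH B dg c 1 (gd b) & (\<forall>j<c. tc j v = lin sc D (tc j (single b 1))) \<and>
  lin sc D v - Wf (single b 1) : cf K & (fst b = {#} --> v = inc (dd (snd b))))" for D b v
 have sGH: "single b 1 : GH B dg c 0 (gd b)" if "b : GB" for b
  using that by (auto simp: GH_def GB_def gd_def)
 have "\<exists>D. \<forall>b. P D b (D b)"
 proof (rule dependent_wf_choice[OF wf_measure[of gd]])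
  fix g h :: "'x tmon => ('x tmon \<Rightarrow>\<^sub>0 'r)" and b v
  assume gh: "!!z. (z, b) : Wellfounded.measure gd ==> g z = h z"
  have "lin sc g (tc j (single b 1)) = lin sc h (tc j (single b 1))" if "b : GB" for j
  proof (rule sc.lin_cong)
   fix z assume "z : keys (tc j (single b 1 :: _ \<Rightarrow>\<^sub>0 'r))"
   hence "gd z + (0 + 2) = gd b" using keys_GH[OF tc_GH[OF sGH[OF that]]] by blast
   thus "g z = h z" by (intro gh) simp
  qed
  moreover have "lin sc g v = lin sc h v" if "v : GH B dg c 1 (gd b)"
  proof (rule sc.lin_cong)
   fix z assume "z : keys v"
   hence "gd z + 1 = gd b" using keys_GH[OF that] by blast
   thus "g z = h z" by (intro gh) simp
  qed
  ultimately show "P g b v = P h b v" unfolding P_def by auto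
 next
  fix b D assume "!!y. (y, b) : Wellfounded.measure gd ==> P D y (D y)"
  hence IH: "P D y (D y)" if "gd y < gd b" for y using that by simp
  have "\<exists>v. P D b v" if b: "b : GB"
  proof -
   obtain al l where bl: "b = (al, l)" by (cases b)
   define n where "n = gd b"
   define e where "e = (single b 1 :: _ \<Rightarrow>\<^sub>0 'r)"
   have eGH: "e : GH B dg c 0 n" using sGH[OF b] by (simp add: e_def n_def)
   have IHk: "b' : GB" "gd b' < gd b" "P D b' (D b')" if "x : GH B dg c (Suc m) n" "b' : keys x" for x b' m
    using keys_GH[OF that] IH[of b'] by (auto simp: n_def)
   have D_tc: "tc j (lin sc D x) = lin sc D (tc j x)" if "x : GH B dg c (Suc m) n" "j < c" for x m j
    by (rule lin_tc_commute) (use IHk[OF that(1)] that(2) in \<open>auto simp: P_def\<close>)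
   have D_sq: "lin sc D (lin sc D x) - Wf x : cf K" if "x : GH B dg c (Suc m) n" for x m
    by (rule lin_sq) (use IHk[OF that] in \<open>auto simp: P_def\<close>)
   have D_GH: "lin sc D x : GH B dg c (Suc (Suc m)) n" if x: "x : GH B dg c (Suc m) n" for x m
   proof (rule sc.lin_mem[OF osub_GH])
    fix b' assume b': "b' : keys x"
    have "gd b' + Suc m = n" using keys_GH[OF x b'] by simp
    thus "D b' : GH B dg c (Suc (Suc m)) n" using IHk[OF x b'] by (auto simp: P_def GH_iff)
   qed
   have D_inc: "lin sc D (inc y) = inc (lin sc dd y)" if y: "keys y <= {l\<in>B. dg l + Suc m = n}" for y m
   proof -
    have "D ({#}, l) = inc (dd l)" if l: "l : keys y" for l
    proof -
     have l: "l : B" "dg l + Suc m = n" using l y by auto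
     have "gd ({#}, l) = dg l" by (simp add: gd_def)
     hence "gd ({#}, l) < gd b" using l(2) n_def by linarith
     hence "P D ({#}, l) (D ({#}, l))" by (rule IH)
     thus ?thesis using l by (simp add: P_def GB_def)
    qed
    hence "lin sc (%l. D ({#}, l)) y = lin sc (%l. inc (dd l)) y" by (rule sc.lin_cong)
    thus ?thesis by (simp add: lin_inc lin_inc')
   qed
   have lB: "l : B" "set_mset al <= {..<c}" using b by (auto simp: bl GB_def)
   show ?thesis
   proof (cases "al = {#}")
    case True
    hence n: "n = dg l" by (simp add: n_def bl gd_def)
    have kd: "keys (dd l) <= {l'\<in>B. dg l' + Suc 0 = n}" using cpl lB(1) unfolding cplx_def n by auto
    have eq: "e = inc (single l 1)" by (simp add: e_def bl True inc_single)
    have "lin sc D (inc (dd l)) = inc (lin sc dd (dd l))" by (rule D_inc[OF kd])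
    moreover have "inc (lin sc dd (dd l)) : cf K" using cplx_sq[OF cpl lB(1)] inc_cf[OF osub_zero[OF K]] by blast
    moreover have "inc (dd l) : GH B dg c 1 n" by (rule inc_GH) (use kd in simp)
    ultimately have "P D b (inc (dd l))"
     unfolding P_def e_def[symmetric] n_def[symmetric] by (simp add: eq bl)
    thus ?thesis by blast
   next
    case False
    define w where "w j = lin sc D (tc j e)" for j
    have te: "tc j e : GH B dg c (Suc (Suc 0)) n" for j using tc_GH[OF eGH, of j] by simp
    have "\<exists>v\<in>GH B dg c 1 n. \<forall>j<c. tc j v = w j"
    proof (rule tc_extend)
     show "tc i (w j) = tc j (w i)" if "i < c" "j < c" for i j
      by (simp add: w_def D_tc[OF te that(1)] D_tc[OF te that(2)] tc_tc[of i j])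
     show "w j : GH B dg c (1 + 2) n" if "j < c" for j
      using D_GH[OF te, of j] by (simp add: w_def numeral_3_eq_3)
    qed simp
    then obtain v0 where v0: "v0 : GH B dg c 1 n" "!!j. j < c ==> tc j v0 = w j" by blast
    have v0': "v0 : GH B dg c (Suc 0) n" using v0(1) by simp
    \<comment> \<open>The defect of the equation for the square at the integrated candidate
      \<open>v0\<close>. Every \<open>tc j u\<close> vanishes modulo \<open>K\<close> by the same
      equation in lower degrees, so only the part of \<open>u\<close> without variables
      counts.\<close>
    define u where "u = Wf e - lin sc D v0"
    have WGH: "Wf x : GH B dg c (m + 2) n" if "x : GH B dg c m n" for x m
     unfolding Wf_def by (intro osub_sum[OF osub_GH] sc.osub_scale[OF osub_GH] tc_GH that)
    have uGH: "u : GH B dg c (Suc (Suc 0)) n"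
     unfolding u_def using WGH[OF eGH] D_GH[OF v0'] by (intro osub_diff[OF osub_GH]) auto
    have tu: "tc j u : cf K" if j: "j < c" for j
    proof -
     have "tc j u = Wf (tc j e) - lin sc D (lin sc D (tc j e))"
      by (simp add: u_def tc_diff Wf_tc D_tc[OF v0' j] v0(2)[OF j] w_def)
     hence "tc j u = - (lin sc D (lin sc D (tc j e)) - Wf (tc j e))" by simp
     thus ?thesis using osub_uminus[OF oK D_sq[OF te[of j]]] by simp
    qed
    have u1: "u - inc (res0 u) : cf K" by (rule GH_all_tc[OF K uGH tu])
    have kr: "keys (res0 u) <= {l\<in>B. dg l + Suc (Suc 0) = n}"
     using uGH unfolding GH_iff by (fastforce simp: in_keys_iff)
    have "lin sc D (Wf e) = Wf v0"
    proof -
     have "lin sc D (Wf e) = (\<Sum>j<c. sc (f j) (w j))" by (simp add: Wf_def sc.lin_sum sc.lin_sc w_def)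
     also have "\<dots> = Wf v0" unfolding Wf_def by (rule sum.cong) (auto simp: v0(2))
     finally show ?thesis .
    qed
    hence "lin sc D u = - (lin sc D (lin sc D v0) - Wf v0)" by (simp add: u_def sc.lin_diff)
    hence "lin sc D u : cf K" using osub_uminus[OF oK D_sq[OF v0']] by simp
    moreover have "lin sc D (u - inc (res0 u)) : cf K" by (rule lin_sc_cf[OF K u1])
    ultimately have "lin sc D (inc (res0 u)) : cf K" using osub_diffD'[OF oK] by (simp add: sc.lin_diff)
    hence cyc: "lin sc dd (res0 u) : cf K" using D_inc[OF kr] inc_cf[OF osub_zero[OF K]] by metis
    have "\<exists>y. keys y <= {l\<in>B. dg l + Suc 0 = n} & res0 u - lin sc dd y : cf K"
    proof (cases "n <= 2")
     case True
     have "size al >= 1" using False by (simp add: Suc_le_eq nonempty_has_size)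
     hence sz: "size al = 1" "dg l = 0" "n = 2" using True by (auto simp: n_def bl gd_def)
     then obtain j where j: "al = {#j#}" by (metis size_1_singleton_mset)
     have jc: "j < c" using lB(2) j by simp
     have "lin sc D v0 : GH B dg 0 (Suc (Suc 0)) n"
      using D_GH[OF v0'] sz(3) unfolding GH_iff by auto
     moreover have tce: "tc i e = (if i = j then inc (single l 1) else 0)" for i
      by (simp add: e_def bl j tc_single inc_single)
     have w0: "w i = 0" for i
     proof -
      have "lin sc D (inc (single l 1)) = inc (lin sc dd (single l 1))"
       by (rule D_inc[of _ 1]) (use lB sz in auto)
      also have "lin sc dd (single l 1) = 0" using cplx_keys0[OF cpl, of l] lB sz by (simp add: gr_def)
      finally show ?thesis by (simp add: w_def tce) (simp add: inc_def)
     qed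
     hence "v0 : GH B dg 0 (Suc 0) n"
     proof -
      have "lookup v0 (bt, l') = 0" if "bt ~= {#}" for bt l'
      proof (rule ccontr)
       assume nz: "lookup v0 (bt, l') ~= 0"
       obtain i ga where i: "bt = add_mset i ga" using \<open>bt ~= {#}\<close> by (metis multiset_cases)
       hence "i < c" using GH_lt[OF v0(1), of i ga l'] nz by simp
       hence "lookup (tc i v0) (ga, l') = 0" using v0(2) w0 by simp
       thus False using nz i by simp
      qed
      hence "bt = {#}" if "lookup v0 (bt, l') ~= 0" for bt l' using that by blast
      thus ?thesis using v0' unfolding GH_iff by (metis empty_subsetI set_mset_empty)
     qed
     hence v0i: "v0 = inc (res0 v0)" "keys (res0 v0) <= {l\<in>B. dg l + Suc 0 = n}" by (rule GH_0)+
     have We: "Wf e = inc (sc (f j) (single l 1))"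
     proof -
      have "Wf e = (\<Sum>i<c. if i = j then sc (f i) (inc (single l 1)) else 0)"
       unfolding Wf_def by (rule sum.cong) (auto simp: tce)
      also have "\<dots> = sc (f j) (inc (single l 1))" using jc by simp
      also have "\<dots> = inc (sc (f j) (single l 1))" by (simp add: inc_def)
      finally show ?thesis .
     qed
     obtain y where y: "keys y <= gr B dg 1" "sc (f j) (single l 1) - lin sc dd y : cf K"
      using kill[OF jc, of l] lB sz by (auto simp: gr_def)
     have "u = inc (sc (f j) (single l 1) - lin sc dd (res0 v0))"
      unfolding u_def We by (subst v0i(1)) (simp add: D_inc[OF v0i(2)] inc_diff)
     hence ru: "res0 u = sc (f j) (single l 1) - lin sc dd (res0 v0)" by simp
     have "keys (y - res0 v0) <= {l\<in>B. dg l + Suc 0 = n}"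
      using osub_diff[OF osub_kin, of y "{l\<in>B. dg l + Suc 0 = n}" "res0 v0"] y(1) v0i(2) sz by (auto simp: gr_def)
     moreover have "res0 u - lin sc dd (y - res0 v0) : cf K" using y(2) by (simp add: ru sc.lin_diff)
     ultimately show ?thesis by blast
    next
     case n2: False
     define i where "i = n - 3"
     have i: "n = Suc (Suc (Suc i))" using n2 by (simp add: i_def)
     have "keys (res0 u) <= gr B dg (Suc i)" using kr i by (auto simp: gr_def)
     then obtain y where "keys y <= gr B dg (Suc (Suc i))" "res0 u - lin sc dd y : cf K"
      using exc cyc unfolding exct_def by blast
     thus ?thesis using i by (intro exI[of _ y]) (auto simp: gr_def)
    qed
    then obtain y where y: "keys y <= {l\<in>B. dg l + Suc 0 = n}" "res0 u - lin sc dd y : cf K" by blast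
    define v where "v = v0 + inc y"
    have "v : GH B dg c 1 n" unfolding v_def using inc_GH[of y B dg 1 n c] y(1) by (intro osub_add[OF osub_GH v0(1)]) auto
    moreover have "tc j v = w j" if "j < c" for j using v0(2)[OF that] by (simp add: v_def tc_add)
    moreover have "lin sc D v - Wf e : cf K"
    proof -
     have "(u - inc (res0 u)) + inc (res0 u - lin sc dd y) : cf K"
      using y(2) inc_cf[OF osub_zero[OF K]] by (intro osub_add[OF oK u1]) blast
     hence "Wf e - lin sc D v0 - inc (lin sc dd y) : cf K" by (simp add: u_def inc_diff)
     hence "- (Wf e - lin sc D v0 - inc (lin sc dd y)) : cf K" by (rule osub_uminus[OF oK])
     thus ?thesis by (simp add: v_def sc.lin_add D_inc[OF y(1)] algebra_simps)
    qed
    ultimately have "P D b v" using False unfolding P_def e_def[symmetric] n_def[symmetric] by (simp add: bl w_def)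
    thus ?thesis by blast
   qed
  qed
  thus "\<exists>v. P D b v" by (cases "b : GB") (auto simp: P_def)
 qed
 thus ?thesis unfolding P_def by blast
qed

end

section \<open>Acyclicity modulo the regular sequence\<close>

lemma GH_shift [simp]: "GH B dg k (Suc m) (Suc n) = GH B dg k m n"
 by (simp add: GH_def)

lemma GH_cut:
 assumes x: "x : GH B dg c m n" and t: "!!j. k <= j ==> j < c ==> tc j x = 0" shows "x : GH B dg k m n"
 unfolding GH_iff
proof (intro allI impI)
 fix al l assume l: "lookup x (al, l) ~= 0"
 have a: "set_mset al <= {..<c} & l : B & dg l + 2 * size al + m = n" using x l by (auto simp: GH_iff)
 have "j < k" if j: "j \<in># al" for j
 proof (rule ccontr)
  assume "\<not> j < k"
  hence "tc j x = 0" using t a j by (metis lessThan_iff not_less subset_iff)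
  moreover obtain bt where "al = add_mset j bt" using j by (meson mset_add)
  hence "lookup (tc j x) (bt, l) ~= 0" using l by simp
  ultimately show False by simp
 qed
 thus "set_mset al <= {..<k} & l : B & dg l + 2 * size al + m = n" using a by blast
qed

lemma GH_keys: "x : GH B dg k m n ==> keys y <= keys x ==> y : GH B dg k m n"
 by (auto simp: GH_def)

lemma cf_mono: "J <= J' ==> cf J <= cf J'"
 by (auto simp: cf_def)

context shamash
begin

definition Jf :: "nat => 'r set" where "Jf k = sp (*) K f {..<k}"

lemma oJf: "osub scl (Jf k)" unfolding Jf_def by (rule osub_sp_ring[OF K])
lemma oJ: "submod sc (cf (Jf k))" by (rule osub_cf[OF oJf])

lemma Jf_Suc: "Jf (Suc k) = Jf k \<boxplus> prin (f k)"
 unfolding Jf_def lessThan_Suc by (rule module.sp_insert[OF module_ring]) auto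

lemma Jf_0: "Jf 0 = K"
 by (auto simp: Jf_def sp_def)

lemma K_Jf: "K <= Jf k"
 unfolding Jf_def by (rule module.sp_base[OF module_ring])

lemma f_Jf: "j < k ==> f j : Jf k"
 unfolding Jf_def by (rule sp_ring_gen[OF K]) auto

lemma Wf_Jf: assumes "x : GH B dg k m n" "k <= c" shows "Wf x : cf (Jf k)"
 unfolding Wf_def
proof (rule osub_sum[OF oJ])
 fix j assume "j : {..<c}"
 show "sc (f j) (tc j x) : cf (Jf k)"
 proof (cases "j < k")
  case True
  thus ?thesis by (rule sc_cf[OF oJf f_Jf])
 next
  case False
  thus ?thesis using GH_tc_zero[OF assms(1), of j] osub_zero[OF oJ] by simp
 qed
qed

lemma Wf_Jf_Suc: assumes "x : GH B dg (Suc k) m n" "k < c" shows "Wf x - sc (f k) (tc k x) : cf (Jf k)"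
proof -
 have "Wf x = sc (f k) (tc k x) + (\<Sum>j\<in>{..<c} - {k}. sc (f j) (tc j x))"
  unfolding Wf_def using assms(2) by (intro sum.remove) auto
 moreover have "(\<Sum>j\<in>{..<c} - {k}. sc (f j) (tc j x)) : cf (Jf k)"
 proof (rule osub_sum[OF oJ])
  fix j assume "j : {..<c} - {k}"
  then consider "j < k" | "Suc k <= j" by fastforce
  thus "sc (f j) (tc j x) : cf (Jf k)"
  proof cases
   case 1
   thus ?thesis by (rule sc_cf[OF oJf f_Jf])
  next
   case 2
   thus ?thesis using GH_tc_zero[OF assms(1), of j] osub_zero[OF oJ] by simp
  qed
 qed
 ultimately show ?thesis by simp
qed

context
 fixes D :: "'x tmon => ('x tmon \<Rightarrow>\<^sub>0 'r)"
 assumes D: "!!b. b : GB ==> D b : GH B dg c 1 (gd b)"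
  "!!b j. b : GB ==> j < c ==> tc j (D b) = lin sc D (tc j (single b 1))"
  "!!b. b : GB ==> lin sc D (D b) - Wf (single b 1) : cf K"
  "!!l. l : B ==> D ({#}, l) = inc (dd l)"
  and regf: "!!k r. k < c ==> f k * r : Jf k ==> r : Jf k"
begin

lemma D_tc: "x : GH B dg c m n ==> j < c ==> tc j (lin sc D x) = lin sc D (tc j x)"
 by (rule lin_tc_commute) (use keys_GH D(2) in blast)

lemma D_GH: assumes x: "x : GH B dg k m n" and k: "k <= c" shows "lin sc D x : GH B dg k (Suc m) n"
proof (rule GH_cut)
 have xc: "x : GH B dg c m n" by (rule GH_mono[OF x k])
 show "lin sc D x : GH B dg c (Suc m) n"
 proof (rule sc.lin_mem[OF osub_GH])
  fix b assume "b : keys x"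
  hence b: "b : GB" "gd b + m = n" using keys_GH[OF xc] by blast+
  show "D b : GH B dg c (Suc m) n" using D(1)[OF b(1)] b(2) by (auto simp: GH_iff)
 qed
 show "tc j (lin sc D x) = 0" if "k <= j" "j < c" for j
  using D_tc[OF xc that(2)] GH_tc_zero[OF x that(1)] by simp
qed

lemma D_sq: "x : GH B dg c m n ==> lin sc D (lin sc D x) - Wf x : cf K"
 by (rule lin_sq) (use keys_GH D(3) in blast)

lemma D_sq_Jf: assumes x: "x : GH B dg (Suc k) m n" and k: "k < c"
 shows "lin sc D (lin sc D x) - sc (f k) (tc k x) : cf (Jf k)"
proof -
 have xc: "x : GH B dg c m n" by (rule GH_mono[OF x]) (use k in simp)
 have "lin sc D (lin sc D x) - Wf x : cf (Jf k)" using D_sq[OF xc] cf_mono[OF K_Jf] by blast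
 from osub_add[OF oJ this Wf_Jf_Suc[OF x k]] show ?thesis by simp
qed

lemma D_inc: "keys y <= B ==> lin sc D (inc y) = inc (lin sc dd y)"
 using sc.lin_cong[of y "%l. D ({#}, l)" "%l. inc (dd l)"] D(4) by (auto simp: lin_inc lin_inc')

lemma cancel_f: assumes "k < c" "sc (f k) x : cf (Jf k)" shows "x : cf (Jf k)"
 using assms regf by (simp add: cf_def)

lemma split_Jf:
 assumes "x : cf (Jf (Suc k))"
 obtains z u where "x = z + sc (f k) u" "z : cf (Jf k)" "keys u <= keys x"
 using cf_splus[OF oJf assms[unfolded Jf_Suc]] by metis

text \<open>Induction on the number \<open>k\<close> of elements divided out, with one variable for
  each. Write \<open>D x = z + f u\<close> with \<open>f = f k\<close>; applying \<open>D\<close>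
  again and cancelling \<open>f\<close> gives \<open>D u = tc k x\<close> modulo
  \<open>Jf k\<close>, so subtracting \<open>D (ts k u)\<close> removes the variable
  \<open>k\<close>. The rest has boundary \<open>f u2\<close> modulo \<open>Jf k\<close>, which
  \<open>D (D (ts k u2))\<close> cancels, leaving a cycle modulo \<open>Jf k\<close> to which
  induction applies.\<close>

lemma D_acyclic:
 "k <= c ==> x : GH B dg k 0 (Suc i) ==> lin sc D x : cf (Jf k) ==>
  \<exists>y\<in>GH B dg k 0 (Suc (Suc i)). x - lin sc D y : cf (Jf k)"
proof (induction k arbitrary: x i)
 case 0
 have r: "x = inc (res0 x)" "keys (res0 x) <= {l\<in>B. dg l + 0 = Suc i}" by (rule GH_0[OF 0(2)])+
 have "lin sc D (inc (res0 x)) = inc (lin sc dd (res0 x))" by (rule D_inc) (use r(2) in auto)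
 hence "inc (lin sc dd (res0 x)) : cf K" using 0(3) r(1) by (simp add: Jf_0)
 hence "lin sc dd (res0 x) : cf K" using inc_cf[OF osub_zero[OF K]] by blast
 then obtain y where y: "keys y <= gr B dg (Suc (Suc i))" "res0 x - lin sc dd y : cf K"
  using exc r(2) unfolding exct_def gr_def by fastforce
 have "lin sc D (inc y) = inc (lin sc dd y)" by (rule D_inc) (use y(1) in \<open>auto simp: gr_def\<close>)
 hence "x - lin sc D (inc y) = inc (res0 x - lin sc dd y)" using r(1) by (simp add: inc_diff)
 hence "x - lin sc D (inc y) : cf (Jf 0)" using y(2) by (simp add: Jf_0 inc_cf[OF osub_zero[OF K]])
 moreover have "inc y : GH B dg 0 0 (Suc (Suc i))" by (rule inc_GH) (use y(1) in \<open>auto simp: gr_def\<close>)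
 ultimately show ?case by blast
next
 case (Suc k)
 have k: "k < c" "k <= c" "Suc k <= c" using Suc(2) by auto
 note J = oJ[of k]
 have JS: "cf (Jf k) <= cf (Jf (Suc k))" unfolding Jf_Suc by (rule cf_mono[OF K_mono])
 have DJ: "lin sc D z : cf (Jf k)" if "z : cf (Jf k)" for z by (rule lin_sc_cf[OF oJf that])
 obtain z u where u: "lin sc D x = z + sc (f k) u" "z : cf (Jf k)" "keys u <= keys (lin sc D x)"
  by (rule split_Jf[OF Suc(4)])
 have uG: "u : GH B dg (Suc k) 0 i" using GH_keys[OF D_GH[OF Suc(3) k(3)] u(3)] by simp
 have "lin sc D (lin sc D x) - sc (f k) (tc k x) : cf (Jf k)" by (rule D_sq_Jf[OF Suc(3) k(1)])
 hence "lin sc D z + sc (f k) (lin sc D u - tc k x) : cf (Jf k)"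
  by (simp add: u(1) sc.lin_add sc.lin_sc sc.scale_right_diff_distrib add_diff_eq)
 hence "sc (f k) (lin sc D u - tc k x) : cf (Jf k)" using osub_add_iff'[OF J DJ[OF u(2)]] by blast
 hence ut: "lin sc D u - tc k x : cf (Jf k)" by (rule cancel_f[OF k(1)])
 define u' where "u' = ts k u"
 have u'G: "u' : GH B dg (Suc k) 0 (Suc (Suc i))"
  unfolding u'_def by (rule ts_GH) (use uG in simp_all)
 define x1 where "x1 = x - lin sc D u'"
 have x1G: "x1 : GH B dg (Suc k) 0 (Suc i)"
  unfolding x1_def using D_GH[OF u'G k(3)] by (intro osub_diff[OF osub_GH Suc(3)]) simp
 have "tc k x1 = - (lin sc D u - tc k x)"
  using D_tc[OF GH_mono[OF u'G k(3)] k(1)] by (simp add: x1_def tc_diff u'_def)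
 hence "tc k x1 : cf (Jf k)" using osub_uminus[OF J ut] by simp
 then obtain x' where x': "x' : GH B dg k 0 (Suc i)" "x1 - x' : cf (Jf k)" by (rule GH_split[OF x1G _ oJf])
 have "lin sc D (lin sc D u') : cf (Jf (Suc k))"
 proof -
  have "lin sc D (lin sc D u') - Wf u' : cf (Jf (Suc k))"
   using D_sq[OF GH_mono[OF u'G k(3)]] cf_mono[OF K_Jf] by blast
  thus ?thesis by (rule osub_diffD[OF oJ]) (rule Wf_Jf[OF u'G k(3)])
 qed
 hence "lin sc D x1 : cf (Jf (Suc k))"
  unfolding x1_def sc.lin_diff by (rule osub_diff[OF oJ Suc(4)])
 moreover have "lin sc D x1 - lin sc D x' : cf (Jf (Suc k))" using DJ[OF x'(2)] JS by (auto simp: sc.lin_diff)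
 ultimately have "lin sc D x' : cf (Jf (Suc k))" by (rule osub_diffD'[OF oJ, rotated])
 then obtain z2 u2 where u2: "lin sc D x' = z2 + sc (f k) u2" "z2 : cf (Jf k)" "keys u2 <= keys (lin sc D x')"
  by (rule split_Jf)
 have u2G: "u2 : GH B dg k 0 i" using GH_keys[OF D_GH[OF x'(1) k(2)] u2(3)] by simp
 have "lin sc D (lin sc D x') - Wf x' : cf (Jf k)"
  using D_sq[OF GH_mono[OF x'(1) k(2)]] cf_mono[OF K_Jf] by blast
 hence "lin sc D (lin sc D x') : cf (Jf k)" by (rule osub_diffD[OF J]) (rule Wf_Jf[OF x'(1) k(2)])
 hence "sc (f k) (lin sc D u2) : cf (Jf k)"
  using osub_add_iff'[OF J DJ[OF u2(2)]] by (simp add: u2(1) sc.lin_add sc.lin_sc)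
 hence Du2: "lin sc D u2 : cf (Jf k)" by (rule cancel_f[OF k(1)])
 define v where "v = ts k u2"
 have vG: "v : GH B dg (Suc k) 0 (Suc (Suc i))"
  unfolding v_def by (rule ts_GH) (use GH_mono[OF u2G, of "Suc k"] in simp_all)
 have DvG: "lin sc D v : GH B dg (Suc k) 0 (Suc i)" using D_GH[OF vG k(3)] by simp
 have "tc k (lin sc D v) : cf (Jf k)" using D_tc[OF GH_mono[OF vG k(3)] k(1)] Du2 by (simp add: v_def)
 then obtain v0 where v0: "v0 : GH B dg k 0 (Suc i)" "lin sc D v - v0 : cf (Jf k)" by (rule GH_split[OF DvG _ oJf])
 have "lin sc D (lin sc D v) - sc (f k) u2 : cf (Jf k)" using D_sq_Jf[OF vG k(1)] by (simp add: v_def)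
 hence "z2 - (lin sc D (lin sc D v) - sc (f k) u2) + lin sc D (lin sc D v - v0) : cf (Jf k)"
  by (rule osub_add[OF J osub_diff[OF J u2(2)] DJ[OF v0(2)]])
 hence "lin sc D (x' - v0) : cf (Jf k)" by (simp add: sc.lin_diff u2(1) algebra_simps)
 then obtain w where w: "w : GH B dg k 0 (Suc (Suc i))" "(x' - v0) - lin sc D w : cf (Jf k)"
  using Suc.IH[OF k(2) osub_diff[OF osub_GH x'(1) v0(1)]] by blast
 have "x - lin sc D (u' + v + w) = (x1 - x') + ((x' - v0) - lin sc D w) - (lin sc D v - v0)"
  by (simp add: x1_def sc.lin_add)
 also have "\<dots> : cf (Jf k)" by (rule osub_diff[OF J osub_add[OF J x'(2) w(2)] v0(2)])
 finally have "x - lin sc D (u' + v + w) : cf (Jf (Suc k))" using JS by blast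
 moreover have "u' + v + w : GH B dg (Suc k) 0 (Suc (Suc i))"
  by (rule osub_add[OF osub_GH osub_add[OF osub_GH u'G vG] GH_mono[OF w(1)]]) simp
 ultimately show ?case by blast
qed

lemma shamash_cplx: "cplx (Jf c) GB gd D"
 unfolding cplx_def
proof (intro ballI conjI)
 fix b assume b: "b : GB"
 show "keys (D b) <= {b'\<in>GB. Suc (gd b') = gd b}" using keys_GH[OF D(1)[OF b]] by auto
 have "single b 1 : GH B dg c 0 (gd b)" using b by (auto simp: GH_def GB_def gd_def)
 hence W: "Wf (single b 1) : cf (Jf c)" by (rule Wf_Jf) simp
 have "lin sc D (D b) - Wf (single b 1) : cf (Jf c)" using D(3)[OF b] cf_mono[OF K_Jf] by blast
 thus "lin sc D (D b) : cf (Jf c)" by (rule osub_diffD[OF oJ _ W])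
qed

lemma shamash_exct: "exct (Jf c) GB gd D"
 unfolding exct_def
proof (intro allI impI)
 fix i x assume x: "keys x <= gr GB gd (Suc i)" "lin sc D x : cf (Jf c)"
 have "x : GH B dg c 0 (Suc i)" using x(1) by (auto simp: GH_def GB_def gd_def gr_def subset_iff)
 then obtain y where y: "y : GH B dg c 0 (Suc (Suc i))" "x - lin sc D y : cf (Jf c)"
  using D_acyclic[OF order_refl _ x(2)] by blast
 have "keys y <= gr GB gd (Suc (Suc i))" using keys_GH[OF y(1)] by (auto simp: gr_def)
 thus "\<exists>y. keys y <= gr GB gd (Suc (Suc i)) & x - lin sc D y : cf (Jf c)" using y(2) by blast
qed

end

lemma shamash_resolution:
 assumes "!!k r. k < c ==> f k * r : Jf k ==> r : Jf k"
 shows "\<exists>D. cplx (Jf c) GB gd D & exct (Jf c) GB gd D & (\<forall>b\<in>GB. \<forall>j<c. tc j (D b) = lin sc D (tc j (single b 1))) \<and>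
  (\<forall>l\<in>B. D ({#}, l) = inc (dd l))"
proof -
 obtain D where D: "!!b. b : GB ==> D b : GH B dg c 1 (gd b)"
  "!!b j. b : GB ==> j < c ==> tc j (D b) = lin sc D (tc j (single b 1))"
  "!!b. b : GB ==> lin sc D (D b) - Wf (single b 1) : cf K"
  "!!b. b : GB ==> fst b = {#} ==> D b = inc (dd (snd b))"
  using homotopies_exist by blast
 have D4: "D ({#}, l) = inc (dd l)" if "l : B" for l using D(4)[of "({#}, l)"] that by (simp add: GB_def)
 show ?thesis
  using shamash_cplx[OF D(1,2,3) D4 assms] shamash_exct[OF D(1,2,3) D4 assms] D(2) D4 by blast
qed

end

section \<open>The Noetherian module of cochains\<close>

text \<open>The transpose of \<open>tc j\<close>. Finitely supported functions on the multiset basis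
  are polynomials with values in the target, and \<open>tdual j\<close> is multiplication by the
  variable \<open>j\<close>.\<close>

definition tdual :: "nat => ('x tmon => 'b::zero) => ('x tmon => 'b)" where
 "tdual j h b = (if j \<in># fst b then h (fst b - {#j#}, snd b) else 0)"

definition lfs :: "('b => 'c) => ('x => 'b) => ('x => 'c)" where
 "lfs w h = (%b. w (h b))"

definition pt :: "'x => 'b::zero => 'x => 'b" where
 "pt b x = (%b'. if b' = b then x else 0)"

definition fsp :: "'x set => ('x => 'b::zero) set" where
 "fsp S = {h. finite {b. h b ~= 0} & (\<forall>b. h b ~= 0 --> b : S)}"

definition valued :: "'b set => ('x => 'b) set" where
 "valued U = {h. \<forall>b. h b : U}"

lemma tdual_funpow:
 "(tdual j ^^ n) h b = (if n <= count (fst b) j then h (fst b - replicate_mset n j, snd b) else 0)"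
proof (induction n arbitrary: b)
 case (Suc n)
 show ?case
 proof (cases "j \<in># fst b")
  case True
  then obtain bt where "fst b = add_mset j bt" by (meson mset_add)
  thus ?thesis by (simp add: tdual_def[of j "(tdual j ^^ n) h"] Suc)
 next
  case False
  hence "count (fst b) j = 0" by (simp add: not_in_iff)
  thus ?thesis using False by (simp add: tdual_def[of j "(tdual j ^^ n) h"])
 qed
qed simp

lemma sum_fun_app: "(sum f S :: 'x => 'b::ab_group_add) b = (\<Sum>i\<in>S. f i b)"
 by (induction S rule: infinite_finite_induct) auto

lemma sum_pt:
 assumes "finite S" "!!b. h b ~= 0 ==> b : S"
 shows "(h :: 'x => 'b::ab_group_add) = (\<Sum>b\<in>S. pt b (h b))"
proof
 fix b
 have "(\<Sum>b'\<in>S. pt b' (h b')) b = (\<Sum>b'\<in>S. pt b' (h b') b)" by (rule sum_fun_app)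
 also have "\<dots> = (\<Sum>b'\<in>S. if b = b' then h b' else 0)" by (rule sum.cong) (auto simp: pt_def)
 also have "\<dots> = h b" using assms by auto
 finally show "h b = (\<Sum>b\<in>S. pt b (h b)) b" by simp
qed

lemma pt_fsp: "b : S ==> pt b x : fsp S"
 by (auto simp: fsp_def pt_def)

lemma pt_valued: "x : V ==> 0 : V ==> pt b x : valued V"
 by (simp add: pt_def valued_def)

lemma pt_diff: "pt b (x - y) = pt b x - pt b (y :: 'b::ab_group_add)"
 by (auto simp: pt_def)

lemma lfs_pt: "additive w ==> lfs w (pt b x) = pt b (w x)"
 by (auto simp: lfs_def pt_def additive.zero)

lemma additive_lfs: "additive w ==> additive (lfs w)"
 by (auto simp: additive_def lfs_def fun_eq_iff)

lemma additive_tdual: "additive (tdual j :: _ => (_ => 'b::ab_group_add))"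
 by (auto simp: additive_def tdual_def fun_eq_iff)

lemma lfs_tdual: "additive (w :: 'b::ab_group_add => 'b) ==> lfs w (tdual j h) = tdual j (lfs w h)"
 by (auto simp: lfs_def tdual_def fun_eq_iff additive.zero)

lemma tdual_tdual: "tdual i (tdual j h) = tdual j (tdual i h)"
 by (rule ext) (auto simp: tdual_def in_diff_count add_mset_commute)

lemma osub_fsp_valued:
 assumes U: "osub Om U" and add: "!!w. w : Om ==> additive w"
 shows "osub (lfs ` Om) (fsp S \<inter> valued U)"
proof (rule osubI)
 show "0 : fsp S \<inter> valued U" by (simp add: fsp_def valued_def osub_zero[OF U])
 show "x - y : fsp S \<inter> valued U" if xy: "x : fsp S \<inter> valued U" "y : fsp S \<inter> valued U" for x y
 proof -
  have "{b. (x - y) b ~= 0} <= {b. x b ~= 0} \<union> {b. y b ~= 0}" by auto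
  moreover have "finite ({b. x b ~= 0} \<union> {b. y b ~= 0})" using xy by (simp add: fsp_def)
  ultimately have "finite {b. (x - y) b ~= 0}" by (rule finite_subset)
  moreover have "b : S" if "(x - y) b ~= 0" for b
  proof -
   have "x b ~= 0 \<or> y b ~= 0" using that by auto
   thus ?thesis using xy by (auto simp: fsp_def)
  qed
  ultimately show ?thesis using xy osub_diff[OF U] by (simp add: fsp_def valued_def)
 qed
 show "w x : fsp S \<inter> valued U" if w: "w : lfs ` Om" and x: "x : fsp S \<inter> valued U" for w x
 proof -
  obtain v where v: "w = lfs v" "v : Om" using w by blast
  have v0: "v 0 = 0" by (rule additive.zero[OF add[OF v(2)]])
  have "{b. w x b ~= 0} <= {b. x b ~= 0}" using v0 by (auto simp: v(1) lfs_def)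
  moreover have "finite {b. x b ~= 0}" using x by (simp add: fsp_def)
  ultimately have "finite {b. w x b ~= 0}" by (rule finite_subset)
  moreover have "b : S" if "w x b ~= 0" for b
  proof -
   have "x b ~= 0" using that v0 by (auto simp: v(1) lfs_def)
   thus ?thesis using x by (auto simp: fsp_def)
  qed
  ultimately show ?thesis using x osub_op[OF U v(2)] by (simp add: v(1) lfs_def fsp_def valued_def)
 qed
qed

lemma valued_UNIV [simp]: "valued UNIV = UNIV" by (simp add: valued_def)

definition mset_basis :: "nat => 'x set => ('x tmon) set" where
 "mset_basis k B = {b. set_mset (fst b) <= {..<k} & snd b : B}"

lemma tdual_fsp:
 assumes h: "h : fsp (mset_basis k B) \<inter> valued U" and j: "j < k" and U: "(0::'b::ab_group_add) : U"
 shows "tdual j h : fsp (mset_basis k B) \<inter> valued U"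
proof -
 have sub: "{b. tdual j h b ~= 0} <= (%b. (add_mset j (fst b), snd b)) ` {b. h b ~= 0}"
 proof
  fix b assume "b : {b. tdual j h b ~= 0}"
  hence b: "j \<in># fst b" "h (fst b - {#j#}, snd b) ~= 0" by (auto simp: tdual_def split: if_splits)
  thus "b : (%b. (add_mset j (fst b), snd b)) ` {b. h b ~= 0}"
   by (intro image_eqI[of _ _ "(fst b - {#j#}, snd b)"]) simp_all
 qed
 moreover have "finite {b. h b ~= 0}" using h by (simp add: fsp_def)
 ultimately have "finite {b. tdual j h b ~= 0}" using finite_surj by blast
 moreover have "b : mset_basis k B" if nz: "tdual j h b ~= 0" for b
 proof -
  obtain b' where "b = (add_mset j (fst b'), snd b')" "h b' ~= 0" using nz sub by blast
  hence b': "b = (add_mset j (fst b'), snd b')" "b' : mset_basis k B" using h unfolding fsp_def by blast+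
  thus ?thesis using j by (simp add: mset_basis_def)
 qed
 moreover have "tdual j h b : U" for b using h U by (auto simp: tdual_def valued_def)
 ultimately show ?thesis by (auto simp: fsp_def valued_def)
qed

definition OpC :: "('b => 'b::zero) set => nat => (('x tmon => 'b) => ('x tmon => 'b)) set" where
 "OpC Om k = lfs ` Om \<union> tdual ` {..<k}"

lemma OpC_Suc: "OpC Om (Suc k) = insert (tdual k) (OpC Om k)"
 by (auto simp: OpC_def lessThan_Suc)

lemma OpC_additive: "(!!w. w : Om ==> additive w) ==> w : OpC Om k ==> additive w"
 by (auto simp: OpC_def additive_lfs additive_tdual)

lemma OpC_comm: "(!!w. w : Om ==> additive w) ==> w : OpC Om k ==> w (tdual j h) = tdual j (w h)"
 by (auto simp: OpC_def lfs_tdual) (rule tdual_tdual)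

lemma osub_OpC:
 assumes U: "osub Om U" and add: "!!w. w : Om ==> additive w" and k: "k <= m"
 shows "osub (OpC Om k) (fsp (mset_basis m B) \<inter> valued U)"
 using osub_fsp_valued[OF U add, of "mset_basis m B"] tdual_fsp[OF _ _ osub_zero[OF U], of _ m B] k
 unfolding osub_def OpC_def by fastforce

text \<open>The terms with exactly \<open>n\<close> factors of the variable \<open>k\<close> form
  \<open>(tdual k ^^ n) g\<close>, with \<open>g\<close> free of \<open>k\<close>. This is the
  leading part that the filtration in Hilbert's theorem splits off.\<close>

lemma cochain_filt:
 assumes U: "osub Om U" and add: "!!w. w : Om ==> additive w"
 shows "h : fsp (mset_basis (Suc k) B) ==> (!!b. h b ~= 0 ==> count (fst b) k < n) ==>
  h : tfilt (tdual k) (fsp (mset_basis k B)) (fsp (mset_basis (Suc k) B) \<inter> valued U) n"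
proof (induction n arbitrary: h)
 case 0
 hence "h = 0" by (auto simp: fun_eq_iff)
 thus ?case by (simp add: fsp_def valued_def osub_zero[OF U])
next
 case (Suc n)
 define g where "g b = (if k \<in># fst b then 0 else h (fst b + replicate_mset n k, snd b))" for b
 have inj: "inj (%b :: _ tmon. (fst b + replicate_mset n k, snd b))" by (auto simp: inj_def)
 have "{b. g b ~= 0} <= (%b. (fst b + replicate_mset n k, snd b)) -` {b. h b ~= 0}"
  by (auto simp: g_def)
 moreover have "finite ((%b. (fst b + replicate_mset n k, snd b)) -` {b. h b ~= 0})"
  using Suc.prems(1) by (intro finite_vimageI inj) (simp add: fsp_def)
 ultimately have "finite {b. g b ~= 0}" by (rule finite_subset)
 moreover have "b : mset_basis k B" if b: "g b ~= 0" for b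
 proof -
  have "k \<notin># fst b" "h (fst b + replicate_mset n k, snd b) ~= 0" using b by (auto simp: g_def split: if_splits)
  hence "(fst b + replicate_mset n k, snd b) : mset_basis (Suc k) B" "k \<notin># fst b"
   using Suc.prems(1) by (auto simp: fsp_def)
  thus ?thesis by (auto simp: mset_basis_def less_Suc_eq)
 qed
 ultimately have g: "g : fsp (mset_basis k B)" by (auto simp: fsp_def)
 have tg: "(tdual k ^^ n) g b = (if count (fst b) k = n then h b else 0)" for b
 proof (cases "n <= count (fst b) k")
  case True
  hence "replicate_mset n k \<subseteq># fst b" by (auto simp: subseteq_mset_def)
  hence "fst b - replicate_mset n k + replicate_mset n k = fst b" by (rule subset_mset.diff_add)
  thus ?thesis using True by (auto simp: tdual_funpow g_def in_diff_count not_in_iff simp del: not_gr_zero)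
 next
  case False
  thus ?thesis by (simp add: tdual_funpow)
 qed
 define h' where "h' = h - (tdual k ^^ n) g"
 have h'b: "h' b = (if count (fst b) k = n then 0 else h b)" for b by (simp add: h'_def tg)
 have "h' : fsp (mset_basis (Suc k) B)"
 proof -
  have "{b. h' b ~= 0} <= {b. h b ~= 0}" by (auto simp: h'b)
  thus ?thesis using Suc.prems(1) finite_subset by (fastforce simp: fsp_def)
 qed
 moreover have "count (fst b) k < n" if "h' b ~= 0" for b
 proof -
  have "count (fst b) k ~= n" "h b ~= 0" using that by (auto simp: h'b split: if_splits)
  thus ?thesis using Suc.prems(2)[of b] by simp
 qed
 ultimately have "h' : tfilt (tdual k) (fsp (mset_basis k B)) (fsp (mset_basis (Suc k) B) \<inter> valued U) n"
  by (rule Suc.IH)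
 hence "h' + (tdual k ^^ n) g : tfilt (tdual k) (fsp (mset_basis k B)) (fsp (mset_basis (Suc k) B) \<inter> valued U) (Suc n)"
  using g by (simp add: splusI)
 thus ?case by (simp add: h'_def)
qed

lemma noeth_OpC:
 assumes U: "osub Om U" and add: "!!w. w : Om ==> additive w"
  and base: "noeth (OpC Om 0) (fsp (mset_basis 0 B)) (fsp (mset_basis 0 B) \<inter> valued U)"
 shows "noeth (OpC Om k) (fsp (mset_basis k B)) (fsp (mset_basis k B) \<inter> valued U)"
proof (induction k)
 case (Suc k)
 have mono: "fsp (mset_basis k B) <= fsp (mset_basis (Suc k) B)"
  by (fastforce simp: fsp_def mset_basis_def)
 have UN: "osub Om UNIV" by (simp add: osub_def)
 show ?case
  unfolding OpC_Suc
 proof (rule noeth_adjoin[OF OpC_additive[OF add] additive_tdual OpC_comm[OF add] _ _ _ _ Suc])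
  show "osub (OpC Om k) (fsp (mset_basis k B))" using osub_OpC[OF UN add, of k k B] by simp
  show "osub (insert (tdual k) (OpC Om k)) (fsp (mset_basis (Suc k) B) \<inter> valued U)"
   using osub_OpC[OF U add, of "Suc k" "Suc k" B] by (simp add: OpC_Suc)
  show "fsp (mset_basis k B) \<inter> valued U <= fsp (mset_basis (Suc k) B) \<inter> valued U" using mono by blast
  show "fsp (mset_basis (Suc k) B) <= (\<Union>n. tfilt (tdual k) (fsp (mset_basis k B)) (fsp (mset_basis (Suc k) B) \<inter> valued U) n)"
  proof
   fix h :: "'b tmon => 'a" assume h: "h : fsp (mset_basis (Suc k) B)"
   have "finite ((%b. count (fst b) k) ` {b. h b ~= 0})" using h by (simp add: fsp_def)
   then obtain n where "\<forall>m\<in>(%b. count (fst b) k) ` {b. h b ~= 0}. m < n" using finite_nat_set_iff_bounded by blast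
   hence "count (fst b) k < n" if "h b ~= 0" for b using that by blast
   thus "h : (\<Union>n. tfilt (tdual k) (fsp (mset_basis k B)) (fsp (mset_basis (Suc k) B) \<inter> valued U) n)"
    using cochain_filt[OF U add h] by blast
  qed
 qed auto
qed (rule base)

lemma finite_msets_bounded:
 assumes "finite A" shows "finite {M. set_mset M <= A & size M <= n}"
proof (rule finite_subset)
 show "{M. set_mset M <= A & size M <= n} <= mset ` {xs. set xs <= A & length xs <= n}"
 proof
  fix M assume M: "M : {M. set_mset M <= A & size M <= n}"
  obtain xs where "M = mset xs" by (metis ex_mset)
  thus "M : mset ` {xs. set xs <= A & length xs <= n}" using M by auto
 qed
 show "finite (mset ` {xs. set xs <= A & length xs <= n})" using finite_lists_length_le[OF assms] by blast
qed

text \<open>Without variables the cochains are a finite power of the coefficient module, generated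
  by point masses of its generators.\<close>

lemma (in Modules.module) noeth_cochains_base:
 assumes N: "noeth scl UNIV J" and U: "submod scale U" and NU: "noeth (range scale) UNIV U"
  and JU: "!!k x. k : J ==> scale k x : U" and B: "finite (B :: 'x set)"
 shows "noeth (lfs ` range scale) (fsp B) (fsp B \<inter> valued U)"
proof -
 have ml: "Modules.module (%r. lfs (scale r) :: ('x => 'b) => _)"
  by unfold_locales (auto simp: lfs_def fun_eq_iff scale_right_distrib scale_left_distrib)
 have rl: "lfs ` range scale = range (%r. lfs (scale r) :: ('x => 'b) => _)" by auto
 have UN: "submod scale UNIV" by (simp add: osub_def)
 obtain p :: nat and y where y: "UNIV = sp scale U y {..<p}"
  by (rule noeth_fg[OF NU UN U]) auto
 let ?V = "fsp B \<inter> valued U" and ?y = "%(l, j). pt l (y j)"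
 have sub: "fsp B <= sp (%r. lfs (scale r)) ?V ?y (B \<times> {..<p})"
 proof
  fix h :: "'x => 'b" assume h: "h : fsp B"
  have "\<exists>u r. u : U & h l = u + (\<Sum>j<p. scale (r j) (y j))" for l
   using y by (metis UNIV_I sp_E)
  then obtain u r where ur: "!!l. u l : U" "!!l. h l = u l + (\<Sum>j<p. scale (r l j) (y j))" by metis
  have "h = (\<Sum>l\<in>B. pt l (h l))" by (rule sum_pt[OF B]) (use h in \<open>auto simp: fsp_def\<close>)
  also have "\<dots> = (\<Sum>l\<in>B. pt l (u l) + (\<Sum>j<p. lfs (scale (r l j)) (pt l (y j))))"
  proof (rule sum.cong[OF refl])
   fix l :: 'x
   have a: "additive (pt l :: 'b => _)" by (auto simp: additive_def pt_def)
   show "pt l (h l) = pt l (u l) + (\<Sum>j<p. lfs (scale (r l j)) (pt l (y j)))"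
    by (subst ur(2)) (simp add: additive.add[OF a] additive.sum[OF a] lfs_pt[OF additive_scale])
  qed
  also have "\<dots> = (\<Sum>l\<in>B. pt l (u l)) + (\<Sum>q\<in>B \<times> {..<p}. lfs (scale (case q of (l, j) => r l j)) (?y q))"
   by (simp add: sum.distrib sum.cartesian_product split_def)
  finally have e: "h = (\<Sum>l\<in>B. pt l (u l)) + (\<Sum>q\<in>B \<times> {..<p}. lfs (scale (case q of (l, j) => r l j)) (?y q))" .
  have "(\<Sum>l\<in>B. pt l (u l)) : ?V"
  proof (rule osub_sum[OF osub_fsp_valued[OF U additive_scale]])
   fix l assume "l : B"
   thus "pt l (u l) : ?V" using pt_fsp[of l B "u l"] ur(1)[of l] osub_zero[OF U] by (simp add: valued_def pt_def)
  qed
  thus "h : sp (%r. lfs (scale r)) ?V ?y (B \<times> {..<p})" by (subst e) (rule sp_I)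
 qed
 have oV: "osub (range (%r. lfs (scale r))) ?V" using osub_fsp_valued[OF U additive_scale, of B] rl by simp
 have "noeth (range (%r. lfs (scale r))) (sp (%r. lfs (scale r)) ?V ?y (B \<times> {..<p})) ?V"
 proof (rule module.noeth_sp[OF ml N oV])
  show "finite (B \<times> {..<p})" using B by simp
  show "lfs (scale k) (case q of (l, j) => pt l (y j)) : ?V" if "k : J" "q : B \<times> {..<p}" for k q
  proof -
   obtain l j where q: "q = (l, j)" "l : B" using \<open>q : B \<times> {..<p}\<close> by auto
   show ?thesis using pt_fsp[OF q(2), of "scale k (y j)"] JU[OF \<open>k : J\<close>] osub_zero[OF U]
    by (simp add: q(1) lfs_pt[OF additive_scale] valued_def) (simp add: pt_def)
  qed
 qed
 hence "noeth (range (%r. lfs (scale r))) (fsp B) ?V" by (rule noeth_mono[OF _ sub]) auto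
 thus ?thesis by (simp add: rl)
qed

lemma lin_tdual:
 fixes h :: "'x tmon => 'b::ab_group_add" and s :: "'r::comm_ring_1 => 'b => 'b"
 assumes M: "Modules.module s"
 shows "lin s (tdual j h) x = lin s h (tc j x)"
proof -
 interpret Modules.module s by (rule M)
 have "tdual j h b = lin s h (tc j (single b 1))" for b
  by (cases b) (simp add: tdual_def tc_single)
 hence "lin s (tdual j h) x = lin s h (lin sc (%b. tc j (single b 1)) x)"
  by (simp only: lin_lin) (rule lin_cong, simp)
 also have "lin sc (%b. tc j (single b 1)) x = tc j (lin sc (%b. single b 1) x)"
  unfolding lin_def[of sc] tc_sum tc_sc ..
 finally show ?thesis by (simp add: lin_unit)
qed

section \<open>Cochains on the Shamash resolution\<close>

locale cochains = shamash K B dg dd c f + Modules.module scale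
 for K :: "'r::comm_ring_1 set" and B :: "'x set" and dg dd c f and scale :: "'r => 'b => 'b::ab_group_add" +
 fixes D :: "'x tmon => ('x tmon \<Rightarrow>\<^sub>0 'r)" and U :: "'b set" and a :: "'i => 'r" and I :: "'i set"
 assumes finB: "finite B" and cD: "cplx (Jf c) GB gd D"
  and tD: "b : GB ==> j < c ==> tc j (D b) = lin sc D (tc j (single b 1))"
  and NJ: "noeth scl UNIV (Jf c)" and oU: "submod scale U"
  and JU: "k : Jf c ==> scale k x : U" and NU: "noeth (range scale) UNIV U" and finI: "finite I"
begin

abbreviation "Zf \<equiv> ifl scale a I U UNIV"

lemma oUNIV: "submod scale UNIV" by (simp add: osub_def)

sublocale base: rees "range scale" "(%i. scale (a i)) ` I" Zf U
 by (rule rees_ifl[OF NU oUNIV oU subset_UNIV finI])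

text \<open>Finite support selects the direct sum over all degrees, not the product; in each single
  degree the basis is finite.\<close>

definition CC :: "('x tmon => 'b) set" where "CC = fsp GB"

lemma GB_mset_basis: "GB = mset_basis c B"
 by (simp add: GB_def mset_basis_def)

definition cob :: "('x tmon => 'b) => ('x tmon => 'b)" where
 "cob h b = (if b : GB then lin scale h (D b) else 0)"

abbreviation "OpS \<equiv> OpC (range scale) c"

lemma keys_D: "b : GB ==> b' : keys (D b) ==> b' : GB & Suc (gd b') = gd b"
 using cD unfolding cplx_def by blast

lemma finite_GB: "finite {b\<in>GB. gd b <= n}"
proof (rule finite_subset)
 show "{b\<in>GB. gd b <= n} <= {M. set_mset M <= {..<c} & size M <= n} \<times> B"
  by (auto simp: GB_def gd_def)
 show "finite ({M. set_mset M <= {..<c} & size M <= n} \<times> B)" using finB by (simp add: finite_msets_bounded)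
qed

lemma CC_I: "(!!b. h b ~= 0 ==> b : GB & gd b <= n) ==> h : CC"
 unfolding CC_def fsp_def using finite_subset[OF _ finite_GB[of n], of "{b. h b ~= 0}"] by blast

lemma CC_bound: assumes "h : CC" obtains n where "!!b. h b ~= 0 ==> b : GB & gd b < n"
proof -
 have "finite (gd ` {b. h b ~= 0})" using assms by (simp add: CC_def fsp_def)
 then obtain n where "\<forall>m\<in>gd ` {b. h b ~= 0}. m < n" using finite_nat_set_iff_bounded by blast
 hence "b : GB & gd b < n" if "h b ~= 0" for b using that assms unfolding CC_def fsp_def by blast
 thus thesis by (rule that)
qed

lemma lin_nz: "lin scale h x ~= 0 ==> \<exists>b\<in>keys x. h b ~= 0"
 by (rule ccontr) (simp add: lin_def)

lemma cob_nz: "cob h b ~= 0 ==> b : GB & (\<exists>b'\<in>GB. h b' ~= 0 & Suc (gd b') = gd b)"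
 using lin_nz[of h "D b"] keys_D[of b] unfolding cob_def by meson

lemma cob_CC: assumes "h : CC" shows "cob h : CC"
proof -
 obtain n where n: "!!b. h b ~= 0 ==> b : GB & gd b < n" using CC_bound[OF assms] by blast
 show ?thesis by (rule CC_I[of _ n]) (use cob_nz n in fastforce)
qed

lemma additive_cob: "additive cob"
 using lin_fun_add by (auto simp: additive_def cob_def fun_eq_iff plus_fun_def)

lemma cob_valued: "submod scale V ==> h : valued V ==> cob h : valued V"
 by (auto simp: valued_def cob_def osub_zero intro: lin_mem)

lemma cob_cob: "cob (cob h) : valued U"
 unfolding valued_def
proof (rule CollectI, rule allI)
 fix b
 show "cob (cob h) b : U"
 proof (cases "b : GB")
  case True
  have "lin scale (cob h) (D b) = lin scale (%b'. lin scale h (D b')) (D b)"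
   by (rule lin_cong) (use keys_D[OF True] in \<open>auto simp: cob_def\<close>)
  also have "\<dots> = lin scale h (lin sc D (D b))" by (simp only: lin_lin)
  also have "\<dots> : U" by (rule lin_cf[OF oU cplx_sq[OF cD True] JU])
  finally show ?thesis using True by (simp add: cob_def)
 qed (simp add: cob_def osub_zero[OF oU])
qed

lemma cob_lfs: "lfs (scale r) (cob h) = cob (lfs (scale r) h)"
 by (auto simp: lfs_def cob_def fun_eq_iff lin_fun_scale)

lemma cob_tdual: assumes j: "j < c" shows "tdual j (cob h) = cob (tdual j h)"
proof
 fix b :: "'x tmon"
 obtain al l where b: "b = (al, l)" by (cases b)
 show "tdual j (cob h) b = cob (tdual j h) b"
 proof (cases "b : GB")
  case True
  have "cob (tdual j h) b = lin scale h (lin sc D (tc j (single b 1)))"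
   using True by (simp add: cob_def lin_tdual[OF module_axioms] tD[OF True j])
  moreover have "(al - {#j#}, l) : GB" using True by (auto simp: b GB_def dest: in_diffD)
  ultimately show ?thesis by (simp add: b tc_single tdual_def cob_def)
 next
  case False
  have "(al - {#j#}, l) ~: GB" if ja: "j \<in># al"
  proof -
   obtain bt where "al = add_mset j bt" using ja by (meson mset_add)
   thus ?thesis using False j by (auto simp: b GB_def)
  qed
  thus ?thesis using False by (auto simp: b tdual_def cob_def)
 qed
qed

lemma OpS_cob: "w : OpS ==> w (cob h) = cob (w h)"
 by (auto simp: OpC_def cob_lfs cob_tdual)

sublocale cochain: rees OpS "(%i. lfs (scale (a i))) ` I" "%n. CC \<inter> valued (Zf n)" "CC \<inter> valued U"
proof (rule rees.intro)
 show "w : OpS ==> additive w" for w by (rule OpC_additive[OF additive_scale])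
 show "w : (%i. lfs (scale (a i))) ` I ==> additive w" for w by (auto intro: additive_lfs additive_scale)
 show "w (v x) = v (w x)" if "w : OpS" "v : (%i. lfs (scale (a i))) ` I" for w v x
 proof -
  obtain i where v: "v = lfs (scale (a i))" using \<open>v : _\<close> by blast
  have "lfs (scale r) (lfs (scale (a i)) x) = lfs (scale (a i)) (lfs (scale r) x)" for r
   by (simp add: lfs_def mult.commute)
  thus ?thesis using \<open>w : OpS\<close> by (auto simp: v OpC_def lfs_tdual[OF additive_scale])
 qed
 show "w (v x) = v (w x)" if "w : (%i. lfs (scale (a i))) ` I" "v : (%i. lfs (scale (a i))) ` I" for w v x
  using that by (auto simp: lfs_def mult.commute)
 show "finite ((%i. lfs (scale (a i))) ` I)" using finI by simp
 show "osub OpS (CC \<inter> valued U)"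
  unfolding CC_def GB_mset_basis by (rule osub_OpC[OF oU additive_scale]) simp_all
 show "w x : CC \<inter> valued U" if "w : (%i. lfs (scale (a i))) ` I" "x : CC \<inter> valued U" for w x
  using that osub_op[OF osub_fsp_valued[OF oU additive_scale, of GB], of w x] by (auto simp: CC_def)
 show Zo: "osub OpS (CC \<inter> valued (Zf n))" for n
  unfolding CC_def GB_mset_basis by (rule osub_OpC[OF base.Z additive_scale]) simp_all
 show "CC \<inter> valued U <= CC \<inter> valued (Zf n)" for n using base.UZ[of n] by (auto simp: valued_def)
 show "w x : CC \<inter> valued (Zf (Suc n))" if wx: "w : (%i. lfs (scale (a i))) ` I" "x : CC \<inter> valued (Zf n)" for w x n
 proof -
  obtain i where i: "w = lfs (scale (a i))" "i : I" using wx(1) by blast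
  have "w x : CC"
   using wx(2) osub_op[OF osub_fsp_valued[OF oUNIV additive_scale, of GB], of w x] i(1) by (simp add: CC_def)
  moreover have "w x b : Zf (Suc n)" for b
  proof -
   have "x b : Zf n" using wx(2) unfolding valued_def by blast
   thus ?thesis using base.aZ[of "scale (a i)" "x b" n] i by (simp add: lfs_def del: ifl.simps)
  qed
  ultimately show ?thesis by (simp add: valued_def del: ifl.simps)
 qed
 show "CC \<inter> valued (Zf (Suc n)) <= C"
  if C: "osub OpS C" "CC \<inter> valued U <= C" "!!w x. w : (%i. lfs (scale (a i))) ` I ==> x : CC \<inter> valued (Zf n) ==> w x : C" for n C
 proof
  fix h assume h: "h : CC \<inter> valued (Zf (Suc n))"
  \<comment> \<open>Generation by the previous stage is checked at one basis element at a time,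
    where it is the property of the coefficient module; finite support then assembles
    \<open>h\<close> from its point masses.\<close>
  have pt: "pt b x : C" if b: "b : GB" and x: "x : Zf (Suc n)" for b x
  proof -
   have o: "submod scale {x. pt b x : C}"
   proof (rule osubI)
    have "pt b (0::'b) = 0" by (auto simp: pt_def)
    thus "0 : {x. pt b x : C}" using osub_zero[OF C(1)] by simp
    show "x - y : {x. pt b x : C}" if "x : {x. pt b x : C}" "y : {x. pt b x : C}" for x y
     using that osub_diff[OF C(1)] by (simp add: pt_diff)
    show "w x : {x. pt b x : C}" if "w : range scale" "x : {x. pt b x : C}" for w x
    proof -
     have "lfs w : OpS" using that(1) by (auto simp: OpC_def)
     hence "lfs w (pt b x) : C" using osub_op[OF C(1)] that(2) by blast
     thus ?thesis by (simp add: lfs_pt[OF additive_scale[OF that(1)]])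
    qed
   qed
   have "Zf (Suc n) <= {x. pt b x : C}"
   proof (rule base.gen[OF o])
    show "U <= {x. pt b x : C}"
    proof
     fix x assume "x : U"
     hence "pt b x : CC \<inter> valued U"
      by (intro IntI pt_valued osub_zero[OF oU]) (simp_all add: CC_def pt_fsp[OF b])
     thus "x : {x. pt b x : C}" using C(2) by blast
    qed
    show "w x : {x. pt b x : C}" if w: "w : (%i. scale (a i)) ` I" and x: "x : Zf n" for w x
    proof -
     obtain i where i: "w = scale (a i)" "i : I" using w by blast
     have "pt b x : CC \<inter> valued (Zf n)"
      by (intro IntI pt_valued[OF x osub_zero[OF base.Z]]) (simp add: CC_def pt_fsp[OF b])
     hence "lfs (scale (a i)) (pt b x) : C" using C(3) i(2) by blast
     thus ?thesis by (simp add: i(1) lfs_pt[OF additive_scale])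
    qed
   qed
   thus ?thesis using x by blast
  qed
  have "h = (\<Sum>b\<in>{b. h b ~= 0}. pt b (h b))"
   by (rule sum_pt) (use h in \<open>auto simp: CC_def fsp_def\<close>)
  also have "\<dots> : C"
   by (rule osub_sum[OF C(1)], rule pt) (use h in \<open>unfold CC_def fsp_def valued_def, blast+\<close>)
  finally show "h : C" .
 qed
 show "noeth OpS (CC \<inter> valued (Zf 0)) (CC \<inter> valued U)"
 proof -
  have inj: "mset_basis 0 B = (Pair {#}) ` B" by (auto simp: mset_basis_def)
  have "finite (mset_basis 0 B)" using finB by (simp add: inj)
  hence "noeth (lfs ` range scale) (fsp (mset_basis 0 B)) (fsp (mset_basis 0 B) \<inter> valued U)"
   using noeth_cochains_base[OF NJ oU NU JU] by blast
  hence "noeth (OpC (range scale) 0) (fsp (mset_basis 0 B)) (fsp (mset_basis 0 B) \<inter> valued U)"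
   by (simp add: OpC_def)
  hence "noeth OpS (fsp (mset_basis c B)) (fsp (mset_basis c B) \<inter> valued U)"
   using noeth_OpC[OF oU additive_scale] by blast
  thus ?thesis by (simp add: CC_def GB_mset_basis)
 qed
qed

text \<open>A class of degree \<open>i\<close> becomes the cochain \<open>x\<close> that is zero in
  all other degrees, and a bounding cochain is cut down to degree \<open>i - 1\<close> before it is
  regarded in the total module. Homogeneity of the coboundary makes the two annihilators
  agree.\<close>

lemma cochains_assp:
 assumes h: "coh scale GB gd D (Zf n) i h" and P: "primep P" "P = {a. ph a : annx scale GB gd D (Zf n) i h}"
 shows "P : assp (%a. lfs (scale (ph a))) {x : CC \<inter> valued (Zf 0). cob x : CC \<inter> valued (Zf n)}
  (cob ` (CC \<inter> valued (Zf 0)) \<boxplus> CC \<inter> valued (Zf n))"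
proof -
 have Z0: "valued (Zf 0) = UNIV" by simp
 have zZ: "0 : Zf n" by (rule osub_zero[OF base.Z])
 define x where "x b = (if b : gr GB gd i then h b else 0)" for b
 have xC: "x : CC" by (rule CC_I[of _ i]) (auto simp: x_def gr_def split: if_splits)
 have cx: "cob x : valued (Zf n)"
  unfolding valued_def
 proof (rule CollectI, rule allI)
  fix b
  show "cob x b : Zf n"
  proof (cases "b : gr GB gd (Suc i)")
   case True
   hence b: "b : GB" "gd b = Suc i" by (auto simp: gr_def)
   have "lin scale x (D b) = lin scale h (D b)"
    by (rule lin_cong) (use keys_D[OF b(1)] b(2) in \<open>auto simp: x_def gr_def\<close>)
   thus ?thesis using h True b(1) unfolding coh_def cob_def by simp
  next
   case False
   have "cob x b = 0"
   proof (rule ccontr)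
    assume "cob x b ~= 0"
    then obtain b' where b': "b : GB" "x b' ~= 0" "Suc (gd b') = gd b" using cob_nz[of x b] by blast
    hence "gd b' = i" by (auto simp: x_def gr_def split: if_splits)
    thus False using b' False by (simp add: gr_def)
   qed
   thus ?thesis using zZ by simp
  qed
 qed
 have "ph a : annx scale GB gd D (Zf n) i h \<longleftrightarrow> lfs (scale (ph a)) x : cob ` CC \<boxplus> CC \<inter> valued (Zf n)" (is "?l \<longleftrightarrow> ?r") for a
 proof
  assume ?l
  then obtain g where g: "!!b. b : gr GB gd i ==> scale (ph a) (h b) - lin scale g (D b) : Zf n" by (auto simp: annx_def)
  define y where "y b = (if b : GB & Suc (gd b) = i then g b else 0)" for b
  have yC: "y : CC" by (rule CC_I[of _ i]) (auto simp: y_def split: if_splits)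
  define z where "z = lfs (scale (ph a)) x - cob y"
  have "z : CC"
  proof -
   have o: "osub (lfs ` range scale) CC"
    using osub_fsp_valued[OF oUNIV additive_scale, of GB] by (simp add: CC_def)
   show ?thesis unfolding z_def by (rule osub_diff[OF o osub_op[OF o _ xC] cob_CC[OF yC]]) simp
  qed
  moreover have "z b : Zf n" for b
  proof (cases "b : gr GB gd i")
   case True
   hence b: "b : GB" "gd b = i" by (auto simp: gr_def)
   have "lin scale y (D b) = lin scale g (D b)"
    by (rule lin_cong) (use keys_D[OF b(1)] b(2) in \<open>auto simp: y_def gr_def\<close>)
   thus ?thesis using g[OF True] True b(1) by (simp add: z_def lfs_def x_def cob_def del: ifl.simps)
  next
   case False
   have "cob y b = 0"
   proof (rule ccontr)
    assume "cob y b ~= 0"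
    then obtain b' where b': "b : GB" "y b' ~= 0" "Suc (gd b') = gd b" using cob_nz[of y b] by blast
    hence "Suc (gd b') = i" by (auto simp: y_def split: if_splits)
    thus False using b' False by (simp add: gr_def)
   qed
   thus ?thesis using False zZ by (simp add: z_def lfs_def x_def del: ifl.simps)
  qed
  ultimately have "z : CC \<inter> valued (Zf n)" unfolding valued_def by blast
  hence "cob y + z : cob ` CC \<boxplus> CC \<inter> valued (Zf n)" by (rule splusI[OF imageI[OF yC]])
  thus ?r by (simp add: z_def)
 next
  assume ?r
  then obtain y z where yz: "lfs (scale (ph a)) x = cob y + z" "z : valued (Zf n)" by (auto elim!: splusE)
  have "scale (ph a) (h b) - lin scale y (D b) : Zf n" if b: "b : gr GB gd i" for b
  proof -
   have "scale (ph a) (h b) = cob y b + z b" using fun_cong[OF yz(1), of b] b by (simp add: lfs_def x_def)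
   moreover have "cob y b = lin scale y (D b)" using b by (simp add: cob_def gr_def)
   moreover have "z b : Zf n" using yz(2) unfolding valued_def by blast
   ultimately show ?thesis by simp
  qed
  thus ?l unfolding annx_def by blast
 qed
 hence "P = {a. lfs (scale (ph a)) x : cob ` CC \<boxplus> CC \<inter> valued (Zf n)}" using P(2) by blast
 thus ?thesis
  unfolding assp_def Z0 Int_UNIV_right
  by (intro CollectI conjI[OF P(1)] bexI[of _ x]) (use xC cx cob_CC[OF xC] in blast)+
qed

text \<open>The scalars whose primes are counted are not those over which the cochains are built.
  They act through \<open>ph\<close>, which is a ring homomorphism only modulo \<open>Jf c\<close>;
  the axioms of \<open>acts\<close> are relaxed for this reason.\<close>

theorem finite_cochain_primes:
 fixes ph :: "'c::comm_ring_1 => 'r"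
 assumes NR: "noeth scl UNIV Ka"
  and ph: "!!a b. ph (a - b) - (ph a - ph b) : Jf c" "!!a b. ph (a * b) - ph a * ph b : Jf c" "ph 1 - 1 : Jf c"
   "!!k. k : Ka ==> ph k : Jf c"
 shows "finite {P. primep P & (\<exists>n i h. coh scale GB gd D (Zf n) i h & P = {a. ph a : annx scale GB gd D (Zf n) i h})}"
proof (rule finite_subset)
 let ?s = "%a. lfs (scale (ph a)) :: ('x tmon => 'b) => _"
 show "{P. primep P & (\<exists>n i h. coh scale GB gd D (Zf n) i h & P = {a. ph a : annx scale GB gd D (Zf n) i h})}
  <= (\<Union>n. assp ?s {x : CC \<inter> valued (Zf 0). cob x : CC \<inter> valued (Zf n)}
   (cob ` (CC \<inter> valued (Zf 0)) \<boxplus> CC \<inter> valued (Zf n)))"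
  using cochains_assp by fast
 have act: "acts OpS Ka ?s (CC \<inter> valued (Zf 0)) (CC \<inter> valued U)"
  unfolding acts_def
 proof (intro conjI allI ballI)
  fix a
  show a: "?s a : OpS" by (simp add: OpC_def)
  show "additive (?s a)" by (rule additive_lfs[OF additive_scale]) simp
  show "w (?s a x) = ?s a (w x)" if "w : OpS" for w x
  proof -
   have "lfs (scale r) (?s a x) = ?s a (lfs (scale r) x)" for r by (simp add: lfs_def mult.commute)
   thus ?thesis using that by (auto simp: OpC_def lfs_tdual[OF additive_scale])
  qed
 next
  fix x assume "x : CC \<inter> valued (Zf 0)"
  hence x: "x : CC" by simp
  have o: "osub (lfs ` range scale) CC"
   using osub_fsp_valued[OF oUNIV additive_scale, of GB] by (simp add: CC_def)
  have s: "?s a x : CC" for a by (rule osub_op[OF o _ x]) simp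
  have U: "z : CC \<inter> valued U" if "z : CC" "!!b. z b : U" for z using that by (simp add: valued_def)
  show "?s (a - b) x - (?s a x - ?s b x) : CC \<inter> valued U" for a b
   by (rule U, intro osub_diff[OF o] s) (use JU[OF ph(1)] in \<open>simp add: lfs_def scale_left_diff_distrib\<close>)
  show "?s (a * b) x - ?s a (?s b x) : CC \<inter> valued U" for a b
  proof (rule U)
   show "?s (a * b) x - ?s a (?s b x) : CC" by (rule osub_diff[OF o s]) (rule osub_op[OF o _ s], simp)
   show "(?s (a * b) x - ?s a (?s b x)) b' : U" for b'
    using JU[OF ph(2)[of a b], of "x b'"] by (simp add: lfs_def scale_left_diff_distrib)
  qed
  show "?s 1 x - x : CC \<inter> valued U"
   by (rule U, rule osub_diff[OF o s x]) (use JU[OF ph(3)] in \<open>simp add: lfs_def scale_left_diff_distrib\<close>)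
  show "?s k x : CC \<inter> valued U" if "k : Ka" for k
   by (rule U[OF s]) (use JU[OF ph(4)[OF that]] in \<open>simp add: lfs_def\<close>)
 qed
 show "finite (\<Union>n. assp ?s {x : CC \<inter> valued (Zf 0). cob x : CC \<inter> valued (Zf n)}
   (cob ` (CC \<inter> valued (Zf 0)) \<boxplus> CC \<inter> valued (Zf n)))"
 proof (rule cochain.assp_cohomology[OF NR act additive_cob OpS_cob])
  show "w (cob x) = cob (w x)" if "w : (%i. lfs (scale (a i))) ` I" for w x using that cob_lfs by auto
  show "cob x : CC \<inter> valued (Zf 0)" if "x : CC \<inter> valued (Zf 0)" for x using that cob_CC by simp
  show "cob x : CC \<inter> valued U" if "x : CC \<inter> valued U" for x using that cob_CC cob_valued[OF oU] by blast
  show "cob (cob x) : CC \<inter> valued U" if "x : CC \<inter> valued (Zf 0)" for x using that cob_CC cob_cob by blast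
  show "CC \<inter> valued (Zf (Suc n)) <= CC \<inter> valued (Zf n)" for n
   using ifl_decreasing[OF oU subset_UNIV oUNIV, of a I n] unfolding valued_def by blast
 qed
qed

end

section \<open>Base change to the completion\<close>

lemma osub_modulo_image:
 assumes W: "submod s W" and Y: "submod t Y" and V: "submod sc V"
  and E: "!!x y. E (x - y) = E x - E y" "!!r x. E (s r x) = sc r (E x)"
  and D: "!!x y. D (x - y) = D x - D y" "!!r x. D (t r x) = sc r (D x)"
 shows "submod s {z\<in>W. \<exists>y\<in>Y. E z - D y : V}" (is "osub _ ?T")
proof (rule osubI)
 have "E 0 = 0" "D 0 = 0" using E(1)[of 0 0] D(1)[of 0 0] by simp_all
 thus "0 : ?T" using osub_zero[OF W] osub_zero[OF Y] osub_zero[OF V] by (auto intro!: bexI[of _ 0])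
 show "x - y : ?T" if xy: "x : ?T" "y : ?T" for x y
 proof -
  obtain v w where vw: "v : Y" "E x - D v : V" "w : Y" "E y - D w : V" using xy by blast
  have "E (x - y) - D (v - w) : V" using osub_diff[OF V vw(2,4)] by (simp add: E D algebra_simps)
  thus ?thesis using osub_diff[OF W, of x y] osub_diff[OF Y vw(1,3)] xy by blast
 qed
 show "w x : ?T" if w: "w : range s" and x: "x : ?T" for w x
 proof -
  obtain r v where r: "w = s r" "v : Y" "E x - D v : V" using w x by blast
  have "E (w x) - D (t r v) : V"
   using sc.osub_scale[OF V r(3), of r] by (simp add: r(1) E D sc.scale_right_diff_distrib)
  thus ?thesis using osub_op[OF W w, of x] osub_op[OF Y rangeI r(2)] x by blast
 qed
qed

lemma (in Modules.module) ifl_scale: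
 assumes U: "submod scale U" "U <= W" and W: "submod scale W" and y: "y : W"
  and K: "!!k. k : K ==> scale k y : U"
 shows "r : ifl (*) a J K UNIV n ==> scale r y : ifl scale a J U W n"
proof (induction n arbitrary: r)
 case 0
 thus ?case using osub_scale[OF W y] by simp
next
 case (Suc n)
 then obtain k x where r: "r = k + (\<Sum>j\<in>J. a j * x j)" "k : K" "\<forall>j\<in>J. x j : ifl (*) a J K UNIV n" by auto
 have "scale r y = scale k y + (\<Sum>j\<in>J. scale (a j) (scale (x j) y))"
  by (simp add: r(1) scale_left_distrib scale_sum_left)
 thus ?case using K[OF r(2)] Suc.IH r(3) by (auto intro!: exI[of _ "scale k y"] exI[of _ "%j. scale (x j) y"])
qed

lemma poly_mapping_sc_sum: "x = (\<Sum>b\<in>keys x. sc (lookup x b) (single b 1))"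
 using lin_unit[of x] by (simp add: lin_def)

lemma cf_ifl:
 assumes U: "submod sc U" "{z. keys z <= F} \<inter> cf K <= U" "U <= {z. keys z <= F}" and K: "osub scl K"
  and x: "keys x <= F" "x : cf (ifl (*) a J K UNIV n)"
 shows "x : ifl sc a J U {z. keys z <= F} n"
proof (subst poly_mapping_sc_sum, rule osub_sum[OF sc.osub_ifl[OF U(1) osub_kin]])
 fix b assume b: "b : keys x"
 show "sc (lookup x b) (single b 1) : ifl sc a J U {z. keys z <= F} n"
 proof (rule sc.ifl_scale[OF U(1,3) osub_kin])
  show "single b 1 : {z. keys z <= F}" using b x(1) by auto
  show "sc k (single b 1) : U" if k: "k : K" for k
  proof -
   have "keys (sc k (single b 1)) <= F" using b x(1) keys_sc[of k "single b 1"] by auto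
   thus ?thesis using sc_cf[OF K k] U(2) by blast
  qed
  show "lookup x b : ifl (*) a J K UNIV n" using x(2) unfolding cf_def by blast
 qed
qed

lemma noeth_kin:
 assumes N: "noeth scl UNIV K" and K: "osub scl K" and F: "finite F"
 shows "noeth (range sc) {z. keys z <= F} ({z. keys z <= F} \<inter> cf K)"
proof -
 let ?U = "{z. keys z <= F} \<inter> cf K"
 have U: "submod sc ?U" by (rule osub_Int[OF osub_kin osub_cf[OF K]])
 have "noeth (range sc) (sp sc ?U (%b. single b 1) F) ?U"
 proof (rule sc.noeth_sp[OF N U F])
  fix k b assume k: "k : K" "b : F"
  have "keys (sc k (single b 1)) <= F" using k(2) keys_sc[of k "single b 1"] by auto
  thus "sc k (single b 1) : ?U" using sc_cf[OF K k(1)] by blast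
 qed
 moreover have "{z. keys z <= F} <= sp sc ?U (%b. single b 1) F"
 proof
  fix z :: "'b \<Rightarrow>\<^sub>0 'a" assume "z : {z. keys z <= F}"
  hence "lin sc (%b. single b 1) z = 0 + (\<Sum>b\<in>F. sc (lookup z b) (single b 1))"
   using sc.lin_superset[OF F, of z "%b. single b 1"] by simp
  hence "z = 0 + (\<Sum>b\<in>F. sc (lookup z b) (single b 1))" by (simp only: lin_unit)
  thus "z : sp sc ?U (%b. single b 1) F" using sp_I[OF osub_zero[OF U], of sc "lookup z"] by metis
 qed
 ultimately show ?thesis by (rule noeth_mono) auto
qed

text \<open>What is used of the completion map from the ring modulo \<open>Ka\<close> to the ring
  modulo \<open>L\<close>: \<open>dense\<close> and \<open>faith\<close> say that it is surjective
  and injective modulo every power of the ideal generated by the \<open>xs j\<close>. The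
  consequences of faithful flatness that occur below are derived from this.\<close>

locale basechange =
 fixes Ka :: "'c::comm_ring_1 set" and xs :: "nat => 'c" and e :: nat and L :: "'r::comm_ring_1 set" and ph :: "'c => 'r"
 assumes Ka: "osub scl Ka" and L: "osub scl L" and NA: "noeth scl UNIV Ka" and NL: "noeth scl UNIV L"
  and ph_diff: "ph (a - b) - (ph a - ph b) : L" and ph_mult: "ph (a * b) - ph a * ph b : L"
  and ph_one: "ph 1 - 1 : L" and ph_Ka: "k : Ka ==> ph k : L"
  and dense: "\<exists>a. s - ph a : ifl (*) (%j. ph (xs j)) {..<e} L UNIV n"
  and faith: "ph a : ifl (*) (%j. ph (xs j)) {..<e} L UNIV n ==> a : ifl (*) xs {..<e} Ka UNIV n"
  and jacA: "jac Ka xs {..<e}" and jacL: "jac L (%j. ph (xs j)) {..<e}"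
begin

abbreviation "mA \<equiv> ifl (*) xs {..<e} Ka UNIV"
abbreviation "mL \<equiv> ifl (*) (%j. ph (xs j)) {..<e} L UNIV"

lemma oU: "osub scl (UNIV :: 'z::comm_ring_1 set)" by (simp add: osub_def)

lemma o_mA: "osub scl (mA n)" by (rule module.osub_ifl[OF module_ring Ka oU])
lemma o_mL: "osub scl (mL n)" by (rule module.osub_ifl[OF module_ring L oU])
lemma L_mL: "L <= mL n" by (rule module.ifl_base[OF module_ring L subset_UNIV oU])
lemma Ka_mA: "Ka <= mA n" by (rule module.ifl_base[OF module_ring Ka subset_UNIV oU])

lemma mL_antimono: "m <= n ==> mL n <= mL m"
 by (rule lift_Suc_antimono_le[of mL]) (rule module.ifl_decreasing[OF module_ring L subset_UNIV oU])

lemmas oL = osub_cf[OF L]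

lemma ph_zero: "ph 0 : L" by (rule ph_Ka[OF osub_zero[OF Ka]])

lemma ph_vimage: assumes T: "osub scl T" "L <= T" shows "osub scl {a. ph a : T}"
proof (rule idealI)
 show "0 : {a. ph a : T}" using ph_zero T by blast
 show "x - y : {a. ph a : T}" if "x : {a. ph a : T}" "y : {a. ph a : T}" for x y
  using that osub_diffD[OF T(1), of "ph (x - y)" "ph x - ph y"] ph_diff T(2) osub_diff[OF T(1)] by blast
 show "r * x : {a. ph a : T}" if "x : {a. ph a : T}" for r x
  using that osub_diffD[OF T(1), of "ph (r * x)" "ph r * ph x"] ph_mult T(2) ideal_smult[OF T(1)] by blast
qed

lemma ph_mA: "a : mA n ==> ph a : mL n"
proof (induction n arbitrary: a)
 case (Suc n)
 have "mA (Suc n) <= {a. ph a : mL (Suc n)}"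
 proof (rule module.ifl_least[OF module_ring ph_vimage[OF o_mL L_mL]])
  show "Ka <= {a. ph a : mL (Suc n)}" using ph_Ka L_mL[of "Suc n"] by blast
  show "xs j * x : {a. ph a : mL (Suc n)}" if "j : {..<e}" "x : mA n" for j x
  proof -
   have "ph (xs j) * ph x : mL (Suc n)"
    by (rule module.ifl_mult[OF module_ring L oU _ that(1) Suc.IH[OF that(2)]]) simp
   thus ?thesis using osub_diffD[OF o_mL] ph_mult L_mL[of "Suc n"] by blast
  qed
 qed
 thus ?case using Suc.prems by blast
qed simp

text \<open>An absent coefficient stays absent, whereas \<open>ph 0\<close> is zero only modulo
  \<open>L\<close>. Identities for \<open>pm\<close> therefore hold modulo
  \<open>cf L\<close>.\<close>

definition pm :: "('x \<Rightarrow>\<^sub>0 'c) => ('x \<Rightarrow>\<^sub>0 'r)" where "pm x = Poly_Mapping.map ph x"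

lemma lookup_pm: "lookup (pm x) b = (ph (lookup x b) when lookup x b ~= 0)"
 by (simp add: pm_def Poly_Mapping.map.rep_eq)

lemma pm_zero [simp]: "pm 0 = 0"
 by (rule poly_mapping_eqI) (simp add: lookup_pm)

lemma pm_mod: "lookup (pm x) b - ph (lookup x b) : L"
 using ph_zero osub_uminus[OF L, of "ph 0"] by (cases "lookup x b = 0") (simp_all add: lookup_pm osub_zero[OF L])

lemma keys_pm: "keys (pm x) <= keys x"
 by (auto simp: in_keys_iff lookup_pm)

lemma pm_mem_iff: "osub scl T ==> L <= T ==> lookup (pm x) b : T \<longleftrightarrow> ph (lookup x b) : T"
 using osub_diff_cong[of scl T "lookup (pm x) b" "ph (lookup x b)"] pm_mod[of x b] by blast

lemma pm_congI:
 assumes "!!b. ph (lookup x b) - lookup y b : L" shows "pm x - y : cf L"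
 unfolding cf_def
proof (rule CollectI, rule allI)
 fix b
 have "(lookup (pm x) b - ph (lookup x b)) + (ph (lookup x b) - lookup y b) : L"
  by (rule osub_add[OF L pm_mod assms])
 thus "lookup (pm x - y) b : L" by (simp add: lookup_minus)
qed

lemma pm_diff: "pm (x - y) - (pm x - pm y) : cf L"
proof (rule pm_congI)
 fix b
 have "ph (lookup (x - y) b) - (ph (lookup x b) - ph (lookup y b)) - ((lookup (pm x) b - ph (lookup x b)) - (lookup (pm y) b - ph (lookup y b))) : L"
  unfolding lookup_minus by (rule osub_diff[OF L ph_diff osub_diff[OF L pm_mod pm_mod]])
 thus "ph (lookup (x - y) b) - lookup (pm x - pm y) b : L" by (simp add: lookup_minus algebra_simps)
qed

lemma pm_sc: "pm (sc a x) - sc (ph a) (pm x) : cf L"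
proof (rule pm_congI)
 fix b
 have "ph (a * lookup x b) - ph a * ph (lookup x b) - ph a * (lookup (pm x) b - ph (lookup x b)) : L"
  by (rule osub_diff[OF L ph_mult ideal_smult[OF L pm_mod]])
 thus "ph (lookup (sc a x) b) - lookup (sc (ph a) (pm x)) b : L" by (simp add: algebra_simps)
qed

lemma pm_vimage:
 assumes T: "submod sc T" "cf L <= T" shows "submod sc {x. pm x : T}"
proof (rule osubI)
 show "0 : {x. pm x : T}" using osub_zero[OF T(1)] by simp
 show "x - y : {x. pm x : T}" if "x : {x. pm x : T}" "y : {x. pm x : T}" for x y
  using that osub_diffD[OF T(1), of "pm (x - y)" "pm x - pm y"] pm_diff[of x y] T(2) osub_diff[OF T(1)] by blast
 show "w x : {x. pm x : T}" if "w : range sc" "x : {x. pm x : T}" for w x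
 proof -
  obtain a where w: "w = sc a" using \<open>w : range sc\<close> by blast
  have "sc (ph a) (pm x) : T" using that(2) sc.osub_scale[OF T(1)] by blast
  thus ?thesis using osub_diffD[OF T(1) subsetD[OF T(2) pm_sc]] by (simp add: w)
 qed
qed

lemma pm_lin: "pm (lin sc g x) - lin sc (%b. pm (g b)) (pm x) : cf L"
proof -
 have sum: "pm (\<Sum>b\<in>S. h b) - (\<Sum>b\<in>S. pm (h b)) : cf L" if "finite S" for S and h :: "'d => ('e \<Rightarrow>\<^sub>0 'c)"
  using that
 proof (induction S)
  case empty
  thus ?case by (simp add: osub_zero[OF oL])
 next
  case (insert b S)
  let ?s = "\<Sum>b\<in>S. h b"
  have "pm (h b) - (pm (h b + ?s) - pm ?s) : cf L" using pm_diff[of "h b + ?s" ?s] by simp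
  from osub_diff[OF oL insert.IH this] show ?case using insert.hyps by (simp add: algebra_simps)
 qed
 have "pm (lin sc g x) - (\<Sum>b\<in>keys x. pm (sc (lookup x b) (g b))) : cf L"
  unfolding lin_def by (rule sum) simp
 moreover have "(\<Sum>b\<in>keys x. pm (sc (lookup x b) (g b)) - sc (lookup (pm x) b) (pm (g b))) : cf L"
 proof (rule osub_sum[OF oL])
  fix b
  have "sc (lookup (pm x) b - ph (lookup x b)) (pm (g b)) : cf L" by (rule sc_cf[OF L pm_mod])
  from osub_diff[OF oL pm_sc[of "lookup x b" "g b"] this]
  show "pm (sc (lookup x b) (g b)) - sc (lookup (pm x) b) (pm (g b)) : cf L"
   by (simp add: sc.scale_left_diff_distrib)
 qed
 ultimately have "pm (lin sc g x) - (\<Sum>b\<in>keys x. pm (sc (lookup x b) (g b))) +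
  (\<Sum>b\<in>keys x. pm (sc (lookup x b) (g b)) - sc (lookup (pm x) b) (pm (g b))) : cf L" by (rule osub_add[OF oL])
 moreover have "lin sc (%b. pm (g b)) (pm x) = (\<Sum>b\<in>keys x. sc (lookup (pm x) b) (pm (g b)))"
  by (rule sc.lin_superset[OF finite_keys keys_pm])
 ultimately show ?thesis by (simp add: sum_subtractf)
qed

lemma pm_cf: "(!!a. a : J ==> ph a : T) ==> osub scl T ==> L <= T ==> x : cf J ==> pm x : cf T"
 by (simp add: cf_def pm_mem_iff)

lemma pm_Ka: "x : cf Ka ==> pm x : cf L"
 by (rule pm_cf[OF ph_Ka L order_refl])

lemma pm_unit: "pm (single b 1) - single b 1 : cf L"
 by (rule pm_congI) (auto simp: lookup_single when_def ph_one ph_zero)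

lemma pm_faith: "pm x : cf (mL n) ==> x : cf (mA n)"
 using faith by (simp add: cf_def pm_mem_iff[OF o_mL L_mL] del: ifl.simps)

lemma cf_L_mL: "cf L <= cf (mL n)"
 by (rule cf_mono[OF L_mL])

lemma pm_approx: "\<exists>y. keys y <= keys x & x - pm y : cf (mL n)"
proof -
 have "\<forall>s. \<exists>a. s - ph a : mL n" using dense by (rule allI)
 from choice[OF this] obtain al where al: "!!s. s - ph (al s) : mL n" by blast
 define y where "y = (\<Sum>b\<in>keys x. single b (al (lookup x b)))"
 have ly: "lookup y b = (if b : keys x then al (lookup x b) else 0)" for b
  by (simp add: y_def lookup_sum lookup_single when_def)
 have "keys y <= keys x" by (auto simp: in_keys_iff[of _ y] ly split: if_splits)
 moreover have "lookup (x - pm y) b : mL n" for b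
 proof -
  have "lookup x b - ph (lookup y b) : mL n"
  proof (cases "b : keys x")
   case True
   thus ?thesis using al by (simp add: ly del: ifl.simps)
  next
   case False
   thus ?thesis using osub_uminus[OF o_mL, of "ph 0"] ph_zero L_mL[of n] by (auto simp: ly in_keys_iff simp del: ifl.simps)
  qed
  from osub_diff[OF o_mL this subsetD[OF L_mL pm_mod[of y b]]] show ?thesis by (simp add: lookup_minus del: ifl.simps)
 qed
 ultimately show ?thesis unfolding cf_def by blast
qed

lemma basechange_cplx:
 assumes C: "cplx Ka B dg dd" shows "cplx L B dg (%b. pm (dd b))"
 unfolding cplx_def
proof (intro ballI conjI)
 fix b assume b: "b : B"
 show "keys (pm (dd b)) <= {b'\<in>B. Suc (dg b') = dg b}" using C b keys_pm[of "dd b"] unfolding cplx_def by blast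
 show "lin sc (%b. pm (dd b)) (pm (dd b)) : cf L"
  using osub_diffD'[OF oL pm_lin pm_Ka[OF cplx_sq[OF C b]]] .
qed

text \<open>A cycle \<open>x\<close> is approximated by a vector \<open>xk\<close> over the smaller
  ring. The boundary of \<open>xk\<close> is small, hence by Artin-Rees the boundary of a small
  \<open>w\<close>, and exactness applies to \<open>xk - w\<close>. So \<open>x\<close> is a
  boundary up to every power of the ideal, and Krull's intersection theorem removes the
  error.\<close>

lemma basechange_exct:
 fixes dd :: "'x => ('x \<Rightarrow>\<^sub>0 'c)"
 assumes C: "cplx Ka B dg dd" and ex: "exct Ka B dg dd" and fin: "!!i. finite (gr B dg i)"
 shows "exct L B dg (%b. pm (dd b))"
 unfolding exct_def
proof (intro allI impI)
 fix i and x :: "'x \<Rightarrow>\<^sub>0 'r"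
 let ?d = "lin sc (%b. pm (dd b))" and ?F0 = "gr B dg i" and ?F1 = "gr B dg (Suc i)" and ?F2 = "gr B dg (Suc (Suc i))"
 assume x: "keys x <= ?F1" "?d x : cf L"
 note oKa = osub_cf[OF Ka]
 note C' = basechange_cplx[OF C]
 define W0 where "W0 = {z :: 'x \<Rightarrow>\<^sub>0 'c. keys z <= ?F0}"
 define U0 where "U0 = W0 \<inter> cf Ka"
 have oW0: "submod sc W0" unfolding W0_def by (rule osub_kin)
 have oU0: "submod sc U0" unfolding U0_def by (rule osub_Int[OF oW0 oKa])
 have NW0: "noeth (range sc) W0 U0" unfolding U0_def W0_def by (rule noeth_kin[OF NA Ka fin])
 have U0W0: "U0 <= W0" by (simp add: U0_def)
 interpret R: rees "range sc" "(%j. sc (xs j)) ` {..<e}" "ifl sc xs {..<e} U0 W0" U0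
  by (rule sc.rees_ifl[OF NW0 oW0 oU0 U0W0]) simp
 define E where "E j = {z\<in>W0. \<exists>w. keys w <= ?F1 & w : cf (mA j) & z - lin sc dd w : cf Ka}" for j
 have oE: "submod sc (E j)" for j
  using osub_modulo_image[OF oW0 osub_Int[OF osub_kin[of ?F1] osub_cf[OF o_mA[of j]]] oKa, of "%x. x" "lin sc dd"]
  by (simp add: E_def sc.lin_diff sc.lin_sc Bex_def conj_assoc)
 have U0E: "U0 <= E j" for j
 proof
  fix z assume "z : U0"
  thus "z : E j" using osub_zero[OF osub_cf[OF o_mA[of j]]] unfolding E_def U0_def
   by (intro CollectI conjI exI[of _ 0]) simp_all
 qed
 have E0: "z : E 0 \<longleftrightarrow> z : W0 & (\<exists>w. keys w <= ?F1 & z - lin sc dd w : cf Ka)" for z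
  by (auto simp: E_def cf_def)
 have aE: "w z : E (Suc j)" if w: "w : (%j. sc (xs j)) ` {..<e}" and z: "z : E j" for w z j
 proof -
  obtain t where t: "w = sc (xs t)" "t : {..<e}" using w by blast
  obtain v where v: "keys v <= ?F1" "v : cf (mA j)" "z - lin sc dd v : cf Ka" using z unfolding E_def by blast
  have "w z - lin sc dd (sc (xs t) v) : cf Ka"
   using sc.osub_scale[OF oKa v(3), of "xs t"] by (simp add: t(1) sc.lin_sc sc.scale_right_diff_distrib)
  moreover have "keys (sc (xs t) v) <= ?F1" using keys_sc[of "xs t" v] v(1) by blast
  moreover have "sc (xs t) v : cf (mA (Suc j))"
   unfolding cf_def
  proof (rule CollectI, rule allI)
   fix b
   have "lookup v b : mA j" using v(2) unfolding cf_def by blast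
   hence "xs t * lookup v b : mA (Suc j)" by (rule module.ifl_mult[OF module_ring Ka oU _ t(2), rotated]) simp
   thus "lookup (sc (xs t) v) b : mA (Suc j)" by (simp del: ifl.simps)
  qed
  moreover have "w z : W0" using sc.osub_scale[OF oW0] z unfolding E_def t(1) by blast
  ultimately show ?thesis unfolding E_def by blast
 qed
 have EE: "E (Suc j) <= E j" for j
  using cf_mono[OF module.ifl_decreasing[OF module_ring Ka subset_UNIV oU, of xs "{..<e}" j]] unfolding E_def by blast
 have aE0: "w z : E 0" if "w : (%j. sc (xs j)) ` {..<e}" "z : E 0" for w z
  using aE[OF that] EE[of 0] by blast
 obtain c0 where c0: "!!n C. n >= c0 ==> submod sc C ==> U0 <= C ==>
   (!!w z. w : (%j. sc (xs j)) ` {..<e} ==> z : ifl sc xs {..<e} U0 W0 n \<inter> E 0 ==> w z : C) ==>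
   ifl sc xs {..<e} U0 W0 (Suc n) \<inter> E 0 <= C"
  by (rule R.artin_rees[OF oE[of 0] U0E[of 0]]) (auto intro: aE0)
 have AR: "ifl sc xs {..<e} U0 W0 (c0 + j) \<inter> E 0 <= E j" for j
 proof (induction j)
  case (Suc j)
  have "ifl sc xs {..<e} U0 W0 (Suc (c0 + j)) \<inter> E 0 <= E (Suc j)"
  proof (rule c0)
   show "w z : E (Suc j)" if "w : (%j. sc (xs j)) ` {..<e}" "z : ifl sc xs {..<e} U0 W0 (c0 + j) \<inter> E 0" for w z
    by (rule aE[OF that(1)]) (use that(2) Suc in blast)
  qed (simp_all add: oE U0E)
  thus ?case by (simp del: ifl.simps)
 qed blast
 define W where "W = {z :: 'x \<Rightarrow>\<^sub>0 'r. keys z <= ?F1}"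
 define U where "U = {z\<in>W. \<exists>y. keys y <= ?F2 & z - ?d y : cf L}"
 have oW: "submod sc W" unfolding W_def by (rule osub_kin)
 have oUU: "submod sc U"
  using osub_modulo_image[OF oW osub_kin[of ?F2] oL, of "%x. x" ?d] by (simp add: U_def sc.lin_diff sc.lin_sc)
 have WLU: "W \<inter> cf L <= U"
 proof
  fix z assume "z : W \<inter> cf L"
  thus "z : U" unfolding U_def by (intro CollectI conjI exI[of _ 0]) simp_all
 qed
 have UW: "U <= W" unfolding U_def by blast
 have "x : ifl sc (%j. ph (xs j)) {..<e} U W k" for k
 proof -
  obtain xk where xk: "keys xk <= keys x" "x - pm xk : cf (mL (c0 + k))" using pm_approx[of x "c0 + k"] by blast
  have kxk: "keys xk <= ?F1" using xk(1) x(1) by blast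
  define y where "y = lin sc dd xk"
  note om = osub_cf[OF o_mL[of "c0 + k"]]
  have "?d (x - pm xk) : cf (mL (c0 + k))" by (rule lin_sc_cf[OF o_mL xk(2)])
  hence "?d x - ?d (pm xk) : cf (mL (c0 + k))" by (simp only: sc.lin_diff)
  hence "?d (pm xk) : cf (mL (c0 + k))" using osub_diffD'[OF om] x(2) cf_L_mL by blast
  hence "pm y : cf (mL (c0 + k))" unfolding y_def
   using osub_diffD[OF om, of "pm (lin sc dd xk)" "?d (pm xk)"] pm_lin[of dd xk] cf_L_mL by blast
  hence "y : cf (mA (c0 + k))" by (rule pm_faith)
  moreover have ky: "keys y <= ?F0" unfolding y_def
   by (rule keys_lin) (use cplx_keys[OF C] kxk in blast)
  ultimately have "y : ifl sc xs {..<e} U0 {z. keys z <= ?F0} (c0 + k)"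
   by (intro cf_ifl[OF oU0 _ _ Ka ky]) (auto simp: U0_def W0_def)
  hence "y : ifl sc xs {..<e} U0 W0 (c0 + k)" unfolding W0_def .
  moreover have "y : E 0"
   using ky kxk osub_zero[OF oKa] unfolding E0 y_def W0_def by (intro conjI exI[of _ xk]) simp_all
  ultimately have "y : E k" using AR by blast
  then obtain w where w: "keys w <= ?F1" "w : cf (mA k)" "y - lin sc dd w : cf Ka" unfolding E_def by blast
  have "keys (xk - w) <= ?F1" using osub_diff[OF osub_kin, of xk ?F1 w] kxk w(1) by simp
  moreover have "lin sc dd (xk - w) : cf Ka" using w(3) by (simp add: sc.lin_diff y_def)
  ultimately obtain v where v: "keys v <= ?F2" "(xk - w) - lin sc dd v : cf Ka" using ex unfolding exct_def by blast
  define q where "q = x - ?d (pm v)"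
  have kdv: "?d (pm v) : W" unfolding W_def
   by (rule CollectI, rule keys_lin) (use cplx_keys[OF C'] v(1) keys_pm[of v] in blast)
  have "q : cf (mL k)"
  proof -
   note ok = osub_cf[OF o_mL[of k]]
   have sub: "cf L <= cf (mL k)" by (rule cf_L_mL)
   have 1: "x - pm xk : cf (mL k)" using xk(2) cf_mono[OF mL_antimono[of k "c0 + k"]] by auto
   have 2: "pm (xk - w - lin sc dd v) : cf (mL k)" using pm_Ka[OF v(2)] sub by blast
   have 3: "pm (xk - w - lin sc dd v) - (pm (xk - w) - pm (lin sc dd v)) : cf (mL k)" using pm_diff sub by blast
   have 4: "pm (xk - w) - (pm xk - pm w) : cf (mL k)" using pm_diff sub by blast
   have 5: "pm (lin sc dd v) - ?d (pm v) : cf (mL k)" using pm_lin[of dd v] sub by blast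
   have 6: "pm w : cf (mL k)" by (rule pm_cf[OF ph_mA o_mL L_mL w(2)])
   have "(x - pm xk) + (pm (xk - w - lin sc dd v) - (pm (xk - w - lin sc dd v) - (pm (xk - w) - pm (lin sc dd v))))
    - (pm (xk - w) - (pm xk - pm w)) + (pm (lin sc dd v) - ?d (pm v)) + pm w : cf (mL k)"
    by (rule osub_add[OF ok osub_add[OF ok osub_diff[OF ok osub_add[OF ok 1 osub_diff[OF ok 2 3]] 4] 5] 6])
   thus ?thesis by (simp add: q_def)
  qed
  moreover have kq: "keys q <= ?F1" using osub_diff[OF oW, of x "?d (pm v)"] kdv x(1) by (simp add: W_def q_def)
  ultimately have "q : ifl sc (%j. ph (xs j)) {..<e} U {z. keys z <= ?F1} k"
   by (intro cf_ifl[OF oUU _ _ L kq]) (use WLU UW in \<open>auto simp: W_def\<close>)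
  hence 1: "q : ifl sc (%j. ph (xs j)) {..<e} U W k" unfolding W_def .
  have "?d (pm v) : U"
   unfolding U_def using kdv keys_pm[of v] v(1) osub_zero[OF oL] by (intro CollectI conjI exI[of _ "pm v"]) auto
  hence "?d (pm v) : ifl sc (%j. ph (xs j)) {..<e} U W k" using sc.ifl_base[OF oUU UW oW] by blast
  from osub_add[OF sc.osub_ifl[OF oUU oW] 1 this] show ?thesis by (simp add: q_def)
 qed
 hence "x : (\<Inter>k. ifl sc (%j. ph (xs j)) {..<e} U W k)" by blast
 also have "\<dots> = U"
 proof (rule sc.krull_intersection[OF _ oW oUU UW _ _ jacL])
  show "noeth (range sc) W U"
   by (rule noeth_mono[OF noeth_kin[OF NL L fin[of "Suc i"]]]) (use WLU in \<open>auto simp: W_def\<close>)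
  show "sc k y : U" if k: "k : L" and y: "y : W" for k y
   using sc_cf[OF L k, of y] sc.osub_scale[OF oW y, of k] WLU by blast
 qed simp
 finally show "\<exists>y. keys y <= ?F2 & x - ?d y : cf L" unfolding U_def by blast
qed

end

section \<open>Extension of submodules and contraction of annihilators\<close>

context basechange
begin

definition ext :: "('n \<Rightarrow>\<^sub>0 'c) set => ('n \<Rightarrow>\<^sub>0 'r) set" where
 "ext V = \<Inter>{T. submod sc T & pm ` V <= T & cf L <= T}"

lemma osub_ext: "submod sc (ext V)"
proof (rule osubI)
 show "0 : ext V" unfolding ext_def using osub_zero by blast
 show "x - y : ext V" if "x : ext V" "y : ext V" for x y
  unfolding ext_def
 proof (rule InterI)
  fix T assume T: "T : {T. submod sc T & pm ` V <= T & cf L <= T}"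
  hence "x : T" "y : T" using that unfolding ext_def by blast+
  thus "x - y : T" using T osub_diff by blast
 qed
 show "w x : ext V" if "w : range sc" "x : ext V" for w x
  unfolding ext_def
 proof (rule InterI)
  fix T assume T: "T : {T. submod sc T & pm ` V <= T & cf L <= T}"
  hence "x : T" using that unfolding ext_def by blast
  thus "w x : T" using T that(1) osub_op by blast
 qed
qed

lemma ext_pm: "x : V ==> pm x : ext V"
 unfolding ext_def by blast

lemma ext_L: "cf L <= ext V"
 unfolding ext_def by blast

lemma ext_least: "submod sc T ==> (!!x. x : V ==> pm x : T) ==> cf L <= T ==> ext V <= T"
 unfolding ext_def by blast

lemma ext_mono: "V <= V' ==> ext V <= ext V'"
 by (rule ext_least[OF osub_ext _ ext_L]) (use ext_pm in blast)

lemma ext_UNIV: "ext UNIV = UNIV"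
proof
 show "UNIV <= ext (UNIV :: ('n \<Rightarrow>\<^sub>0 'c) set)"
 proof
  fix x :: "'n \<Rightarrow>\<^sub>0 'r"
  have "single b 1 : ext (UNIV :: ('n \<Rightarrow>\<^sub>0 'c) set)" for b
   by (rule osub_diffD'[OF osub_ext subsetD[OF ext_L pm_unit] ext_pm]) simp
  hence "lin sc (%b. single b 1) x : ext (UNIV :: ('n \<Rightarrow>\<^sub>0 'c) set)" by (rule sc.lin_mem[OF osub_ext])
  thus "x : ext UNIV" by (simp add: lin_unit)
 qed
qed simp

text \<open>Both sides are generated by the same kind of products, so each inclusion is tested on
  generators. It shows that reducing the coefficients modulo powers of the ideal is compatible with
  the completion.\<close>

lemma ext_ifl:
 assumes U: "submod sc U" and I: "finite I"
 shows "ext (ifl sc a I U UNIV n) = ifl sc (%i. ph (a i)) I (ext U) UNIV n"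
proof (induction n)
 case 0
 thus ?case by (simp add: ext_UNIV)
next
 case (Suc n)
 let ?I = "ifl sc a I U UNIV" and ?I' = "ifl sc (%i. ph (a i)) I (ext U) UNIV"
 have oU': "submod sc UNIV" by (simp add: osub_def)
 note oI' = sc.osub_ifl[OF osub_ext[of U] oU', of "%i. ph (a i)" I "Suc n"]
 have base: "ext U <= ?I' (Suc n)" by (rule sc.ifl_base[OF osub_ext subset_UNIV oU'])
 show ?case
 proof
  show "ext (?I (Suc n)) <= ?I' (Suc n)"
  proof (rule ext_least[OF oI'])
   show LT: "cf L <= ?I' (Suc n)" using ext_L base by blast
   have "?I (Suc n) <= {x. pm x : ?I' (Suc n)}"
   proof (rule sc.ifl_least[OF pm_vimage[OF oI' LT]])
    show "U <= {x. pm x : ?I' (Suc n)}" using ext_pm base by blast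
    show "sc (a j) x : {x. pm x : ?I' (Suc n)}" if "j : I" "x : ?I n" for j x
    proof -
     have "pm x : ?I' n" using Suc ext_pm[OF that(2)] by simp
     hence "sc (ph (a j)) (pm x) : ?I' (Suc n)" by (rule sc.ifl_mult[OF osub_ext oU' I that(1)])
     thus ?thesis using osub_diffD[OF oI' subsetD[OF LT pm_sc]] by blast
    qed
   qed
   thus "pm x : ?I' (Suc n)" if "x : ?I (Suc n)" for x using that by blast
  qed
  show "?I' (Suc n) <= ext (?I (Suc n))"
  proof (rule sc.ifl_least[OF osub_ext])
   show "ext U <= ext (?I (Suc n))" by (rule ext_mono[OF sc.ifl_base[OF U subset_UNIV oU']])
   show "sc (ph (a j)) x : ext (?I (Suc n))" if "j : I" "x : ?I' n" for j x
   proof -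
    let ?T = "{x. sc (ph (a j)) x : ext (?I (Suc n))}"
    have "ext (?I n) <= ?T"
    proof (rule ext_least)
     show "submod sc ?T"
     proof (rule osubI)
      show "0 : ?T" using osub_zero[OF osub_ext] by simp
      show "p - q : ?T"
       if "p : ?T" "q : ?T" for p q
       using that osub_diff[OF osub_ext] by (simp add: sc.scale_right_diff_distrib del: ifl.simps)
      show "w p : ?T"
       if "w : range sc" "p : ?T" for w p
      proof -
       obtain r where r: "w = sc r" using \<open>w : range sc\<close> by blast
       have "sc r (sc (ph (a j)) p) : ext (?I (Suc n))" by (rule sc.osub_scale[OF osub_ext]) (use that(2) in blast)
       thus ?thesis by (simp add: r mult.commute del: ifl.simps)
      qed
     qed
     show "pm y : ?T" if "y : ?I n" for y
     proof -
      have "pm (sc (a j) y) : ext (?I (Suc n))"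
       by (rule ext_pm[OF sc.ifl_mult[OF U oU' I \<open>j : I\<close> that]])
      thus ?thesis using osub_diffD'[OF osub_ext subsetD[OF ext_L pm_sc]] by blast
     qed
     show "cf L <= ?T"
      using sc.osub_scale[OF oL] ext_L by blast
    qed
    thus ?thesis using that(2) Suc by blast
   qed
  qed
 qed
qed

text \<open>An element of \<open>ext V\<close> is, modulo \<open>cf L\<close>, a combination of
  images of \<open>V\<close> with scalars from the larger ring, and density replaces each scalar by
  one from the smaller ring.\<close>

lemma ext_approx:
 assumes V: "submod sc V" and x: "x : ext V"
 shows "\<exists>u\<in>V. x - pm u : cf (mL n)"
proof -
 note om = osub_cf[OF o_mL[of n]]
 let ?T = "{x. \<exists>u\<in>V. x - pm u : cf (mL n)}"
 have "ext V <= ?T"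
 proof (rule ext_least)
  show "submod sc ?T"
  proof (rule osubI)
   show "0 : ?T"
    by (intro CollectI bexI[of _ 0]) (simp_all add: osub_zero[OF om] osub_zero[OF V] del: ifl.simps)
   show "p - q : ?T" if pq: "p : ?T" "q : ?T" for p q
   proof -
    obtain u v where uv: "u : V" "p - pm u : cf (mL n)" "v : V" "q - pm v : cf (mL n)" using pq by blast
    have "(p - pm u) - (q - pm v) - (pm (u - v) - (pm u - pm v)) : cf (mL n)"
     by (rule osub_diff[OF om osub_diff[OF om uv(2,4)] subsetD[OF cf_L_mL pm_diff]])
    hence "(p - q) - pm (u - v) : cf (mL n)" by (simp add: algebra_simps del: ifl.simps)
    thus ?thesis using osub_diff[OF V uv(1,3)] by blast
   qed
   show "w p : ?T" if w: "w : range sc" and p: "p : ?T" for w p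
   proof -
    obtain s where s: "w = sc s" using w by blast
    obtain u where u: "u : V" "p - pm u : cf (mL n)" using p by blast
    obtain a where a: "s - ph a : mL n" using dense by blast
    have "sc s (p - pm u) + sc (s - ph a) (pm u) - (pm (sc a u) - sc (ph a) (pm u)) : cf (mL n)"
     by (rule osub_diff[OF om osub_add[OF om sc.osub_scale[OF om u(2)] sc_cf[OF o_mL a]] subsetD[OF cf_L_mL pm_sc]])
    also have "sc s (p - pm u) + sc (s - ph a) (pm u) - (pm (sc a u) - sc (ph a) (pm u)) = sc s p - pm (sc a u)"
     by (simp add: sc.scale_right_diff_distrib sc.scale_left_diff_distrib)
    finally show ?thesis using sc.osub_scale[OF V u(1)] s by blast
   qed
  qed
  show "pm y : ?T" if "y : V" for y
   using that osub_zero[OF om] by (intro CollectI bexI[of _ y]) (simp_all del: ifl.simps)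
  show "cf L <= ?T"
  proof
   fix x :: "'a \<Rightarrow>\<^sub>0 'r" assume "x : cf L"
   hence "x : cf (mL n)" using cf_L_mL by blast
   thus "x : ?T"
    using osub_zero[OF V] by (intro CollectI bexI[of _ 0]) (simp_all del: ifl.simps)
  qed
 qed
 thus ?thesis using x by blast
qed

lemma noeth_ext:
 assumes N: "noeth (range sc) UNIV V" and V: "submod sc V"
 shows "noeth (range sc) UNIV (ext V)"
proof -
 have oU': "submod sc (UNIV :: ('a \<Rightarrow>\<^sub>0 'c) set)" by (simp add: osub_def)
 obtain p :: nat and y where y: "UNIV = sp sc V y {..<p}" by (rule sc.noeth_fg[OF N oU' V]) auto
 let ?S = "sp sc (ext V) (%j. pm (y j)) {..<p}"
 have oS: "submod sc ?S" by (rule sc.osub_sp[OF osub_ext])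
 have VS: "ext V <= ?S" by (rule sc.sp_base)
 have LS: "cf L <= ?S" using ext_L VS by blast
 have "sp sc V y {..<p} <= {x. pm x : ?S}"
 proof (rule sc.sp_least[OF pm_vimage[OF oS LS]])
  show "V <= {x. pm x : ?S}" using ext_pm VS by blast
  show "y j : {x. pm x : ?S}" if "j : {..<p}" for j
   using sc.sp_gen[OF osub_ext _ that, of "%j. pm (y j)"] by simp
 qed
 hence "pm x : ?S" for x using y by blast
 hence "ext UNIV <= ?S" using ext_least[OF oS _ LS, of UNIV] by blast
 hence "UNIV = ?S" by (simp add: ext_UNIV top.extremum_unique)
 moreover have "noeth (range sc) ?S (ext V)"
  by (rule sc.noeth_sp[OF NL osub_ext]) (use ext_L sc_cf[OF L] in auto)
 ultimately show ?thesis by simp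
qed

lemma coh_basechange:
 assumes h: "coh sc B dg dd V i h"
 shows "coh sc B dg (%b. pm (dd b)) (ext V) i (%b. pm (h b))"
 unfolding coh_def
proof
 fix b assume "b : gr B dg (Suc i)"
 hence "pm (lin sc h (dd b)) : ext V" using h ext_pm unfolding coh_def by blast
 thus "lin sc (%b. pm (h b)) (pm (dd b)) : ext V"
  using osub_diffD'[OF osub_ext subsetD[OF ext_L pm_lin]] by blast
qed

text \<open>If \<open>ph a\<close> kills the image of a class, approximating the bounding cochain
  shows that \<open>a h\<close> is a coboundary up to every power of the ideal. Krull's intersection
  theorem is then applied over the smaller ring, in the finite power of the coefficient module
  indexed by \<open>gr B dg i\<close>.\<close>

lemma annx_basechange:
 fixes dd :: "'x => ('x \<Rightarrow>\<^sub>0 'c)" and h :: "'x => ('n \<Rightarrow>\<^sub>0 'c)"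
 assumes fin: "finite (gr B dg i)" and V: "submod sc V" "cf Ka <= V" and NV: "noeth (range sc) UNIV V"
 shows "ph a : annx sc B dg (%b. pm (dd b)) (ext V) i (%b. pm (h b)) \<longleftrightarrow> a : annx sc B dg dd V i h"
proof
 assume "a : annx sc B dg dd V i h"
 then obtain g where g: "!!b. b : gr B dg i ==> sc a (h b) - lin sc g (dd b) : V" by (auto simp: annx_def)
 have "sc (ph a) (pm (h b)) - lin sc (%b. pm (g b)) (pm (dd b)) : ext V" if b: "b : gr B dg i" for b
 proof -
  have 1: "pm (sc a (h b) - lin sc g (dd b)) : ext V" by (rule ext_pm[OF g[OF b]])
  have 2: "pm (sc a (h b) - lin sc g (dd b)) - (pm (sc a (h b)) - pm (lin sc g (dd b))) : ext V"
   by (rule subsetD[OF ext_L pm_diff])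
  have 3: "pm (sc a (h b)) - sc (ph a) (pm (h b)) : ext V" by (rule subsetD[OF ext_L pm_sc])
  have 4: "pm (lin sc g (dd b)) - lin sc (%b. pm (g b)) (pm (dd b)) : ext V" by (rule subsetD[OF ext_L pm_lin])
  have "pm (sc a (h b)) - pm (lin sc g (dd b)) : ext V" by (rule osub_diffD'[OF osub_ext 2 1])
  from osub_add[OF osub_ext osub_diff[OF osub_ext this 3] 4] show ?thesis by simp
 qed
 thus "ph a : annx sc B dg (%b. pm (dd b)) (ext V) i (%b. pm (h b))" unfolding annx_def by blast
next
 assume "ph a : annx sc B dg (%b. pm (dd b)) (ext V) i (%b. pm (h b))"
 then obtain g where g: "!!b. b : gr B dg i ==> sc (ph a) (pm (h b)) - lin sc g (pm (dd b)) : ext V" by (auto simp: annx_def)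
 let ?F = "gr B dg i"
 let ?s = "%r. lfs (sc r) :: ('x => ('n \<Rightarrow>\<^sub>0 'c)) => _"
 have ml: "Modules.module ?s"
  by unfold_locales (auto simp: lfs_def fun_eq_iff sc.scale_right_distrib sc.scale_left_distrib)
 have rl: "range ?s = lfs ` range sc" by auto
 have oU': "submod sc (UNIV :: ('n \<Rightarrow>\<^sub>0 'c) set)" by (simp add: osub_def)
 define W where "W = (fsp ?F :: ('x => ('n \<Rightarrow>\<^sub>0 'c)) set)"
 have oW: "submod ?s W" using osub_fsp_valued[OF oU' sc.additive_scale, of ?F] by (simp add: W_def rl)
 \<comment> \<open>Coboundaries with all components taken together, because one bounding cochain has
   to serve every basis element of degree \<open>i\<close>.\<close>
 define T where "T = {v\<in>W. \<exists>g. \<forall>b\<in>?F. v b - lin sc g (dd b) : V}"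
 have oT: "submod ?s T"
 proof (rule osubI)
  have "\<forall>b\<in>?F. 0 - lin sc (%_. 0) (dd b) : V" using osub_zero[OF V(1)] by (simp add: lin_def)
  thus "0 : T" using osub_zero[OF oW] unfolding T_def by auto
  show "p - q : T" if pq: "p : T" "q : T" for p q
  proof -
   obtain g g' where gg: "\<forall>b\<in>?F. p b - lin sc g (dd b) : V" "\<forall>b\<in>?F. q b - lin sc g' (dd b) : V" using pq unfolding T_def by blast
   have "(p - q) b - lin sc (%b. g b - g' b) (dd b) : V" if b: "b : ?F" for b
   proof -
    have "(p b - lin sc g (dd b)) - (q b - lin sc g' (dd b)) : V" using osub_diff[OF V(1)] gg b by blast
    thus ?thesis by (simp add: sc.lin_fun_diff algebra_simps)
   qed
   moreover have "p - q : W" using osub_diff[OF oW] pq unfolding T_def by blast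
   ultimately show ?thesis unfolding T_def by blast
  qed
  show "w p : T" if w: "w : range ?s" and p: "p : T" for w p
  proof -
   obtain r where r: "w = lfs (sc r)" using w by blast
   obtain g where gg: "\<forall>b\<in>?F. p b - lin sc g (dd b) : V" using p unfolding T_def by blast
   have "w p b - lin sc (%b. sc r (g b)) (dd b) : V" if b: "b : ?F" for b
    using sc.osub_scale[OF V(1) gg[rule_format, OF b], of r]
    by (simp add: r lfs_def sc.lin_fun_scale sc.scale_right_diff_distrib)
   moreover have "w p : W" using osub_op[OF oW w] p unfolding T_def by blast
   ultimately show ?thesis unfolding T_def by blast
  qed
 qed
 have TW: "T <= W" unfolding T_def by blast
 have VT: "W \<inter> valued V <= T"
 proof
  fix v assume v: "v : W \<inter> valued V"
  hence "\<forall>b\<in>?F. v b - lin sc (%_. 0) (dd b) : V" by (simp add: lin_def valued_def)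
  thus "v : T" using v unfolding T_def by blast
 qed
 have KV: "sc k x : V" if "k : Ka" for k x using sc_cf[OF Ka that] V(2) by blast
 have NT: "noeth (range ?s) W T"
  by (rule noeth_mono[OF sc.noeth_cochains_base[OF NA V(1) NV KV fin]]) (use VT in \<open>simp_all add: W_def rl\<close>)
 define v0 where "v0 b = (if b : ?F then sc a (h b) else 0)" for b
 have inW: "v : W" if "!!b. v b ~= 0 ==> b : ?F" for v
  unfolding W_def fsp_def using that finite_subset[OF _ fin, of "{b. v b ~= 0}"] by blast
 have "v0 : ifl ?s xs {..<e} T W k" for k
 proof -
  note om = osub_cf[OF o_mL[of k]]
  have "\<exists>y. g b - pm y : cf (mL k)" for b using pm_approx[of "g b" k] by blast
  then obtain gk where gk: "!!b. g b - pm (gk b) : cf (mL k)" by metis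
  have "\<exists>u\<in>V. sc a (h b) - lin sc gk (dd b) - u : cf (mA k)" if b: "b : ?F" for b
  proof -
   let ?q = "sc a (h b) - lin sc gk (dd b)" and ?x = "sc (ph a) (pm (h b)) - lin sc g (pm (dd b))"
   obtain u where u: "u : V" "?x - pm u : cf (mL k)" using ext_approx[OF V(1) g[OF b]] by blast
   have 1: "lin sc (%b. g b - pm (gk b)) (pm (dd b)) : cf (mL k)" by (rule sc.lin_mem[OF om gk])
   have 2: "pm (lin sc gk (dd b)) - lin sc (%b. pm (gk b)) (pm (dd b)) : cf (mL k)" by (rule subsetD[OF cf_L_mL pm_lin])
   have 3: "pm (sc a (h b)) - sc (ph a) (pm (h b)) : cf (mL k)" by (rule subsetD[OF cf_L_mL pm_sc])
   have 4: "pm ?q - (pm (sc a (h b)) - pm (lin sc gk (dd b))) : cf (mL k)" by (rule subsetD[OF cf_L_mL pm_diff])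
   have 5: "pm (?q - u) - (pm ?q - pm u) : cf (mL k)" by (rule subsetD[OF cf_L_mL pm_diff])
   have "(?x - pm u) + lin sc (%b. g b - pm (gk b)) (pm (dd b)) - (pm (lin sc gk (dd b)) - lin sc (%b. pm (gk b)) (pm (dd b)))
    + (pm (sc a (h b)) - sc (ph a) (pm (h b))) + (pm ?q - (pm (sc a (h b)) - pm (lin sc gk (dd b))))
    + (pm (?q - u) - (pm ?q - pm u)) : cf (mL k)"
    by (rule osub_add[OF om osub_add[OF om osub_add[OF om osub_diff[OF om osub_add[OF om u(2) 1] 2] 3] 4] 5])
   hence "pm (?q - u) : cf (mL k)" by (simp add: sc.lin_fun_diff del: ifl.simps)
   thus ?thesis using u(1) pm_faith by blast
  qed
  then obtain u where u: "!!b. b : ?F ==> u b : V" "!!b. b : ?F ==> sc a (h b) - lin sc gk (dd b) - u b : cf (mA k)" by metis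
  define z where "z b = sc a (h b) - lin sc gk (dd b) - u b" for b
  define ta where "ta b = (if b : ?F then lin sc gk (dd b) + u b else 0)" for b
  have "ta : T"
   unfolding T_def by (intro CollectI conjI exI[of _ gk] ballI inW) (auto simp: ta_def u(1) split: if_splits)
  hence 1: "ta : ifl ?s xs {..<e} T W k" using module.ifl_base[OF ml oT TW oW] by blast
  have pz: "pt b (z b) : ifl ?s xs {..<e} T W k" if b: "b : ?F" for b
  proof -
   have ap: "additive (pt b :: ('n \<Rightarrow>\<^sub>0 'c) => _)" by (auto simp: additive_def pt_def)
   have "pt b (z b) = (\<Sum>q\<in>keys (z b). lfs (sc (lookup (z b) q)) (pt b (single q 1)))"
    by (subst poly_mapping_sc_sum) (simp only: additive.sum[OF ap] lfs_pt[OF sc.additive_scale[OF rangeI]])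
   also have "\<dots> : ifl ?s xs {..<e} T W k"
   proof (rule osub_sum[OF module.osub_ifl[OF ml oT oW]], rule module.ifl_scale[OF ml oT TW oW])
    fix q
    show pw: "pt b (single q 1) : W" unfolding W_def by (rule pt_fsp[OF b])
    show "lfs (sc r) (pt b (single q 1)) : T" if "r : Ka" for r
    proof -
     have "lfs (sc r) (pt b (single q 1)) = pt b (sc r (single q 1))" by (rule lfs_pt[OF sc.additive_scale]) simp
     hence "lfs (sc r) (pt b (single q 1)) : valued V" using pt_valued[OF KV[OF that] osub_zero[OF V(1)]] by metis
     moreover have "lfs (sc r) (pt b (single q 1)) : W" by (rule osub_op[OF oW _ pw]) simp
     ultimately show ?thesis using VT by blast
    qed
    show "lookup (z b) q : mA k" using u(2)[OF b] unfolding z_def cf_def by blast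
   qed
   finally show ?thesis .
  qed
  have "v0 - ta = (\<Sum>b\<in>?F. pt b (z b))"
  proof -
   have "v0 - ta = (\<Sum>b\<in>?F. pt b ((v0 - ta) b))"
    by (rule sum_pt[OF fin]) (auto simp: v0_def ta_def split: if_splits)
   also have "\<dots> = (\<Sum>b\<in>?F. pt b (z b))" by (rule sum.cong) (auto simp: v0_def ta_def z_def diff_diff_add)
   finally show ?thesis .
  qed
  hence "v0 - ta : ifl ?s xs {..<e} T W k" using osub_sum[OF module.osub_ifl[OF ml oT oW] pz] by simp
  thus ?thesis by (rule osub_diffD[OF module.osub_ifl[OF ml oT oW] _ 1])
 qed
 hence "v0 : (\<Inter>k. ifl ?s xs {..<e} T W k)" by blast
 also have "\<dots> = T"
 proof (rule module.krull_intersection[OF ml NT oW oT TW _ _ jacA])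
  show "lfs (sc k) y : T" if k: "k : Ka" and y: "y : W" for k y
  proof -
   have "lfs (sc k) y : W" by (rule osub_op[OF oW _ y]) simp
   moreover have "lfs (sc k) y : valued V" using KV[OF k] by (simp add: valued_def lfs_def)
   ultimately show ?thesis using VT by blast
  qed
 qed simp
 finally show "a : annx sc B dg dd V i h" unfolding T_def annx_def by (auto simp: v0_def)
qed

end

section \<open>Finiteness over a complete intersection\<close>

text \<open>\<open>e\<close> induces an injection of the homology in degree 0 into the module
  presented by \<open>s\<close> and \<open>V\<close>. Surjectivity is expressed separately by
  covering conditions.\<close>

definition augm where
 "augm s e V K B dg dd \<longleftrightarrow> (\<forall>x. keys x <= gr B dg 0 -->
  (lin s e x : V \<longleftrightarrow> (\<exists>y. keys y <= gr B dg 1 & x - lin sc dd y : cf K)))"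

lemma augm_boundary:
 assumes K: "osub scl K" and G: "cplx K B dg dd" and A: "augm s e V K B dg dd" and b: "b : gr B dg 1"
 shows "lin s e (dd b) : V"
proof -
 have "keys (dd b) <= gr B dg 0" using cplx_keys[OF G, of b 0] b by simp
 moreover have "keys (single b (1::'a)) <= gr B dg 1" using b by simp
 moreover have "dd b - lin sc dd (single b 1) : cf K" using osub_zero[OF osub_cf[OF K]] by simp
 ultimately show ?thesis using A unfolding augm_def by blast
qed

text \<open>Compatibility of \<open>al\<close> with the augmentations forces the image of a boundary
  into the kernel of the second augmentation, where \<open>augm\<close> provides a preimage.\<close>

lemma augm_lift:
 fixes s :: "'r::comm_ring_1 => 'e => 'e::ab_group_add"
 assumes M: "Modules.module s" and V: "submod s V"
  and K: "osub scl K" and G: "cplx K B dg dd" and A: "augm s e V K B dg dd" "augm s e' V K B' dg' dd'"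
  and al: "!!b. b : gr B dg 0 ==> keys (al b) <= gr B' dg' 0 & e b - lin s e' (al b) : V"
 shows "b : gr B dg 1 ==> \<exists>y. keys y <= gr B' dg' 1 & lin sc al (dd b) - lin sc dd' y : cf K"
proof -
 assume b: "b : gr B dg 1"
 interpret M: Modules.module s by (rule M)
 have kd: "keys (dd b) <= gr B dg 0" using cplx_keys[OF G, of b 0] b by simp
 have "lin s (%b. e b - lin s e' (al b)) (dd b) : V" by (rule M.lin_mem[OF V]) (use kd al in blast)
 hence "lin s e (dd b) - lin s e' (lin sc al (dd b)) : V" by (simp add: M.lin_fun_diff M.lin_lin)
 hence "lin s e' (lin sc al (dd b)) : V" using osub_diffD'[OF V] augm_boundary[OF K G A(1) b] by blast
 moreover have "keys (lin sc al (dd b)) <= gr B' dg' 0" by (rule keys_lin) (use kd al in blast)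
 ultimately show ?thesis using A(2) unfolding augm_def by blast
qed

text \<open>The covering hypotheses lift each augmentation through the other, and
  \<open>augm\<close> converts compatibility with the augmentations into the obstruction conditions
  of \<open>annx_compare\<close>.\<close>

lemma (in Modules.module) annx_compare_augm:
 fixes s :: "'a => 'e => 'e::ab_group_add"
 assumes M: "Modules.module s" and V: "submod s V"
  and K: "osub scl K" and G: "cplx K B dg dd" and H: "cplx K B' dg' dd'"
  and exG: "exct K B dg dd" and exH: "exct K B' dg' dd'"
  and A: "augm s e V K B dg dd" and A': "augm s e' V K B' dg' dd'"
  and cov: "!!b. b : gr B dg 0 ==> \<exists>x. keys x <= gr B' dg' 0 & e b - lin s e' x : V"
  and cov': "!!b. b : gr B' dg' 0 ==> \<exists>x. keys x <= gr B dg 0 & e' b - lin s e x : V"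
  and U: "submod scale U" and KU: "!!k x. k : K ==> scale k x : U"
  and h: "coh scale B dg dd U i h"
 shows "\<exists>h'. coh scale B' dg' dd' U i h' & annx scale B' dg' dd' U i h' = annx scale B dg dd U i h"
proof -
 interpret M: Modules.module s by (rule M)
 have "\<forall>b. \<exists>x. b : gr B dg 0 --> keys x <= gr B' dg' 0 & e b - lin s e' x : V" using cov by blast
 from choice[OF this] obtain al where al: "!!b. b : gr B dg 0 ==> keys (al b) <= gr B' dg' 0 & e b - lin s e' (al b) : V" by blast
 have "\<forall>b. \<exists>x. b : gr B' dg' 0 --> keys x <= gr B dg 0 & e' b - lin s e x : V" using cov' by blast
 from choice[OF this] obtain bt where bt: "!!b. b : gr B' dg' 0 ==> keys (bt b) <= gr B dg 0 & e' b - lin s e (bt b) : V" by blast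
 have btal: "\<exists>y. keys y <= gr B dg 1 & lin sc bt (al b) - single b 1 - lin sc dd y : cf K" if b: "b : gr B dg 0" for b
 proof -
  have "lin s (%z. e' z - lin s e (bt z)) (al b) : V" by (rule M.lin_mem[OF V]) (use al[OF b] bt in blast)
  hence "lin s e' (al b) - lin s e (lin sc bt (al b)) : V" by (simp add: M.lin_fun_diff M.lin_lin)
  hence "e b - lin s e' (al b) + (lin s e' (al b) - lin s e (lin sc bt (al b))) : V"
   using osub_add[OF V] al[OF b] by blast
  hence "- (e b - lin s e (lin sc bt (al b))) : V" using osub_uminus[OF V] by force
  hence "lin s e (lin sc bt (al b) - single b 1) : V" by (simp add: M.lin_diff)
  moreover have "keys (lin sc bt (al b)) <= gr B dg 0" by (rule keys_lin) (use al[OF b] bt in blast)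
  hence "keys (lin sc bt (al b) - single b 1) <= gr B dg 0"
   using osub_diff[OF osub_kin, of "lin sc bt (al b)" "gr B dg 0" "single b 1"] b by simp
  ultimately show ?thesis using A unfolding augm_def by blast
 qed
 show ?thesis
  by (rule annx_compare[OF K G H exG exH _ augm_lift[OF M V K G A A' al] _ augm_lift[OF M V K H A' A bt] btal U KU h])
   (use al bt in blast)+
qed

text \<open>The dimension bound is applied to the first syzygy, which gives one step more than the
  dimension; \<open>FR_ressq\<close> starts from such a positive index.\<close>

lemma regular_FR_Suc:
 assumes N: "noeth scl UNIV K" and K: "osub scl K" and L: "locl K n" and R: "reg d K n"
  and V: "submod sc V" and KW: "!!k w. k : K ==> w : W ==> sc k w : V"
 shows "FR (Suc d) K W V"
 unfolding FR.simps
proof (intro allI impI)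
 fix b :: nat and c assume c: "\<forall>j<b. c j : W" and "W = sp sc V c {..<b}"
 have sub: "Kb K b <= kerc c b V" by (rule Kb_kerc[OF V _ KW]) (use c in auto)
 show "FR d K (kerc c b V) (Kb K b)"
 proof (rule regular_FR[OF N K L R osub_kerc[OF V] osub_Kb[OF K] sub])
  show "noeth (range sc) (kerc c b V) (Kb K b)"
   by (rule noeth_mono[OF noeth_Kb[OF N K]]) (auto simp: kerc_def)
  show "sc k w : Kb K b" if "k : K" "w : kerc c b V" for k w
   using that sc_cf[OF K, of k w] keys_sc[of k w] unfolding Kb_def kerc_def by blast
 qed
qed

lemma unit_gens:
 fixes V :: "(nat \<Rightarrow>\<^sub>0 'r::comm_ring_1) set"
 assumes V: "submod sc V" "V <= {z. keys z <= {..<p}}"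
 shows "\<forall>j<p. single j (1::'r) : {z. keys z <= {..<p::nat}}" "{z. keys z <= {..<p}} = sp sc V (%j. single j 1) {..<p}"
proof -
 show g: "\<forall>j<p. single j (1::'r) : {z. keys z <= {..<p}}" by auto
 show "{z. keys z <= {..<p}} = sp sc V (%j. single j 1) {..<p}"
 proof
  show "{z. keys z <= {..<p}} <= sp sc V (%j. single j 1) {..<p}"
  proof
   fix z :: "nat \<Rightarrow>\<^sub>0 'r" assume "z : {z. keys z <= {..<p}}"
   hence "0 + lin sc (%j. single j 1) z : sp sc V (%j. single j 1) {..<p}"
    using sp_lin_I osub_zero[OF V(1)] by blast
   thus "z : sp sc V (%j. single j 1) {..<p}" by (simp add: lin_unit)
  qed
  show "sp sc V (%j. single j 1) {..<p} <= {z. keys z <= {..<p}}"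
   by (rule sc.sp_least[OF osub_kin V(2)]) (use g in blast)
 qed
qed

context basechange
begin

text \<open>Over the completion the homology of the complex in degree 0 is a module
  \<open>W / V\<close>, which is also a module over \<open>Q\<close> killed by the regular sequence.
  The completed complex and the Shamash complex of its finite resolution over \<open>Q\<close>
  resolve the same module, so they give the same annihilators, and these contract to
  \<open>A\<close>.\<close>

lemma finite_primes_finite_free:
 fixes c :: nat and U :: "('n \<Rightarrow>\<^sub>0 'c) set" and a :: "'i => 'c" and dd :: "nat \<times> nat => (nat \<times> nat \<Rightarrow>\<^sub>0 'c)"
 assumes Q: "noeth scl UNIV Kq" "osub scl Kq" "locl Kq nq" "reg d Kq nq"
  and Lf: "L = sp (*) Kq f {..<c}" and regf: "!!k r. k < c ==> f k * r : sp (*) Kq f {..<k} ==> r : sp (*) Kq f {..<k}"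
  and cpl: "cplx Ka (Bs b) fst dd" and exc: "exct Ka (Bs b) fst dd"
  and U: "submod sc U" "cf Ka <= U" and NU: "noeth (range sc) UNIV U" and I: "finite I"
 shows "finite {P. primep P & (\<exists>n i h. coh sc (Bs b) fst dd (ifl sc a I U UNIV n) i h \<and>
  P = annx sc (Bs b) fst dd (ifl sc a I U UNIV n) i h)}"
proof -
 let ?d = "%b. pm (dd b)"
 let ?p = "b 0"
 have fin: "finite (gr (Bs b) fst i)" for i by (simp add: gr_Bs)
 have cpl': "cplx L (Bs b) fst ?d" by (rule basechange_cplx[OF cpl])
 have exc': "exct L (Bs b) fst ?d" by (rule basechange_exct[OF cpl exc fin])
 have KqL: "Kq <= L" unfolding Lf by (rule module.sp_base[OF module_ring])
 have cKL: "cf Kq <= cf L" by (rule cf_mono[OF KqL])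
 define W where "W = {z :: nat \<Rightarrow>\<^sub>0 'r. keys z <= {..<?p}}"
 \<comment> \<open>The boundaries of the completed complex in degree 0, read as vectors through
   \<open>emb\<close>.\<close>
 define V where "V = {z\<in>W. \<exists>y. keys y <= gr (Bs b) fst 1 & emb 0 z - lin sc ?d y : cf L}"
 have oW: "submod sc W" unfolding W_def by (rule osub_kin)
 have VW: "V <= W" unfolding V_def by blast
 have emb_sc: "emb 0 (sc r z) = sc r (emb 0 z)" for r z by (simp add: emb_def sc.lin_sc)
 have oV: "submod sc V"
  using osub_modulo_image[OF oW osub_kin[of "gr (Bs b) fst 1"] oL, of "emb 0" "lin sc ?d"]
  by (simp add: V_def sc.lin_diff sc.lin_sc emb_diff emb_sc)
 have WLV: "W \<inter> cf L <= V"
 proof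
  fix z assume "z : W \<inter> cf L"
  thus "z : V" unfolding V_def using emb_cf[OF L, of 0 z] by (intro CollectI conjI exI[of _ 0]) simp_all
 qed
 have KW: "sc k w : V" if "k : Kq" "w : W" for k w
  using sc_cf[OF L, of k w] sc.osub_scale[OF oW that(2), of k] KqL that(1) WLV by blast
 note gens = unit_gens[OF oV VW[unfolded W_def], folded W_def]
 have NWV: "noeth (range sc) W V"
  by (rule noeth_mono[OF noeth_kin[OF Q(1,2), of "{..<?p}"]]) (use WLV cKL in \<open>auto simp: W_def\<close>)
 \<comment> \<open>The degree 0 generators are the unit vectors, so the resolution over
   \<open>Q\<close> has the same degree 0 term and the same augmentation as the completed
   complex.\<close>
 obtain b' c' where R: "ressq Kq W V b' c'" "!!i. i > Suc d ==> b' i = 0" "b' 0 = ?p" "c' 0 = (%j. single j 1)"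
  using FR_ressq[OF Q(1,2) oW oV VW NWV KW gens regular_FR_Suc[OF Q oV KW]] by blast
 let ?B = "Bs b'" and ?dl = "dl c'"
 have KbV: "v : Kb Kq (b' 0) ==> lin sc (c' 0) v : V" for v
  using WLV cKL unfolding Kb_def R(3,4) W_def by (auto simp: lin_unit)
 have H0: "z : V \<longleftrightarrow> (\<exists>y. keys y <= gr ?B fst 1 & emb 0 z - lin sc ?dl y : cf Kq)" if "z : W" for z
  using ressq_H0[OF Q(2) oV R(1) _ KbV, of z] that by (simp add: R(3,4) lin_unit W_def)
 have cQ: "cplx Kq ?B fst ?dl" and eQ: "exct Kq ?B fst ?dl"
  by (rule ressq_cplx[OF Q(2) R(1)], rule ressq_exct[OF Q(2) R(1)])
 have fL: "f j : L" if "j < c" for j unfolding Lf by (rule sp_ring_gen[OF Q(2)]) (use that in auto)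
 interpret S: shamash Kq ?B fst ?dl c f
 proof (rule shamash.intro[OF Q(2) cQ eQ])
  fix j b0 assume j: "j < c" and b0: "b0 : gr ?B fst 0"
  then obtain l where l: "b0 = (0, l)" "l < ?p" by (auto simp: gr_Bs R(3))
  have "single l (f j) : W \<inter> cf L"
   using l(2) fL[OF j] osub_zero[OF L] by (auto simp: W_def cf_def lookup_single when_def)
  hence "single l (f j) : V" "single l (f j) : W" using WLV by blast+
  then obtain y where "keys y <= gr ?B fst 1" "emb 0 (single l (f j)) - lin sc ?dl y : cf Kq" using H0 by blast
  moreover have "emb 0 (single l (f j)) = sc (f j) (single b0 1)" by (simp add: emb_def l)
  ultimately show "\<exists>y. keys y <= gr ?B fst 1 & sc (f j) (single b0 1) - lin sc ?dl y : cf Kq" by auto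
 qed
 have JL: "S.Jf c = L" by (simp add: S.Jf_def Lf)
 obtain D where D: "cplx L S.GB S.gd D" "exct L S.GB S.gd D"
  "!!b j. b : S.GB ==> j < c ==> tc j (D b) = lin sc D (tc j (single b 1))" "!!l. l : ?B ==> D ({#}, l) = inc (?dl l)"
  using S.shamash_resolution[OF regf[folded S.Jf_def]] unfolding JL by blast
 have finB: "finite ?B"
 proof (rule finite_subset)
  show "?B <= (\<Union>i\<in>{..Suc d}. Pair i ` {..<b' i})"
  proof
   fix x assume x: "x : ?B"
   obtain i j where ij: "x = (i, j)" by (cases x)
   hence j: "j < b' i" using x by (simp add: Bs_def)
   hence "i <= Suc d" using R(2)[of i] by (metis not_less not_less_zero)
   thus "x : (\<Union>i\<in>{..Suc d}. Pair i ` {..<b' i})" using j ij by auto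
  qed
 qed simp
 interpret C: cochains Kq ?B fst ?dl c f sc D "ext U" "%i. ph (a i)" I
 proof (intro cochains.intro cochains_axioms.intro)
  show "sc k x : ext U" if "k : S.Jf c" for k and x :: "'n \<Rightarrow>\<^sub>0 'r"
   using that sc_cf[OF L, of k x] ext_L unfolding JL by blast
 qed (simp_all add: S.shamash_axioms module_sc finB D JL NL osub_ext noeth_ext[OF NU U(1)] I)
 let ?Z = "ifl sc (%i. ph (a i)) I (ext U) UNIV"
 have "finite {P. primep P & (\<exists>n i h. coh sc S.GB S.gd D (?Z n) i h & P = {a. ph a : annx sc S.GB S.gd D (?Z n) i h})}"
  by (rule C.finite_cochain_primes[OF NA]) (simp_all only: JL ph_diff ph_mult ph_one ph_Ka)
 moreover have "{P. primep P & (\<exists>n i h. coh sc (Bs b) fst dd (ifl sc a I U UNIV n) i h \<and>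
   P = annx sc (Bs b) fst dd (ifl sc a I U UNIV n) i h)}
  <= {P. primep P & (\<exists>n i h. coh sc S.GB S.gd D (?Z n) i h & P = {a. ph a : annx sc S.GB S.gd D (?Z n) i h})}"
 proof
  fix P assume "P : {P. primep P & (\<exists>n i h. coh sc (Bs b) fst dd (ifl sc a I U UNIV n) i h \<and>
   P = annx sc (Bs b) fst dd (ifl sc a I U UNIV n) i h)}"
  then obtain n i h where P: "primep P" and h: "coh sc (Bs b) fst dd (ifl sc a I U UNIV n) i h"
   and Ph: "P = annx sc (Bs b) fst dd (ifl sc a I U UNIV n) i h" by blast
  let ?U = "ifl sc a I U UNIV n"
  have oU': "submod sc (UNIV :: ('n \<Rightarrow>\<^sub>0 'c) set)" "submod sc (UNIV :: ('n \<Rightarrow>\<^sub>0 'r) set)" by (simp_all add: osub_def)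
  have oUn: "submod sc ?U" by (rule sc.osub_ifl[OF U(1) oU'(1)])
  have UUn: "U <= ?U" by (rule sc.ifl_base[OF U(1) subset_UNIV oU'(1)])
  have eU: "ext ?U = ?Z n" by (rule ext_ifl[OF U(1) I])
  have h1: "coh sc (Bs b) fst ?d (?Z n) i (%b. pm (h b))" using coh_basechange[OF h] by (simp only: eU)
  have "ph a : annx sc (Bs b) fst ?d (ext ?U) i (%b. pm (h b)) \<longleftrightarrow> a : annx sc (Bs b) fst dd ?U i h" for a
  proof (rule annx_basechange[OF fin oUn])
   show "cf Ka <= ?U" using U(2) UUn by blast
   show "noeth (range sc) UNIV ?U" by (rule noeth_mono[OF NU]) (use UUn in simp_all)
  qed
  hence P1: "P = {a. ph a : annx sc (Bs b) fst ?d (?Z n) i (%b. pm (h b))}" unfolding Ph eU by blast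
  let ?e = "%q :: nat \<times> nat. single (snd q) (1::'r)" and ?e' = "%q :: (nat \<times> nat) tmon. single (snd (snd q)) (1::'r)"
  have le: "lin sc ?e (emb 0 z) = z" for z by (simp add: emb_def sc.lin_lin lin_unit)
  have le': "lin sc ?e' (inc z) = lin sc ?e z" for z by (simp add: S.lin_inc)
  have A: "augm sc ?e V L (Bs b) fst ?d"
   unfolding augm_def
  proof (intro allI impI)
   fix x :: "nat \<times> nat \<Rightarrow>\<^sub>0 'r" assume "keys x <= gr (Bs b) fst 0"
   then obtain z where z: "x = emb 0 z" "keys z <= {..<?p}" by (rule emb_surj)
   thus "lin sc ?e x : V \<longleftrightarrow> (\<exists>y. keys y <= gr (Bs b) fst 1 & x - lin sc ?d y : cf L)"
    unfolding z(1) le V_def W_def by blast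
  qed
  have gr0: "gr S.GB S.gd 0 = Pair {#} ` gr ?B fst 0"
   by (auto simp: gr_def S.GB_def S.gd_def)
  \<comment> \<open>Every variable has degree 2, so in degrees 0 and 1 the Shamash complex is the
    resolution over \<open>Q\<close>; its homology in degree 0 is therefore \<open>W / V\<close> as
    well.\<close>
  have gr1: "gr S.GB S.gd 1 = Pair {#} ` gr ?B fst 1"
  proof -
   have "i + 2 * size al = Suc 0 \<longleftrightarrow> al = {#} & i = Suc 0" for i and al :: "nat multiset"
    by (cases "size al") auto
   thus ?thesis by (auto simp: gr_def S.GB_def S.gd_def)
  qed
  have inc_surj: "\<exists>z. x = inc z & keys z <= F" if x: "keys x <= Pair {#} ` F" for x :: "(nat \<times> nat) tmon \<Rightarrow>\<^sub>0 'r" and F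
  proof (intro exI conjI)
   show "x = inc (res0 x)"
   proof (rule poly_mapping_eqI)
    fix q show "lookup x q = lookup (inc (res0 x)) q"
     using x by (cases q) (auto simp: in_keys_iff subset_iff)
   qed
   show "keys (res0 x) <= F" using x by (auto simp: in_keys_iff subset_iff)
  qed
  have keys_inc: "keys (inc z) <= Pair {#} ` F" if "keys z <= F" for z :: "nat \<times> nat \<Rightarrow>\<^sub>0 'r" and F
   using that by (auto simp: in_keys_iff subset_iff split: if_splits)
  have D_inc: "lin sc D (inc y) = inc (lin sc ?dl y)" if "keys y <= gr ?B fst 1" for y
  proof -
   have "lin sc (%l. D ({#}, l)) y = lin sc (%l. inc (?dl l)) y"
    by (rule sc.lin_cong) (use that D(4) in \<open>auto simp: gr_def\<close>)
   thus ?thesis by (simp add: S.lin_inc S.lin_inc')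
  qed
  have A': "augm sc ?e' V L S.GB S.gd D"
   unfolding augm_def
  proof (intro allI impI)
   fix x :: "(nat \<times> nat) tmon \<Rightarrow>\<^sub>0 'r" assume "keys x <= gr S.GB S.gd 0"
   then obtain x0 where x0: "x = inc x0" "keys x0 <= gr ?B fst 0" unfolding gr0 using inc_surj by blast
   obtain z where z: "x0 = emb 0 z" "keys z <= {..<b' 0}" by (rule emb_surj[OF x0(2)])
   have zW: "z : W" using z(2) by (simp add: W_def R(3))
   have lx: "lin sc ?e' x = z" unfolding x0(1) z(1) le' le ..
   show "lin sc ?e' x : V \<longleftrightarrow> (\<exists>y. keys y <= gr S.GB S.gd 1 & x - lin sc D y : cf L)"
   proof
    assume "lin sc ?e' x : V"
    then obtain y where y: "keys y <= gr ?B fst 1" "emb 0 z - lin sc ?dl y : cf Kq" using H0[OF zW] lx by auto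
    have "x - lin sc D (inc y) = inc (emb 0 z - lin sc ?dl y)" by (simp add: x0(1) z(1) D_inc[OF y(1)] inc_diff)
    moreover have "inc (emb 0 z - lin sc ?dl y) : cf L" unfolding inc_cf[OF osub_zero[OF L]] using y(2) cKL by blast
    ultimately have "x - lin sc D (inc y) : cf L" by metis
    thus "\<exists>y. keys y <= gr S.GB S.gd 1 & x - lin sc D y : cf L" using keys_inc[OF y(1)] unfolding gr1 by blast
   next
    assume "\<exists>y. keys y <= gr S.GB S.gd 1 & x - lin sc D y : cf L"
    then obtain y where y: "keys y <= gr ?B fst 1" "x - lin sc D (inc y) : cf L" unfolding gr1 using inc_surj by blast
    have "x - lin sc D (inc y) = inc (emb 0 z - lin sc ?dl y)" by (simp add: x0(1) z(1) D_inc[OF y(1)] inc_diff)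
    hence y2: "emb 0 z - lin sc ?dl y : cf L" using y(2) inc_cf[OF osub_zero[OF L]] by metis
    have "keys (lin sc ?dl y) <= gr ?B fst 0" by (rule keys_lin) (use y(1) cplx_keys[OF cQ, of _ 0] in auto)
    then obtain z' where z': "lin sc ?dl y = emb 0 z'" "keys z' <= {..<b' 0}" by (rule emb_surj)
    have z'W: "z' : W" using z'(2) by (simp add: W_def R(3))
    have "z' : V" unfolding H0[OF z'W] using y(1) z'(1) osub_zero[OF osub_cf[OF Q(2)]] by (intro exI[of _ y]) simp
    moreover have "z - z' : cf L" using y2 emb_cf[OF L, of 0 "z - z'"] by (simp add: z'(1) emb_diff)
    hence "z - z' : V" using WLV osub_diff[OF oW zW z'W] by blast
    ultimately show "lin sc ?e' x : V" unfolding lx by (rule osub_diffD[OF oV, rotated])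
   qed
  qed
  have "\<exists>h'. coh sc S.GB S.gd D (?Z n) i h' & annx sc S.GB S.gd D (?Z n) i h' = annx sc (Bs b) fst ?d (?Z n) i (%b. pm (h b))"
  proof (rule sc.annx_compare_augm[OF module_sc oV L cpl' D(1) exc' D(2) A A' _ _ sc.osub_ifl[OF osub_ext oU'(2)] _ h1])
   show "\<exists>x. keys x <= gr S.GB S.gd 0 & ?e q - lin sc ?e' x : V" if "q : gr (Bs b) fst 0" for q
    using that osub_zero[OF oV] unfolding gr0 gr_Bs R(3) by (intro exI[of _ "single ({#}, q) 1"]) auto
   show "\<exists>x. keys x <= gr (Bs b) fst 0 & ?e' q - lin sc ?e x : V" if "q : gr S.GB S.gd 0" for q
    using that osub_zero[OF oV] unfolding gr0 gr_Bs R(3) by (intro exI[of _ "single (snd q) 1"]) auto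
   show "sc k x : ?Z n" if "k : L" for k and x :: "'n \<Rightarrow>\<^sub>0 'r"
    using sc_cf[OF L that, of x] ext_L[of U] sc.ifl_base[OF osub_ext[of U] subset_UNIV oU'(2)] by blast
  qed
  thus "P : {P. primep P & (\<exists>n i h. coh sc S.GB S.gd D (?Z n) i h & P = {a. ph a : annx sc S.GB S.gd D (?Z n) i h})}"
   using P P1 by blast
 qed
 ultimately show ?thesis by (rule finite_subset[rotated])
qed

text \<open>The given resolution may have terms of infinite rank. It is exchanged for one of finite
  rank in each degree, which preserves the annihilators, before passing to the completion, since
  approximation and Krull's theorem work in finitely generated modules.\<close>

theorem finite_ext_primes:
 fixes c :: nat and U :: "('n \<Rightarrow>\<^sub>0 'c) set" and a :: "'i => 'c" and dd :: "'x => ('x \<Rightarrow>\<^sub>0 'c)" and s :: "'c => 'e => 'e::ab_group_add"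
 assumes Q: "noeth scl UNIV Kq" "osub scl Kq" "locl Kq nq" "reg d Kq nq"
  and Lf: "L = sp (*) Kq f {..<c}" and regf: "!!k r. k < c ==> f k * r : sp (*) Kq f {..<k} ==> r : sp (*) Kq f {..<k}"
  and cpl: "cplx Ka B dg dd" and exc: "exct Ka B dg dd"
  and M: "Modules.module s" and V: "submod s V" and KV: "!!k x. k : Ka ==> s k x : V"
  and A: "augm s ep V Ka B dg dd" and fg: "UNIV = sp s V y {..<p::nat}"
  and sur: "!!j. j < p ==> \<exists>x. keys x <= gr B dg 0 & y j - lin s ep x : V"
  and U: "submod sc U" "cf Ka <= U" and NU: "noeth (range sc) UNIV U" and I: "finite I"
 shows "finite {P. primep P & (\<exists>n i h. coh sc B dg dd (ifl sc a I U UNIV n) i h \<and>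
  P = annx sc B dg dd (ifl sc a I U UNIV n) i h)}"
proof -
 interpret M: Modules.module s by (rule M)
 define W0 where "W0 = {z :: nat \<Rightarrow>\<^sub>0 'c. keys z <= {..<p}}"
 define V0 where "V0 = {z\<in>W0. lin s y z : V}"
 have oW0: "submod sc W0" unfolding W0_def by (rule osub_kin)
 have V0W: "V0 <= W0" unfolding V0_def by blast
 have oV0: "submod sc V0"
 proof (rule osubI)
  show "0 : V0" using osub_zero[OF oW0] osub_zero[OF V] by (simp add: V0_def)
  show "p - q : V0" if "p : V0" "q : V0" for p q
   using that osub_diff[OF oW0] osub_diff[OF V] by (simp add: V0_def M.lin_diff)
  show "u p : V0" if u: "u : range sc" "p : V0" for u p
   using that osub_op[OF oW0 u(1)] M.osub_scale[OF V] by (auto simp: V0_def M.lin_sc)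
 qed
 have KW0: "sc k w : V0" if "k : Ka" "w : W0" for k w
  using KV[OF that(1)] sc.osub_scale[OF oW0 that(2)] by (simp add: V0_def M.lin_sc)
 note gens = unit_gens[OF oV0 V0W[unfolded W0_def], folded W0_def]
 obtain b c0 where R: "ressq Ka W0 V0 b c0" "b 0 = p" "c0 0 = (%j. single j 1)"
  using ressq_exists[OF NA Ka oV0 KW0 gens] by blast
 have cR: "cplx Ka (Bs b) fst (dl c0)" and eR: "exct Ka (Bs b) fst (dl c0)"
  by (rule ressq_cplx[OF Ka R(1)], rule ressq_exct[OF Ka R(1)])
 have A': "augm s (%q. y (snd q)) V Ka (Bs b) fst (dl c0)"
  unfolding augm_def
 proof (intro allI impI)
  fix x :: "nat \<times> nat \<Rightarrow>\<^sub>0 'c" assume "keys x <= gr (Bs b) fst 0"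
  then obtain z where z: "x = emb 0 z" "keys z <= {..<b 0}" by (rule emb_surj)
  have zW: "z : W0" using z(2) by (simp add: W0_def R(2))
  have l: "lin s (%q. y (snd q)) x = lin s y z" by (simp add: z(1) emb_def M.lin_lin)
  have KbV: "lin sc (c0 0) v : V0" if v: "v : Kb Ka (b 0)" for v
  proof -
   have v: "keys v <= {..<p}" "v : cf Ka" using v by (auto simp: Kb_def R(2))
   have "lin s y v : V" by (rule M.lin_cf[OF V v(2) KV])
   thus ?thesis using v(1) by (simp add: R(3) lin_unit V0_def W0_def)
  qed
  have "z : V0 \<longleftrightarrow> (\<exists>y. keys y <= gr (Bs b) fst 1 & emb 0 z - lin sc (dl c0) y : cf Ka)"
   using ressq_H0[OF Ka oV0 R(1) z(2) KbV] by (simp add: R(3) lin_unit)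
  thus "lin s (%q. y (snd q)) x : V \<longleftrightarrow> (\<exists>y. keys y <= gr (Bs b) fst 1 & x - lin sc (dl c0) y : cf Ka)"
   using zW unfolding l z(1)[symmetric] V0_def by blast
 qed
 have cov: "\<exists>x. keys x <= gr (Bs b) fst 0 & w - lin s (%q. y (snd q)) x : V" for w
 proof -
  obtain u r where ur: "u : V" "w = u + (\<Sum>j<p. s (r j) (y j))" using fg by (metis UNIV_I sp_E)
  define z where "z = (\<Sum>j<p. single j (r j))"
  have "lin s (%q. y (snd q)) (emb 0 z) = lin s y z" by (simp add: emb_def M.lin_lin)
  also have "\<dots> = (\<Sum>j<p. s (r j) (y j))" by (simp add: z_def M.lin_sum)
  finally have "w - lin s (%q. y (snd q)) (emb 0 z) = u" using ur(2) by simp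
  moreover have "keys (emb 0 z) <= gr (Bs b) fst 0"
   using sum_single_lin(1)[of r p] unfolding keys_emb gr_Bs R(2) z_def by blast
  ultimately show ?thesis using ur(1) by metis
 qed
 let ?Z = "ifl sc a I U UNIV"
 have oU': "submod sc (UNIV :: ('n \<Rightarrow>\<^sub>0 'c) set)" by (simp add: osub_def)
 have "\<exists>h'. coh sc (Bs b) fst (dl c0) (?Z n) i h' & annx sc (Bs b) fst (dl c0) (?Z n) i h' = annx sc B dg dd (?Z n) i h"
  if h: "coh sc B dg dd (?Z n) i h" for n i h
 proof (rule sc.annx_compare_augm[OF M V Ka cpl cR exc eR A A' cov _ sc.osub_ifl[OF U(1) oU'] _ h])
  show "\<exists>x. keys x <= gr B dg 0 & y (snd q) - lin s ep x : V" if "q : gr (Bs b) fst 0" for q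
   using that sur unfolding gr_Bs R(2) by auto
  show "sc k x : ?Z n" if "k : Ka" for k and x :: "'n \<Rightarrow>\<^sub>0 'c"
   using sc_cf[OF Ka that, of x] U(2) sc.ifl_base[OF U(1) subset_UNIV oU'] by blast
 qed
 hence "{P. primep P & (\<exists>n i h. coh sc B dg dd (?Z n) i h & P = annx sc B dg dd (?Z n) i h)}
  <= {P. primep P & (\<exists>n i h. coh sc (Bs b) fst (dl c0) (?Z n) i h & P = annx sc (Bs b) fst (dl c0) (?Z n) i h)}"
  by (smt (verit, ccfv_threshold) Collect_mono)
 moreover have "finite {P. primep P & (\<exists>n i h. coh sc (Bs b) fst (dl c0) (?Z n) i h & P = annx sc (Bs b) fst (dl c0) (?Z n) i h)}"
  by (rule finite_primes_finite_free[OF Q Lf regf cR eR U NU I])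
 ultimately show ?thesis by (rule finite_subset)
qed

end

section \<open>Completions\<close>

text \<open>\<open>ps\<close> sends a coherent sequence to its limit in the completion, presented modulo \<open>L\<close>.\<close>

locale complmap =
 fixes Ka :: "'c::comm_ring_1 set" and xs :: "nat => 'c" and e :: nat and L :: "'r::comm_ring_1 set" and ps :: "(nat => 'c) => 'r"
  and cch :: "(nat => 'c) => bool"
 assumes Ka: "osub scl Ka" and L: "osub scl L"
  and cch_def: "cch a \<longleftrightarrow> (\<forall>n. a (Suc n) - a n : ifl (*) xs {..<e} Ka UNIV n)"
  and diff: "cch a ==> cch b ==> ps (%n. a n - b n) - (ps a - ps b) : L"
  and mult: "cch a ==> cch b ==> ps (%n. a n * b n) - ps a * ps b : L"
  and one: "ps (%_. 1) - 1 : L"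
  and null: "cch a ==> ps a : L \<longleftrightarrow> (\<forall>n. a n : ifl (*) xs {..<e} Ka UNIV n)"
  and surj: "\<exists>a. cch a & s - ps a : L"
begin

abbreviation "mA \<equiv> ifl (*) xs {..<e} Ka UNIV"
abbreviation "ph \<equiv> %x. ps (%_. x)"
abbreviation "mL \<equiv> ifl (*) (%j. ph (xs j)) {..<e} L UNIV"

lemma oU: "osub scl (UNIV :: 'z::comm_ring_1 set)" by (simp add: osub_def)
lemma o_mA: "osub scl (mA n)" by (rule module.osub_ifl[OF module_ring Ka oU])
lemma o_mL: "osub scl (mL n)" by (rule module.osub_ifl[OF module_ring L oU])
lemma L_mL: "L <= mL n" by (rule module.ifl_base[OF module_ring L subset_UNIV oU])
lemma Ka_mA: "Ka <= mA n" by (rule module.ifl_base[OF module_ring Ka subset_UNIV oU])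
lemma mA_Suc: "mA (Suc n) <= mA n" by (rule module.ifl_decreasing[OF module_ring Ka subset_UNIV oU])
lemma mA_antimono: "m <= n ==> mA n <= mA m"
 by (rule lift_Suc_antimono_le[of mA]) (rule mA_Suc)
lemma xs_mA: "j < e ==> r : mA n ==> xs j * r : mA (Suc n)"
 by (rule module.ifl_mult[OF module_ring Ka oU]) simp_all

lemma cch_const: "cch (%_. x)"
 using osub_zero[OF o_mA] by (simp add: cch_def del: ifl.simps)

lemma cch_diff: assumes "cch a" "cch b" shows "cch (%n. a n - b n)"
 unfolding cch_def
proof
 fix n
 have "(a (Suc n) - a n) - (b (Suc n) - b n) : mA n" using osub_diff[OF o_mA] assms unfolding cch_def by blast
 thus "(a (Suc n) - b (Suc n)) - (a n - b n) : mA n" by (simp add: algebra_simps del: ifl.simps)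
qed

lemma cch_mult: assumes "cch a" "cch b" shows "cch (%n. a n * b n)"
 unfolding cch_def
proof
 fix n
 have "a (Suc n) * (b (Suc n) - b n) + b n * (a (Suc n) - a n) : mA n"
  using assms unfolding cch_def by (intro osub_add[OF o_mA] ideal_smult[OF o_mA]) auto
 thus "a (Suc n) * b (Suc n) - a n * b n : mA n" by (simp add: algebra_simps del: ifl.simps)
qed

lemma cch_step: assumes "cch a" "m <= n" shows "a n - a m : mA m"
 using assms(2)
proof (induction n rule: dec_induct)
 case base
 thus ?case using osub_zero[OF o_mA] by simp
next
 case (step n)
 have "a (Suc n) - a n : mA m" using assms(1) mA_antimono[OF step.hyps(1)] unfolding cch_def by blast
 from osub_add[OF o_mA this step.IH] show ?case by simp
qed

lemma ps_cong: assumes "cch a" "cch b" "!!n. a n - b n : mA n" shows "ps a - ps b : L"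
 using osub_diffD'[OF L diff[OF assms(1,2)]] null[OF cch_diff[OF assms(1,2)]] assms(3) by blast

lemma cch_scaled: "cch a ==> cch (%n. x * a n)"
 using cch_mult[OF cch_const[of x]] .

lemma ps_scaled: "cch a ==> ps (%n. x * a n) - ph x * ps a : L"
 using mult[OF cch_const[of x]] .

lemma cch_sum: "(!!j. j : S ==> cch (a j)) ==> cch (%n. \<Sum>j\<in>S. a j n)"
proof (induction S rule: infinite_finite_induct)
 case (insert j S)
 have "cch (%n. a j n - (0 - (\<Sum>j\<in>S. a j n)))"
  using insert by (intro cch_diff cch_const) auto
 thus ?case using insert by simp
qed (use cch_const[of 0] in simp_all)

lemma ps_zero: "ph 0 : L"
 using null[OF cch_const[of 0]] osub_zero[OF o_mA] by blast

lemma ps_sum: "finite S ==> (!!j. j : S ==> cch (a j)) ==> ps (%n. \<Sum>j\<in>S. a j n) - (\<Sum>j\<in>S. ps (a j)) : L"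
proof (induction S rule: finite_induct)
 case empty
 thus ?case using ps_zero by simp
next
 case (insert j S)
 have c: "cch (%n. \<Sum>j\<in>insert j S. a j n)" "cch (%n. \<Sum>j\<in>S. a j n)" using insert.prems by (auto intro: cch_sum)
 have "(%n. (\<Sum>j\<in>insert j S. a j n) - (\<Sum>j\<in>S. a j n)) = a j" using insert.hyps by simp
 hence "ps (a j) - (ps (%n. \<Sum>j\<in>insert j S. a j n) - ps (%n. \<Sum>j\<in>S. a j n)) : L" using diff[OF c] by simp
 moreover have "ps (%n. \<Sum>j\<in>S. a j n) - (\<Sum>j\<in>S. ps (a j)) : L" using insert by simp
 ultimately have "(ps (%n. \<Sum>j\<in>S. a j n) - (\<Sum>j\<in>S. ps (a j))) - (ps (a j) - (ps (%n. \<Sum>j\<in>insert j S. a j n) - ps (%n. \<Sum>j\<in>S. a j n))) : L"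
  using osub_diff[OF L] by blast
 moreover have "(\<Sum>j\<in>insert j S. ps (a j)) = ps (a j) + (\<Sum>j\<in>S. ps (a j))" using insert.hyps by simp
 ultimately show ?case by (simp add: algebra_simps)
qed

text \<open>A convergent sequence is a telescoping series whose increments lie in higher and higher
  powers. Each increment is a combination of the \<open>xs j\<close>; summing the coefficients gives
  convergent sequences \<open>ga j\<close> whose \<open>n\<close>-th terms lie in the
  \<open>n\<close>-th power, and the limit is the combination of the \<open>xs j\<close> with their
  limits.\<close>

lemma null_mL: "cch y ==> y n : mA n ==> ps y : mL n"
proof (induction n arbitrary: y)
 case (Suc n)
 have ex: "\<exists>d. (\<forall>j<e. d j : mA m) & r - (\<Sum>j<e. xs j * d j) : Ka" if r: "r : mA (Suc m)" for r m
 proof -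
  obtain u x where ux: "r = u + (\<Sum>j<e. xs j * x j)" "u : Ka" "\<forall>j\<in>{..<e}. x j : mA m" using r by auto
  have "r - (\<Sum>j<e. xs j * x j) = u" by (simp add: ux(1))
  thus ?thesis using ux by (intro exI[of _ x]) auto
 qed
 \<comment> \<open>The series starts with the value at index \<open>Suc n\<close>. In the bound
   below, \<open>k - 1\<close> truncates to 0 for \<open>k = 0\<close>, so the terms for
   \<open>k = 0\<close> and \<open>k = 1\<close> lie in the same power.\<close>
 define R where "R k = (if k = 0 then y (Suc n) else y (Suc (n + k)) - y (n + k))" for k
 have R: "R k : mA (Suc (n + (k - 1)))" for k
 proof (cases k)
  case 0
  thus ?thesis using Suc.prems(2) by (simp add: R_def del: ifl.simps)
 next
  case (Suc k')
  thus ?thesis using \<open>cch y\<close> unfolding cch_def by (simp add: R_def del: ifl.simps)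
 qed
 have "\<forall>k. \<exists>d. (\<forall>j<e. d j : mA (n + (k - 1))) & R k - (\<Sum>j<e. xs j * d j) : Ka" using ex[OF R] by blast
 from choice[OF this] obtain d where d: "!!k j. j < e ==> d k j : mA (n + (k - 1))"
  "!!k. R k - (\<Sum>j<e. xs j * d k j) : Ka" by blast
 define ga where "ga j m = (\<Sum>k\<le>m - n. d k j)" for j m
 have cga: "cch (ga j)" if j: "j < e" for j
  unfolding cch_def
 proof
  fix m
  show "ga j (Suc m) - ga j m : mA m"
  proof (cases "m < n")
   case True
   thus ?thesis using osub_zero[OF o_mA] by (simp add: ga_def del: ifl.simps)
  next
   case False
   hence "Suc m - n = Suc (m - n)" by simp
   thus ?thesis using d(1)[OF j, of "Suc (m - n)"] False by (simp add: ga_def del: ifl.simps)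
  qed
 qed
 have gan: "ga j n : mA n" if j: "j < e" for j using d(1)[OF j, of 0] by (simp add: ga_def del: ifl.simps)
 have tel: "(\<Sum>k\<le>t. R k) = y (Suc (n + t))" for t
  by (induction t) (simp_all add: R_def)
 define w where "w m = (\<Sum>j<e. xs j * ga j m)" for m
 have cw: "cch w" unfolding w_def by (rule cch_sum, rule cch_scaled, rule cga) simp
 have "y m - w m : mA m" for m
 proof -
  have "w m = (\<Sum>k\<le>m - n. \<Sum>j<e. xs j * d k j)"
   unfolding w_def ga_def sum_distrib_left by (rule sum.swap)
  hence "y (Suc (n + (m - n))) - w m = (\<Sum>k\<le>m - n. R k - (\<Sum>j<e. xs j * d k j))"
   by (simp add: tel[symmetric] sum_subtractf)
  also have "\<dots> : mA m" by (rule osub_sum[OF o_mA subsetD[OF Ka_mA d(2)]])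
  finally have 1: "y (Suc (n + (m - n))) - w m : mA m" .
  have "y (Suc (n + (m - n))) - y m : mA m" by (rule cch_step[OF Suc.prems(1)]) simp
  from osub_diff[OF o_mA 1 this] show ?thesis by (simp del: ifl.simps)
 qed
 hence 1: "ps y - ps w : mL (Suc n)" using ps_cong[OF Suc.prems(1) cw] L_mL by blast
 have "ps w - (\<Sum>j<e. ps (%m. xs j * ga j m)) : L" unfolding w_def
  by (rule ps_sum) (auto intro: cch_scaled cga)
 moreover have "(\<Sum>j<e. ps (%m. xs j * ga j m)) : mL (Suc n)"
 proof (rule osub_sum[OF o_mL])
  fix j assume j: "j : {..<e}"
  hence je: "j < e" by simp
  have "ph (xs j) * ps (ga j) : mL (Suc n)"
   by (rule module.ifl_mult[OF module_ring L oU _ j Suc.IH[OF cga[OF je] gan[OF je]]]) simp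
  moreover have "ps (%m. xs j * ga j m) - ph (xs j) * ps (ga j) : mL (Suc n)"
   using ps_scaled[OF cga[OF je]] L_mL by blast
  ultimately show "ps (%m. xs j * ga j m) : mL (Suc n)" by (rule osub_diffD[OF o_mL, rotated])
 qed
 ultimately have "ps w : mL (Suc n)" using osub_diffD[OF o_mL] L_mL by blast
 thus ?case by (rule osub_diffD[OF o_mL 1])
qed simp

text \<open>\<open>T n\<close> consists of the elements all of whose representing sequences have
  \<open>n\<close>-th term in the \<open>n\<close>-th power. It is an ideal containing
  \<open>L\<close>, and multiplication by \<open>xs j\<close> raises the index by one, so it
  contains the \<open>n\<close>-th power formed in the completion.\<close>

lemma faithful: "ph a : mL n ==> a : mA n"
proof -
 define T where "T n = {s. \<forall>a. cch a --> s - ps a : L --> a n : mA n}" for n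
 have oT: "osub scl (T n)" for n
 proof (rule idealI)
  show "0 : T n" unfolding T_def using null osub_uminus[OF L] by fastforce
  show "p - q : T n" if pq: "p : T n" "q : T n" for p q
   unfolding T_def
  proof (intro CollectI allI impI)
   fix a assume a: "cch a" "p - q - ps a : L"
   obtain b where b: "cch b" "q - ps b : L" using surj by blast
   have cab: "cch (%n. a n - (0 - b n))" by (intro cch_diff a b cch_const)
   have 1: "ps (%n. a n - (0 - b n)) - (ps a - ps (%n. 0 - b n)) : L" by (intro diff a cch_diff b cch_const)
   have 2: "ps (%n. 0 - b n) - (ph 0 - ps b) : L" by (intro diff b cch_const)
   have "(p - q - ps a) + (q - ps b) - (ps (%n. a n - (0 - b n)) - (ps a - ps (%n. 0 - b n))) + (ps (%n. 0 - b n) - (ph 0 - ps b)) + ph 0 : L"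
    by (rule osub_add[OF L osub_add[OF L osub_diff[OF L osub_add[OF L a(2) b(2)] 1] 2] ps_zero])
   hence "p - ps (%n. a n - (0 - b n)) : L" by (simp add: algebra_simps)
   hence "a n - (0 - b n) : mA n" using pq(1) cab unfolding T_def by blast
   moreover have "b n : mA n" using pq(2) b unfolding T_def by blast
   ultimately show "a n : mA n" using osub_diff[OF o_mA, of "a n - (0 - b n)" n "b n"] by (simp del: ifl.simps)
  qed
  show "r * p : T n" if p: "p : T n" for r p
   unfolding T_def
  proof (intro CollectI allI impI)
   fix a assume a: "cch a" "r * p - ps a : L"
   obtain b where b: "cch b" "p - ps b : L" using surj by blast
   obtain d where d: "cch d" "r - ps d : L" using surj by blast
   have m: "ps (%n. d n * b n) - ps d * ps b : L" by (rule mult[OF d(1) b(1)])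
   have "(r * p - ps a) - r * (p - ps b) - ps b * (r - ps d) + (ps (%n. d n * b n) - ps d * ps b) : L"
    by (rule osub_add[OF L osub_diff[OF L osub_diff[OF L a(2) ideal_smult[OF L b(2)]] ideal_smult[OF L d(2)]] m])
   hence "ps (%n. d n * b n) - ps a : L" by (simp add: algebra_simps)
   hence "ps (%n. d n * b n - a n) : L"
    using osub_diffD[OF L diff[OF cch_mult[OF d(1) b(1)] a(1)]] by blast
   hence "d n * b n - a n : mA n" using null[OF cch_diff[OF cch_mult[OF d(1) b(1)] a(1)]] by blast
   moreover have "d n * b n : mA n" using p b unfolding T_def by (intro ideal_smult[OF o_mA]) blast
   ultimately show "a n : mA n" by (rule osub_diffD'[OF o_mA])
  qed
 qed
 have LT: "L <= T n" for n
 proof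
  fix s assume s: "s : L"
  have "a n : mA n" if "cch a" "s - ps a : L" for a
   using osub_diffD'[OF L that(2) s] null[OF that(1)] by blast
  thus "s : T n" unfolding T_def by blast
 qed
 have "mL n <= T n" for n
 proof (induction n)
  case 0
  thus ?case by (simp add: T_def)
 next
  case (Suc n)
  show ?case
  proof (rule module.ifl_least[OF module_ring oT LT])
   fix j s assume j: "j : {..<e}" and s: "s : mL n"
   have sT: "s : T n" using s Suc by blast
   show "ph (xs j) * s : T (Suc n)"
    unfolding T_def
   proof (intro CollectI allI impI)
    fix a assume a: "cch a" "ph (xs j) * s - ps a : L"
    obtain b where b: "cch b" "s - ps b : L" using surj by blast
    have bn: "b n : mA n" using sT b unfolding T_def by blast
    have "b (Suc n) - b n : mA n" using b(1) unfolding cch_def by blast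
    from osub_diffD[OF o_mA this bn] have bS: "b (Suc n) : mA n" .
    have "(ph (xs j) * s - ps a) - ph (xs j) * (s - ps b) + (ps (%n. xs j * b n) - ph (xs j) * ps b) : L"
     by (rule osub_add[OF L osub_diff[OF L a(2) ideal_smult[OF L b(2)]] ps_scaled[OF b(1)]])
    hence "ps (%n. xs j * b n) - ps a : L" by (simp add: algebra_simps)
    hence "ps (%n. xs j * b n - a n) : L"
     using osub_diffD[OF L diff[OF cch_scaled[OF b(1)] a(1)]] by blast
    hence "xs j * b (Suc n) - a (Suc n) : mA (Suc n)" using null[OF cch_diff[OF cch_scaled[OF b(1)] a(1)]] by blast
    moreover have "xs j * b (Suc n) : mA (Suc n)" by (rule xs_mA[OF _ bS]) (use j in simp)
    ultimately show "a (Suc n) : mA (Suc n)" by (rule osub_diffD'[OF o_mA])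
   qed
  qed
 qed
 moreover assume "ph a : mL n"
 ultimately have "ph a : T n" by blast
 thus "a : mA n" using cch_const[of a] osub_zero[OF L] unfolding T_def by (auto simp del: ifl.simps)
qed

text \<open>For density, the limit of a sequence differs from the constant sequence at its
  \<open>n\<close>-th term by an element of the \<open>n\<close>-th power. For the radical
  condition, an \<open>xs j\<close> invertible in the completion would put 1 into the first power
  over the original ring.\<close>

lemma basechange:
 assumes NA: "noeth scl UNIV Ka" and NL: "noeth scl UNIV L" and jA: "jac Ka xs {..<e}"
  and 1: "1 ~: mA 1" and n: "locl L n"
 shows "basechange Ka xs e L ph"
proof (rule basechange.intro[OF Ka L NA NL])
 show "ph (a - b) - (ph a - ph b) : L" for a b by (rule diff[OF cch_const cch_const])
 show "ph (a * b) - ph a * ph b : L" for a b by (rule mult[OF cch_const cch_const])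
 show "ph 1 - 1 : L" by (rule one)
 show "ph k : L" if "k : Ka" for k using null[OF cch_const[of k]] that Ka_mA by blast
 show "\<exists>a. s - ph a : mL n" for s n
 proof -
  obtain a where a: "cch a" "s - ps a : L" using surj by blast
  have "ps (%k. a k - a n) : mL n" by (rule null_mL[OF cch_diff[OF a(1) cch_const]]) (simp add: osub_zero[OF o_mA] del: ifl.simps)
  moreover have "ps (%k. a k - a n) - (ps a - ph (a n)) : mL n" using diff[OF a(1) cch_const] L_mL by blast
  ultimately have "ps a - ph (a n) : mL n" by (rule osub_diffD'[OF o_mL, rotated])
  from osub_add[OF o_mL subsetD[OF L_mL a(2)] this] have "s - ph (a n) : mL n" by (simp del: ifl.simps)
  thus ?thesis by blast
 qed
 show "a : mA n" if "ph a : mL n" for a n using that by (rule faithful)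
 show "jac Ka xs {..<e}" by (rule jA)
 show "jac L (%j. ph (xs j)) {..<e}"
 proof (rule locl_jac[OF n])
  fix j assume j: "j : {..<e}"
  show "ph (xs j) : n"
  proof (rule ccontr)
   assume "ph (xs j) ~: n"
   then obtain v where v: "v * ph (xs j) - 1 : L" using n unfolding locl_def by blast
   obtain b where b: "cch b" "v - ps b : L" using surj by blast
   have "(v * ph (xs j) - 1) - ph (xs j) * (v - ps b) + (ps (%n. xs j * b n) - ph (xs j) * ps b) - (ph 1 - 1) : L"
    by (rule osub_diff[OF L osub_add[OF L osub_diff[OF L v ideal_smult[OF L b(2)]] ps_scaled[OF b(1)]] one])
   hence "ps (%n. xs j * b n) - ph 1 : L" by (simp add: algebra_simps)
   hence "ps (%n. xs j * b n - 1) : L" using osub_diffD[OF L diff[OF cch_scaled[OF b(1)] cch_const]] by blast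
   hence "xs j * b 1 - 1 : mA 1" using null[OF cch_diff[OF cch_scaled[OF b(1)] cch_const]] by blast
   moreover have "xs j * b 1 : mA (Suc 0)" by (rule xs_mA) (use j in simp_all)
   ultimately have "1 : mA 1" unfolding One_nat_def by (rule osub_diffD'[OF o_mA])
   thus False using 1 by blast
  qed
 qed
qed

end

section \<open>Presentation of a commutative ring by a ring type\<close>

text \<open>The preceding algebra concerns type-class rings modulo an ideal. \<open>ev\<close>
  presents a ring with carrier as such a quotient with kernel \<open>Kr\<close>, and
  \<open>pull\<close> translates its ideals into ideals above \<open>Kr\<close>.\<close>

locale present = cring R for R :: "('a, 'b) ring_scheme" (structure) +
 fixes ev :: "'z::comm_ring_1 => 'a"
 assumes ev_closed [simp]: "ev x : carrier R" and ev_add: "ev (x + y) = ev x \<oplus> ev y"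
  and ev_mult: "ev (x * y) = ev x \<otimes> ev y" and ev_one: "ev 1 = \<one>"
  and ev_surj: "a : carrier R ==> \<exists>x. ev x = a"
begin

lemma ev_zero: "ev 0 = \<zero>"
 using ev_add[of 0 0] add.r_cancel_one'[of "ev 0" "ev 0"] by simp

lemma ev_uminus: "ev (- x) = \<ominus> ev x"
proof -
 have "ev x \<oplus> ev (- x) = \<zero>" using ev_add[of x "- x"] ev_zero by simp
 thus ?thesis by (metis ev_closed minus_equality a_comm)
qed

lemma ev_diff: "ev (x - y) = ev x \<ominus> ev y"
 using ev_add[of x "- y"] by (simp add: ev_uminus minus_eq)

definition pull :: "'a set => 'z set" where "pull S = {z. ev z : S}"
definition Kr :: "'z set" where "Kr = pull {\<zero>}"

lemma pull_iff: "z : pull S \<longleftrightarrow> ev z : S" by (simp add: pull_def)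
lemma Kr_iff: "z : Kr \<longleftrightarrow> ev z = \<zero>" by (simp add: Kr_def pull_def)

lemma ev_eq_iff: "ev x = ev y \<longleftrightarrow> x - y : Kr"
 by (simp add: Kr_iff ev_diff)

lemma osub_pull: assumes "ideal J R" shows "osub scl (pull J)"
proof -
 interpret ideal J R by fact
 show ?thesis
 proof (rule idealI)
  show "0 : pull J" by (simp add: pull_iff ev_zero)
  show "x - y : pull J" if "x : pull J" "y : pull J" for x y
   using that a_closed[of "ev x" "\<ominus> ev y"] a_inv_closed[of "ev y"] by (simp add: pull_iff ev_diff minus_eq)
  show "r * x : pull J" if "x : pull J" for r x
   using that I_l_closed[of "ev x" "ev r"] by (simp add: pull_iff ev_mult)
 qed
qed

lemma osub_Kr: "osub scl Kr"
 unfolding Kr_def by (rule osub_pull[OF zeroideal])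

lemma Kr_pull: assumes "ideal J R" shows "Kr <= pull J"
proof
 fix z assume "z : Kr"
 thus "z : pull J" using additive_subgroup.zero_closed[OF ideal.axioms(1)[OF assms]] by (simp add: Kr_iff pull_iff)
qed

lemma image_pull: assumes "S <= carrier R" shows "ev ` pull S = S"
proof
 show "S <= ev ` pull S"
 proof
  fix s assume s: "s : S"
  then obtain x where "ev x = s" using assms ev_surj by blast
  thus "s : ev ` pull S" using s by (auto simp: pull_iff)
 qed
qed (auto simp: pull_iff)

lemma pull_image: "osub scl T ==> Kr <= T ==> pull (ev ` T) = T"
proof -
 assume T: "osub scl T" "Kr <= T"
 have "z : T" if "ev z = ev t" "t : T" for z t
  using osub_diffD[OF T(1), of z t] that T(2) ev_eq_iff[of z t] by blast
 thus ?thesis by (auto simp: pull_iff)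
qed

lemma ideal_image: assumes T: "osub scl T" shows "ideal (ev ` T) R"
proof (rule Ideal.idealI[OF ring_axioms])
 show "subgroup (ev ` T) (add_monoid R)"
 proof (rule add.subgroupI)
  show "ev ` T <= carrier R" by auto
  show "ev ` T ~= {}" using osub_zero[OF T] by auto
  show "\<ominus> a : ev ` T" if "a : ev ` T" for a
   using that osub_uminus[OF T] by (auto simp flip: ev_uminus)
  show "a \<oplus> b : ev ` T" if "a : ev ` T" "b : ev ` T" for a b
   using that osub_add[OF T] by (auto simp flip: ev_add)
 qed
 show l: "x \<otimes> a : ev ` T" if "a : ev ` T" "x : carrier R" for a x
 proof -
  obtain t where t: "a = ev t" "t : T" using \<open>a : ev ` T\<close> by blast
  obtain y where y: "ev y = x" using ev_surj[OF \<open>x : carrier R\<close>] by blast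
  have "x \<otimes> a = ev (y * t)" by (simp add: ev_mult t y)
  thus ?thesis using ideal_smult[OF T t(2), of y] by (simp only: image_eqI)
 qed
 show "a \<otimes> x : ev ` T" if "a : ev ` T" "x : carrier R" for a x
 proof -
  have "a : carrier R" using that(1) by auto
  thus ?thesis using l[OF that] that(2) by (simp add: m_comm)
 qed
qed

lemma noeth_Kr: assumes N: "noetherian_ring R" shows "noeth scl UNIV Kr"
 unfolding noeth_def
proof (intro allI impI)
 fix f :: "nat => 'z set" assume f: "\<forall>n. osub scl (f n) & Kr <= f n & f n <= UNIV & f n <= f (Suc n)"
 have up: "f n <= f m" if "n <= m" for n m using f that by (metis lift_Suc_mono_le)
 define C where "C = range (%n. ev ` f n)"
 have "subset.chain {I. ideal I R} C"
  unfolding subset.chain_def C_def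
 proof (intro conjI ballI)
  show "range (%n. ev ` f n) <= {I. ideal I R}" using f ideal_image by auto
  show "(\<subset>)\<^sup>=\<^sup>= x y \<or> (\<subset>)\<^sup>=\<^sup>= y x" if xy: "x : range (%n. ev ` f n)" "y : range (%n. ev ` f n)" for x y
  proof -
   obtain n m where nm: "x = ev ` f n" "y = ev ` f m" using xy by blast
   hence "x <= y \<or> y <= x" using up[of n m] up[of m n] by (metis image_mono nat_le_linear)
   thus ?thesis by auto
  qed
 qed
 hence "\<Union>C : C" by (intro noetherian_ring.ideal_chain_is_trivial[OF N]) (auto simp: C_def)
 then obtain n where n: "\<Union>C = ev ` f n" by (auto simp: C_def)
 have "f m = f n" if "m >= n" for m
 proof
  show "f n <= f m" by (rule up[OF that])
  have "ev ` f m <= ev ` f n" using n by (auto simp: C_def)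
  hence "pull (ev ` f m) <= pull (ev ` f n)" by (auto simp: pull_def)
  thus "f m <= f n" using f by (simp add: pull_image)
 qed
 thus "\<exists>n. \<forall>m\<ge>n. f m = f n" by blast
qed

lemma ideal_fg:
 assumes N: "noetherian_ring R" and I: "ideal I R"
 obtains k :: nat and g where "pull I = sp (*) Kr g {..<k}"
proof -
 have "noeth scl (pull I) Kr" by (rule noeth_mono[OF noeth_Kr[OF N]]) auto
 thus thesis
  by (rule module.noeth_fg[OF module_ring _ osub_pull[OF I] osub_Kr Kr_pull[OF I]]) (rule that)
qed

lemma pull_genideal:
 fixes g :: "nat => 'z"
 shows "pull (Idl (ev ` g ` {..<k})) = sp (*) Kr g {..<k}"
proof -
 let ?S = "sp (*) Kr g {..<k}"
 have oS: "osub scl ?S" by (rule osub_sp_ring[OF osub_Kr])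
 have KS: "Kr <= ?S" by (rule module.sp_base[OF module_ring])
 have sub: "ev ` g ` {..<k} <= carrier R" by auto
 have "Idl (ev ` g ` {..<k}) <= ev ` ?S"
 proof (rule genideal_minimal[OF ideal_image[OF oS]])
  have "g j : ?S" if "j < k" for j by (rule sp_ring_gen[OF osub_Kr]) (use that in auto)
  thus "ev ` g ` {..<k} <= ev ` ?S" by auto
 qed
 hence "pull (Idl (ev ` g ` {..<k})) <= pull (ev ` ?S)" by (auto simp: pull_iff)
 moreover have "?S <= pull (Idl (ev ` g ` {..<k}))"
 proof (rule module.sp_least[OF module_ring osub_pull[OF genideal_ideal[OF sub]] Kr_pull[OF genideal_ideal[OF sub]]])
  show "g j : pull (Idl (ev ` g ` {..<k}))" if "j : {..<k}" for j
   using genideal_self[OF sub] that by (auto simp: pull_iff)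
 qed
 ultimately show ?thesis using pull_image[OF oS KS] by blast
qed

lemma pull_prime: assumes P: "primeideal P R" shows "pr (pull P)" "Kr <= pull P"
proof -
 interpret primeideal P R by (rule P)
 have "1 ~: pull P" using I_notcarr one_imp_carrier by (auto simp: pull_iff ev_one)
 moreover have "a : pull P \<or> b : pull P" if "a * b : pull P" for a b
  using that I_prime[of "ev a" "ev b"] by (simp add: pull_iff ev_mult)
 ultimately show "pr (pull P)" using osub_pull[OF is_ideal] by (auto simp: pr_def primep_def)
 show "Kr <= pull P" by (rule Kr_pull[OF is_ideal])
qed

lemma pull_power:
 fixes a :: "nat => 'z"
 assumes I: "ideal I R" and a: "pull I = sp (*) Kr a {..<q}"
 shows "ideal (ideal_power R I n) R & pull (ideal_power R I n) = ifl (*) a {..<q} Kr UNIV n"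
proof (induction n)
 case 0
 have "ideal_power R I 0 = carrier R" by (simp add: nat_pow_def ideals_set_def)
 thus ?case using oneideal by (simp add: pull_def)
next
 case (Suc n)
 let ?P = "ideal_power R I n" and ?J = "ifl (*) a {..<q} Kr UNIV"
 have PS: "ideal_power R I (Suc n) = ideal_prod R ?P I" by (simp add: nat_pow_def ideals_set_def)
 have oU: "osub scl (UNIV :: 'z set)" by (simp add: osub_def)
 have oJ: "osub scl (?J m)" for m by (rule module.osub_ifl[OF module_ring osub_Kr oU])
 have KJ: "Kr <= ?J m" for m by (rule module.ifl_base[OF module_ring osub_Kr subset_UNIV oU])
 have P: "ideal ?P R" and pP: "pull ?P = ?J n" using Suc by auto
 have id: "ideal (ideal_prod R ?P I) R" by (rule ideal_prod_is_ideal[OF P I])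
 have aI: "ev (a j) : I" if "j < q" for j
  using sp_ring_gen[OF osub_Kr, of "{..<q}" j a] that a by (auto simp: pull_iff)
 have 1: "?J (Suc n) <= pull (ideal_prod R ?P I)"
 proof (rule module.ifl_least[OF module_ring osub_pull[OF id] Kr_pull[OF id]])
  fix j x assume j: "j : {..<q}" and x: "x : ?J n"
  have "ev x : ?P" using x pP by (auto simp: pull_iff)
  hence "ev x \<otimes> ev (a j) : ideal_prod R ?P I" using aI j by (intro ideal_prod.prod) auto
  thus "a j * x : pull (ideal_prod R ?P I)" by (simp add: pull_iff ev_mult m_comm)
 qed
 have "s : ev ` ?J (Suc n)" if "s : ideal_prod R ?P I" for s
  using that
 proof (induction rule: ideal_prod.induct)
  case (prod i j)
  have "i : carrier R" "j : carrier R" using prod ideal.Icarr[OF P] ideal.Icarr[OF I] by auto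
  then obtain x y where xy: "i = ev x" "j = ev y" using ev_surj[of i] ev_surj[of j] by auto
  have x: "x : ?J n" and "y : sp (*) Kr a {..<q}" using prod xy pP a by (auto simp: pull_iff)
  then obtain u r where y: "u : Kr" "y = u + (\<Sum>j<q. r j * a j)" by (auto elim: sp_E)
  have "(\<Sum>j<q. r j * a j) * x = (\<Sum>j<q. a j * (r j * x))"
   by (simp add: sum_distrib_right mult.assoc mult.left_commute)
  hence "x * y = x * u + (\<Sum>j<q. a j * (r j * x))" by (simp add: y(2) distrib_left mult.commute)
  also have "\<dots> : ?J (Suc n)"
  proof (rule osub_add[OF oJ])
   show "x * u : ?J (Suc n)" using ideal_smult[OF osub_Kr y(1)] KJ by blast
   show "(\<Sum>j<q. a j * (r j * x)) : ?J (Suc n)"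
    by (rule osub_sum[OF oJ], rule module.ifl_mult[OF module_ring osub_Kr oU]) (simp_all add: ideal_smult[OF oJ x] del: ifl.simps)
  qed
  finally show ?case unfolding xy ev_mult[symmetric] by (rule imageI)
 next
  case (sum s1 s2)
  then obtain x y where "s1 = ev x" "x : ?J (Suc n)" "s2 = ev y" "y : ?J (Suc n)" by blast
  hence "s1 \<oplus> s2 = ev (x + y)" "x + y : ?J (Suc n)" using osub_add[OF oJ] by (simp_all add: ev_add del: ifl.simps)
  thus ?case by blast
 qed
 hence "pull (ideal_prod R ?P I) <= pull (ev ` ?J (Suc n))" by (auto simp: pull_iff simp del: ifl.simps)
 hence "pull (ideal_prod R ?P I) <= ?J (Suc n)" unfolding pull_image[OF oJ KJ] .
 thus ?case using id 1 unfolding PS by blast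
qed

text \<open>A non-unit lies in a proper ideal, which the chain condition enlarges to a maximal one
  without Zorn's lemma; by uniqueness that ideal is \<open>\<mm>\<close>.\<close>

lemma local_locl:
 assumes "noetherian_local_ring R \<mm>"
 shows "locl Kr (pull \<mm>)"
proof -
 interpret M: noetherian_local_ring R \<mm> by fact
 interpret mx: maximalideal \<mm> R by (rule M.max_ideal)
 have id: "ideal \<mm> R" by (rule mx.is_ideal)
 have N: "noeth scl UNIV Kr" by (rule noeth_Kr) unfold_locales
 have one: "1 ~: pull \<mm>" using mx.I_notcarr mx.one_imp_carrier by (auto simp: pull_iff ev_one)
 have "\<exists>v. v * x - 1 : Kr" if x: "x ~: pull \<mm>" for x
 proof (rule ccontr)
  assume neg: "\<nexists>v. v * x - 1 : Kr"
  define T0 where "T0 = Kr \<boxplus> prin x"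
  have oT0: "osub scl T0" unfolding T0_def by (rule osub_scl_splus[OF osub_Kr osub_princ])
  have "1 ~: T0"
  proof
   assume "1 : T0"
   then obtain k r where k: "1 = k + r * x" "k : Kr" by (auto simp: T0_def elim!: splusE)
   have "r * x - 1 = - k" by (subst k(1)) simp
   thus False using neg osub_uminus[OF osub_Kr k(2)] by metis
  qed
  define C where "C = {T. osub scl T & Kr <= T & 1 ~: T}"
  have "T0 : C" using oT0 \<open>1 ~: T0\<close> K_mono by (auto simp: C_def T0_def)
  then obtain T where T: "T : C" "T0 <= T" "!!T'. T' : C ==> T <= T' ==> T' = T"
   by (rule noeth_maxE[OF N]) (auto simp: C_def)
  have oT: "osub scl T" "Kr <= T" "1 ~: T" using T(1) by (auto simp: C_def)
  have "maximalideal (ev ` T) R"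
  proof (rule maximalidealI[OF ideal_image[OF oT(1)]])
   show "carrier R ~= ev ` T"
   proof
    assume "carrier R = ev ` T"
    hence "1 : pull (ev ` T)" using one_closed by (simp add: pull_iff ev_one)
    thus False using oT pull_image by blast
   qed
   show "J = ev ` T \<or> J = carrier R" if J: "ideal J R" "ev ` T <= J" "J <= carrier R" for J
   proof (cases "1 : pull J")
    case True
    thus ?thesis using ideal.one_imp_carrier[OF J(1)] by (simp add: pull_iff ev_one)
   next
    case False
    have "pull J : C" using False osub_pull[OF J(1)] Kr_pull[OF J(1)] by (simp add: C_def)
    moreover have "T <= pull J" using J(2) by (auto simp: pull_iff)
    ultimately have "pull J = T" by (rule T(3))
    thus ?thesis using image_pull[OF J(3)] by simp
   qed
  qed
  hence "ev ` T = \<mm>" by (rule M.max_ideal_unique)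
  hence "T = pull \<mm>" using pull_image[OF oT(1,2)] by simp
  thus False using x T(2) x_in_Kx[OF osub_Kr, of x] by (auto simp: T0_def)
 qed
 thus ?thesis using osub_pull[OF id] Kr_pull[OF id] one by (simp add: locl_def)
qed

text \<open>The least number principle supplies \<open>d\<close> generators. As the supremum that
  defines \<open>krull_dim\<close> has the finite value \<open>d\<close>, the set of chain lengths
  is finite and the supremum is attained by an actual chain.\<close>

lemma regular_reg:
 assumes "regular_local_ring R \<mm>"
 shows "\<exists>d. reg d Kr (pull \<mm>)"
proof -
 interpret M: regular_local_ring R \<mm> by fact
 interpret mx: maximalideal \<mm> R by (rule M.max_ideal)
 have N: "noetherian_ring R" by unfold_locales
 define d where "d = min_generators R \<mm>"
 obtain k :: nat and g where g: "pull \<mm> = sp (*) Kr g {..<k}" by (rule ideal_fg[OF N mx.is_ideal])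
 have "Idl (ev ` g ` {..<k}) = \<mm>"
 proof -
  have "pull (Idl (ev ` g ` {..<k})) = pull \<mm>" using pull_genideal[of g k] g by simp
  moreover have "Idl (ev ` g ` {..<k}) <= carrier R"
   by (rule subsetI, rule ideal.Icarr[OF genideal_ideal]) auto
  moreover have "\<mm> <= carrier R" using mx.a_subset .
  ultimately show ?thesis using image_pull by metis
 qed
 hence "\<exists>S\<subseteq>carrier R. finite S & card S = card (ev ` g ` {..<k}) & Idl S = \<mm>"
  by (intro exI[of _ "ev ` g ` {..<k}"]) auto
 hence "\<exists>S\<subseteq>carrier R. finite S & card S = d & Idl S = \<mm>"
  unfolding d_def min_generators_def by (rule LeastI)
 then obtain S where S: "S <= carrier R" "finite S" "card S = d" "Idl S = \<mm>" by blast
 obtain s where s: "S = s ` {..<d}" using S(2,3) by (metis finite_imp_nat_seg_image_inj_on lessThan_def card_image card_lessThan)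
 have "s j : carrier R" if "j < d" for j using that s S(1) by auto
 hence "\<forall>j. \<exists>x. j < d --> ev x = s j" using ev_surj by (intro allI) (metis (full_types))
 from choice[OF this] obtain x where x: "!!j. j < d ==> ev (x j) = s j" by blast
 have "ev ` x ` {..<d} = S" using x s by (simp add: image_image)
 hence gen: "pull \<mm> = sp (*) Kr x {..<d}" using pull_genideal[of x d] S(4) by simp
 define A where "A = {enat n | n. \<exists>p. (\<forall>i\<le>n. primeideal (p i) R) & (\<forall>i<n. p i \<subset> p (Suc i))}"
 have SA: "Sup A = enat d" using M.regular by (simp add: d_def krull_dim_def A_def)
 have "enat 0 : A" unfolding A_def
  using maximalideal_prime[OF M.max_ideal] by (intro CollectI exI[of _ 0] conjI exI[of _ "%_. \<mm>"]) auto
 hence "A ~= {}" by blast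
 hence "finite A" "Max A = enat d" using SA by (auto simp: Sup_enat_def split: if_splits)
 hence "enat d : A" using Max_in[of A] \<open>A ~= {}\<close> by simp
 then obtain p where p: "\<forall>i\<le>d. primeideal (p i) R" "\<forall>i<d. p i \<subset> p (Suc i)" by (auto simp: A_def)
 have "chn Kr d (%i. pull (p i))"
  unfolding chn_def
 proof (intro conjI allI impI)
  show "pr (pull (p i))" "Kr <= pull (p i)" if "i <= d" for i using pull_prime p(1) that by blast+
  show "pull (p i) \<subset> pull (p (Suc i))" if i: "i < d" for i
  proof -
   have "p (Suc i) <= carrier R" using p(1) i ideal.Icarr[OF primeideal.axioms(1)] by (metis Suc_leI subsetI)
   hence "ev ` pull (p (Suc i)) = p (Suc i)" by (rule image_pull)
   moreover have "p i \<subset> p (Suc i)" using p(2) i by blast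
   moreover have "p i <= carrier R" using \<open>p i \<subset> p (Suc i)\<close> \<open>p (Suc i) <= carrier R\<close> by blast
   hence "ev ` pull (p i) = p i" by (rule image_pull)
   ultimately have "pull (p i) ~= pull (p (Suc i))" by auto
   moreover have "pull (p i) <= pull (p (Suc i))" using \<open>p i \<subset> p (Suc i)\<close> by (auto simp: pull_iff)
   ultimately show ?thesis by blast
  qed
 qed
 thus ?thesis using gen unfolding reg_def by blast
qed

end

text \<open>Together with \<open>ifl_scale\<close> this identifies the recursive \<open>ifl\<close>
  with the submodule generated by \<open>U\<close> and the products of the \<open>n\<close>-th power
  with module elements, which is the shape of \<open>ideal_smult\<close>.\<close>

lemma (in Modules.module) ifl_generated:
 assumes U: "submod scale U" and K: "osub scl K" and J: "finite J"
 shows "submod scale T ==> U <= T ==> (!!r w. r : ifl (*) a J K UNIV n ==> scale r w : T) ==>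
  ifl scale a J U UNIV n <= T"
proof (induction n arbitrary: T)
 case 0
 have "w : T" for w using 0(3)[of 1 w] by simp
 thus ?case by blast
next
 case (Suc n)
 have oU: "osub scl (UNIV :: 'a set)" by (simp add: osub_def)
 show ?case
 proof (rule ifl_least[OF Suc.prems(1,2)])
  fix j x assume j: "j : J" and x: "x : ifl scale a J U UNIV n"
  have "ifl scale a J U UNIV n <= {x. scale (a j) x : T}"
  proof (rule Suc.IH)
   show "submod scale {x. scale (a j) x : T}"
   proof (rule osubI)
    show "0 : {x. scale (a j) x : T}" using osub_zero[OF Suc.prems(1)] by simp
    show "p - q : {x. scale (a j) x : T}" if "p : {x. scale (a j) x : T}" "q : {x. scale (a j) x : T}" for p q
     using that osub_diff[OF Suc.prems(1)] by (simp add: scale_right_diff_distrib)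
    show "w p : {x. scale (a j) x : T}" if w: "w : range scale" "p : {x. scale (a j) x : T}" for w p
    proof -
     obtain r where r: "w = scale r" using w(1) by blast
     have "scale r (scale (a j) p) : T" using osub_scale[OF Suc.prems(1)] w(2) by blast
     thus ?thesis by (simp add: r mult.commute)
    qed
   qed
   show "U <= {x. scale (a j) x : T}" using osub_scale[OF U] Suc.prems(2) by blast
   show "scale r w : {x. scale (a j) x : T}" if r: "r : ifl (*) a J K UNIV n" for r w
   proof -
    have "a j * r : ifl (*) a J K UNIV (Suc n)" by (rule module.ifl_mult[OF module_ring K oU J j r])
    hence "scale (a j * r) w : T" by (rule Suc.prems(3))
    thus ?thesis by simp
   qed
  qed
  thus "scale (a j) x : T" using x by blast
 qed
qed

section \<open>Presentation of a module\<close>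

locale present_module = present R ev + N: Module.module R N
 for R :: "('a, 'b) ring_scheme" (structure) and ev :: "'z::comm_ring_1 => 'a" and N :: "('a, 'n, 'c) module_scheme"
begin

text \<open>The presenting module is free on the whole element type, so basis elements outside the
  carrier need a value as well.\<close>

definition nv :: "'n => 'n" where "nv b = (if b : carrier N then b else \<zero>\<^bsub>N\<^esub>)"

definition EE :: "('n \<Rightarrow>\<^sub>0 'z) => 'n" where
 "EE x = (\<Oplus>\<^bsub>N\<^esub>b\<in>keys x. ev (lookup x b) \<odot>\<^bsub>N\<^esub> nv b)"

lemma nv_closed [simp]: "nv b : carrier N" by (simp add: nv_def)

lemma EE_superset:
 assumes "finite S" "keys x <= S" shows "EE x = (\<Oplus>\<^bsub>N\<^esub>b\<in>S. ev (lookup x b) \<odot>\<^bsub>N\<^esub> nv b)"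
 unfolding EE_def
 by (rule N.M.add.finprod_mono_neutral_cong_left) (use assms in \<open>auto simp: in_keys_iff ev_zero\<close>)

lemma EE_closed [simp]: "EE x : carrier N"
 unfolding EE_def by (rule N.M.finsum_closed) auto

lemma EE_add: "EE (x + y) = EE x \<oplus>\<^bsub>N\<^esub> EE y"
proof -
 let ?S = "keys x \<union> keys y"
 have "EE (x + y) = (\<Oplus>\<^bsub>N\<^esub>b\<in>?S. ev (lookup (x + y) b) \<odot>\<^bsub>N\<^esub> nv b)"
  by (rule EE_superset) (simp_all add: Poly_Mapping.keys_add)
 also have "\<dots> = (\<Oplus>\<^bsub>N\<^esub>b\<in>?S. ev (lookup x b) \<odot>\<^bsub>N\<^esub> nv b \<oplus>\<^bsub>N\<^esub> ev (lookup y b) \<odot>\<^bsub>N\<^esub> nv b)"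
  by (rule N.M.finsum_cong') (auto simp: lookup_add ev_add N.smult_l_distr)
 also have "\<dots> = (\<Oplus>\<^bsub>N\<^esub>b\<in>?S. ev (lookup x b) \<odot>\<^bsub>N\<^esub> nv b) \<oplus>\<^bsub>N\<^esub> (\<Oplus>\<^bsub>N\<^esub>b\<in>?S. ev (lookup y b) \<odot>\<^bsub>N\<^esub> nv b)"
  by (rule N.M.finsum_addf) auto
 finally show ?thesis using EE_superset[of ?S x] EE_superset[of ?S y] by simp
qed

lemma EE_sc: "EE (sc r x) = ev r \<odot>\<^bsub>N\<^esub> EE x"
proof -
 have "EE (sc r x) = (\<Oplus>\<^bsub>N\<^esub>b\<in>keys x. ev (lookup (sc r x) b) \<odot>\<^bsub>N\<^esub> nv b)"
  by (rule EE_superset) (simp_all add: keys_sc)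
 also have "\<dots> = (\<Oplus>\<^bsub>N\<^esub>b\<in>keys x. ev r \<odot>\<^bsub>N\<^esub> (ev (lookup x b) \<odot>\<^bsub>N\<^esub> nv b))"
  by (rule N.M.finsum_cong') (auto simp: ev_mult N.smult_assoc1)
 also have "\<dots> = ev r \<odot>\<^bsub>N\<^esub> EE x"
  unfolding EE_def by (rule N.finsum_smult_ldistr[symmetric]) auto
 finally show ?thesis .
qed

lemma EE_zero: "EE 0 = \<zero>\<^bsub>N\<^esub>"
 by (simp add: EE_def)

lemma EE_single: assumes "b : carrier N" shows "EE (single b 1) = b"
proof -
 have "EE (single b 1) = (\<Oplus>\<^bsub>N\<^esub>b'\<in>{b}. ev (lookup (single b 1) b') \<odot>\<^bsub>N\<^esub> nv b')"
  by (rule EE_superset) auto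
 also have "\<dots> = b" using assms by (subst N.M.finsum_insert) (auto simp: ev_one nv_def)
 finally show ?thesis .
qed

lemma EE_uminus: "EE (- x) = \<ominus>\<^bsub>N\<^esub> EE x"
proof -
 have "EE x \<oplus>\<^bsub>N\<^esub> EE (- x) = \<zero>\<^bsub>N\<^esub>" using EE_add[of x "- x"] EE_zero by simp
 thus ?thesis by (metis EE_closed N.M.minus_equality N.M.a_comm)
qed

lemma EE_diff: "EE (x - y) = EE x \<oplus>\<^bsub>N\<^esub> \<ominus>\<^bsub>N\<^esub> EE y"
 using EE_add[of x "- y"] by (simp add: EE_uminus)

definition pullN :: "'n set => ('n \<Rightarrow>\<^sub>0 'z) set" where "pullN H = {x. EE x : H}"
definition relN :: "('n \<Rightarrow>\<^sub>0 'z) set" where "relN = pullN {\<zero>\<^bsub>N\<^esub>}"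

lemma pullN_iff: "x : pullN H \<longleftrightarrow> EE x : H" by (simp add: pullN_def)
lemma relN_iff: "x : relN \<longleftrightarrow> EE x = \<zero>\<^bsub>N\<^esub>" by (simp add: relN_def pullN_def)

lemma osub_pullN: assumes H: "submodule H R N" shows "submod sc (pullN H)"
proof (rule osubI)
 show "0 : pullN H" using subgroup.one_closed[OF submodule.axioms(1)[OF H]] by (simp add: pullN_iff EE_zero)
 show "x - y : pullN H" if "x : pullN H" "y : pullN H" for x y
  using that N.submoduleE(5)[OF H, of "EE x" "\<ominus>\<^bsub>N\<^esub> EE y"] N.submoduleE(3)[OF H, of "EE y"] by (simp add: pullN_iff EE_diff)
 show "w x : pullN H" if w: "w : range sc" "x : pullN H" for w x
 proof -
  obtain r where r: "w = sc r" using w(1) by blast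
  show ?thesis using w(2) N.submoduleE(4)[OF H, of "ev r" "EE x"] by (simp add: r pullN_iff EE_sc)
 qed
qed

lemma submodule_image: assumes T: "submod sc T" shows "submodule (EE ` T) R N"
proof (rule N.submoduleI)
 show "EE ` T <= carrier N" by auto
 show "\<zero>\<^bsub>N\<^esub> : EE ` T" using imageI[OF osub_zero[OF T], of EE] by (simp add: EE_zero)
 show "\<ominus>\<^bsub>N\<^esub> a : EE ` T" if a: "a : EE ` T" for a
 proof -
  obtain t where t: "a = EE t" "t : T" using a by blast
  show ?thesis using imageI[OF osub_uminus[OF T t(2)], of EE] by (simp add: t(1) EE_uminus)
 qed
 show "a \<oplus>\<^bsub>N\<^esub> b : EE ` T" if a: "a : EE ` T" and b: "b : EE ` T" for a b
 proof -
  obtain t where t: "a = EE t" "t : T" using a by blast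
  obtain u where u: "b = EE u" "u : T" using b by blast
  show ?thesis using imageI[OF osub_add[OF T t(2) u(2)], of EE] by (simp add: t(1) u(1) EE_add)
 qed
 show "a \<odot>\<^bsub>N\<^esub> x : EE ` T" if a: "a : carrier R" and x: "x : EE ` T" for a x
 proof -
  obtain t where t: "x = EE t" "t : T" using x by blast
  obtain r where r: "ev r = a" using ev_surj[OF a] by blast
  show ?thesis using imageI[OF sc.osub_scale[OF T t(2), of r], of EE] by (simp add: t(1) r EE_sc)
 qed
qed

lemma EE_eq_iff: "EE x = EE y \<longleftrightarrow> x - y : relN"
proof
 assume "EE x = EE y"
 thus "x - y : relN" by (simp add: relN_iff EE_diff N.M.r_neg)
next
 assume "x - y : relN"
 thus "EE x = EE y" using EE_add[of "x - y" y] by (simp add: relN_iff)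
qed

lemma submodule_zero: "submodule {\<zero>\<^bsub>N\<^esub>} R N"
 by (rule N.submoduleI) auto

lemma osub_relN: "submod sc relN"
 unfolding relN_def by (rule osub_pullN[OF submodule_zero])

lemma relN_pullN: assumes "submodule H R N" shows "relN <= pullN H"
 using subgroup.one_closed[OF submodule.axioms(1)[OF assms]] by (auto simp: relN_iff pullN_iff)

lemma Kr_relN: "k : Kr ==> sc k x : relN"
 by (simp add: relN_iff EE_sc Kr_iff)

lemma cf_relN: "cf Kr <= relN"
proof
 fix x :: "'n \<Rightarrow>\<^sub>0 'z" assume x: "x : cf Kr"
 have "(\<Oplus>\<^bsub>N\<^esub>b\<in>keys x. ev (lookup x b) \<odot>\<^bsub>N\<^esub> nv b) = (\<Oplus>\<^bsub>N\<^esub>b\<in>keys x. \<zero>\<^bsub>N\<^esub>)"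
  by (rule N.M.finsum_cong') (use x in \<open>auto simp: cf_def Kr_iff\<close>)
 thus "x : relN" by (simp add: relN_iff EE_def)
qed

lemma EE_surj: "n : carrier N ==> \<exists>x. EE x = n"
 using EE_single by blast

lemma pullN_image:
 assumes T: "submod sc T" "relN <= T" shows "pullN (EE ` T) = T"
proof
 show "pullN (EE ` T) <= T"
 proof
  fix x assume "x : pullN (EE ` T)"
  then obtain t where t: "EE x = EE t" "t : T" by (auto simp: pullN_iff)
  hence "x - t : T" using EE_eq_iff[of x t] T(2) by blast
  thus "x : T" by (rule osub_diffD[OF T(1) _ t(2)])
 qed
qed (auto simp: pullN_iff)

lemma finitely_generated:
 assumes "finitely_generated_module R N"
 obtains p :: nat and y where "UNIV = sp sc relN y {..<p}"
proof -
 obtain S where S: "finite S" "S <= carrier N" "module_span R N S = carrier N"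
  using assms by (auto simp: finitely_generated_module_def)
 obtain p :: nat and s where s: "S = s ` {..<p}" using S(1) by (metis finite_imp_nat_seg_image_inj_on lessThan_def)
 let ?T = "sp sc relN (%j. single (s j) 1) {..<p}"
 have oT: "submod sc ?T" by (rule sc.osub_sp[OF osub_relN])
 have UT: "relN <= ?T" by (rule sc.sp_base)
 have "S <= EE ` ?T"
 proof
  fix n assume n: "n : S"
  then obtain j where j: "j < p" "n = s j" using s by auto
  have "single (s j) 1 : ?T" using sc.sp_gen[OF osub_relN, of "{..<p}" j "%j. single (s j) 1"] j(1) by simp
  moreover have "EE (single (s j) 1) = n" using n S(2) j(2) EE_single by blast
  ultimately show "n : EE ` ?T" by blast
 qed
 hence "carrier N <= EE ` ?T"
  using submodule_image[OF oT] unfolding S(3)[symmetric] module_span_def by blast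
 hence "x : pullN (EE ` ?T)" for x using EE_closed[of x] unfolding pullN_iff by blast
 hence "UNIV = ?T" unfolding pullN_image[OF oT UT] by blast
 thus thesis by (rule that)
qed

lemma noeth_relN:
 assumes N: "noetherian_ring R" and "finitely_generated_module R N"
 shows "noeth (range sc) UNIV relN"
proof -
 obtain p :: nat and y where y: "UNIV = sp sc relN y {..<p}" by (rule finitely_generated[OF assms(2)])
 have "noeth (range sc) (sp sc relN y {..<p}) relN"
  by (rule sc.noeth_sp[OF noeth_Kr[OF N] osub_relN]) (auto intro: Kr_relN)
 thus ?thesis by (simp only: y[symmetric])
qed

lemma ideal_smult_pull:
 fixes a :: "nat => 'z"
 assumes I: "ideal I R" and a: "pull I = sp (*) Kr a {..<q}"
 shows "submodule (ideal_smult R (ideal_power R I n) N) R N"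
  "pullN (ideal_smult R (ideal_power R I n) N) = ifl sc a {..<q} relN UNIV n"
proof -
 let ?P = "ideal_power R I n" and ?J = "ifl sc a {..<q} relN UNIV n"
 let ?G = "{b \<odot>\<^bsub>N\<^esub> x |b x. b : ?P & x : carrier N}"
 have P: "ideal ?P R" "pull ?P = ifl (*) a {..<q} Kr UNIV n" using pull_power[OF I a] by auto
 have oU: "submod sc UNIV" by (simp add: osub_def)
 have oJ: "submod sc ?J" by (rule sc.osub_ifl[OF osub_relN oU])
 have UJ: "relN <= ?J" by (rule sc.ifl_base[OF osub_relN subset_UNIV oU])
 have GJ: "?G <= EE ` ?J"
 proof
  fix g assume "g : ?G"
  then obtain b x where g: "g = b \<odot>\<^bsub>N\<^esub> x" "b : ?P" "x : carrier N" by blast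
  obtain r where r: "ev r = b" using ev_surj ideal.Icarr[OF P(1) g(2)] by blast
  obtain w where w: "EE w = x" using EE_surj[OF g(3)] by blast
  have "r : pull ?P" using g(2) r by (simp add: pull_iff)
  hence "r : ifl (*) a {..<q} Kr UNIV n" unfolding P(2) .
  hence "sc r w : ?J" using sc.ifl_scale[OF osub_relN subset_UNIV oU UNIV_I Kr_relN] by blast
  moreover have "g = EE (sc r w)" by (simp add: g(1) EE_sc r w)
  ultimately show "g : EE ` ?J" by blast
 qed
 have least: "EE ` ?J <= H" if H: "submodule H R N" "?G <= H" for H
 proof -
  have "?J <= pullN H"
  proof (rule sc.ifl_generated[OF osub_relN osub_Kr _ osub_pullN[OF H(1)] relN_pullN[OF H(1)]])
   fix r :: 'z and w :: "'n \<Rightarrow>\<^sub>0 'z" assume "r : ifl (*) a {..<q} Kr UNIV n"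
   hence "r : pull ?P" unfolding P(2) .
   hence "ev r : ?P" by (simp add: pull_iff)
   hence "ev r \<odot>\<^bsub>N\<^esub> EE w : H" using H(2) EE_closed by blast
   thus "sc r w : pullN H" by (simp add: pullN_iff EE_sc)
  qed simp
  thus ?thesis by (auto simp: pullN_iff)
 qed
 have "ideal_smult R ?P N = EE ` ?J"
  unfolding ideal_smult_def module_span_def using submodule_image[OF oJ] GJ least by blast
 thus "submodule (ideal_smult R ?P N) R N" "pullN (ideal_smult R ?P N) = ?J"
  using submodule_image[OF oJ] pullN_image[OF oJ UJ] by simp_all
qed

text \<open>Presents the quotient of \<open>N\<close> by \<open>H\<close> as a surjection from the
  free module with kernel \<open>pullN H\<close>, so that cochains into the quotient can be handled
  by representatives.\<close>

definition Qm :: "'n set => ('n \<Rightarrow>\<^sub>0 'z) => 'n set" where "Qm H x = H +>\<^bsub>N\<^esub> EE x"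

lemma Qm_props:
 assumes H: "submodule H R N"
 shows "carrier (quotient_module N H) = range (Qm H)"
  "Qm H (x + y) = Qm H x \<oplus>\<^bsub>quotient_module N H\<^esub> Qm H y"
  "Qm H (sc r x) = ev r \<odot>\<^bsub>quotient_module N H\<^esub> Qm H x"
  "Qm H x = \<zero>\<^bsub>quotient_module N H\<^esub> \<longleftrightarrow> x : pullN H"
proof -
 interpret sub: abelian_subgroup H N
  by (rule abelian_subgroupI3[OF additive_subgroupI[OF submodule.axioms(1)[OF H]] N.M.abelian_group_axioms])
 note HG = N.submoduleE(1)[OF H]
 show "carrier (quotient_module N H) = range (Qm H)"
 proof
  show "carrier (quotient_module N H) <= range (Qm H)"
  proof
   fix C assume "C : carrier (quotient_module N H)"
   then obtain n where n: "n : carrier N" "C = H +>\<^bsub>N\<^esub> n" by (auto simp: quotient_module_def A_RCOSETS_def')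
   then obtain x where "EE x = n" using EE_surj by blast
   hence "C = Qm H x" using n(2) by (simp add: Qm_def)
   thus "C : range (Qm H)" by blast
  qed
  show "range (Qm H) <= carrier (quotient_module N H)"
   using N.M.a_rcosetsI[OF HG] by (auto simp: quotient_module_def Qm_def)
 qed
 show "Qm H (x + y) = Qm H x \<oplus>\<^bsub>quotient_module N H\<^esub> Qm H y"
  by (simp add: quotient_module_def Qm_def EE_add sub.a_rcos_sum)
 show "Qm H x = \<zero>\<^bsub>quotient_module N H\<^esub> \<longleftrightarrow> x : pullN H"
  using N.M.a_coset_join1[OF _ EE_closed submodule.axioms(1)[OF H]] N.M.a_coset_join2[OF EE_closed submodule.axioms(1)[OF H]]
  by (auto simp: quotient_module_def Qm_def pullN_iff)
 show "Qm H (sc r x) = ev r \<odot>\<^bsub>quotient_module N H\<^esub> Qm H x"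
 proof -
  have "H +>\<^bsub>N\<^esub> (ev r \<odot>\<^bsub>N\<^esub> y) = H +>\<^bsub>N\<^esub> (ev r \<odot>\<^bsub>N\<^esub> EE x)" if y: "y : H +>\<^bsub>N\<^esub> EE x" for y
  proof -
   obtain h where h: "h : H" "y = h \<oplus>\<^bsub>N\<^esub> EE x" using y by (auto simp: a_r_coset_def')
   have hN: "h : carrier N" using h(1) HG by blast
   have "ev r \<odot>\<^bsub>N\<^esub> y = (ev r \<odot>\<^bsub>N\<^esub> h) \<oplus>\<^bsub>N\<^esub> (ev r \<odot>\<^bsub>N\<^esub> EE x)" using hN by (simp add: h(2) N.smult_r_distr)
   moreover have "ev r \<odot>\<^bsub>N\<^esub> h : H" by (rule N.submoduleE(4)[OF H ev_closed h(1)])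
   ultimately have "ev r \<odot>\<^bsub>N\<^esub> y : H +>\<^bsub>N\<^esub> (ev r \<odot>\<^bsub>N\<^esub> EE x)" using N.M.a_rcosI[OF _ HG] by simp
   thus ?thesis using N.M.a_repr_independence[OF _ _ submodule.axioms(1)[OF H]] by simp
  qed
  moreover have "EE x : H +>\<^bsub>N\<^esub> EE x"
   using N.M.a_rcosI[OF sub.zero_closed HG EE_closed, of x] by simp
  ultimately have "(\<Union>y\<in>H +>\<^bsub>N\<^esub> EE x. H +>\<^bsub>N\<^esub> (ev r \<odot>\<^bsub>N\<^esub> y)) = H +>\<^bsub>N\<^esub> (ev r \<odot>\<^bsub>N\<^esub> EE x)" by blast
  thus ?thesis by (simp add: quotient_module_def Qm_def EE_sc)
 qed
qed

end

section \<open>Free resolutions and Ext\<close>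

locale present_res = present_module R ev M
 for R :: "('a, 'b) ring_scheme" (structure) and ev :: "'z::comm_ring_1 => 'a" and M :: "('a, 'm, 'c) module_scheme" +
 fixes B :: "nat => 'x set" and d :: "nat => ('x => 'a) => ('x => 'a)" and ea :: "('x => 'a) => 'm"
 assumes res: "free_resolution R M B d ea"
begin

abbreviation "F i \<equiv> free_module R (B i)"

definition BB :: "(nat \<times> 'x) set" where "BB = {(i, b). b : B i}"
definition ind :: "'x => 'x => 'a" where "ind b = (%x. if x = b then \<one> else \<zero>)"
definition EV :: "nat => (nat \<times> 'x \<Rightarrow>\<^sub>0 'z) => 'x => 'a" where "EV i x = (%b. ev (lookup x (i, b)))"
text \<open>A coefficientwise lift to the presenting ring, by choice. The differential lifted in
  this way squares to zero only modulo \<open>Kr\<close>, which is what \<open>cplx\<close> asks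
  for.\<close>

definition lfc :: "nat => ('x => 'a) => (nat \<times> 'x \<Rightarrow>\<^sub>0 'z)" where
 "lfc i f = (\<Sum>b\<in>{b. f b ~= \<zero>}. single (i, b) (SOME z. ev z = f b))"
definition dlt :: "nat \<times> 'x => (nat \<times> 'x \<Rightarrow>\<^sub>0 'z)" where
 "dlt p = (case fst p of 0 => 0 | Suc k => lfc k (d k (ind (snd p))))"

lemma gr_BB: "gr BB fst i = Pair i ` B i"
 by (auto simp: gr_def BB_def)

lemma F_carrier: "f : carrier (F i) \<longleftrightarrow> (\<forall>x. f x : carrier R) & {x. f x ~= \<zero>} <= B i & finite {x. f x ~= \<zero>}"
 by (auto simp: free_module_def)

lemma F_add: "f \<oplus>\<^bsub>F i\<^esub> g = (%x. f x \<oplus> g x)" and F_smult: "a \<odot>\<^bsub>F i\<^esub> f = (%x. a \<otimes> f x)"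
 and F_zero: "\<zero>\<^bsub>F i\<^esub> = (%_. \<zero>)"
 by (simp_all add: free_module_def)

lemma ind_F: "b : B i ==> ind b : carrier (F i)"
 by (auto simp: F_carrier ind_def)

lemma EV_F: assumes "keys x <= gr BB fst i" shows "EV i x : carrier (F i)"
proof -
 have sub: "{b. ev (lookup x (i, b)) ~= \<zero>} <= snd ` keys x"
 proof
  fix b assume "b : {b. ev (lookup x (i, b)) ~= \<zero>}"
  hence "(i, b) : keys x" by (auto simp: in_keys_iff ev_zero)
  thus "b : snd ` keys x" by force
 qed
 hence "finite {b. ev (lookup x (i, b)) ~= \<zero>}" by (rule finite_subset) simp
 moreover have "snd ` keys x <= B i" using assms by (auto simp: gr_BB)
 ultimately show ?thesis using sub by (auto simp: F_carrier EV_def)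
qed

lemma EV_add: "EV i (x + y) = EV i x \<oplus>\<^bsub>F i\<^esub> EV i y"
 and EV_sc: "EV i (sc r x) = ev r \<odot>\<^bsub>F i\<^esub> EV i x"
 by (simp_all add: EV_def F_add F_smult lookup_add ev_add ev_mult)

lemma EV_single: "EV i (single (i, b) 1) = ind b"
 by (auto simp: EV_def ind_def lookup_single when_def ev_one ev_zero)

lemma EV_eq_iff:
 assumes "keys x <= gr BB fst i" "keys y <= gr BB fst i" shows "EV i x = EV i y \<longleftrightarrow> x - y : cf Kr"
proof
 assume e: "EV i x = EV i y"
 have "lookup (x - y) p : Kr" for p
 proof (cases "fst p = i")
  case True
  thus ?thesis using fun_cong[OF e, of "snd p"] by (cases p) (simp add: EV_def ev_eq_iff lookup_minus)
 next
  case False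
  hence "p ~: keys x" "p ~: keys y" using assms by (auto simp: gr_def)
  thus ?thesis using osub_zero[OF osub_Kr] by (simp add: lookup_minus in_keys_iff)
 qed
 thus "x - y : cf Kr" by (simp add: cf_def)
next
 assume "x - y : cf Kr"
 thus "EV i x = EV i y" by (simp add: EV_def fun_eq_iff ev_eq_iff cf_def lookup_minus)
qed

lemma EV_zero: "EV i 0 = \<zero>\<^bsub>F i\<^esub>"
 by (simp add: EV_def F_zero ev_zero)

lemma EV_zero_iff: "keys x <= gr BB fst i ==> EV i x = \<zero>\<^bsub>F i\<^esub> \<longleftrightarrow> x : cf Kr"
 using EV_eq_iff[of x i 0] by (simp add: EV_zero)

lemma lfc:
 assumes f: "f : carrier (F i)" shows "keys (lfc i f) <= gr BB fst i" "EV i (lfc i f) = f"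
proof -
 have fin: "finite {b. f b ~= \<zero>}" and fB: "{b. f b ~= \<zero>} <= B i" and fR: "f b : carrier R" for b using f by (auto simp: F_carrier)
 have l: "lookup (lfc i f) (j, b) = (if j = i & f b ~= \<zero> then (SOME z. ev z = f b) else 0)" for j b
 proof -
  have "lookup (lfc i f) (j, b) = (\<Sum>b'\<in>{b. f b ~= \<zero>}. if b' = b then (if j = i then (SOME z. ev z = f b') else 0) else 0)"
   by (cases "j = i") (simp_all add: lfc_def lookup_sum lookup_single when_def cong: if_cong)
  thus ?thesis using fin by auto
 qed
 show "keys (lfc i f) <= gr BB fst i"
  using fB by (auto simp: in_keys_iff l gr_BB split: if_splits)
 have "ev (SOME z. ev z = f b) = f b" for b by (rule someI_ex[OF ev_surj[OF fR]])
 thus "EV i (lfc i f) = f" by (auto simp: EV_def l ev_zero)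
qed

text \<open>A homomorphism from a free module is determined by its values on the basis, and lifting
  these along \<open>q\<close> turns it into a linear extension; this serves the differentials, the
  augmentation and the cochains alike. \<open>h0\<close> gives a preimage of the value at zero,
  which is then computed as a multiple by zero.\<close>

lemma hom_lin:
 assumes h_add: "!!f g. f : carrier (F i) ==> g : carrier (F i) ==> h (f \<oplus>\<^bsub>F i\<^esub> g) = h f \<oplus>\<^bsub>T\<^esub> h g"
  and h_sc: "!!a f. a : carrier R ==> f : carrier (F i) ==> h (a \<odot>\<^bsub>F i\<^esub> f) = a \<odot>\<^bsub>T\<^esub> h f"
  and S: "Modules.module s" and q_add: "!!v w. q (v + w) = q v \<oplus>\<^bsub>T\<^esub> q w" and q_sc: "!!r w. q (s r w) = ev r \<odot>\<^bsub>T\<^esub> q w"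
  and c: "!!b. b : B i ==> h (ind b) = q (c (i, b))" and h0: "h \<zero>\<^bsub>F i\<^esub> : range q" and x: "keys x <= gr BB fst i"
 shows "h (EV i x) = q (lin s c x)"
proof -
 interpret S: Modules.module s by (rule S)
 have kF: "EV i (sc r (single p 1)) : carrier (F i)" if "p : gr BB fst i" for r p
 proof (rule EV_F)
  have "keys (sc r (single p 1)) <= keys (single p (1::'z))" by (rule keys_sc)
  also have "\<dots> <= gr BB fst i" using that by simp
  finally show "keys (sc r (single p 1)) <= gr BB fst i" .
 qed
 have sumk: "keys (\<Sum>p\<in>P. sc (lookup x p) (single p 1)) <= gr BB fst i" if "P <= gr BB fst i" for P
 proof -
  have "(\<Sum>p\<in>P. sc (lookup x p) (single p 1)) : {z. keys z <= gr BB fst i}"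
  proof (rule osub_sum[OF osub_kin])
   fix p assume "p : P"
   hence "keys (single p (1::'z)) <= gr BB fst i" using that by auto
   thus "sc (lookup x p) (single p 1) : {z. keys z <= gr BB fst i}" using keys_sc[of "lookup x p" "single p 1"] by blast
  qed
  thus ?thesis by blast
 qed
 have "h (EV i (\<Sum>p\<in>P. sc (lookup x p) (single p 1))) = q (\<Sum>p\<in>P. s (lookup x p) (c p))"
  if "finite P" "P <= gr BB fst i" for P
  using that
 proof (induction P rule: finite_induct)
  case empty
  obtain w where w: "h \<zero>\<^bsub>F i\<^esub> = q w" using h0 by blast
  have z: "\<zero>\<^bsub>F i\<^esub> : carrier (F i)" by (simp add: F_carrier F_zero)
  have "ev 0 \<odot>\<^bsub>F i\<^esub> \<zero>\<^bsub>F i\<^esub> = \<zero>\<^bsub>F i\<^esub>" by (simp add: F_smult F_zero)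
  hence "h \<zero>\<^bsub>F i\<^esub> = ev 0 \<odot>\<^bsub>T\<^esub> q w" using h_sc[OF ev_closed z, of 0] w by simp
  also have "\<dots> = q (s 0 w)" by (rule q_sc[symmetric])
  finally show ?case by (simp add: EV_zero)
 next
  case (insert p P)
  obtain b where p: "p = (i, b)" "b : B i" using insert.prems by (auto simp: gr_BB)
  have pg: "p : gr BB fst i" using insert.prems by blast
  have "EV i (sc (lookup x p) (single p 1)) = ev (lookup x p) \<odot>\<^bsub>F i\<^esub> ind b" by (simp only: EV_sc p(1) EV_single)
  hence 1: "h (EV i (sc (lookup x p) (single p 1))) = q (s (lookup x p) (c p))"
   using h_sc[OF ev_closed ind_F[OF p(2)]] c[OF p(2)] by (simp add: q_sc p(1))
  have "h (EV i (\<Sum>p\<in>insert p P. sc (lookup x p) (single p 1))) =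
   h (EV i (sc (lookup x p) (single p 1)) \<oplus>\<^bsub>F i\<^esub> EV i (\<Sum>p\<in>P. sc (lookup x p) (single p 1)))"
   unfolding EV_add[symmetric] using insert.hyps by simp
  also have "\<dots> = q (s (lookup x p) (c p)) \<oplus>\<^bsub>T\<^esub> q (\<Sum>p\<in>P. s (lookup x p) (c p))"
   unfolding 1[symmetric] using insert.IH insert.prems h_add[OF kF[OF pg] EV_F[OF sumk]] by simp
  also have "\<dots> = q (\<Sum>p\<in>insert p P. s (lookup x p) (c p))" using insert.hyps by (simp add: q_add)
  finally show ?case .
 qed
 from this[OF finite_keys x] show ?thesis using poly_mapping_sc_sum[of x] by (simp add: lin_def)
qed

lemma d_hom: "d i : module_hom_set R (F (Suc i)) (F i)" and ea_hom: "ea : module_hom_set R (F 0) M"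
 using res by (auto simp: free_resolution_def)

lemma d_closed: "f : carrier (F (Suc i)) ==> d i f : carrier (F i)"
 using d_hom[of i] by (auto simp: module_hom_set_def)

lemma zero_F: "\<zero>\<^bsub>F i\<^esub> : carrier (F i)"
 by (simp add: F_carrier F_zero)

lemma F_range: "f : carrier (F i) ==> f : range (EV i)"
 using lfc(2)[of f i] by (metis rangeI)

lemma d_EV: assumes "keys x <= gr BB fst (Suc i)" shows "d i (EV (Suc i) x) = EV i (lin sc dlt x)"
proof (rule hom_lin[OF _ _ module_sc EV_add EV_sc _ _ assms])
 show "d i (ind b) = EV i (dlt (Suc i, b))" if "b : B (Suc i)" for b
  using lfc(2)[OF d_closed[OF ind_F[OF that]]] by (simp add: dlt_def)
 show "d i \<zero>\<^bsub>F (Suc i)\<^esub> : range (EV i)" by (rule F_range[OF d_closed[OF zero_F]])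
qed (use d_hom[of i] in \<open>auto simp: module_hom_set_def\<close>)

definition ep :: "nat \<times> 'x => ('m \<Rightarrow>\<^sub>0 'z)" where "ep p = single (ea (ind (snd p))) 1"

lemma ea_EV: assumes "keys x <= gr BB fst 0" shows "ea (EV 0 x) = EE (lin sc ep x)"
proof (rule hom_lin[OF _ _ module_sc EE_add EE_sc _ _ assms])
 have c: "f : carrier (F 0) ==> ea f : carrier M" for f using ea_hom by (auto simp: module_hom_set_def)
 show "ea (ind b) = EE (ep (0, b))" if "b : B 0" for b
  using EE_single[OF c[OF ind_F[OF that]]] by (simp add: ep_def)
 show "ea \<zero>\<^bsub>F 0\<^esub> : range EE" using EE_surj[OF c[OF zero_F]] by (metis rangeI)
qed (use ea_hom in \<open>auto simp: module_hom_set_def\<close>)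

lemma keys_dlt: assumes "p : gr BB fst (Suc i)" shows "keys (dlt p) <= gr BB fst i"
proof -
 obtain b where p: "p = (Suc i, b)" "b : B (Suc i)" using assms by (auto simp: gr_BB)
 thus ?thesis using lfc(1)[OF d_closed[OF ind_F[OF p(2)]]] by (simp add: dlt_def)
qed

lemma dd_zero: "f : carrier (F (Suc (Suc i))) ==> d i (d (Suc i) f) = \<zero>\<^bsub>F i\<^esub>"
 using res unfolding free_resolution_def by blast

lemma cplx_dlt: "cplx Kr BB fst dlt"
 unfolding cplx_def
proof (intro ballI conjI)
 fix p assume p: "p : BB"
 show "keys (dlt p) <= {b'\<in>BB. Suc (fst b') = fst p}"
 proof (cases "fst p")
  case 0
  thus ?thesis by (simp add: dlt_def)
 next
  case (Suc i)
  thus ?thesis using keys_dlt[of p i] p by (auto simp: gr_def)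
 qed
 consider "fst p = 0" | "fst p = 1" | i where "fst p = Suc (Suc i)" by (metis One_nat_def not0_implies_Suc)
 thus "lin sc dlt (dlt p) : cf Kr"
 proof cases
  case 1
  thus ?thesis using osub_zero[OF osub_cf[OF osub_Kr]] by (simp add: dlt_def)
 next
  case 2
  hence k: "keys (dlt p) <= gr BB fst 0" using keys_dlt[of p 0] p by (simp add: gr_def)
  have "lin sc dlt (dlt p) = lin sc (%_. 0) (dlt p)"
   by (rule sc.lin_cong) (use k in \<open>auto simp: gr_def dlt_def\<close>)
  thus ?thesis using osub_zero[OF osub_cf[OF osub_Kr]] by (simp add: lin_def)
 next
  case 3
  hence k: "keys (dlt p) <= gr BB fst (Suc i)" using keys_dlt[of p "Suc i"] p by (simp add: gr_def)
  obtain b where b: "p = (Suc (Suc i), b)" "b : B (Suc (Suc i))" using 3 p by (cases p) (auto simp: BB_def)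
  have "EV (Suc i) (dlt p) = d (Suc i) (ind b)"
   using lfc(2)[OF d_closed[OF ind_F[OF b(2)]]] by (simp add: b(1) dlt_def)
  hence "EV i (lin sc dlt (dlt p)) = \<zero>\<^bsub>F i\<^esub>" using d_EV[OF k] dd_zero[OF ind_F[OF b(2)]] by simp
  moreover have "keys (lin sc dlt (dlt p)) <= gr BB fst i" by (rule keys_lin) (use k keys_dlt in blast)
  ultimately show ?thesis using EV_zero_iff by blast
 qed
qed

lemma exct_dlt: "exct Kr BB fst dlt"
 unfolding exct_def
proof (intro allI impI)
 fix i x assume x: "keys x <= gr BB fst (Suc i)" "lin sc dlt x : cf Kr"
 have kl: "keys (lin sc dlt x) <= gr BB fst i" by (rule keys_lin) (use x(1) keys_dlt in blast)
 have "d i (EV (Suc i) x) = \<zero>\<^bsub>F i\<^esub>" using d_EV[OF x(1)] EV_zero_iff[OF kl] x(2) by simp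
 hence "EV (Suc i) x : d (Suc i) ` carrier (F (Suc (Suc i)))"
  using res EV_F[OF x(1)] unfolding free_resolution_def by blast
 then obtain g where g: "g : carrier (F (Suc (Suc i)))" "EV (Suc i) x = d (Suc i) g" by blast
 define y where "y = lfc (Suc (Suc i)) g"
 have y: "keys y <= gr BB fst (Suc (Suc i))" "EV (Suc (Suc i)) y = g" unfolding y_def by (rule lfc[OF g(1)])+
 have "EV (Suc i) x = EV (Suc i) (lin sc dlt y)" using d_EV[OF y(1)] y(2) g(2) by simp
 moreover have "keys (lin sc dlt y) <= gr BB fst (Suc i)" by (rule keys_lin) (use y(1) keys_dlt in blast)
 ultimately show "\<exists>y. keys y <= gr BB fst (Suc (Suc i)) & x - lin sc dlt y : cf Kr"
  using y(1) EV_eq_iff[OF x(1)] by blast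
qed

lemma augm_dlt: "augm sc ep relN Kr BB fst dlt"
 unfolding augm_def
proof (intro allI impI)
 fix x :: "nat \<times> 'x \<Rightarrow>\<^sub>0 'z" assume x: "keys x <= gr BB fst 0"
 have ex: "d 0 ` carrier (F 1) = {f : carrier (F 0). ea f = \<zero>\<^bsub>M\<^esub>}" using res by (simp add: free_resolution_def)
 have k1: "keys (lin sc dlt y) <= gr BB fst 0" if "keys y <= gr BB fst 1" for y
  by (rule keys_lin) (use that keys_dlt[of _ 0] in auto)
 have dE: "d 0 (EV 1 y) = EV 0 (lin sc dlt y)" if "keys y <= gr BB fst 1" for y using d_EV[of y 0] that by simp
 have "lin sc ep x : relN \<longleftrightarrow> ea (EV 0 x) = \<zero>\<^bsub>M\<^esub>" by (simp add: relN_iff ea_EV[OF x])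
 also have "\<dots> \<longleftrightarrow> EV 0 x : d 0 ` carrier (F 1)" using EV_F[OF x] unfolding ex by blast
 also have "\<dots> \<longleftrightarrow> (\<exists>y. keys y <= gr BB fst 1 & x - lin sc dlt y : cf Kr)"
 proof
  assume "EV 0 x : d 0 ` carrier (F 1)"
  then obtain g where g: "g : carrier (F 1)" "EV 0 x = d 0 g" by blast
  hence "EV 0 x = EV 0 (lin sc dlt (lfc 1 g))" using dE[OF lfc(1)[OF g(1)]] lfc(2)[OF g(1)] by simp
  thus "\<exists>y. keys y <= gr BB fst 1 & x - lin sc dlt y : cf Kr"
   using EV_eq_iff[OF x k1[OF lfc(1)[OF g(1)]]] lfc(1)[OF g(1)] by blast
 next
  assume "\<exists>y. keys y <= gr BB fst 1 & x - lin sc dlt y : cf Kr"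
  then obtain y where y: "keys y <= gr BB fst 1" "x - lin sc dlt y : cf Kr" by blast
  have "EV 0 x = d 0 (EV 1 y)" using EV_eq_iff[OF x k1[OF y(1)]] y(2) dE[OF y(1)] by simp
  thus "EV 0 x : d 0 ` carrier (F 1)" using EV_F[OF y(1)] by blast
 qed
 finally show "lin sc ep x : relN \<longleftrightarrow> (\<exists>y. keys y <= gr BB fst 1 & x - lin sc dlt y : cf Kr)" .
qed

lemma ep_surj: "\<exists>x. keys x <= gr BB fst 0 & w - lin sc ep x : relN"
proof -
 have "EE w : ea ` carrier (F 0)" using res EE_closed[of w] unfolding free_resolution_def by blast
 then obtain f where f: "f : carrier (F 0)" "EE w = ea f" by blast
 have "EE w = EE (lin sc ep (lfc 0 f))" using ea_EV[OF lfc(1)[OF f(1)]] lfc(2)[OF f(1)] f(2) by simp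
 thus ?thesis using lfc(1)[OF f(1)] EE_eq_iff by blast
qed

section \<open>Cochains with values in a presented module\<close>

context
 fixes T :: "('a, 'k, 't) module_scheme" and s :: "'z => 'w => 'w::ab_group_add" and Q :: "'w => 'k" and U :: "'w set"
 assumes S: "Modules.module s" and oU: "submod s U"
  and Q_carrier: "carrier T = range Q" and Q_add: "!!v w. Q (v + w) = Q v \<oplus>\<^bsub>T\<^esub> Q w"
  and Q_sc: "!!r w. Q (s r w) = ev r \<odot>\<^bsub>T\<^esub> Q w" and Q_zero: "!!w. Q w = \<zero>\<^bsub>T\<^esub> \<longleftrightarrow> w : U"
begin

interpretation S: Modules.module s by (rule S)

lemma Q0: "Q 0 = \<zero>\<^bsub>T\<^esub>" using Q_zero osub_zero[OF oU] by blast

lemma Q_eq: "Q v = Q w \<longleftrightarrow> v - w : U"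
proof
 assume "Q v = Q w"
 hence "Q (v - w) = Q (w - w)" using Q_add[of v "- w"] Q_add[of w "- w"] by simp
 thus "v - w : U" using Q_zero[of "v - w"] Q0 by simp
next
 assume "v - w : U"
 hence "Q (v - w) = \<zero>\<^bsub>T\<^esub>" using Q_zero by blast
 hence "Q (v - w) = Q 0" by (simp add: Q0)
 thus "Q v = Q w" using Q_add[of "v - w" w] Q_add[of 0 w] by simp
qed

lemma Kr_U: "k : Kr ==> s k w : U"
 using Q_sc[of k w] Q_sc[of 0 w] Q0 Q_zero by (simp add: Kr_iff ev_zero)

text \<open>Up to values in \<open>U\<close> the functions \<open>g\<close> parametrise the
  homomorphisms. The restriction to the carrier makes equality of functions agree with equality in
  \<open>Hom_module\<close>.\<close>

definition Hm :: "nat => (nat \<times> 'x => 'w) => ('x => 'a) => 'k" where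
 "Hm i g = (\<lambda>f\<in>carrier (F i). Q (lin s g (lfc i f)))"

lemma Hm_EV: assumes "keys x <= gr BB fst i" shows "Hm i g (EV i x) = Q (lin s g x)"
proof -
 note f = EV_F[OF assms]
 have "lfc i (EV i x) - x : cf Kr" using EV_eq_iff[OF lfc(1)[OF f] assms] lfc(2)[OF f] by blast
 hence "lin s g (lfc i (EV i x) - x) : U" by (rule S.lin_cf[OF oU _ Kr_U])
 thus ?thesis using f Q_eq by (simp add: Hm_def S.lin_diff)
qed

lemma Hm_ind: assumes "b : B i" shows "Hm i g (ind b) = Q (g (i, b))"
 using Hm_EV[of "single (i, b) 1" i g] assms by (simp add: EV_single gr_BB)

lemma Hm_eq_iff: "Hm i g = Hm i g' \<longleftrightarrow> (\<forall>p\<in>gr BB fst i. g p - g' p : U)"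
proof
 assume e: "Hm i g = Hm i g'"
 show "\<forall>p\<in>gr BB fst i. g p - g' p : U"
 proof
  fix p assume "p : gr BB fst i"
  then obtain b where p: "p = (i, b)" "b : B i" by (auto simp: gr_BB)
  have "Q (g p) = Q (g' p)" using Hm_ind[OF p(2), of g] Hm_ind[OF p(2), of g'] e by (simp add: p(1))
  thus "g p - g' p : U" using Q_eq by blast
 qed
next
 assume g: "\<forall>p\<in>gr BB fst i. g p - g' p : U"
 have "Q (lin s g (lfc i f)) = Q (lin s g' (lfc i f))" if "f : carrier (F i)" for f
 proof -
  have "lin s (%p. g p - g' p) (lfc i f) : U" by (rule S.lin_mem[OF oU]) (use g lfc(1)[OF that] in blast)
  thus ?thesis using Q_eq by (simp add: S.lin_fun_diff)
 qed
 thus "Hm i g = Hm i g'" by (auto simp: Hm_def)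
qed

lemma Hm_add: "Hm i g \<oplus>\<^bsub>Hom_module R (F i) T\<^esub> Hm i g' = Hm i (%p. g p + g' p)"
 by (auto simp: Hom_module_def Hm_def S.lin_fun_add Q_add)

lemma Hm_sc: "ev r \<odot>\<^bsub>Hom_module R (F i) T\<^esub> Hm i g = Hm i (%p. s r (g p))"
 by (auto simp: Hom_module_def Hm_def S.lin_fun_scale Q_sc)

lemma Hm_zero: "\<zero>\<^bsub>Hom_module R (F i) T\<^esub> = Hm i (%_. 0)"
 by (auto simp: Hom_module_def Hm_def lin_def Q0)

lemma Hm_carrier: "Hm i g : carrier (Hom_module R (F i) T)"
proof -
 interpret Fi: Module.module R "F i" by (rule free_module_is_module) (rule is_cring)
 have "Hm i g (f \<oplus>\<^bsub>F i\<^esub> f') = Hm i g f \<oplus>\<^bsub>T\<^esub> Hm i g f'" if f: "f : carrier (F i)" "f' : carrier (F i)" for f f'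
 proof -
  have "keys (lfc i f + lfc i f') <= gr BB fst i"
   using Poly_Mapping.keys_add[of "lfc i f" "lfc i f'"] lfc(1)[OF f(1)] lfc(1)[OF f(2)] by blast
  moreover have "EV i (lfc i f + lfc i f') = f \<oplus>\<^bsub>F i\<^esub> f'" using lfc(2) f by (simp add: EV_add)
  ultimately have "Hm i g (f \<oplus>\<^bsub>F i\<^esub> f') = Q (lin s g (lfc i f + lfc i f'))" using Hm_EV by metis
  thus ?thesis using f by (simp add: S.lin_add Q_add Hm_def)
 qed
 moreover have "Hm i g (a \<odot>\<^bsub>F i\<^esub> f) = a \<odot>\<^bsub>T\<^esub> Hm i g f" if a: "a : carrier R" and f: "f : carrier (F i)" for a f
 proof -
  obtain r where r: "ev r = a" using ev_surj[OF a] by blast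
  have "keys (sc r (lfc i f)) <= gr BB fst i" using keys_sc[of r "lfc i f"] lfc(1)[OF f] by blast
  moreover have "EV i (sc r (lfc i f)) = a \<odot>\<^bsub>F i\<^esub> f" using lfc(2)[OF f] by (simp add: EV_sc r)
  ultimately have "Hm i g (a \<odot>\<^bsub>F i\<^esub> f) = Q (lin s g (sc r (lfc i f)))" using Hm_EV by metis
  thus ?thesis using f by (simp add: S.lin_sc Q_sc r Hm_def)
 qed
 moreover have "Hm i g : carrier (F i) \<rightarrow> carrier T" by (auto simp: Hm_def Q_carrier)
 moreover have "Hm i g : extensional (carrier (F i))" by (simp add: Hm_def)
 ultimately show ?thesis by (simp add: Hom_module_def module_hom_set_def)
qed

lemma Hm_exists: assumes h: "h : carrier (Hom_module R (F i) T)" shows "\<exists>g. h = Hm i g"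
proof -
 have h': "h : module_hom_set R (F i) T" "h : extensional (carrier (F i))" using h by (auto simp: Hom_module_def)
 have hT: "h f : range Q" if "f : carrier (F i)" for f using h'(1) that Q_carrier by (auto simp: module_hom_set_def)
 have "\<forall>p :: nat \<times> 'x. \<exists>w. snd p : B i --> h (ind (snd p)) = Q w" using hT[OF ind_F] by blast
 from choice[OF this] obtain g where g: "!!p :: nat \<times> 'x. snd p : B i ==> h (ind (snd p)) = Q (g p)" by blast
 have "h f = Hm i g f" if f: "f : carrier (F i)" for f
 proof -
  have "h (EV i (lfc i f)) = Q (lin s g (lfc i f))"
  proof (rule hom_lin[where h = h and T = T and s = s and q = Q and c = g])
   show "h \<zero>\<^bsub>F i\<^esub> : range Q" by (rule hT[OF zero_F])
   show "h (ind b) = Q (g (i, b))" if "b : B i" for b using g[of "(i, b)"] that by simp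
  qed (use h'(1) S Q_add Q_sc lfc(1)[OF f] in \<open>auto simp: module_hom_set_def\<close>)
  thus ?thesis using f lfc(2)[OF f] by (simp add: Hm_def)
 qed
 hence "h = Hm i g" using h'(2) by (intro extensionalityI[of h "carrier (F i)"]) (simp_all add: Hm_def)
 thus ?thesis by blast
qed

lemma Hm_differential: "Hom_differential R B d i (Hm i g) = Hm (Suc i) (%p. lin s g (dlt p))"
proof -
 have "Hm i g (d i f) = Q (lin s (%p. lin s g (dlt p)) (lfc (Suc i) f))" if f: "f : carrier (F (Suc i))" for f
 proof -
  note l = lfc[OF f]
  have "keys (lin sc dlt (lfc (Suc i) f)) <= gr BB fst i" by (rule keys_lin) (use l(1) keys_dlt in blast)
  from Hm_EV[OF this, of g] show ?thesis using d_EV[OF l(1)] l(2) by (simp add: S.lin_lin)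
 qed
 thus ?thesis by (auto simp: Hom_differential_def Hm_def[of "Suc i"])
qed

text \<open>One formula for all degrees: the lifted differential is zero on degree 0, so there the
  condition says that \<open>g\<close> takes values in \<open>U\<close>, in accordance with the
  separate clause of \<open>Hom_coboundaries\<close>.\<close>

definition bdr :: "nat => (nat \<times> 'x => 'w) => bool" where
 "bdr i g \<longleftrightarrow> (\<exists>u. \<forall>p\<in>gr BB fst i. g p - lin s u (dlt p) : U)"

lemma coboundaries: "Hom_coboundaries R B d T i = {Hm i g |g. bdr i g}"
proof (cases i)
 case 0
 have z: "lin s u (dlt p) = 0" if "p : gr BB fst 0" for u p using that by (simp add: gr_def dlt_def)
 have "bdr 0 g \<longleftrightarrow> Hm 0 g = Hm 0 (%_. 0)" for g using z by (simp add: bdr_def Hm_eq_iff)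
 hence "{Hm 0 g |g. bdr 0 g} = {Hm 0 (%_. 0)}" by blast
 thus ?thesis by (simp add: 0 Hm_zero)
next
 case (Suc k)
 show ?thesis
 proof
  show "Hom_coboundaries R B d T i <= {Hm i g |g. bdr i g}"
  proof
   fix h assume "h : Hom_coboundaries R B d T i"
   then obtain h' where h': "h' : carrier (Hom_module R (F k) T)" "h = Hom_differential R B d k h'" by (auto simp: Suc)
   obtain u where u: "h' = Hm k u" using Hm_exists[OF h'(1)] by blast
   have "h = Hm i (%p. lin s u (dlt p))" by (simp add: h'(2) u Hm_differential Suc)
   moreover have "bdr i (%p. lin s u (dlt p))" unfolding bdr_def using osub_zero[OF oU] by (intro exI[of _ u]) simp
   ultimately show "h : {Hm i g |g. bdr i g}" by blast
  qed
  show "{Hm i g |g. bdr i g} <= Hom_coboundaries R B d T i"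
  proof
   fix h assume "h : {Hm i g |g. bdr i g}"
   then obtain g u where g: "h = Hm i g" "\<forall>p\<in>gr BB fst i. g p - lin s u (dlt p) : U" unfolding bdr_def by blast
   hence "h = Hm i (%p. lin s u (dlt p))" using Hm_eq_iff by metis
   hence "h = Hom_differential R B d k (Hm k u)" by (simp add: Hm_differential Suc)
   thus "h : Hom_coboundaries R B d T i" using Hm_carrier by (auto simp: Suc)
  qed
 qed
qed

lemma bdr_diff: "bdr i g ==> bdr i g' ==> bdr i (%p. g p - g' p)"
proof -
 assume "bdr i g" "bdr i g'"
 then obtain u u' where u: "\<forall>p\<in>gr BB fst i. g p - lin s u (dlt p) : U" "\<forall>p\<in>gr BB fst i. g' p - lin s u' (dlt p) : U"
  unfolding bdr_def by blast
 have "(g p - g' p) - lin s (%p. u p - u' p) (dlt p) : U" if p: "p : gr BB fst i" for p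
 proof -
  have "(g p - lin s u (dlt p)) - (g' p - lin s u' (dlt p)) : U" using osub_diff[OF oU] u p by blast
  thus ?thesis by (simp add: S.lin_fun_diff algebra_simps)
 qed
 thus "bdr i (%p. g p - g' p)" unfolding bdr_def by blast
qed

lemma bdr_zero: "bdr i (%_. 0)"
 unfolding bdr_def using osub_zero[OF oU] by (intro exI[of _ "%_. 0"]) (simp add: lin_def)

lemma bdr_sc: "bdr i g ==> bdr i (%p. s r (g p))"
proof -
 assume "bdr i g"
 then obtain u where u: "\<forall>p\<in>gr BB fst i. g p - lin s u (dlt p) : U" unfolding bdr_def by blast
 have "s r (g p) - lin s (%p. s r (u p)) (dlt p) : U" if p: "p : gr BB fst i" for p
  using S.osub_scale[OF oU u[rule_format, OF p], of r] by (simp add: S.lin_fun_scale S.scale_right_diff_distrib)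
 thus ?thesis unfolding bdr_def by blast
qed

lemma bdr_add: "bdr i g ==> bdr i g' ==> bdr i (%p. g p + g' p)"
 using bdr_diff[of i g "%p. 0 - g' p"] bdr_diff[OF bdr_zero, of i g'] by simp

text \<open>Cosets of homomorphisms are rewritten through \<open>Hm\<close> as families of
  representatives. A scalar kills the class of \<open>h\<close> when the multiplied coset is the
  coset of coboundaries, which holds exactly when the scaled \<open>h\<close> is a
  coboundary.\<close>

lemma ext_class:
 assumes P: "P : associated_primes R (Hom_cohomology R B d T i)"
 shows "primeideal P R & (\<exists>h. coh s BB fst dlt U i h & pull P = annx s BB fst dlt U i h)"
proof -
 let ?HM = "Hom_module R (F i) T" and ?H = "Hom_coboundaries R B d T i"
 obtain C where prime: "primeideal P R" and C: "C : carrier (Hom_cohomology R B d T i)"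
  and PC: "P = {a : carrier R. a \<odot>\<^bsub>Hom_cohomology R B d T i\<^esub> C = \<zero>\<^bsub>Hom_cohomology R B d T i\<^esub>}"
  using P by (auto simp: associated_primes_def)
 have coset: "H +>\<^bsub>?HM\<lparr>carrier := Z\<rparr>\<^esub> x = {k \<oplus>\<^bsub>?HM\<^esub> x |k. k : H}" for H Z x
  by (auto simp: a_r_coset_def')
 obtain h0 where h0: "h0 : Hom_cocycles R B d T i" "C = {k \<oplus>\<^bsub>?HM\<^esub> h0 |k. k : ?H}"
  using C by (auto simp: Hom_cohomology_def quotient_module_def A_RCOSETS_def' coset)
 obtain h where h: "h0 = Hm i h" using Hm_exists h0(1) by (auto simp: Hom_cocycles_def)
 have "Hm (Suc i) (%p. lin s h (dlt p)) = Hm (Suc i) (%_. 0)"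
  using h0(1) by (simp add: Hom_cocycles_def h Hm_differential Hm_zero)
 hence coh: "coh s BB fst dlt U i h" by (simp add: Hm_eq_iff coh_def)
 have CH: "C = {Hm i (%p. g p + h p) |g. bdr i g}"
  unfolding h0(2) coboundaries h by (auto simp: Hm_add) (metis Hm_add)+
 have sm: "ev r \<odot>\<^bsub>Hom_cohomology R B d T i\<^esub> C = (\<Union>x\<in>C. {k \<oplus>\<^bsub>?HM\<^esub> (ev r \<odot>\<^bsub>?HM\<^esub> x) |k. k : ?H})" for r
  by (simp add: Hom_cohomology_def quotient_module_def coset)
 have zr: "\<zero>\<^bsub>Hom_cohomology R B d T i\<^esub> = ?H" by (simp add: Hom_cohomology_def quotient_module_def)
 \<comment> \<open>Scalar multiplication in the quotient module is a union over representatives, so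
   the multiple of a coset carries two independent coboundaries \<open>g\<close> and
   \<open>g'\<close>.\<close>
 have el: "ev r \<odot>\<^bsub>Hom_cohomology R B d T i\<^esub> C = {Hm i (%p. g' p + s r (g p + h p)) |g g'. bdr i g & bdr i g'}" for r
  unfolding sm unfolding CH coboundaries
 proof (intro Set.set_eqI iffI)
  fix y assume "y : (\<Union>x\<in>{Hm i (%p. g p + h p) |g. bdr i g}. {k \<oplus>\<^bsub>?HM\<^esub> (ev r \<odot>\<^bsub>?HM\<^esub> x) |k. k : {Hm i g |g. bdr i g}})"
  then obtain g g' where "bdr i g" "bdr i g'" "y = Hm i g' \<oplus>\<^bsub>?HM\<^esub> (ev r \<odot>\<^bsub>?HM\<^esub> Hm i (%p. g p + h p))" by blast
  thus "y : {Hm i (%p. g' p + s r (g p + h p)) |g g'. bdr i g & bdr i g'}" unfolding Hm_sc Hm_add by blast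
 next
  fix y assume "y : {Hm i (%p. g' p + s r (g p + h p)) |g g'. bdr i g & bdr i g'}"
  then obtain g g' where g: "bdr i g" "bdr i g'" "y = Hm i (%p. g' p + s r (g p + h p))" by blast
  have "y = Hm i g' \<oplus>\<^bsub>?HM\<^esub> (ev r \<odot>\<^bsub>?HM\<^esub> Hm i (%p. g p + h p))" by (simp add: Hm_sc Hm_add g(3))
  thus "y : (\<Union>x\<in>{Hm i (%p. g p + h p) |g. bdr i g}. {k \<oplus>\<^bsub>?HM\<^esub> (ev r \<odot>\<^bsub>?HM\<^esub> x) |k. k : {Hm i g |g. bdr i g}})"
   using g(1,2) by blast
 qed
 have "ev r : P \<longleftrightarrow> r : annx s BB fst dlt U i h" for r
 proof -
  have "ev r : P \<longleftrightarrow> {Hm i (%p. g' p + s r (g p + h p)) |g g'. bdr i g & bdr i g'} = {Hm i g |g. bdr i g}"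
   unfolding PC by (simp add: el zr coboundaries)
  also have "\<dots> \<longleftrightarrow> bdr i (%p. s r (h p))"
  proof
   assume "{Hm i (%p. g' p + s r (g p + h p)) |g g'. bdr i g & bdr i g'} = {Hm i g |g. bdr i g}"
   moreover have "Hm i (%p. 0 + s r (0 + h p)) : {Hm i (%p. g' p + s r (g p + h p)) |g g'. bdr i g & bdr i g'}"
    by (intro CollectI exI[of _ "%_. 0"] conjI bdr_zero refl)
   ultimately obtain g where g: "Hm i (%p. s r (h p)) = Hm i g" "bdr i g" by auto
   obtain u where u: "\<forall>p\<in>gr BB fst i. g p - lin s u (dlt p) : U" using g(2) unfolding bdr_def by blast
   have "s r (h p) - lin s u (dlt p) : U" if p: "p : gr BB fst i" for p
   proof -
    have "s r (h p) - g p : U" using g(1) p unfolding Hm_eq_iff by blast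
    from osub_add[OF oU this u[rule_format, OF p]] show ?thesis by simp
   qed
   thus "bdr i (%p. s r (h p))" unfolding bdr_def by blast
  next
   assume rh: "bdr i (%p. s r (h p))"
   show "{Hm i (%p. g' p + s r (g p + h p)) |g g'. bdr i g & bdr i g'} = {Hm i g |g. bdr i g}"
   proof (intro Set.set_eqI iffI)
    fix y assume "y : {Hm i (%p. g' p + s r (g p + h p)) |g g'. bdr i g & bdr i g'}"
    then obtain g g' where g: "bdr i g" "bdr i g'" "y = Hm i (%p. g' p + s r (g p + h p))" by blast
    have "bdr i (%p. g' p + (s r (g p) + s r (h p)))" by (rule bdr_add[OF g(2) bdr_add[OF bdr_sc[OF g(1)] rh]])
    hence "bdr i (%p. g' p + s r (g p + h p))" by (simp add: S.scale_right_distrib)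
    thus "y : {Hm i g |g. bdr i g}" using g(3) by blast
   next
    fix y assume "y : {Hm i g |g. bdr i g}"
    then obtain g where g: "y = Hm i g" "bdr i g" by blast
    have "y = Hm i (%p. (g p - s r (h p)) + s r (0 + h p))" by (simp add: g(1))
    moreover have "bdr i (%p. g p - s r (h p))" by (rule bdr_diff[OF g(2) rh])
    ultimately show "y : {Hm i (%p. g' p + s r (g p + h p)) |g g'. bdr i g & bdr i g'}"
     using bdr_zero by (intro CollectI exI[of _ "%_. 0"] exI[of _ "%p. g p - s r (h p)"]) simp
   qed
  qed
  also have "\<dots> \<longleftrightarrow> r : annx s BB fst dlt U i h" by (simp add: bdr_def annx_def)
  finally show ?thesis .
 qed
 hence "pull P = annx s BB fst dlt U i h" unfolding pull_def by blast
 thus ?thesis using prime coh by blast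
qed

end

end

section \<open>Presenting rings and completions\<close>

context cring
begin

text \<open>The presenting ring is the integral monoid ring on the free commutative monoid over the whole
 type \<open>'a\<close>; elements outside the carrier are sent to \<open>\<zero>\<close>.\<close>

definition mval :: "'a multiset => 'a" where
 "mval m = fold_mset (%a x. if x : carrier R then (if a : carrier R then a else \<zero>) \<otimes> x else x) \<one> m"

text \<open>The guards make each step the identity outside the carrier and keep it inside otherwise,
  so the steps commute for all arguments, as folding over a multiset requires.\<close>

lemma mval_comm: "comp_fun_commute (%a x. if x : carrier R then (if a : carrier R then a else \<zero>) \<otimes> x else x)"
 by unfold_locales (auto simp: fun_eq_iff m_lcomm)

lemma mval_closed [simp]: "mval m : carrier R"
 by (induction m) (auto simp: mval_def comp_fun_commute.fold_mset_add_mset[OF mval_comm])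

lemma mval_empty: "mval {#} = \<one>"
 by (simp add: mval_def)

lemma mval_add_mset: "mval (add_mset a m) = (if a : carrier R then a else \<zero>) \<otimes> mval m"
 using mval_closed[of m] by (simp add: mval_def comp_fun_commute.fold_mset_add_mset[OF mval_comm])

lemma mval_add: "mval (m + m') = mval m \<otimes> mval m'"
 by (induction m) (auto simp: mval_empty mval_add_mset m_assoc)

definition pval :: "('a multiset \<Rightarrow>\<^sub>0 int) => 'a" where
 "pval x = (\<Oplus>m\<in>keys x. add_pow R (lookup x m) (mval m))"

lemma add_pow0: "add_pow R (0 :: int) x = \<zero>"
 by (simp add: add_pow_def int_pow_def nat_pow_def)

lemma pval_superset:
 assumes "finite S" "keys x <= S" shows "pval x = (\<Oplus>m\<in>S. add_pow R (lookup x m) (mval m))"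
 unfolding pval_def
 by (rule add.finprod_mono_neutral_cong_left) (use assms in \<open>auto simp: in_keys_iff add_pow0\<close>)

lemma pval_closed [simp]: "pval x : carrier R"
 unfolding pval_def by (rule finsum_closed) auto

lemma pval_add: "pval (x + y) = pval x \<oplus> pval y"
proof -
 let ?S = "keys x \<union> keys y"
 have "pval (x + y) = (\<Oplus>m\<in>?S. add_pow R (lookup (x + y) m) (mval m))"
  by (rule pval_superset) (simp_all add: Poly_Mapping.keys_add)
 also have "\<dots> = (\<Oplus>m\<in>?S. add_pow R (lookup x m) (mval m) \<oplus> add_pow R (lookup y m) (mval m))"
  by (rule finsum_cong') (auto simp: lookup_add add.int_pow_mult)
 also have "\<dots> = (\<Oplus>m\<in>?S. add_pow R (lookup x m) (mval m)) \<oplus> (\<Oplus>m\<in>?S. add_pow R (lookup y m) (mval m))"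
  by (rule finsum_addf) auto
 finally show ?thesis using pval_superset[of ?S x] pval_superset[of ?S y] by simp
qed

lemma pval_single: "pval (single m k) = add_pow R (k) (mval m)"
proof -
 have "pval (single m k) = (\<Oplus>m'\<in>{m}. add_pow R (lookup (single m k) m') (mval m'))"
  by (rule pval_superset) auto
 also have "\<dots> = add_pow R (k) (mval m)" by (subst finsum_insert) auto
 finally show ?thesis .
qed

lemma poly_mapping_single_induct:
 fixes x :: "'k \<Rightarrow>\<^sub>0 'z::comm_ring_1"
 assumes s: "!!b k. P (single b k)" and a: "!!x y. P x ==> P y ==> P (x + y)"
 shows "P x"
proof -
 have "P (\<Sum>b\<in>S. single b (lookup x b))" if "finite S" for S
  using that by (induction S rule: finite_induct) (use s[of _ 0] s a in auto)
 moreover have "x = (\<Sum>b\<in>keys x. single b (lookup x b))" using poly_mapping_sc_sum[of x] by simp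
 ultimately show ?thesis by (metis finite_keys)
qed

lemma pval_mult: "pval (x * y) = pval x \<otimes> pval y"
proof -
 have 1: "pval (single m k * single m' k') = pval (single m k) \<otimes> pval (single m' k')" for m k m' k'
 proof -
  have "pval (single m k * single m' k') = add_pow R (k * k') (mval m \<otimes> mval m')"
   by (simp add: Poly_Mapping.mult_single pval_single mval_add)
  also have "\<dots> = add_pow R (k) (add_pow R (k') (mval m \<otimes> mval m'))"
   using add.int_pow_pow[of "mval m \<otimes> mval m'" k k'] by (simp add: mult.commute)
  also have "\<dots> = (add_pow R (k) (mval m)) \<otimes> (add_pow R (k') (mval m'))"
   by (simp only: add_pow_ldistr_int[OF mval_closed add.int_pow_closed[OF mval_closed]] add_pow_rdistr_int[OF mval_closed mval_closed])
  finally show ?thesis by (simp add: pval_single)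
 qed
 have 2: "pval (single m k * y) = pval (single m k) \<otimes> pval y" for m k
  by (induction y rule: poly_mapping_single_induct) (simp_all add: 1 distrib_left pval_add r_distr)
 show ?thesis
  by (induction x rule: poly_mapping_single_induct) (simp_all add: 2 distrib_right pval_add l_distr)
qed

lemma present_pval: "present R pval"
proof (rule present.intro[OF is_cring], unfold_locales)
 show "pval x : carrier R" for x by simp
 show "pval (x + y) = pval x \<oplus> pval y" for x y by (rule pval_add)
 show "pval (x * y) = pval x \<otimes> pval y" for x y by (rule pval_mult)
 have "pval (single {#} 1) = \<one>" unfolding pval_single mval_empty by simp
 thus "pval 1 = \<one>" unfolding Poly_Mapping.single_one .
 show "\<exists>x. pval x = a" if "a : carrier R" for a
  using that by (intro exI[of _ "single {#a#} 1"]) (simp add: pval_single mval_add_mset mval_empty)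
qed

end

section \<open>Quotients and completions in terms of representatives\<close>

lemma (in present) coset_eq: assumes "ideal I R" shows "I +> ev x = I +> ev y \<longleftrightarrow> x - y : pull I"
 using quotient_eq_iff_same_a_r_cos[OF assms, of "ev x" "ev y"] by (simp add: pull_iff ev_diff)

lemma (in present) coset_mem: assumes I: "ideal I R" shows "ev y : I +> ev x \<longleftrightarrow> y - x : pull I"
proof -
 interpret ideal I R by (rule I)
 have self: "ev y : I +> ev y" using a_rcosI[OF zero_closed a_subset ev_closed, of y] by simp
 show ?thesis
 proof
  assume "ev y : I +> ev x"
  hence "I +> ev x = I +> ev y" by (rule a_repr_independence[OF _ ev_closed a_subgroup])
  thus "y - x : pull I" using coset_eq[OF I, of y x] by simp
 next
  assume "y - x : pull I"
  thus "ev y : I +> ev x" using coset_eq[OF I, of y x] self by simp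
 qed
qed

lemma (in present) coset_sub:
 assumes "ideal I R" "ideal J R" "I <= J" "y - x : pull J" shows "I +> ev y <= J +> ev x"
proof -
 have "J +> ev y = J +> ev x" using coset_eq[OF assms(2)] assms(4) by blast
 moreover have "I +> ev y <= J +> ev y" using assms(3) by (auto simp: a_r_coset_def')
 ultimately show ?thesis by simp
qed

lemma (in present) Quot_carrier: "ideal I R ==> carrier (R Quot I) = range (%x. I +> ev x)"
proof (intro Set.set_eqI iffI)
 assume I: "ideal I R"
 fix C assume "C : carrier (R Quot I)"
 then obtain a where "a : carrier R" "C = I +> a" by (auto simp: FactRing_def A_RCOSETS_def')
 thus "C : range (%x. I +> ev x)" using ev_surj by blast
next
 assume I: "ideal I R"
 fix C assume "C : range (%x. I +> ev x)"
 thus "C : carrier (R Quot I)" by (auto simp: FactRing_def A_RCOSETS_def')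
qed

lemma (in present) Quot_add: assumes "ideal I R" shows "(I +> ev x) \<oplus>\<^bsub>R Quot I\<^esub> (I +> ev y) = I +> ev (x + y)"
proof -
 interpret ideal I R by fact
 show ?thesis by (simp add: FactRing_def a_rcos_sum ev_add)
qed

lemma (in present) Quot_mult: assumes "ideal I R" shows "(I +> ev x) \<otimes>\<^bsub>R Quot I\<^esub> (I +> ev y) = I +> ev (x * y)"
proof -
 interpret ideal I R by fact
 show ?thesis by (simp add: FactRing_def rcoset_mult_add ev_mult)
qed

text \<open>A point of the completion is a sequence of nested cosets; representatives form a
  sequence whose consecutive differences lie in increasing powers, and every such sequence arises.
  Following this by the isomorphism and a choice of representatives in \<open>Q\<close> gives
  \<open>ps\<close>, a homomorphism modulo the preimage of \<open>J\<close>.\<close>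

lemma completion_map:
 fixes A :: "('a, 'b) ring_scheme" and Q :: "'q ring" and evA :: "'c::comm_ring_1 => 'a" and evQ :: "'r::comm_ring_1 => 'q"
 assumes PA: "present A evA" and PQ: "present Q evQ" and m: "ideal \<mm> A" and xs: "present.pull evA \<mm> = sp (*) (present.Kr A evA) xs {..<e}"
  and J: "ideal J Q" and iso: "completion A \<mm> \<simeq> Q Quot J"
 shows "\<exists>ps. complmap (present.Kr A evA) xs e (present.pull evQ J) ps
  (%a. \<forall>n. a (Suc n) - a n : ifl (*) xs {..<e} (present.Kr A evA) UNIV n)"
proof -
 interpret A: present A evA by (rule PA)
 interpret Q: present Q evQ by (rule PQ)
 let ?P = "ideal_power A \<mm>" and ?C = "completion A \<mm>" and ?q = "%x. J +>\<^bsub>Q\<^esub> evQ x"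
 let ?m = "ifl (*) xs {..<e} A.Kr UNIV"
 have P: "ideal (?P n) A" "A.pull (?P n) = ?m n" for n using A.pull_power[OF m xs] by auto
 have om: "osub scl (?m n)" for n using A.osub_pull[OF P(1)] P(2) by metis
 have mS: "?m (Suc n) <= ?m n" for n
  by (rule module.ifl_decreasing[OF module_ring A.osub_Kr subset_UNIV]) (simp add: osub_def)
 have PS: "?P (Suc n) <= ?P n" for n
 proof
  fix x assume x: "x : ?P (Suc n)"
  then obtain z where z: "evA z = x" using A.ev_surj ideal.Icarr[OF P(1)] by blast
  have "z : A.pull (?P (Suc n))" using x z by (simp add: A.pull_iff)
  hence "z : A.pull (?P n)" using mS P(2) by blast
  thus "x : ?P n" using z by (simp add: A.pull_iff)
 qed
 define ch where "ch a \<longleftrightarrow> (\<forall>n. a (Suc n) - a n : ?m n)" for a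
 obtain tt where tt: "tt : ring_iso ?C (Q Quot J)" using iso by (auto simp: is_ring_iso_def)
 have tt_hom: "tt (x \<oplus>\<^bsub>?C\<^esub> y) = tt x \<oplus>\<^bsub>Q Quot J\<^esub> tt y" "tt (x \<otimes>\<^bsub>?C\<^esub> y) = tt x \<otimes>\<^bsub>Q Quot J\<^esub> tt y"
  if "x : carrier ?C" "y : carrier ?C" for x y
  using tt that by (auto simp: ring_iso_def ring_hom_def)
 have tt_one: "tt \<one>\<^bsub>?C\<^esub> = \<one>\<^bsub>Q Quot J\<^esub>" using tt by (auto simp: ring_iso_def ring_hom_def)
 have tt_bij: "bij_betw tt (carrier ?C) (carrier (Q Quot J))" using tt by (auto simp: ring_iso_def)
 define si where "si a = (%n. ?P n +>\<^bsub>A\<^esub> evA (a n))" for a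
 have siC: "si a : carrier ?C" if "ch a" for a
 proof -
  have "?P (Suc n) +>\<^bsub>A\<^esub> evA (a (Suc n)) <= ?P n +>\<^bsub>A\<^esub> evA (a n)" for n
   by (rule A.coset_sub[OF P(1) P(1) PS]) (use that P(2) in \<open>simp add: ch_def\<close>)
  moreover have "?P n +>\<^bsub>A\<^esub> evA (a n) : carrier (A Quot ?P n)" for n using A.Quot_carrier[OF P(1)] by blast
  ultimately show ?thesis by (simp add: completion_def si_def)
 qed
 have si_eq: "si a = si b \<longleftrightarrow> (\<forall>n. a n - b n : ?m n)" for a b
  using A.coset_eq[OF P(1)] P(2) by (auto simp: si_def fun_eq_iff simp del: ifl.simps)
 have si_add: "si a \<oplus>\<^bsub>?C\<^esub> si b = si (%n. a n + b n)" and si_mult: "si a \<otimes>\<^bsub>?C\<^esub> si b = si (%n. a n * b n)" for a b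
  using A.Quot_add[OF P(1)] A.Quot_mult[OF P(1)] by (simp_all add: completion_def si_def)
 have si_one: "\<one>\<^bsub>?C\<^esub> = si (%_. 1)" by (simp add: completion_def si_def FactRing_def A.ev_one)
 have si_surj: "\<exists>a. ch a & si a = x" if x: "x : carrier ?C" for x
 proof -
  have xn: "x n : carrier (A Quot ?P n)" "x (Suc n) <= x n" for n using x by (auto simp: completion_def)
  have "\<forall>n. \<exists>z. x n = ?P n +>\<^bsub>A\<^esub> evA z" using xn(1) A.Quot_carrier[OF P(1)] by blast
  from choice[OF this] obtain a where a: "!!n. x n = ?P n +>\<^bsub>A\<^esub> evA (a n)" by blast
  have "a (Suc n) - a n : ?m n" for n
  proof -
   \<comment> \<open>Nestedness of the cosets becomes a congruence of representatives by evaluating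
     the inclusion at one element.\<close>
   have "evA (a (Suc n)) : x (Suc n)"
    unfolding a A.coset_mem[OF P(1)] P(2) using osub_zero[OF om] by (simp del: ifl.simps)
   hence "evA (a (Suc n)) : ?P n +>\<^bsub>A\<^esub> evA (a n)" using xn(2)[of n] a[of n] by blast
   thus ?thesis unfolding A.coset_mem[OF P(1)] P(2) .
  qed
  hence "ch a" unfolding ch_def by blast
  moreover have "si a = x" using a by (auto simp: si_def)
  ultimately show ?thesis by blast
 qed
 define ps where "ps a = (SOME z. tt (si a) = ?q z)" for a
 have ps: "tt (si a) = ?q (ps a)" if "ch a" for a
 proof -
  have "tt (si a) : carrier (Q Quot J)" using bij_betwE[OF tt_bij] siC[OF that] by blast
  hence "\<exists>z. tt (si a) = ?q z" using Q.Quot_carrier[OF J] by blast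
  thus ?thesis unfolding ps_def by (rule someI_ex)
 qed
 have ch_const: "ch (%_. z)" for z using osub_zero[OF om] by (simp add: ch_def del: ifl.simps)
 have ch_diff: "ch (%n. a n - b n)" if ab: "ch a" "ch b" for a b
  unfolding ch_def
 proof
  fix n
  have "(a (Suc n) - a n) - (b (Suc n) - b n) : ?m n" using osub_diff[OF om] ab unfolding ch_def by blast
  thus "(a (Suc n) - b (Suc n)) - (a n - b n) : ?m n" by (simp add: algebra_simps del: ifl.simps)
 qed
 have ch_mult: "ch (%n. a n * b n)" if ab: "ch a" "ch b" for a b
  unfolding ch_def
 proof
  fix n
  have "a (Suc n) * (b (Suc n) - b n) + b n * (a (Suc n) - a n) : ?m n"
   using ab unfolding ch_def by (intro osub_add[OF om] ideal_smult[OF om]) auto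
  thus "a (Suc n) * b (Suc n) - a n * b n : ?m n" by (simp add: algebra_simps del: ifl.simps)
 qed
 have oL: "osub scl (Q.pull J)" by (rule Q.osub_pull[OF J])
 have diff: "ps (%n. a n - b n) - (ps a - ps b) : Q.pull J" if ab: "ch a" "ch b" for a b
 proof -
  have "?q (ps (%n. a n - b n) + ps b) = tt (si (%n. a n - b n)) \<oplus>\<^bsub>Q Quot J\<^esub> tt (si b)"
   by (simp add: ps[OF ch_diff[OF ab]] ps[OF ab(2)] Q.Quot_add[OF J])
  also have "\<dots> = tt (si a)" by (simp add: tt_hom(1)[OF siC[OF ch_diff[OF ab]] siC[OF ab(2)], symmetric] si_add)
  finally have "?q (ps (%n. a n - b n) + ps b) = ?q (ps a)" by (simp add: ps[OF ab(1)])
  hence "ps (%n. a n - b n) + ps b - ps a : Q.pull J" using Q.coset_eq[OF J] by blast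
  thus ?thesis by (simp add: algebra_simps)
 qed
 have "complmap A.Kr xs e (Q.pull J) ps ch"
 proof (rule complmap.intro[OF A.osub_Kr oL])
  show "ch a \<longleftrightarrow> (\<forall>n. a (Suc n) - a n : ?m n)" for a by (rule ch_def)
  show "ps (%n. a n - b n) - (ps a - ps b) : Q.pull J" if "ch a" "ch b" for a b by (rule diff[OF that])
  show "ps (%n. a n * b n) - ps a * ps b : Q.pull J" if ab: "ch a" "ch b" for a b
  proof -
   have "?q (ps (%n. a n * b n)) = ?q (ps a * ps b)"
    using tt_hom(2)[OF siC[OF ab(1)] siC[OF ab(2)]]
    by (simp add: ps[OF ch_mult[OF ab], symmetric] ps[OF ab(1)] ps[OF ab(2)] si_mult Q.Quot_mult[OF J])
   thus ?thesis using Q.coset_eq[OF J] by blast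
  qed
  show "ps (%_. 1) - 1 : Q.pull J"
  proof -
   have "?q (ps (%_. 1)) = ?q 1"
    using tt_one by (simp add: ps[OF ch_const, symmetric] si_one) (simp add: FactRing_def Q.ev_one)
   thus ?thesis using Q.coset_eq[OF J] by blast
  qed
  show "ps a : Q.pull J \<longleftrightarrow> (\<forall>n. a n : ?m n)" if a: "ch a" for a
  proof -
   have z: "ps (%_. 0) : Q.pull J" using diff[OF ch_const ch_const, of 0 0] osub_diffD[OF oL, of "ps (%_. 0)" 0] by simp
   have "ps a : Q.pull J \<longleftrightarrow> ?q (ps a) = ?q (ps (%_. 0))"
    unfolding Q.coset_eq[OF J] using osub_diff_iff[OF oL z] by blast
   also have "\<dots> \<longleftrightarrow> tt (si a) = tt (si (%_. 0))" by (simp add: ps[OF a] ps[OF ch_const])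
   also have "\<dots> \<longleftrightarrow> si a = si (%_. 0)"
    using bij_betw_imp_inj_on[OF tt_bij] siC[OF a] siC[OF ch_const] by (metis inj_on_def)
   finally show ?thesis by (simp add: si_eq del: ifl.simps)
  qed
  show "\<exists>a. ch a & s - ps a : Q.pull J" for s
  proof -
   have "?q s : carrier (Q Quot J)" using Q.Quot_carrier[OF J] by blast
   then obtain x where x: "x : carrier ?C" "tt x = ?q s" using bij_betw_imp_surj_on[OF tt_bij] by (metis imageE)
   obtain a where a: "ch a" "si a = x" using si_surj[OF x(1)] by blast
   have "?q s = ?q (ps a)" using ps[OF a(1)] x(2) a(2) by simp
   thus ?thesis using a(1) Q.coset_eq[OF J] by blast
  qed
 qed
 thus ?thesis unfolding ch_def by blast
qed

section \<open>Finiteness of the associated primes of Ext over a local complete intersection\<close>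

theorem corollary3p2p2:
  fixes A :: "('a, 'r) ring_scheme" and \<mm> I :: "'a set"
    and M :: "('a, 'm, 's) module_scheme" and N :: "('a, 'n, 't) module_scheme"
  assumes "local_complete_intersection TYPE('q) A \<mm>"
    and "finitely_generated_module A M"
    and "finitely_generated_module A N"
    and "ideal I A"
  shows "finite (\<Union>n\<in>{1..}. \<Union>i\<in>{0..}. associated_primes A
           (Ext A i M (quotient_module N (ideal_smult A (ideal_power A I n) N))))"
proof -
 obtain Q :: "'q ring" and \<nn> fs where local: "noetherian_local_ring A \<mm>" and regQ: "regular_local_ring Q \<nn>"
  and fs: "regular_sequence Q fs" and iso: "completion A \<mm> \<simeq> Q Quot (Idl\<^bsub>Q\<^esub> (set fs))"
  using assms(1) by (auto simp: local_complete_intersection_def)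
 interpret LA: noetherian_local_ring A \<mm> by (rule local)
 interpret LQ: regular_local_ring Q \<nn> by (rule regQ)
 have NQ: "noetherian_ring Q" and NA: "noetherian_ring A" by unfold_locales
 define evA where "evA = LA.pval"
 define evQ where "evQ = LQ.pval"
 have PA: "present A evA" and PQ: "present Q evQ" unfolding evA_def evQ_def by (rule LA.present_pval, rule LQ.present_pval)
 have mM: "Module.module A M" and mN: "Module.module A N" using assms(2,3) by (auto simp: finitely_generated_module_def)
 obtain B d where Bd: "some_free_resolution A M = (B, d)" by (cases "some_free_resolution A M")
 obtain ea where res: "free_resolution A M B d ea" using some_free_resolution[OF mM Bd] by blast
 interpret A: present A evA by (rule PA)
 interpret Q: present Q evQ by (rule PQ)
 interpret N: present_module A evA N by (intro present_module.intro PA mN)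
 interpret M: present_res A evA M B d ea by (intro present_res.intro present_module.intro present_res_axioms.intro PA mM res)
 have mi: "ideal \<mm> A" by (rule maximalideal.axioms(1)[OF LA.max_ideal])
 obtain e :: nat and xs where xs: "A.pull \<mm> = sp (*) A.Kr xs {..<e}" by (rule A.ideal_fg[OF NA mi])
 obtain q :: nat and a where a: "A.pull I = sp (*) A.Kr a {..<q}" by (rule A.ideal_fg[OF NA assms(4)])
 have lA: "locl A.Kr (A.pull \<mm>)" by (rule A.local_locl[OF local])
 have lQ: "locl Q.Kr (Q.pull \<nn>)" by (rule Q.local_locl) unfold_locales
 obtain dm where reg: "reg dm Q.Kr (Q.pull \<nn>)" using Q.regular_reg[OF regQ] by blast
 have NKA: "noeth scl UNIV A.Kr" and NKQ: "noeth scl UNIV Q.Kr"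
  by (rule A.noeth_Kr[OF NA], rule Q.noeth_Kr[OF NQ])
 let ?J = "Idl\<^bsub>Q\<^esub> (set fs)" and ?c = "length fs"
 have fsQ: "set fs <= carrier Q" using fs by (simp add: regular_sequence_def)
 hence J: "ideal ?J Q" by (rule LQ.genideal_ideal)
 have "\<forall>j. \<exists>x. j < ?c --> evQ x = fs ! j" using fsQ Q.ev_surj nth_mem by (metis subsetD)
 from choice[OF this] obtain f where f: "!!j. j < ?c ==> evQ (f j) = fs ! j" by blast
 have take: "set (take k fs) = evQ ` f ` {..<k}" if "k <= ?c" for k
 proof -
  have "set (take k fs) = (!) fs ` {..<k}" using that by (metis atLeast0LessThan nth_image)
  also have "\<dots> = evQ ` f ` {..<k}" unfolding image_image by (rule image_cong) (use f that in auto)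
  finally show ?thesis .
 qed
 have pullk: "Q.pull (Idl\<^bsub>Q\<^esub> (set (take k fs))) = sp (*) Q.Kr f {..<k}" if "k <= ?c" for k
  unfolding take[OF that] by (rule Q.pull_genideal)
 define L where "L = Q.pull ?J"
 have Lf: "L = sp (*) Q.Kr f {..<?c}" using pullk[of ?c] by (simp add: L_def)
 have regf: "r : sp (*) Q.Kr f {..<k}" if k: "k < ?c" "f k * r : sp (*) Q.Kr f {..<k}" for k r
 proof -
  have kc: "k <= ?c" using k(1) by simp
  have "evQ (f k * r) : Idl\<^bsub>Q\<^esub> (set (take k fs))" using k(2) unfolding pullk[OF kc, symmetric] Q.pull_iff .
  hence "fs ! k \<otimes>\<^bsub>Q\<^esub> evQ r : Idl\<^bsub>Q\<^esub> (set (take k fs))" using f[OF k(1)] by (simp add: Q.ev_mult)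
  hence "evQ r : Idl\<^bsub>Q\<^esub> (set (take k fs))" using fs k(1) Q.ev_closed unfolding regular_sequence_def by blast
  thus ?thesis unfolding pullk[OF kc, symmetric] Q.pull_iff .
 qed
 have oL: "osub scl L" and KL: "Q.Kr <= L" unfolding L_def by (rule Q.osub_pull[OF J], rule Q.Kr_pull[OF J])
 have NL: "noeth scl UNIV L" by (rule noeth_mono[OF NKQ]) (use KL in auto)
 have "1 ~: L"
  using fs ideal.one_imp_carrier[OF J] by (auto simp: L_def Q.pull_iff Q.ev_one regular_sequence_def)
 \<comment> \<open>A regular sequence generates a proper ideal by definition, and a proper ideal of
   a local ring lies in the maximal ideal; hence the quotient of \<open>Q\<close> is again
   local.\<close>
 have "L <= Q.pull \<nn>"
 proof
  fix x assume x: "x : L"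
  show "x : Q.pull \<nn>"
  proof (rule ccontr)
   assume "x ~: Q.pull \<nn>"
   then obtain v where "v * x - 1 : Q.Kr" using lQ unfolding locl_def by blast
   hence "v * x - 1 : L" using KL by blast
   hence "1 : L" using osub_diffD'[OF oL _ ideal_smult[OF oL x]] by blast
   thus False using \<open>1 ~: L\<close> by blast
  qed
 qed
 hence lL: "locl L (Q.pull \<nn>)" by (rule locl_mono[OF lQ KL])
 have xm: "xs j : A.pull \<mm>" if "j : {..<e}" for j
  unfolding xs by (rule sp_ring_gen[OF A.osub_Kr]) (use that in auto)
 have jA: "jac A.Kr xs {..<e}" by (rule locl_jac[OF lA xm])
 have "ifl (*) xs {..<e} A.Kr UNIV (Suc 0) <= A.pull \<mm>"
  by (rule module.ifl_least[OF module_ring A.osub_pull[OF mi] A.Kr_pull[OF mi]])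
   (use ideal_smult[OF A.osub_pull[OF mi] xm] in \<open>simp add: mult.commute\<close>)
 hence m1: "1 ~: ifl (*) xs {..<e} A.Kr UNIV 1" using lA unfolding locl_def One_nat_def by blast
 obtain ps where "complmap A.Kr xs e L ps (%a. \<forall>n. a (Suc n) - a n : ifl (*) xs {..<e} A.Kr UNIV n)"
  using completion_map[OF PA PQ mi xs J iso] unfolding L_def by blast
 then interpret C: complmap A.Kr xs e L ps "%a. \<forall>n. a (Suc n) - a n : ifl (*) xs {..<e} A.Kr UNIV n" .
 interpret BC: basechange A.Kr xs e L "%x. ps (%_. x)" by (rule C.basechange[OF NKA NL jA m1 lL])
 obtain p :: nat and y where y: "UNIV = sp sc M.relN y {..<p}" by (rule M.finitely_generated[OF assms(2)])
 let ?U = "ifl sc a {..<q} N.relN UNIV"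
 let ?P = "{P. primep P & (\<exists>n i h. coh sc M.BB fst M.dlt (?U n) i h & P = annx sc M.BB fst M.dlt (?U n) i h)}"
 have fin: "finite ?P"
  by (rule BC.finite_ext_primes[OF NKQ Q.osub_Kr lQ reg Lf regf M.cplx_dlt M.exct_dlt module_sc M.osub_relN M.Kr_relN M.augm_dlt y
   M.ep_surj N.osub_relN N.cf_relN N.noeth_relN[OF NA assms(3)]]) simp_all
 \<comment> \<open>A prime of \<open>A\<close> is the image of its preimage in the presenting ring,
   so finiteness passes from the preimages to the primes themselves.\<close>
 have "P : (`) evA ` ?P"
  if P: "P : associated_primes A (Ext A i M (quotient_module N (ideal_smult A (ideal_power A I n) N)))" for P n i
 proof -
  let ?H = "ideal_smult A (ideal_power A I n) N"
  have H: "submodule ?H A N" "N.pullN ?H = ?U n" by (rule N.ideal_smult_pull[OF assms(4) a])+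
  have "P : associated_primes A (Hom_cohomology A B d (quotient_module N ?H) i)" using P by (simp add: Ext_def Bd)
  hence "primeideal P A & (\<exists>h. coh sc M.BB fst M.dlt (N.pullN ?H) i h & A.pull P = annx sc M.BB fst M.dlt (N.pullN ?H) i h)"
   by (rule M.ext_class[OF module_sc N.osub_pullN[OF H(1)] N.Qm_props[OF H(1)]])
  hence prime: "primeideal P A" and "\<exists>h. coh sc M.BB fst M.dlt (?U n) i h & A.pull P = annx sc M.BB fst M.dlt (?U n) i h"
   unfolding H(2) by blast+
  moreover have "primep (A.pull P)" using A.pull_prime(1)[OF prime] by (simp add: pr_def)
  ultimately have "A.pull P : ?P" by blast
  moreover have "P <= carrier A" using ideal.Icarr[OF primeideal.axioms(1)[OF prime]] by blast
  hence "P = evA ` A.pull P" by (simp add: A.image_pull)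
  ultimately show ?thesis by blast
 qed
 hence "(\<Union>n\<in>{1..}. \<Union>i\<in>{0..}. associated_primes A
   (Ext A i M (quotient_module N (ideal_smult A (ideal_power A I n) N)))) <= (`) evA ` ?P" by blast
 thus ?thesis by (rule finite_subset) (rule finite_imageI[OF fin])
qed

end
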